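(* Assume that $L>4/\sqrt{3}$. Then for every $s\geq 2$ there exists $\eta>0$ such that for every $\delta>0$ there exist $u_{0}^\delta\in Z^2(\mathbb{R}\times\mathbb{T}_L)\cap H^s(\mathbb{R}\times\mathbb{T}_L)$ and a time $T^\delta\sim|\log\delta|$ such that $$\|u_{0}^\delta - Q\|_{H^s(\mathbb{R}\times\mathbb{T}_{L})}<\delta$$ and the solution $u^\delta$ of the equation $$u_{t}-u_{x}+uu_{x}+u_{xxx}-\partial_{x}^{-1}u_{yy}=0,\qquad (x,y)\in\mathbb{R}\times\mathbb{T}_{L},$$ with initial value $u^\delta|_{t=0}=u_0^\delta$ satisfies $$\inf_{a\in\mathbb{R}}\|u^\delta(T^\delta,\cdot)-Q(\cdot-a)\|_{L^2(\mathbb{R}\times\mathbb{T}_{L})}\geq\eta.$$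
   Context: For $L>0$, $\mathbb{T}_L=\mathbb{R}/2\pi L\mathbb{Z}$. The unknown $u=u(t,x,y)$ is real valued. The equation is the KP-I equation written in a frame moving with speed one. $Q(x)=3\,\mathrm{sech}^2(x/2)$ is the profile of the KdV solitary wave, viewed as a function on $\mathbb{R}\times\mathbb{T}_L$ independent of $y$ and as a stationary solution of the equation; $Q(\cdot-a)$ denotes the translate $(x,y)\mapsto Q(x-a)$. The Fourier transform of $u$ on $\mathbb{R}\times\mathbb{T}_L$ is $$\hat u(\xi,k)=\frac{1}{2\pi L}\int_{-\infty}^{\infty}\int_0^{2\pi L}e^{-i(x\xi+yk/L)}u(x,y)\,dy\,dx,\qquad \xi\in\mathbb{R},\ k\in\mathbb{Z},$$ and $$Z^2(\mathbb{R}\times\mathbb{T}_L)=\Bigl\{u:\ \|\hat u(\xi,k)(1+|\xi|^2+|k/\xi|^2)\|_{L^2(\mathbb{R}\times\mathbb{Z})}<+\infty\Bigr\}.$$ The anti-derivative $\partial_x^{-1}$ is defined by dividing the Fourier transform by $i\xi$, for $u\in L^2$ such that $\xi^{-1}\hat u\in L^2$. By a known theorem of Ionescu and Kenig, the Cauchy problem for this equation is globally well-posed for data in $Z^2(\mathbb{R}\times\mathbb{T}_L)$; "the solution" is the global solution given by this theorem. $T^\delta\sim|\log\delta|$ means that $T^\delta$ is of the order of $|\log\delta|$ (comparable up to positive constants independent of $\delta$) as $\delta\to0$. *)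

theory Defs
  imports "HOL-Analysis.Analysis" "HOL-Library.Landau_Symbols"
begin

subsection \<open>Square-integrable functions\<close>

definition L2 :: "'a measure \<Rightarrow> ('a \<Rightarrow> 'b::real_normed_vector) set" where
  "L2 M = {f \<in> borel_measurable M. integrable M (\<lambda>x. (norm (f x))\<^sup>2)}"

definition L2_norm :: "'a measure \<Rightarrow> ('a \<Rightarrow> 'b::real_normed_vector) \<Rightarrow> real" where
  "L2_norm M f = sqrt (\<integral>x. (norm (f x))\<^sup>2 \<partial>M)"

text \<open>Membership in \<open>L2\<close> is demanded explicitly because \<^const>\<open>L2_norm\<close> is \<open>0\<close>
  for functions that are not square-integrable.\<close>

definition L2_tendsto ::
  "'a measure \<Rightarrow> ('i \<Rightarrow> 'a \<Rightarrow> 'b::real_normed_vector) \<Rightarrow> ('a \<Rightarrow> 'b) \<Rightarrow> 'i filter \<Rightarrow> bool" where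
  "L2_tendsto M f g F \<longleftrightarrow>
     (\<forall>\<^sub>F i in F. (\<lambda>x. f i x - g x) \<in> L2 M) \<and>
     ((\<lambda>i. L2_norm M (\<lambda>x. f i x - g x)) \<longlongrightarrow> 0) F"


subsection \<open>The cylinder and its Fourier transform\<close>

text \<open>Functions on \<open>\<real> \<times> \<real>/2\<pi>L\<int>\<close> are functions of \<open>(x, y)\<close> that are \<open>2\<pi>L\<close>-periodic in \<open>y\<close>;
  they are integrated over one period.\<close>

definition periodic_y :: "real \<Rightarrow> (real \<times> real \<Rightarrow> real) \<Rightarrow> bool" where
  "periodic_y L u \<longleftrightarrow> (\<forall>x y. u (x, y + 2 * pi * L) = u (x, y))"

definition cylinder :: "real \<Rightarrow> (real \<times> real) measure" where
  "cylinder L = restrict_space lborel (UNIV \<times> {0..<2 * pi * L})"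

definition freq :: "(real \<times> int) measure" where
  "freq = lborel \<Otimes>\<^sub>M count_space UNIV"

definition fourier_trunc :: "real \<Rightarrow> real \<Rightarrow> (real \<times> real \<Rightarrow> real) \<Rightarrow> real \<times> int \<Rightarrow> complex" where
  "fourier_trunc L R u = (\<lambda>(\<xi>, k).
     complex_of_real (1 / (2 * pi * L)) *
     (LINT p:{-R..R} \<times> {0..<2 * pi * L}|lborel.
        exp (- \<i> * complex_of_real (fst p * \<xi> + snd p * real_of_int k / L)) * complex_of_real (u p)))"

text \<open>For \<open>u\<close> square-integrable but not integrable, the integral over the whole cylinder does not
  converge absolutely, and the transform is the limit in \<open>L\<^sup>2\<close> of the integrals over \<open>\<bar>x\<bar> \<le> R\<close>
  (Plancherel).  It is determined up to a null set.\<close>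

definition fourier :: "real \<Rightarrow> (real \<times> real \<Rightarrow> real) \<Rightarrow> real \<times> int \<Rightarrow> complex" where
  "fourier L u = (SOME U. U \<in> L2 freq \<and> L2_tendsto freq (\<lambda>R. fourier_trunc L R u) U at_top)"


subsection \<open>Function spaces\<close>

text \<open>The value of the weight at \<open>\<xi> = 0\<close> is irrelevant, since that set is null.  Both weights used
  below for spaces are at least \<open>1\<close>, so the elements of the spaces are square-integrable.\<close>

definition Z2_weight :: "real \<times> int \<Rightarrow> real" where
  "Z2_weight = (\<lambda>(\<xi>, k). 1 + \<bar>\<xi>\<bar>\<^sup>2 + \<bar>real_of_int k / \<xi>\<bar>\<^sup>2)"

definition Z2 :: "real \<Rightarrow> (real \<times> real \<Rightarrow> real) set" where
  "Z2 L = {u \<in> L2 (cylinder L). periodic_y L u \<and>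
             (\<lambda>p. complex_of_real (Z2_weight p) * fourier L u p) \<in> L2 freq}"

definition Hs_weight :: "real \<Rightarrow> real \<Rightarrow> real \<times> int \<Rightarrow> real" where
  "Hs_weight L s = (\<lambda>(\<xi>, k). (1 + \<xi>\<^sup>2 + (real_of_int k / L)\<^sup>2) powr (s / 2))"

text \<open>Only used for \<open>s \<ge> 0\<close>.\<close>

definition Hs :: "real \<Rightarrow> real \<Rightarrow> (real \<times> real \<Rightarrow> real) set" where
  "Hs L s = {u \<in> L2 (cylinder L). periodic_y L u \<and>
               (\<lambda>p. complex_of_real (Hs_weight L s p) * fourier L u p) \<in> L2 freq}"

definition Hs_norm :: "real \<Rightarrow> real \<Rightarrow> (real \<times> real \<Rightarrow> real) \<Rightarrow> real" where
  "Hs_norm L s u = L2_norm freq (\<lambda>p. complex_of_real (Hs_weight L s p) * fourier L u p)"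


subsection \<open>The KP-I equation\<close>

text \<open>The \<open>x\<close>-derivative of a function that has one in \<open>L\<^sup>2\<close>, as every function in \<^const>\<open>Z2\<close> does.\<close>

definition dx :: "real \<Rightarrow> (real \<times> real \<Rightarrow> real) \<Rightarrow> real \<times> real \<Rightarrow> real" where
  "dx L u = (SOME v. v \<in> L2 (cylinder L) \<and>
     (AE (\<xi>, k) in freq. fourier L v (\<xi>, k) = \<i> * complex_of_real \<xi> * fourier L u (\<xi>, k)))"

text \<open>The Fourier transform of \<open>u\<^sub>x - u u\<^sub>x - u\<^sub>x\<^sub>x\<^sub>x + \<partial>\<^sub>x\<^sup>-\<^sup>1 u\<^sub>y\<^sub>y\<close>.  For \<open>u\<close> in \<^const>\<open>Z2\<close> the product
  \<open>u u\<^sub>x\<close> is square-integrable because \<open>u\<close> is bounded, while the other terms are in general only in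
  \<open>H\<^sup>-\<^sup>1\<close>, so they are given by their symbols.\<close>

definition KPI_rhs :: "real \<Rightarrow> (real \<times> real \<Rightarrow> real) \<Rightarrow> real \<times> int \<Rightarrow> complex" where
  "KPI_rhs L u = (\<lambda>(\<xi>, k).
     let X = \<i> * complex_of_real \<xi>; Y = \<i> * complex_of_real (real_of_int k / L) in
       X * fourier L u (\<xi>, k)
     - fourier L (\<lambda>p. u p * dx L u p) (\<xi>, k)
     - X ^ 3 * fourier L u (\<xi>, k)
     + Y\<^sup>2 / X * fourier L u (\<xi>, k))"

text \<open>Global strong solutions: \<open>u\<close> is continuous from \<open>\<real>\<close> to \<open>Z\<^sup>2\<close>, and its difference quotients
  converge in \<open>H\<^sup>-\<^sup>1\<close> to the right-hand side \<open>u\<^sub>t\<close>.  The solution of Ionescu and Kenig satisfies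
  this; the extra space-time regularity in which they prove uniqueness is not required here.\<close>

definition KPI_solution ::
  "real \<Rightarrow> (real \<times> real \<Rightarrow> real) \<Rightarrow> (real \<Rightarrow> real \<times> real \<Rightarrow> real) \<Rightarrow> bool" where
  "KPI_solution L u\<^sub>0 u \<longleftrightarrow>
     (\<forall>t. u t \<in> Z2 L) \<and>
     (\<forall>t. L2_tendsto freq (\<lambda>\<tau> p. complex_of_real (Z2_weight p) * fourier L (u \<tau>) p)
                          (\<lambda>p. complex_of_real (Z2_weight p) * fourier L (u t) p) (at t)) \<and>
     (\<forall>t. L2_tendsto freq
            (\<lambda>h p. complex_of_real (Hs_weight L (-1) p) *
                     ((fourier L (u (t + h)) p - fourier L (u t) p) / complex_of_real h))
            (\<lambda>p. complex_of_real (Hs_weight L (-1) p) * KPI_rhs L (u t) p) (at 0)) \<and>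
     (AE p in cylinder L. u 0 p = u\<^sub>0 p)"


subsection \<open>The solitary wave\<close>

definition Q :: "real \<times> real \<Rightarrow> real" where
  "Q = (\<lambda>(x, y). 3 * (1 / cosh (x / 2))\<^sup>2)"

definition translate_x :: "real \<Rightarrow> (real \<times> real \<Rightarrow> real) \<Rightarrow> real \<times> real \<Rightarrow> real" where
  "translate_x a f = (\<lambda>(x, y). f (x - a, y))"

end

theory Submission
  imports Defs "HOL-Probability.Probability" "HOL-Real_Asymp.Real_Asymp"
begin

text \<open>The line soliton \<open>Q\<close> is unstable because an explicit solution of the equation leaves it.  Let
\<open>\<tau> = 1 + e\<^sup>x + 2 e\<^sup>\<mu>\<^sup>x\<^sup>+\<^sup>\<sigma>\<^sup>t cos (l y) + \<alpha> e\<^sup>2\<^sup>\<kappa>\<^sup>x\<^sup>+\<^sup>2\<^sup>\<sigma>\<^sup>t\<close> with \<open>l = 1/L\<close>, \<open>\<mu> = 1/2 + \<kappa>\<close>, \<open>\<sigma> = \<kappa> - 4\<kappa>\<^sup>3\<close>.  For suitable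
\<open>\<alpha>\<close> the function \<open>U = 12 \<partial>\<^sub>x\<^sup>2 log \<tau>\<close> solves the equation for all times.  This is Hirota's
method: the equation for \<open>log \<tau>\<close> is bilinear in \<open>\<tau>\<close>, and for a sum of exponentials it reduces to the
dispersion relation at the differences of exponents (\<open>bilinear\<close>, \<open>evolution\<close>).  The relation
forces \<open>l = \<surd>3 (1/4 - \<kappa>\<^sup>2)\<close>, and a \<open>\<kappa>\<close> strictly between \<open>0\<close> and \<open>1/2\<close> with this property
exists exactly when \<open>L > 4/\<surd>3\<close>; then \<open>\<sigma> > 0\<close>.

As \<open>t \<rightarrow> -\<infinity>\<close>, \<open>\<tau>\<close> tends to \<open>1 + e\<^sup>x\<close> and \<open>U\<close> to \<open>12 \<partial>\<^sub>x\<^sup>2 log (1 + e\<^sup>x) = Q\<close>.  The difference and all its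
derivatives are \<open>O(e\<^sup>\<sigma>\<^sup>t e\<^sup>-\<^sup>c\<^sup>|\<^sup>x\<^sup>|)\<close> for times bounded above, because they lie in a
differentially closed ideal of functions with this decay (\<open>idl_decay\<close>); hence the difference is
\<open>O(e\<^sup>\<sigma>\<^sup>t)\<close> in every \<open>H\<^sup>s\<close> (\<open>Hs_norm_decay\<close>).  Starting at time \<open>-T\<close> with \<open>\<sigma> T\<close> equal to \<open>|log \<delta>|\<close> up
to an additive constant gives data within \<open>\<delta>\<close> of \<open>Q\<close> whose solution equals \<open>U(0)\<close> after time \<open>T\<close>.

A translate of \<open>Q\<close> has no Fourier modes with \<open>k \<noteq> 0\<close>, so its \<open>L\<^sup>2\<close> distance to \<open>U(0)\<close> is at least
the norm of those modes of \<open>U(0)\<close> (\<open>distance_lower_bound\<close>).  They do not all vanish, since \<open>U(0)\<close>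
depends on \<open>y\<close> (\<open>transverse_pos\<close>).

The theorem speaks of every solution with the given data that is continuous in \<open>Z\<^sup>2\<close> and
differentiable in \<open>H\<^sup>-\<^sup>1\<close>, so a uniqueness statement is needed: a solution \<open>v\<close> with bounded \<open>v\<^sub>x\<close> is unique among all solutions with its data
(\<open>KPI_uniqueness\<close>).  The difference \<open>w\<close> of two solutions satisfies \<open>d/dt \<parallel>w\<parallel>\<^sup>2 = - \<integral> v\<^sub>x w\<^sup>2\<close>, because the linear
part of the equation is skew-adjoint, and Gronwall's inequality applies.  The integrations by parts
behind this identity use that functions in \<open>Z\<^sup>2\<close> are bounded, and that the Fourier transform is an
isometry of \<open>L\<^sup>2\<close> up to a factor; Plancherel's theorem on the cylinder is proved by summation
with a Gaussian weight in \<open>\<xi>\<close> and an Abel weight in \<open>k\<close>.\<close>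

section \<open>Square-integrable functions\<close>

lemma L2I: "f \<in> borel_measurable M \<Longrightarrow> integrable M (\<lambda>x. (norm (f x))\<^sup>2) \<Longrightarrow> f \<in> L2 M"
  by (simp add: L2_def)

lemma L2_measurable [measurable_dest]: "f \<in> L2 M \<Longrightarrow> f \<in> borel_measurable M"
  by (simp add: L2_def)

lemma L2_integrable_sq: "f \<in> L2 M \<Longrightarrow> integrable M (\<lambda>x. (norm (f x))\<^sup>2)"
  by (simp add: L2_def)

lemma L2_norm_nonneg [simp]: "L2_norm M f \<ge> 0"
  by (simp add: L2_norm_def)

lemma L2_norm_sq: "(L2_norm M f)\<^sup>2 = (\<integral>x. (norm (f x))\<^sup>2 \<partial>M)"
  by (simp add: L2_norm_def)

lemma L2_norm_mono:
  assumes "g \<in> L2 M" "f \<in> borel_measurable M" "AE x in M. norm (f x) \<le> norm (g x)"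
  shows "f \<in> L2 M" "L2_norm M f \<le> L2_norm M g"
proof -
  have le: "AE x in M. (norm (f x))\<^sup>2 \<le> (norm (g x))\<^sup>2"
    using assms(3) by eventually_elim (simp add: power_mono)
  have *: "integrable M (\<lambda>x. (norm (f x))\<^sup>2)"
    by (rule Bochner_Integration.integrable_bound[OF L2_integrable_sq[OF assms(1)]])
       (use assms(2) le in auto)
  then show "f \<in> L2 M" using assms(2) by (auto intro: L2I)
  show "L2_norm M f \<le> L2_norm M g"
    unfolding L2_norm_def
    by (intro real_sqrt_le_mono integral_mono_AE * L2_integrable_sq[OF assms(1)] le)
qed

lemma L2_cong_AE:
  assumes "g \<in> L2 M" "f \<in> borel_measurable M" "AE x in M. f x = g x"
  shows "f \<in> L2 M"
  by (rule L2_norm_mono(1)[OF assms(1,2)]) (use assms(3) in auto)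

lemma L2_norm_cong_AE:
  assumes "f \<in> borel_measurable M" "g \<in> borel_measurable M" "AE x in M. norm (f x) = norm (g x)"
  shows "L2_norm M f = L2_norm M g"
  unfolding L2_norm_def by (intro arg_cong[where f=sqrt] integral_cong_AE) (use assms in auto)

lemma L2_scaleR:
  fixes f :: "'a \<Rightarrow> 'b::{banach, second_countable_topology}"
  assumes "f \<in> L2 M"
  shows "(\<lambda>x. c *\<^sub>R f x) \<in> L2 M" "L2_norm M (\<lambda>x. c *\<^sub>R f x) = \<bar>c\<bar> * L2_norm M f"
proof -
  have [measurable]: "f \<in> borel_measurable M" using assms by (rule L2_measurable)
  show "(\<lambda>x. c *\<^sub>R f x) \<in> L2 M"
    using L2_integrable_sq[OF assms] by (intro L2I) (auto simp: power_mult_distrib)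
  show "L2_norm M (\<lambda>x. c *\<^sub>R f x) = \<bar>c\<bar> * L2_norm M f"
    by (simp add: L2_norm_def power_mult_distrib real_sqrt_mult)
qed

lemma L2_cmult:
  fixes f :: "'a \<Rightarrow> 'b::{real_normed_field, banach, second_countable_topology}"
  assumes "f \<in> L2 M"
  shows "(\<lambda>x. c * f x) \<in> L2 M" "L2_norm M (\<lambda>x. c * f x) = norm c * L2_norm M f"
proof -
  have [measurable]: "f \<in> borel_measurable M" using assms by (rule L2_measurable)
  show "(\<lambda>x. c * f x) \<in> L2 M"
    using L2_integrable_sq[OF assms] by (intro L2I) (auto simp: power_mult_distrib norm_mult)
  show "L2_norm M (\<lambda>x. c * f x) = norm c * L2_norm M f"
    by (simp add: L2_norm_def power_mult_distrib real_sqrt_mult norm_mult)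
qed

lemma L2_zero [simp]: "(\<lambda>x. 0) \<in> L2 M" by (simp add: L2_def)

lemma L2_norm_zero [simp]: "L2_norm M (\<lambda>x. 0) = 0" by (simp add: L2_norm_def)

lemma L2_add:
  fixes f g :: "'a \<Rightarrow> 'b::{banach, second_countable_topology}"
  assumes "f \<in> L2 M" "g \<in> L2 M"
  shows "(\<lambda>x. f x + g x) \<in> L2 M"
proof (rule L2I)
  have [measurable]: "f \<in> borel_measurable M" "g \<in> borel_measurable M"
    using assms by (auto intro: L2_measurable)
  show "(\<lambda>x. f x + g x) \<in> borel_measurable M" by measurable
  show "integrable M (\<lambda>x. (norm (f x + g x))\<^sup>2)"
  proof (rule Bochner_Integration.integrable_bound)
    show "integrable M (\<lambda>x. 2 * (norm (f x))\<^sup>2 + 2 * (norm (g x))\<^sup>2)"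
      using assms by (auto intro!: L2_integrable_sq)
    have "(norm (f x + g x))\<^sup>2 \<le> 2 * (norm (f x))\<^sup>2 + 2 * (norm (g x))\<^sup>2" for x
    proof -
      have "(norm (f x + g x))\<^sup>2 \<le> (norm (f x) + norm (g x))\<^sup>2"
        by (intro power_mono norm_triangle_ineq) auto
      also have "\<dots> \<le> 2 * (norm (f x))\<^sup>2 + 2 * (norm (g x))\<^sup>2"
        using sum_squares_bound[of "norm (f x)" "norm (g x)"] by (simp add: power2_sum)
      finally show ?thesis .
    qed
    then show "AE x in M. norm ((norm (f x + g x))\<^sup>2) \<le> norm (2 * (norm (f x))\<^sup>2 + 2 * (norm (g x))\<^sup>2)"
      by auto
  qed measurable
qed

lemma L2_uminus:
  fixes f :: "'a \<Rightarrow> 'b::{banach, second_countable_topology}"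
  shows "f \<in> L2 M \<Longrightarrow> (\<lambda>x. - f x) \<in> L2 M"
  using L2_scaleR(1)[of f M "-1"] by simp

lemma L2_diff:
  fixes f g :: "'a \<Rightarrow> 'b::{banach, second_countable_topology}"
  assumes "f \<in> L2 M" "g \<in> L2 M"
  shows "(\<lambda>x. f x - g x) \<in> L2 M"
  using L2_add[OF assms(1) L2_uminus[OF assms(2)]] by simp

text \<open>Convergence in \<open>L\<^sup>2\<close> only controls differences; this recovers membership of the limit.\<close>

lemma L2_diff_cancel:
  fixes f g :: "'a \<Rightarrow> 'b::{banach, second_countable_topology}"
  assumes "(\<lambda>x. f x - g x) \<in> L2 M" "f \<in> L2 M"
  shows "g \<in> L2 M"
  using L2_diff[OF assms(2,1)] by simp

lemma L2_integrable_mult: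
  fixes f g :: "'a \<Rightarrow> 'b::{real_normed_algebra, banach, second_countable_topology}"
  assumes "f \<in> L2 M" "g \<in> L2 M"
  shows "integrable M (\<lambda>x. f x * g x)"
proof (rule Bochner_Integration.integrable_bound)
  have [measurable]: "f \<in> borel_measurable M" "g \<in> borel_measurable M"
    using assms by (auto intro: L2_measurable)
  show "(\<lambda>x. f x * g x) \<in> borel_measurable M" by measurable
  show "integrable M (\<lambda>x. (norm (f x))\<^sup>2 + (norm (g x))\<^sup>2)"
    using assms by (auto intro!: L2_integrable_sq)
  have "norm (f x * g x) \<le> (norm (f x))\<^sup>2 + (norm (g x))\<^sup>2" for x
  proof -
    have "norm (f x * g x) \<le> norm (f x) * norm (g x)" by (rule norm_mult_ineq)
    also have "\<dots> \<le> 2 * norm (f x) * norm (g x)" by simp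
    also have "\<dots> \<le> (norm (f x))\<^sup>2 + (norm (g x))\<^sup>2" by (rule sum_squares_bound)
    finally show ?thesis .
  qed
  then show "AE x in M. norm (f x * g x) \<le> norm ((norm (f x))\<^sup>2 + (norm (g x))\<^sup>2)"
    by auto
qed

lemma L2_norm_of: "f \<in> L2 M \<Longrightarrow> (\<lambda>x. norm (f x)) \<in> L2 M"
  by (auto simp: L2_def)

lemma L2_cnj: "f \<in> L2 M \<Longrightarrow> (\<lambda>x. cnj (f x)) \<in> L2 M"
  by (auto simp: L2_def intro!: borel_measurable_continuous_on[OF continuous_on_cnj])

lemma L2_Cauchy_Schwarz_norm:
  fixes f :: "'a \<Rightarrow> 'b::{banach, second_countable_topology}"
    and g :: "'a \<Rightarrow> 'c::{banach, second_countable_topology}"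
  assumes "f \<in> L2 M" "g \<in> L2 M"
  shows "(\<integral>x. norm (f x) * norm (g x) \<partial>M) \<le> L2_norm M f * L2_norm M g"
proof -
  have i: "integrable M (\<lambda>x. norm (f x) * norm (g x))"
    using L2_integrable_mult[OF L2_norm_of[OF assms(1)] L2_norm_of[OF assms(2)]] .
  have [measurable]: "f \<in> borel_measurable M" "g \<in> borel_measurable M"
    using assms by (auto intro: L2_measurable)
  have sq: "(\<integral>\<^sup>+x. ennreal (norm (h x))^2 \<partial>M) = ennreal ((L2_norm M h)\<^sup>2)" if "h \<in> L2 M"
    for h :: "'a \<Rightarrow> 'd::{banach, second_countable_topology}"
    unfolding L2_norm_sq ennreal_power[OF norm_ge_zero]
    by (subst nn_integral_eq_integral) (use L2_integrable_sq[OF that] in auto)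
  have "(\<integral>\<^sup>+x. ennreal (norm (f x)) * ennreal (norm (g x)) \<partial>M)\<^sup>2
      \<le> ennreal ((L2_norm M f)\<^sup>2) * ennreal ((L2_norm M g)\<^sup>2)"
    using Cauchy_Schwarz_nn_integral[of "\<lambda>x. ennreal (norm (f x))" M "\<lambda>x. ennreal (norm (g x))"]
    by (simp add: sq assms)
  also have "(\<integral>\<^sup>+x. ennreal (norm (f x)) * ennreal (norm (g x)) \<partial>M)
      = ennreal (\<integral>x. norm (f x) * norm (g x) \<partial>M)"
    by (subst nn_integral_eq_integral[symmetric, OF i]) (auto simp: ennreal_mult)
  finally have "ennreal ((\<integral>x. norm (f x) * norm (g x) \<partial>M)\<^sup>2)
      \<le> ennreal ((L2_norm M f * L2_norm M g)\<^sup>2)"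
    by (simp add: ennreal_power ennreal_mult[symmetric] power_mult_distrib)
  then show ?thesis
    by (subst (asm) ennreal_le_iff) (auto intro: power2_le_imp_le)
qed

lemma L2_Cauchy_Schwarz:
  fixes f g :: "'a \<Rightarrow> 'b::{real_normed_algebra, banach, second_countable_topology}"
  assumes "f \<in> L2 M" "g \<in> L2 M"
  shows "norm (\<integral>x. f x * g x \<partial>M) \<le> L2_norm M f * L2_norm M g"
proof -
  have "norm (\<integral>x. f x * g x \<partial>M) \<le> (\<integral>x. norm (f x) * norm (g x) \<partial>M)"
    using L2_integrable_mult[OF L2_norm_of[OF assms(1)] L2_norm_of[OF assms(2)]]
      L2_integrable_mult[OF assms]
    by - (rule order.trans[OF integral_norm_bound], rule integral_mono, auto intro: norm_mult_ineq)
  with L2_Cauchy_Schwarz_norm[OF assms] show ?thesis by simp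
qed

lemma L2_triangle:
  fixes f g :: "'a \<Rightarrow> 'b::{banach, second_countable_topology}"
  assumes "f \<in> L2 M" "g \<in> L2 M"
  shows "L2_norm M (\<lambda>x. f x + g x) \<le> L2_norm M f + L2_norm M g"
proof (rule power2_le_imp_le)
  have i: "integrable M (\<lambda>x. norm (f x) * norm (g x))"
    using L2_integrable_mult[OF L2_norm_of[OF assms(1)] L2_norm_of[OF assms(2)]] .
  have "(L2_norm M (\<lambda>x. f x + g x))\<^sup>2 \<le> (\<integral>x. (norm (f x))\<^sup>2 + 2 * (norm (f x) * norm (g x)) + (norm (g x))\<^sup>2 \<partial>M)"
    unfolding L2_norm_sq
  proof (rule integral_mono)
    show "integrable M (\<lambda>x. (norm (f x + g x))\<^sup>2)" by (rule L2_integrable_sq[OF L2_add[OF assms]])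
    show "integrable M (\<lambda>x. (norm (f x))\<^sup>2 + 2 * (norm (f x) * norm (g x)) + (norm (g x))\<^sup>2)"
      using i L2_integrable_sq[OF assms(1)] L2_integrable_sq[OF assms(2)] by auto
    fix x
    have "(norm (f x + g x))\<^sup>2 \<le> (norm (f x) + norm (g x))\<^sup>2"
      by (intro power_mono norm_triangle_ineq) auto
    then show "(norm (f x + g x))\<^sup>2 \<le> (norm (f x))\<^sup>2 + 2 * (norm (f x) * norm (g x)) + (norm (g x))\<^sup>2"
      by (simp add: power2_sum)
  qed
  also have "\<dots> = (L2_norm M f)\<^sup>2 + 2 * (\<integral>x. norm (f x) * norm (g x) \<partial>M) + (L2_norm M g)\<^sup>2"
    unfolding L2_norm_sq using i L2_integrable_sq[OF assms(1)] L2_integrable_sq[OF assms(2)] by simp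
  also have "\<dots> \<le> (L2_norm M f + L2_norm M g)\<^sup>2"
    using L2_Cauchy_Schwarz_norm[OF assms] by (simp add: power2_sum)
  finally show "(L2_norm M (\<lambda>x. f x + g x))\<^sup>2 \<le> (L2_norm M f + L2_norm M g)\<^sup>2" .
qed simp

lemma L2_norm_minus_commute: "L2_norm M (\<lambda>x. f x - g x) = L2_norm M (\<lambda>x. g x - f x)"
  by (simp add: L2_norm_def norm_minus_commute)

lemma L2_triangle_diff:
  fixes f g h :: "'a \<Rightarrow> 'b::{banach, second_countable_topology}"
  assumes "(\<lambda>x. f x - g x) \<in> L2 M" "(\<lambda>x. g x - h x) \<in> L2 M"
  shows "L2_norm M (\<lambda>x. f x - h x) \<le> L2_norm M (\<lambda>x. f x - g x) + L2_norm M (\<lambda>x. g x - h x)"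
  using L2_triangle[OF assms] by simp

lemma L2_norm_eq_0_iff:
  fixes f :: "'a \<Rightarrow> 'b::{banach, second_countable_topology}"
  assumes "f \<in> L2 M"
  shows "L2_norm M f = 0 \<longleftrightarrow> (AE x in M. f x = 0)"
  using integral_nonneg_eq_0_iff_AE[OF L2_integrable_sq[OF assms]]
  by (simp add: L2_norm_def)

lemma L2_tendstoD:
  assumes "L2_tendsto M f g F"
  shows "eventually (\<lambda>i. (\<lambda>x. f i x - g x) \<in> L2 M) F"
    "((\<lambda>i. L2_norm M (\<lambda>x. f i x - g x)) \<longlongrightarrow> 0) F"
  using assms by (auto simp: L2_tendsto_def)

lemma L2_tendsto_unique:
  fixes f :: "'i \<Rightarrow> 'a \<Rightarrow> 'b::{banach, second_countable_topology}"
  assumes "L2_tendsto M f g F" "L2_tendsto M f h F" "F \<noteq> bot"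
    "g \<in> L2 M" "h \<in> L2 M"
  shows "AE x in M. g x = h x"
proof -
  have "eventually (\<lambda>i. L2_norm M (\<lambda>x. g x - h x) \<le>
      L2_norm M (\<lambda>x. f i x - g x) + L2_norm M (\<lambda>x. f i x - h x)) F"
    using L2_tendstoD(1)[OF assms(1)] L2_tendstoD(1)[OF assms(2)]
  proof eventually_elim
    case (elim i)
    have "(\<lambda>x. g x - f i x) \<in> L2 M" using L2_uminus[OF elim(1)] by simp
    from L2_triangle_diff[OF this elim(2)] show ?case
      by (simp add: L2_norm_minus_commute[of M g])
  qed
  moreover have "((\<lambda>i. L2_norm M (\<lambda>x. f i x - g x) + L2_norm M (\<lambda>x. f i x - h x)) \<longlongrightarrow> 0 + 0) F"
    using assms(1,2) unfolding L2_tendsto_def by (intro tendsto_add) auto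
  ultimately have "L2_norm M (\<lambda>x. g x - h x) \<le> 0 + 0"
    using assms(3) tendsto_lowerbound by blast
  then have "L2_norm M (\<lambda>x. g x - h x) = 0" by (simp add: antisym)
  then show ?thesis using L2_norm_eq_0_iff[OF L2_diff[OF assms(4,5)]] by simp
qed

lemma L2_tendsto_norm:
  fixes f :: "'i \<Rightarrow> 'a \<Rightarrow> 'b::{banach, second_countable_topology}"
  assumes "L2_tendsto M f g F" "g \<in> L2 M"
  shows "((\<lambda>i. L2_norm M (f i)) \<longlongrightarrow> L2_norm M g) F"
proof (rule Lim_transform_bound[where g="\<lambda>i. L2_norm M (\<lambda>x. f i x - g x)", THEN Lim_transform[rotated]])
  show "((\<lambda>_. L2_norm M g) \<longlongrightarrow> L2_norm M g) F" by simp
  show "((\<lambda>i. L2_norm M (\<lambda>x. f i x - g x)) \<longlongrightarrow> 0) F" using assms by (auto simp: L2_tendsto_def)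
  show "eventually (\<lambda>i. norm (L2_norm M (f i) - L2_norm M g) \<le> norm (L2_norm M (\<lambda>x. f i x - g x))) F"
    using L2_tendstoD(1)[OF assms(1)]
  proof eventually_elim
    case (elim i)
    have "L2_norm M (f i) \<le> L2_norm M (\<lambda>x. f i x - g x) + L2_norm M g"
      using L2_triangle[OF elim(1) assms(2)] by simp
    moreover have "f i \<in> L2 M" using L2_add[OF elim(1) assms(2)] by simp
    then have "L2_norm M g \<le> L2_norm M (\<lambda>x. f i x - g x) + L2_norm M (f i)"
      using L2_triangle[OF L2_uminus[OF elim(1)], of "f i"] by (simp add: L2_norm_minus_commute)
    ultimately show ?case by simp
  qed
qed

lemma L2_tendsto_integral_mult:
  fixes f g :: "'i \<Rightarrow> 'a \<Rightarrow> 'b::{real_normed_algebra, banach, second_countable_topology}"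
  assumes f: "L2_tendsto M f f0 F" and g: "L2_tendsto M g g0 F"
    and f0: "f0 \<in> L2 M" and g0: "g0 \<in> L2 M"
  shows "((\<lambda>i. \<integral>x. f i x * g i x \<partial>M) \<longlongrightarrow> (\<integral>x. f0 x * g0 x \<partial>M)) F"
proof (rule LIM_zero_cancel, rule Lim_null_comparison)
  let ?a = "\<lambda>i. L2_norm M (\<lambda>x. f i x - f0 x)" and ?b = "\<lambda>i. L2_norm M (\<lambda>x. g i x - g0 x)"
  show "((\<lambda>i. ?a i * ?b i + ?a i * L2_norm M g0 + L2_norm M f0 * ?b i) \<longlongrightarrow> 0) F"
    using f g unfolding L2_tendsto_def by (auto intro!: tendsto_eq_intros)
  show "eventually (\<lambda>i. norm ((\<integral>x. f i x * g i x \<partial>M) - (\<integral>x. f0 x * g0 x \<partial>M)) \<le>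
      ?a i * ?b i + ?a i * L2_norm M g0 + L2_norm M f0 * ?b i) F"
    using L2_tendstoD(1)[OF f] L2_tendstoD(1)[OF g]
  proof eventually_elim
    case (elim i)
    have fi: "f i \<in> L2 M" and gi: "g i \<in> L2 M"
      using L2_add[OF elim(1) f0] L2_add[OF elim(2) g0] by auto
    have "(\<integral>x. f i x * g i x \<partial>M) - (\<integral>x. f0 x * g0 x \<partial>M)
       = (\<integral>x. f i x * g i x - f0 x * g0 x \<partial>M)"
      by (simp add: L2_integrable_mult fi gi f0 g0)
    also have "\<dots> = (\<integral>x. ((f i x - f0 x) * (g i x - g0 x) + (f i x - f0 x) * g0 x) + f0 x * (g i x - g0 x) \<partial>M)"
      by (simp add: algebra_simps)
    also have "\<dots> = (\<integral>x. (f i x - f0 x) * (g i x - g0 x) \<partial>M)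
      + (\<integral>x. (f i x - f0 x) * g0 x \<partial>M) + (\<integral>x. f0 x * (g i x - g0 x) \<partial>M)"
      by (subst Bochner_Integration.integral_add, intro Bochner_Integration.integrable_add,
          (intro L2_integrable_mult elim f0 g0)+,
          subst Bochner_Integration.integral_add, (intro L2_integrable_mult elim f0 g0)+) simp
    finally show ?case
      using L2_Cauchy_Schwarz[OF elim(1) elim(2)] L2_Cauchy_Schwarz[OF elim(1) g0]
        L2_Cauchy_Schwarz[OF f0 elim(2)]
      by (simp only:) (rule order.trans[OF norm_triangle_ineq], rule add_mono,
          rule order.trans[OF norm_triangle_ineq], rule add_mono)
  qed
qed

text \<open>Completeness: a subsequence whose steps have \<open>L\<^sup>2\<close> norm at most \<open>2\<^sup>-\<^sup>n\<close> satisfies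
  \<open>\<Sum> 2\<^sup>n |f\<^sub>n\<^sub>+\<^sub>1 - f\<^sub>n|\<^sup>2 < \<infinity>\<close> almost everywhere, hence converges pointwise there, and Fatou's lemma
  turns the Cauchy condition into convergence in norm.\<close>

lemma L2_complete:
  fixes f :: "nat \<Rightarrow> 'a \<Rightarrow> 'b::{banach, second_countable_topology}"
  assumes f: "\<And>n. f n \<in> L2 M"
    and cauchy: "\<And>e. e > 0 \<Longrightarrow> \<exists>N. \<forall>m\<ge>N. \<forall>n\<ge>N. L2_norm M (\<lambda>x. f m x - f n x) < e"
  obtains g where "g \<in> L2 M" "L2_tendsto M f g sequentially"
proof -
  have [measurable]: "f n \<in> borel_measurable M" for n using f by (rule L2_measurable)
  have "\<exists>N. \<forall>k. (\<forall>m\<ge>N k. \<forall>n\<ge>N k. L2_norm M (\<lambda>x. f m x - f n x) < (1/2)^k)"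
    using cauchy by (intro choice allI) simp
  then obtain N where N: "\<And>k m n. m \<ge> N k \<Longrightarrow> n \<ge> N k \<Longrightarrow> L2_norm M (\<lambda>x. f m x - f n x) < (1/2)^k"
    by blast
  define r where "r k = Max (N ` {..k}) + k" for k
  have rN: "N k \<le> r k'" if "k \<le> k'" for k k'
    using Max_ge[of "N ` {..k'}" "N k"] that by (auto simp: r_def intro: trans_le_add1)
  have rk: "k \<le> r k" for k by (simp add: r_def)
  define d where "d k x = f (r (Suc k)) x - f (r k) x" for k x
  have [measurable]: "d k \<in> borel_measurable M" for k unfolding d_def by measurable
  have nn: "(\<integral>\<^sup>+x. ennreal ((norm (h x))\<^sup>2) \<partial>M) = ennreal ((L2_norm M h)\<^sup>2)" if "h \<in> L2 M" for h :: "'a \<Rightarrow> 'b"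
    unfolding L2_norm_sq by (subst nn_integral_eq_integral) (use L2_integrable_sq[OF that] in auto)
  have dn: "(L2_norm M (d k))\<^sup>2 \<le> ((1/2)^k)\<^sup>2" for k
    unfolding d_def using N[of k "r (Suc k)" "r k"] rN[of k "Suc k"] rN[of k k]
    by (intro power_mono) auto
  have "(\<integral>\<^sup>+x. (\<Sum>k. ennreal (2^k * (norm (d k x))\<^sup>2)) \<partial>M) = (\<Sum>k. \<integral>\<^sup>+x. ennreal (2^k * (norm (d k x))\<^sup>2) \<partial>M)"
    by (rule nn_integral_suminf) measurable
  also have "\<dots> \<le> (\<Sum>k. ennreal ((1/2)^k))"
  proof (rule suminf_le)
    fix k
    have "(\<integral>\<^sup>+x. ennreal (2^k * (norm (d k x))\<^sup>2) \<partial>M) = ennreal (2^k) * ennreal ((L2_norm M (d k))\<^sup>2)"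
      by (subst nn[symmetric]) (auto simp: d_def[abs_def] ennreal_mult nn_integral_cmult intro!: L2_diff f)
    also have "\<dots> \<le> ennreal (2^k * ((1/2)^k)\<^sup>2)"
      using dn[of k] by (subst ennreal_mult[symmetric]) (auto intro!: ennreal_leI)
    also have "2^k * ((1/2)^k)\<^sup>2 = ((1/2)^k :: real)"
      by (simp add: power2_eq_square power_one_over field_simps)
    finally show "(\<integral>\<^sup>+x. ennreal (2^k * (norm (d k x))\<^sup>2) \<partial>M) \<le> ennreal ((1/2)^k)" .
  qed auto
  also have "\<dots> = ennreal (\<Sum>k. (1/2)^k)"
    by (rule suminf_ennreal2) (auto intro: summable_geometric)
  finally have "(\<integral>\<^sup>+x. (\<Sum>k. ennreal (2^k * (norm (d k x))\<^sup>2)) \<partial>M) \<noteq> \<infinity>"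
    by (auto simp: top_unique)
  then have "AE x in M. (\<Sum>k. ennreal (2^k * (norm (d k x))\<^sup>2)) \<noteq> \<infinity>"
    by (intro nn_integral_PInf_AE) auto
  then have conv: "AE x in M. convergent (\<lambda>k. f (r k) x)"
  proof eventually_elim
    case (elim x)
    then have "summable (\<lambda>k. 2^k * (norm (d k x))\<^sup>2)"
      by (intro summable_suminf_not_top) auto
    then have "(\<lambda>k. 2^k * (norm (d k x))\<^sup>2) \<longlonglongrightarrow> 0" by (rule summable_LIMSEQ_zero)
    then have "Bseq (\<lambda>k. 2^k * (norm (d k x))\<^sup>2)" by (intro convergent_imp_Bseq) (auto simp: convergent_def)
    then obtain C where C: "C > 0" "\<And>k. norm (2^k * (norm (d k x))\<^sup>2) \<le> C" by (auto simp: Bseq_def)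
    have "norm (d k x) \<le> sqrt C * (sqrt (1/2))^k" for k
    proof -
      have "(norm (d k x))\<^sup>2 \<le> C * (1/2)^k"
        using C(2)[of k] by (simp add: field_simps power_one_over)
      then have "norm (d k x) \<le> sqrt (C * (1/2)^k)" by (intro real_le_rsqrt)
      then show ?thesis by (simp add: real_sqrt_mult real_sqrt_power)
    qed
    moreover have "summable (\<lambda>k. sqrt C * (sqrt (1/2))^k)"
      by (intro summable_mult summable_geometric) auto
    ultimately have "summable (\<lambda>k. d k x)"
      by - (rule summable_comparison_test'[where g="\<lambda>k. sqrt C * (sqrt (1/2))^k" and N=0], auto)
    then have "convergent (\<lambda>n. \<Sum>k<n. d k x)" by (simp add: summable_iff_convergent)
    moreover have "(\<Sum>k<n. d k x) = f (r n) x - f (r 0) x" for n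
      unfolding d_def by (rule sum_lessThan_telescope)
    ultimately have "convergent (\<lambda>n. f (r n) x - f (r 0) x)" by simp
    then show ?case by (simp add: convergent_diff_const_right_iff)
  qed
  define g where "g x = lim (\<lambda>k. f (r k) x)" for x
  have [measurable]: "g \<in> borel_measurable M" unfolding g_def by measurable
  have lim: "AE x in M. (\<lambda>k. f (r k) x) \<longlonglongrightarrow> g x"
    using conv by eventually_elim (simp add: g_def convergent_LIMSEQ_iff)
  have key: "(\<lambda>x. f n x - g x) \<in> L2 M \<and> L2_norm M (\<lambda>x. f n x - g x) \<le> (1/2)^k" if n: "n \<ge> N k" for n k
  proof -
    have "(\<integral>\<^sup>+x. ennreal ((norm (f n x - g x))\<^sup>2) \<partial>M)
        = (\<integral>\<^sup>+x. liminf (\<lambda>j. ennreal ((norm (f n x - f (r j) x))\<^sup>2)) \<partial>M)"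
    proof (rule nn_integral_cong_AE, use lim in eventually_elim)
      case (elim x)
      have "(\<lambda>j. ennreal ((norm (f n x - f (r j) x))\<^sup>2)) \<longlonglongrightarrow> ennreal ((norm (f n x - g x))\<^sup>2)"
        by (intro tendsto_intros elim)
      then show ?case by (rule lim_imp_Liminf[OF trivial_limit_sequentially, symmetric])
    qed
    also have "\<dots> \<le> liminf (\<lambda>j. \<integral>\<^sup>+x. ennreal ((norm (f n x - f (r j) x))\<^sup>2) \<partial>M)"
      by (rule nn_integral_liminf) measurable
    also have "\<dots> \<le> ennreal (((1/2)^k)\<^sup>2)"
    proof (rule Liminf_le)
      show "eventually (\<lambda>j. (\<integral>\<^sup>+x. ennreal ((norm (f n x - f (r j) x))\<^sup>2) \<partial>M) \<le> ennreal (((1/2)^k)\<^sup>2)) sequentially"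
        using eventually_ge_at_top[of k]
      proof eventually_elim
        case (elim j)
        then have "L2_norm M (\<lambda>x. f n x - f (r j) x) \<le> (1/2)^k" using N[OF n rN[of k j]] by simp
        then show ?case
          by (subst nn) (auto intro!: L2_diff f ennreal_leI power_mono)
      qed
    qed simp
    finally have *: "(\<integral>\<^sup>+x. ennreal ((norm (f n x - g x))\<^sup>2) \<partial>M) \<le> ennreal (((1/2)^k)\<^sup>2)" .
    then have "integrable M (\<lambda>x. (norm (f n x - g x))\<^sup>2)"
      by (intro integrableI_bounded) (auto simp: less_top[symmetric] top_unique)
    then have m: "(\<lambda>x. f n x - g x) \<in> L2 M" by (intro L2I) auto
    have "(L2_norm M (\<lambda>x. f n x - g x))\<^sup>2 \<le> ((1/2)^k)\<^sup>2"
      using * unfolding nn[OF m] by (subst (asm) ennreal_le_iff) auto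
    then show ?thesis using m by (auto intro: power2_le_imp_le)
  qed
  show ?thesis
  proof (rule that)
    show "g \<in> L2 M" using L2_diff_cancel[OF conjunct1[OF key[of 0 "N 0"]] f] by simp
    show "L2_tendsto M f g sequentially"
      unfolding L2_tendsto_def
    proof
      show "eventually (\<lambda>n. (\<lambda>x. f n x - g x) \<in> L2 M) sequentially"
        using eventually_ge_at_top[of "N 0"] by eventually_elim (use key[of 0] in auto)
      show "(\<lambda>n. L2_norm M (\<lambda>x. f n x - g x)) \<longlonglongrightarrow> 0"
      proof (rule LIMSEQ_I)
        fix e :: real assume "e > 0"
        then obtain k where "(1/2)^k < e" using real_arch_pow_inv[of e "1/2"] by auto
        then show "\<exists>no. \<forall>n\<ge>no. norm (L2_norm M (\<lambda>x. f n x - g x) - 0) < e"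
          using key[of k] by (intro exI[of _ "N k"]) (auto intro: le_less_trans)
      qed
    qed
  qed
qed

section \<open>Integration on the cylinder\<close>

text \<open>The oscillating exponentials are bounded but not integrable, so Fubini's theorem is available when
both variables carry an integrable factor.\<close>

lemma Fubini_bounded_kernel:
  fixes f :: "'a \<Rightarrow> complex" and w :: "'b \<Rightarrow> complex" and k :: "'a \<Rightarrow> 'b \<Rightarrow> complex"
  assumes "sigma_finite_measure M" "sigma_finite_measure N"
    and f: "integrable M f" and w: "integrable N w"
    and k: "(\<lambda>(p, q). k p q) \<in> borel_measurable (M \<Otimes>\<^sub>M N)" and b: "\<And>p q. norm (k p q) \<le> B"
  shows "(\<integral>q. w q * (\<integral>p. f p * k p q \<partial>M) \<partial>N) = (\<integral>p. f p * (\<integral>q. w q * k p q \<partial>N) \<partial>M)"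
proof -
  interpret M: sigma_finite_measure M by fact
  interpret N: sigma_finite_measure N by fact
  interpret pair_sigma_finite M N ..
  have [measurable]: "f \<in> borel_measurable M" "w \<in> borel_measurable N" using f w by auto
  note k[measurable]
  have fw: "integrable (M \<Otimes>\<^sub>M N) (\<lambda>(p, q). f p * w q)"
  proof (rule Fubini_integrable)
    show "(\<lambda>(p, q). f p * w q) \<in> borel_measurable (M \<Otimes>\<^sub>M N)" by measurable
    show "integrable M (\<lambda>p. \<integral>q. norm (case (p, q) of (p, q) \<Rightarrow> f p * w q) \<partial>N)"
      using f by (auto simp: norm_mult)
    show "AE p in M. integrable N (\<lambda>q. case (p, q) of (p, q) \<Rightarrow> f p * w q)"
      using w by auto
  qed
  have "integrable (M \<Otimes>\<^sub>M N) (\<lambda>(p, q). (f p * w q) * k p q)"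
  proof (rule Bochner_Integration.integrable_bound)
    show "integrable (M \<Otimes>\<^sub>M N) (\<lambda>x. \<bar>B\<bar> * norm (case x of (p, q) \<Rightarrow> f p * w q))"
      using fw by (intro integrable_mult_right integrable_norm)
    have "norm (f p * w q * k p q) \<le> \<bar>B\<bar> * norm (f p * w q)" for p q
    proof -
      have "norm (f p * w q) * norm (k p q) \<le> norm (f p * w q) * \<bar>B\<bar>"
        using b[of p q] by (intro mult_left_mono) auto
      then show ?thesis by (simp add: norm_mult mult_ac)
    qed
    then show "AE x in M \<Otimes>\<^sub>M N. norm (case x of (p, q) \<Rightarrow> f p * w q * k p q) \<le> norm (\<bar>B\<bar> * norm (case x of (p, q) \<Rightarrow> f p * w q))"
      by (auto simp: split_beta')
  qed measurable
  from Fubini_integral[OF this]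
  have "(\<integral>q. (\<integral>p. f p * w q * k p q \<partial>M) \<partial>N) = (\<integral>p. (\<integral>q. f p * w q * k p q \<partial>N) \<partial>M)" .
  moreover have "(\<integral>p. f p * w q * k p q \<partial>M) = w q * (\<integral>p. f p * k p q \<partial>M)" for q
    by (simp add: mult.assoc mult.left_commute flip: integral_mult_right_zero)
  moreover have "(\<integral>q. f p * w q * k p q \<partial>N) = f p * (\<integral>q. w q * k p q \<partial>N)" for p
    by (simp add: mult.assoc flip: integral_mult_right_zero)
  ultimately show ?thesis by simp
qed

lemma L2_dominated:
  fixes f :: "nat \<Rightarrow> 'a \<Rightarrow> 'b::{banach, second_countable_topology}"
  assumes "\<And>n. f n \<in> borel_measurable M" "g \<in> borel_measurable M" "h \<in> L2 M"
    and "AE x in M. (\<lambda>n. f n x) \<longlonglongrightarrow> g x"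
    and "\<And>n. AE x in M. norm (f n x - g x) \<le> norm (h x)"
  shows "L2_tendsto M f g sequentially"
  unfolding L2_tendsto_def
proof
  note [measurable] = assms(1,2)
  have "(\<lambda>x. f n x - g x) \<in> L2 M" for n
    by (rule L2_norm_mono(1)[OF assms(3)]) (use assms(5) in auto)
  then show "eventually (\<lambda>n. (\<lambda>x. f n x - g x) \<in> L2 M) sequentially" by simp
  have "(\<lambda>n. \<integral>x. (norm (f n x - g x))\<^sup>2 \<partial>M) \<longlonglongrightarrow> (\<integral>x. 0 \<partial>M)"
  proof (rule integral_dominated_convergence)
    show "integrable M (\<lambda>x. (norm (h x))\<^sup>2)" by (rule L2_integrable_sq[OF assms(3)])
    show "AE x in M. (\<lambda>n. (norm (f n x - g x))\<^sup>2) \<longlonglongrightarrow> 0"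
      using assms(4)
    proof eventually_elim
      case (elim x)
      have "(\<lambda>n. (norm (f n x - g x))\<^sup>2) \<longlonglongrightarrow> (norm (g x - g x))\<^sup>2" by (intro tendsto_intros elim)
      then show ?case by simp
    qed
    show "AE x in M. norm ((norm (f n x - g x))\<^sup>2) \<le> (norm (h x))\<^sup>2" for n
      using assms(5)[of n] by eventually_elim (simp add: power_mono)
  qed measurable
  then have "(\<lambda>n. sqrt (\<integral>x. (norm (f n x - g x))\<^sup>2 \<partial>M)) \<longlonglongrightarrow> sqrt 0"
    by (intro tendsto_real_sqrt) simp
  then show "(\<lambda>n. L2_norm M (\<lambda>x. f n x - g x)) \<longlonglongrightarrow> 0" by (simp add: L2_norm_def)
qed

definition emode :: "real \<Rightarrow> real \<times> real \<Rightarrow> real \<times> int \<Rightarrow> complex" where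
  "emode L p q = exp (- \<i> * complex_of_real (fst p * fst q + snd p * real_of_int (snd q) / L))"

lemma norm_emode [simp]: "norm (emode L p q) = 1"
  by (simp add: emode_def norm_exp_eq_Re)

text \<open>The transform of an integrable function as an absolutely convergent integral.  On \<open>L\<^sup>1 \<inter> L\<^sup>2\<close> it agrees almost
everywhere with \<^const>\<open>fourier\<close>, which is only defined as a limit of such integrals.\<close>

definition F1 :: "real \<Rightarrow> (real \<times> real \<Rightarrow> real) \<Rightarrow> real \<times> int \<Rightarrow> complex" where
  "F1 L u q = complex_of_real (1 / (2 * pi * L)) * (\<integral>p. complex_of_real (u p) * emode L p q \<partial>cylinder L)"

locale period = fixes L :: real assumes L_pos: "L > 0"
begin

abbreviation "Cy \<equiv> cylinder L"
abbreviation "Ydom \<equiv> {0..<2 * pi * L}"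
abbreviation "Yc \<equiv> restrict_space lborel Ydom"

lemma space_Cy [simp]: "space Cy = UNIV \<times> Ydom"
  by (auto simp: cylinder_def space_restrict_space)

lemma borel_measurable_CyI: "f \<in> borel_measurable borel \<Longrightarrow> f \<in> borel_measurable Cy"
  unfolding cylinder_def by (intro measurable_restrict_space1) simp

lemma sets_Cy: "sets Cy = (\<lambda>A. A \<inter> (UNIV \<times> Ydom)) ` sets borel"
  unfolding cylinder_def sets_restrict_space by (auto simp: Int_commute)

lemma strip_borel [measurable]: "UNIV \<times> Ydom \<in> sets (borel :: (real \<times> real) measure)"
  by (simp add: borel_prod[symmetric])

lemma emeasure_Cy: "A \<in> sets borel \<Longrightarrow> emeasure Cy (A \<inter> (UNIV \<times> Ydom)) = emeasure lborel (A \<inter> (UNIV \<times> Ydom))"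
  unfolding cylinder_def by (subst emeasure_restrict_space) auto

sublocale Cy: sigma_finite_measure "cylinder L"
  unfolding cylinder_def by (intro sigma_finite_measure_restrict_space) (auto intro: lborel.sigma_finite_measure_axioms)

sublocale Yc: finite_measure "restrict_space lborel {0..<2 * pi * L}"
  by (intro finite_measureI) (use L_pos in \<open>simp add: emeasure_restrict_space space_restrict_space\<close>)

sublocale freq: sigma_finite_measure freq
proof -
  interpret A: sigma_finite_measure "count_space (UNIV :: int set)"
    by (rule sigma_finite_measure_count_space_countable) simp
  interpret pair_sigma_finite lborel "count_space (UNIV :: int set)" ..
  show "sigma_finite_measure freq" unfolding freq_def by unfold_locales
qed

sublocale XY: pair_sigma_finite lborel "restrict_space lborel {0..<2 * pi * L}" ..

sublocale CF: pair_sigma_finite "cylinder L" freq ..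

sublocale CC: pair_sigma_finite "cylinder L" "cylinder L" ..

lemma cylinder_eq_pair: "cylinder L = lborel \<Otimes>\<^sub>M Yc"
proof (rule pair_measure_eqI[symmetric])
  show "sigma_finite_measure (lborel :: real measure)" "sigma_finite_measure Yc" by unfold_locales
  have snd: "snd \<in> borel_measurable (lborel \<Otimes>\<^sub>M Yc)"
    by (rule measurable_compose[OF measurable_snd]) (simp add: measurable_restrict_space1)
  show "sets (lborel \<Otimes>\<^sub>M Yc) = sets Cy"
  proof
    show "sets (lborel \<Otimes>\<^sub>M Yc) \<subseteq> sets Cy"
    proof (rule sets_pair_in_sets)
      fix A B assume A: "A \<in> sets (lborel :: real measure)" and B: "B \<in> sets Yc"
      then obtain B0 where B0: "B0 \<in> sets borel" "B = Ydom \<inter> B0" by (auto simp: sets_restrict_space)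
      have "A \<times> B0 \<in> sets borel" using A B0 by (simp add: borel_prod[symmetric])
      moreover have "A \<times> B = (A \<times> B0) \<inter> (UNIV \<times> Ydom)" using B0 by auto
      ultimately show "A \<times> B \<in> sets Cy" unfolding sets_Cy by blast
    qed
    show "sets Cy \<subseteq> sets (lborel \<Otimes>\<^sub>M Yc)"
    proof
      fix S assume "S \<in> sets Cy"
      then obtain A where A: "A \<in> sets borel" "S = A \<inter> (UNIV \<times> Ydom)" by (auto simp: sets_Cy)
      have "(\<lambda>p. (fst p, snd p)) \<in> measurable (lborel \<Otimes>\<^sub>M Yc) (borel \<Otimes>\<^sub>M borel)"
        using snd by measurable
      then have "(\<lambda>p. p) \<in> borel_measurable (lborel \<Otimes>\<^sub>M Yc)" by (simp add: borel_prod)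
      from measurable_sets[OF this A(1)] show "S \<in> sets (lborel \<Otimes>\<^sub>M Yc)"
        using A(2) by (simp add: space_pair_measure space_restrict_space del: vimage_ident)
          (simp add: Int_commute)
    qed
  qed
  fix A B assume A: "A \<in> sets (lborel :: real measure)" and B: "B \<in> sets Yc"
  have B': "B \<in> sets borel" "B \<subseteq> Ydom" using B by (auto simp: sets_restrict_space)
  have AB: "A \<times> B \<in> sets borel" using A B' by (simp add: borel_prod[symmetric])
  have "emeasure Cy (A \<times> B) = emeasure lborel (A \<times> B)"
    using emeasure_Cy[OF AB] B' by (simp add: Int_absorb2 Sigma_mono)
  also have "\<dots> = emeasure lborel A * emeasure lborel B"
    using A B' by (simp add: lborel.emeasure_pair_measure_Times lborel_prod[symmetric])
  finally show "emeasure lborel A * emeasure Yc B = emeasure Cy (A \<times> B)"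
    using B' by (simp add: emeasure_restrict_space)
qed

lemma measurable_fst_Cy [measurable]: "fst \<in> borel_measurable Cy"
  by (rule borel_measurable_CyI) (simp add: borel_prod[symmetric])

lemma measurable_snd_Cy [measurable]: "snd \<in> borel_measurable Cy"
  by (rule borel_measurable_CyI) (simp add: borel_prod[symmetric])

lemma measurable_fst_freq [measurable]: "fst \<in> borel_measurable freq"
  unfolding freq_def by measurable

lemma measurable_snd_freq [measurable]: "snd \<in> measurable freq (count_space UNIV)"
  unfolding freq_def by measurable

lemma measurable_int_fun [measurable]: "(\<lambda>q. f (snd q)) \<in> borel_measurable freq"
  by (rule measurable_compose[OF measurable_snd_freq]) simp

lemma measurable_emode [measurable]:
  "(\<lambda>(p, q). emode L p q) \<in> borel_measurable (Cy \<Otimes>\<^sub>M freq)"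
  "emode L p \<in> borel_measurable freq" "(\<lambda>p. emode L p q) \<in> borel_measurable Cy"
proof -
  have [measurable]: "(\<lambda>x. real_of_int (snd (snd x))) \<in> borel_measurable (Cy \<Otimes>\<^sub>M freq)"
    by (rule measurable_compose[OF measurable_snd measurable_int_fun])
  show "(\<lambda>(p, q). emode L p q) \<in> borel_measurable (Cy \<Otimes>\<^sub>M freq)"
    unfolding emode_def split_beta' by measurable
  show "emode L p \<in> borel_measurable freq" "(\<lambda>p. emode L p q) \<in> borel_measurable Cy"
    unfolding emode_def by measurable
qed

lemma integrable_emode:
  "integrable Cy u \<Longrightarrow> integrable Cy (\<lambda>p. complex_of_real (u p) * emode L p q)"
  by (rule Bochner_Integration.integrable_bound[of _ u]) (auto simp: norm_mult)

lemma measurable_F1 [measurable]: 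
  assumes [measurable]: "u \<in> borel_measurable Cy"
  shows "F1 L u \<in> borel_measurable freq"
proof -
  have "(\<lambda>q. \<integral>p. (case (q, p) of (q, p) \<Rightarrow> complex_of_real (u p) * emode L p q) \<partial>Cy) \<in> borel_measurable freq"
    by (rule Cy.borel_measurable_lebesgue_integral[of _ freq, unfolded split_beta']) measurable
  then show ?thesis unfolding F1_def[abs_def] by measurable
qed

lemma norm_F1_le: "integrable Cy u \<Longrightarrow> norm (F1 L u q) \<le> 1 / (2 * pi * L) * (\<integral>p. \<bar>u p\<bar> \<partial>Cy)"
proof -
  assume u: "integrable Cy u"
  have "norm (\<integral>p. complex_of_real (u p) * emode L p q \<partial>Cy) \<le> (\<integral>p. norm (complex_of_real (u p) * emode L p q) \<partial>Cy)"
    by (rule integral_norm_bound)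
  then show ?thesis using L_pos by (auto simp: F1_def norm_mult norm_divide intro!: divide_right_mono)
qed

lemma F1_diff: "integrable Cy u \<Longrightarrow> integrable Cy v \<Longrightarrow> F1 L (\<lambda>p. u p - v p) q = F1 L u q - F1 L v q"
  unfolding F1_def by (simp add: integrable_emode algebra_simps)

lemma F1_add: "integrable Cy u \<Longrightarrow> integrable Cy v \<Longrightarrow> F1 L (\<lambda>p. u p + v p) q = F1 L u q + F1 L v q"
  unfolding F1_def by (simp add: integrable_emode algebra_simps)

lemma F1_cmult: "F1 L (\<lambda>p. c * u p) q = of_real c * F1 L u q"
  unfolding F1_def by (simp add: mult.assoc)

lemma F1_cong_AE:
  assumes [measurable]: "u \<in> borel_measurable Cy" "v \<in> borel_measurable Cy" and "AE p in Cy. u p = v p"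
  shows "F1 L u = F1 L v"
proof
  fix q show "F1 L u q = F1 L v q"
    unfolding F1_def by (intro arg_cong2[where f="(*)"] integral_cong_AE refl) (use assms(3) in auto)
qed

lemma fourier_trunc_eq: "fourier_trunc L R u = F1 L (\<lambda>p. indicator ({-R..R} \<times> UNIV) p * u p)"
proof
  fix q
  show "fourier_trunc L R u q = F1 L (\<lambda>p. indicator ({-R..R} \<times> UNIV) p * u p) q"
    unfolding fourier_trunc_def F1_def emode_def set_lebesgue_integral_def cylinder_def
    by (subst integral_restrict_space)
       (auto simp: split_beta indicator_times scaleR_conv_of_real indicator_def set_lebesgue_integral_def
         intro!: Bochner_Integration.integral_cong)
qed

end

section \<open>Gauss and Poisson kernels\<close>

lemma product_integral:
  fixes f :: "'a \<Rightarrow> 'c::{real_normed_field, banach, second_countable_topology}" and w :: "'b \<Rightarrow> 'c::{real_normed_field, banach, second_countable_topology}"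
  assumes "sigma_finite_measure M" "sigma_finite_measure N"
    and f: "integrable M f" and w: "integrable N w"
  shows "integrable (M \<Otimes>\<^sub>M N) (\<lambda>p. f (fst p) * w (snd p))"
    and "(\<integral>p. f (fst p) * w (snd p) \<partial>(M \<Otimes>\<^sub>M N)) = (\<integral>x. f x \<partial>M) * (\<integral>y. w y \<partial>N)"
proof -
  interpret M: sigma_finite_measure M by fact
  interpret N: sigma_finite_measure N by fact
  interpret pair_sigma_finite M N ..
  have [measurable]: "f \<in> borel_measurable M" "w \<in> borel_measurable N" using f w by auto
  show *: "integrable (M \<Otimes>\<^sub>M N) (\<lambda>p. f (fst p) * w (snd p))"
  proof (rule Fubini_integrable)
    show "(\<lambda>p. f (fst p) * w (snd p)) \<in> borel_measurable (M \<Otimes>\<^sub>M N)" by measurable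
    show "integrable M (\<lambda>x. \<integral>y. norm (f (fst (x, y)) * w (snd (x, y))) \<partial>N)"
      using f by (auto simp: norm_mult)
    show "AE x in M. integrable N (\<lambda>y. f (fst (x, y)) * w (snd (x, y)))"
      using w by auto
  qed
  show "(\<integral>p. f (fst p) * w (snd p) \<partial>(M \<Otimes>\<^sub>M N)) = (\<integral>x. f x \<partial>M) * (\<integral>y. w y \<partial>N)"
    using integral_fst'[OF *] by simp
qed

lemma gauss_integrable:
  assumes "\<nu> > (0::real)"
  shows "integrable lborel (\<lambda>\<xi>. exp (- (\<xi> / \<nu>)\<^sup>2 / 2))"
proof -
  have "(\<lambda>\<xi>. exp (- (\<xi> / \<nu>)\<^sup>2 / 2)) = (\<lambda>\<xi>. sqrt (2 * pi * \<nu>\<^sup>2) * normal_density 0 \<nu> \<xi>)"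
    using assms by (auto simp: normal_density_def power_divide fun_eq_iff)
  then show ?thesis using assms by simp
qed

text \<open>The Gaussian is, up to normalisation, its own Fourier transform; this is read off from the
characteristic function of the normal distribution.\<close>

lemma gauss_transform:
  assumes "\<nu> > (0::real)"
  shows "(\<integral>\<xi>. complex_of_real (exp (- (\<xi> / \<nu>)\<^sup>2 / 2)) * iexp (x * \<xi>) \<partial>lborel)
    = complex_of_real (2 * pi * normal_density 0 (1 / \<nu>) x)"
proof -
  have "(\<integral>\<xi>. complex_of_real (exp (- (\<xi> / \<nu>)\<^sup>2 / 2)) * iexp (x * \<xi>) \<partial>lborel)
      = \<nu> *\<^sub>R (\<integral>s. complex_of_real (exp (- s\<^sup>2 / 2)) * iexp (x * (\<nu> * s)) \<partial>lborel)"
    using assms by (subst lborel_integral_real_affine[where c=\<nu> and t=0]) (auto simp: mult_ac)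
  also have "(\<integral>s. complex_of_real (exp (- s\<^sup>2 / 2)) * iexp (x * (\<nu> * s)) \<partial>lborel)
      = (\<integral>s. complex_of_real (sqrt (2 * pi)) * (std_normal_density s *\<^sub>R iexp ((x * \<nu>) * s)) \<partial>lborel)"
    by (rule Bochner_Integration.integral_cong)
       (auto simp: std_normal_density_def scaleR_conv_of_real mult_ac simp flip: of_real_mult)
  also have "\<dots> = complex_of_real (sqrt (2 * pi)) * (\<integral>s. std_normal_density s *\<^sub>R iexp ((x * \<nu>) * s) \<partial>lborel)"
    by (rule integral_mult_right_zero)
  also have "\<dots> = complex_of_real (sqrt (2 * pi)) * char std_normal_distribution (x * \<nu>)"
    unfolding char_def by (subst integral_density) (auto simp: normal_density_nonneg)
  also have "\<dots> = complex_of_real (sqrt (2 * pi) * exp (- ((x * \<nu>)\<^sup>2) / 2))"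
    by (simp add: char_std_normal_distribution)
  finally have "(\<integral>\<xi>. complex_of_real (exp (- (\<xi> / \<nu>)\<^sup>2 / 2)) * iexp (x * \<xi>) \<partial>lborel)
      = complex_of_real (\<nu> * (sqrt (2 * pi) * exp (- ((x * \<nu>)\<^sup>2) / 2)))"
    by (simp add: scaleR_conv_of_real)
  also have "\<nu> * (sqrt (2 * pi) * exp (- ((x * \<nu>)\<^sup>2) / 2)) = 2 * pi * normal_density 0 (1 / \<nu>) x"
    using assms by (simp add: normal_density_def power_divide real_sqrt_mult real_sqrt_divide field_simps)
  finally show ?thesis .
qed

text \<open>The Poisson kernel of the unit disc, the sum of the series \<open>\<Sum> r\<^sup>|\<^sup>k\<^sup>| e\<^sup>i\<^sup>k\<^sup>\<theta>\<close>.\<close>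

definition poisson :: "real \<Rightarrow> real \<Rightarrow> real" where
  "poisson r \<theta> = (1 - r\<^sup>2) / (1 - 2 * r * cos \<theta> + r\<^sup>2)"

lemma poisson_denom: fixes r :: real shows "1 - 2 * r * cos \<theta> + r\<^sup>2 = (1 - r)\<^sup>2 + 2 * r * (1 - cos \<theta>)"
  by (simp add: power2_eq_square algebra_simps)

lemma poisson_nonneg: "0 \<le> r \<Longrightarrow> r < 1 \<Longrightarrow> 0 \<le> poisson r \<theta>"
  unfolding poisson_def poisson_denom by (intro divide_nonneg_nonneg) (auto simp: power_le_one)

lemma poisson_even: "poisson r (- \<theta>) = poisson r \<theta>"
  by (simp add: poisson_def)

lemma poisson_le:
  assumes "0 \<le> r" "r < 1"
  shows "poisson r \<theta> \<le> (1 - r\<^sup>2) / (1 - r)\<^sup>2"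
  unfolding poisson_def poisson_denom
  using assms by (intro divide_left_mono mult_pos_pos add_pos_nonneg) (auto simp: power_le_one)

text \<open>Away from the peak the kernel tends to zero as \<open>r \<rightarrow> 1\<close>.\<close>

lemma poisson_le_away:
  assumes "1/2 \<le> r" "r < 1" "cos \<theta> \<le> c" "c < 1"
  shows "poisson r \<theta> \<le> (1 - r\<^sup>2) / (1 - c)"
  unfolding poisson_def poisson_denom
proof (intro divide_left_mono mult_pos_pos)
  have "1 * (1 - c) \<le> (2 * r) * (1 - cos \<theta>)"
    using assms by (intro mult_mono) auto
  then show *: "1 - c \<le> (1 - r)\<^sup>2 + 2 * r * (1 - cos \<theta>)"
    by (intro add_increasing) auto
  show "0 < (1 - r)\<^sup>2 + 2 * r * (1 - cos \<theta>)" using assms by (intro less_le_trans[OF _ *]) simp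
qed (use assms in \<open>auto simp: power_le_one\<close>)

lemma poisson_sum:
  assumes r: "0 \<le> r" "r < 1"
  shows "integrable (count_space UNIV) (\<lambda>k::int. complex_of_real (r ^ nat \<bar>k\<bar>) * iexp (\<theta> * real_of_int k))"
    and "(\<integral>k. complex_of_real (r ^ nat \<bar>k\<bar>) * iexp (\<theta> * real_of_int k) \<partial>count_space UNIV) = complex_of_real (poisson r \<theta>)"
proof -
  define f where "f k = complex_of_real (r ^ nat \<bar>k\<bar>) * iexp (\<theta> * real_of_int k)" for k :: int
  define z where "z = complex_of_real r * cis \<theta>"
  define neg where "neg n = - int (Suc n)" for n
  have nz: "norm z < 1" using r by (simp add: z_def norm_mult)
  have f1: "f (int n) = z ^ n" for n
    by (simp add: f_def z_def power_mult_distrib cis_conv_exp mult_ac flip: exp_of_nat_mult)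
  have f2: "f (neg n) = cnj z * cnj z ^ n" for n
  proof -
    have "nat \<bar>neg n\<bar> = Suc n" by (simp add: neg_def)
    moreover have "iexp (\<theta> * real_of_int (neg n)) = cnj (cis \<theta>) ^ Suc n"
    proof -
      have "cnj (cis \<theta>) ^ Suc n = cis (real (Suc n) * (- \<theta>))" by (simp only: cis_cnj Complex.DeMoivre)
      then show ?thesis unfolding cis_conv_exp by (simp add: neg_def algebra_simps)
    qed
    ultimately have "f (neg n) = cnj z ^ Suc n" by (simp add: f_def z_def power_mult_distrib)
    then show ?thesis by simp
  qed
  have U: "(UNIV :: int set) = range int \<union> range neg"
  proof -
    have "k \<in> range int \<union> range neg" for k
    proof (cases "k \<ge> 0")
      case True then show ?thesis by (auto intro: range_eqI[of _ _ "nat k"])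
    next
      case False then show ?thesis by (auto simp: neg_def intro!: range_eqI[of _ _ "nat (- k) - 1"])
    qed
    then show ?thesis by auto
  qed
  have D: "range int \<inter> range neg = {}" by (auto simp: neg_def)
  have inj: "inj int" "inj neg" by (auto simp: inj_def neg_def)
  have s1: "Infinite_Set_Sum.abs_summable_on f (range int)"
    by (rule abs_summable_on_reindex) (use nz in \<open>simp add: f1 abs_summable_on_nat_iff' norm_power summable_geometric\<close>)
  have s2: "Infinite_Set_Sum.abs_summable_on f (range neg)"
    by (rule abs_summable_on_reindex) (use nz in \<open>simp add: f2 abs_summable_on_nat_iff' norm_power norm_mult summable_geometric summable_mult\<close>)
  have s: "Infinite_Set_Sum.abs_summable_on f UNIV" unfolding U using s1 s2 by (rule abs_summable_on_union)
  then show "integrable (count_space UNIV) (\<lambda>k::int. complex_of_real (r ^ nat \<bar>k\<bar>) * iexp (\<theta> * real_of_int k))"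
    by (simp add: abs_summable_on_def f_def[abs_def])
  have "infsetsum f UNIV = infsetsum f (range int) + infsetsum f (range neg)"
    unfolding U by (rule infsetsum_Un_disjoint[OF s1 s2 D])
  also have "infsetsum f (range int) = infsetsum (\<lambda>n. z ^ n) UNIV"
    using infsetsum_reindex_bij_betw[OF inj_on_imp_bij_betw[OF inj(1)], of f] by (simp add: f1)
  also have "\<dots> = (\<Sum>n. z ^ n)"
    by (rule infsetsum_nat') (use nz in \<open>simp add: abs_summable_on_nat_iff' norm_power summable_geometric\<close>)
  also have "infsetsum f (range neg) = infsetsum (\<lambda>n. cnj z * cnj z ^ n) UNIV"
    using infsetsum_reindex_bij_betw[OF inj_on_imp_bij_betw[OF inj(2)], of f] by (simp add: f2)
  also have "\<dots> = (\<Sum>n. cnj z * cnj z ^ n)"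
    by (rule infsetsum_nat') (use nz in \<open>simp add: abs_summable_on_nat_iff' norm_power norm_mult summable_geometric summable_mult\<close>)
  also have "\<dots> = cnj z * (\<Sum>n. cnj z ^ n)" using nz by (intro suminf_mult summable_geometric) simp
  also have "(\<Sum>n. z ^ n) = 1 / (1 - z)" using nz by (rule suminf_geometric)
  also have "(\<Sum>n. cnj z ^ n) = 1 / (1 - cnj z)" using nz by (intro suminf_geometric) simp
  also have "1 / (1 - z) + cnj z * (1 / (1 - cnj z)) = complex_of_real (poisson r \<theta>)"
  proof -
    have ne: "1 - z \<noteq> 0" "1 - cnj z \<noteq> 0" using nz by auto
    have zz: "z * cnj z = complex_of_real (r\<^sup>2)"
      unfolding complex_norm_square[symmetric] by (simp add: z_def norm_mult)
    have zp: "z + cnj z = complex_of_real (2 * r * cos \<theta>)"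
      by (simp add: z_def complex_eq_iff)
    have "1 / (1 - z) + cnj z * (1 / (1 - cnj z)) = (1 - z * cnj z) / ((1 - z) * (1 - cnj z))"
      using ne by (simp add: field_simps)
    also have "(1 - z) * (1 - cnj z) = 1 - (z + cnj z) + z * cnj z" by (simp add: algebra_simps)
    finally show ?thesis unfolding zz zp by (simp add: poisson_def)
  qed
  finally show "(\<integral>k. complex_of_real (r ^ nat \<bar>k\<bar>) * iexp (\<theta> * real_of_int k) \<partial>count_space UNIV) = complex_of_real (poisson r \<theta>)"
    by (simp add: infsetsum_def f_def)
qed

context period begin

text \<open>The measure on the fibre lives on a half-open interval, and the fundamental theorem of calculus on the closed
one; the end point is null.\<close>

lemma Yc_FTC:
  fixes F :: "real \<Rightarrow> 'a::euclidean_space"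
  assumes "\<And>x. (F has_vector_derivative f x) (at x)" "continuous_on UNIV f"
  shows "(\<integral>y. f y \<partial>Yc) = F (2 * pi * L) - F 0"
proof -
  have [measurable]: "f \<in> borel_measurable borel" using assms(2) by (rule borel_measurable_continuous_onI)
  have "(\<integral>y. f y \<partial>Yc) = (\<integral>y. indicator Ydom y *\<^sub>R f y \<partial>lborel)"
    by (subst integral_restrict_space) auto
  also have "\<dots> = (\<integral>y. indicator {0..2 * pi * L} y *\<^sub>R f y \<partial>lborel)"
    by (rule integral_cong_AE, measurable)
       (use AE_lborel_singleton[of "2 * pi * L"] in eventually_elim, auto simp: indicator_def)
  also have "\<dots> = F (2 * pi * L) - F 0"
    using L_pos assms
    by (intro integral_FTC_atLeastAtMost) (auto intro: has_vector_derivative_at_within continuous_on_subset)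
  finally show ?thesis .
qed

lemma measurable_Yc [measurable (raw)]: "f \<in> borel_measurable borel \<Longrightarrow> f \<in> borel_measurable Yc"
  by (intro measurable_restrict_space1) simp

lemma measure_Yc [simp]: "measure Yc Ydom = 2 * pi * L"
  using L_pos by (simp add: measure_restrict_space)

lemma space_Yc [simp]: "space Yc = Ydom" by (simp add: space_restrict_space)

lemma Yc_iexp: "(\<integral>y. iexp ((y - a) / L * real_of_int k) \<partial>Yc) = (if k = 0 then complex_of_real (2 * pi * L) else 0)"
proof (cases "k = 0")
  case False
  let ?c = "\<i> * complex_of_real (real_of_int k / L)"
  have c: "?c \<noteq> 0" using False L_pos by simp
  have "(\<integral>y. iexp ((y - a) / L * real_of_int k) \<partial>Yc)
      = exp (?c * (complex_of_real (2 * pi * L) - a)) / ?c - exp (?c * (complex_of_real 0 - a)) / ?c"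
  proof (rule Yc_FTC)
    fix x
    have "((\<lambda>z. exp (?c * (z - a)) / ?c) has_field_derivative exp (?c * (complex_of_real x - a))) (at (complex_of_real x))"
      using c by (auto intro!: derivative_eq_intros)
    from has_vector_derivative_real_field[OF this]
    show "((\<lambda>y. exp (?c * (complex_of_real y - a)) / ?c) has_vector_derivative iexp ((x - a) / L * real_of_int k)) (at x)"
      by (simp add: mult_ac diff_divide_distrib right_diff_distrib)
  qed (intro continuous_intros, use L_pos in auto)
  also have "exp (?c * (complex_of_real (2 * pi * L) - a)) = exp (?c * (complex_of_real 0 - a)) * exp (\<i> * (of_int k * (of_real pi * 2)))"
  proof -
    have "?c * complex_of_real (2 * pi * L) = \<i> * (of_int k * (of_real pi * 2))"
      using L_pos by simp
    then show ?thesis by (simp only: exp_add[symmetric] right_diff_distrib) simp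
  qed
  also have "exp (\<i> * (of_int k * (of_real pi * 2))) = 1" using exp_integer_2pi[of "of_int k"] by (simp add: mult_ac)
  finally show ?thesis using False by simp
qed (simp add: scaleR_conv_of_real)

lemma poisson_mass:
  assumes r: "0 \<le> r" "r < 1"
  shows "(\<integral>y. poisson r ((y - a) / L) \<partial>Yc) = 2 * pi * L"
proof -
  have meas: "(\<lambda>(p, k). iexp ((p - a) / L * real_of_int k)) \<in> borel_measurable (Yc \<Otimes>\<^sub>M count_space UNIV)"
  proof -
    have [measurable]: "fst \<in> borel_measurable (Yc \<Otimes>\<^sub>M count_space (UNIV::int set))"
      by (rule measurable_compose[OF measurable_fst]) simp
    have [measurable]: "(\<lambda>x. real_of_int (snd x)) \<in> borel_measurable (Yc \<Otimes>\<^sub>M count_space (UNIV::int set))"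
      by (rule measurable_compose[OF measurable_snd]) simp
    show ?thesis unfolding split_beta' by measurable
  qed
  have "complex_of_real (\<integral>y. poisson r ((y - a) / L) \<partial>Yc)
      = (\<integral>y. 1 * (\<integral>k. complex_of_real (r ^ nat \<bar>k\<bar>) * iexp ((y - a) / L * real_of_int k) \<partial>count_space UNIV) \<partial>Yc)"
    unfolding poisson_sum(2)[OF r] by simp
  also have "\<dots> = (\<integral>k. complex_of_real (r ^ nat \<bar>k\<bar>) * (\<integral>y. 1 * iexp ((y - a) / L * real_of_int k) \<partial>Yc) \<partial>count_space UNIV)"
  proof (rule Fubini_bounded_kernel[symmetric, where B=1])
    show "sigma_finite_measure Yc" "sigma_finite_measure (count_space (UNIV :: int set))"
      by (auto intro: Yc.sigma_finite_measure_axioms sigma_finite_measure_count_space_countable)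
    show "integrable Yc (\<lambda>y. 1 :: complex)" by simp
    show "integrable (count_space UNIV) (\<lambda>k::int. complex_of_real (r ^ nat \<bar>k\<bar>))"
      using poisson_sum(1)[OF r, of 0] by simp
    show "(\<lambda>(p, k). iexp ((p - a) / L * real_of_int k)) \<in> borel_measurable (Yc \<Otimes>\<^sub>M count_space UNIV)"
      by (rule meas)
    show "norm (iexp ((p - a) / L * real_of_int k)) \<le> 1" for p k by (simp only: norm_exp_i_times order_refl)
  qed
  also have "\<dots> = (\<integral>k. (if k \<in> {0} then complex_of_real (2 * pi * L) else 0) \<partial>count_space (UNIV::int set))"
    by (intro Bochner_Integration.integral_cong refl) (simp only: mult_1 Yc_iexp, simp)
  also have "\<dots> = complex_of_real (2 * pi * L)"
    by (subst lebesgue_integral_count_space_finite_support) (auto simp: finite_subset[of _ "{0}"])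
  finally show ?thesis by (simp only: of_real_eq_iff)
qed

end

section \<open>Plancherel's theorem on the cylinder\<close>

lemma cnj_measurable [measurable]: "cnj \<in> borel_measurable borel"
  by (rule borel_measurable_continuous_onI) (intro continuous_intros)

lemma norm_integral_le_nn:
  fixes f :: "'a \<Rightarrow> 'b::{banach, second_countable_topology}"
  shows "ennreal (norm (\<integral>x. f x \<partial>M)) \<le> (\<integral>\<^sup>+x. norm (f x) \<partial>M)"
  by (cases "integrable M f") (auto intro: integral_norm_bound_ennreal simp: not_integrable_integral_eq)

lemma nn_sq_L2: "f \<in> L2 M \<Longrightarrow> (\<integral>\<^sup>+x. ennreal ((norm (f x))\<^sup>2) \<partial>M) = ennreal ((L2_norm M f)\<^sup>2)"
  unfolding L2_norm_sq by (subst nn_integral_eq_integral) (auto intro: L2_integrable_sq)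

context period begin

definition rr :: "nat \<Rightarrow> real" where "rr n = 1 - 1 / (real n + 2)"

lemma rr_bounds: "1/2 \<le> rr n" "0 \<le> rr n" "rr n < 1"
  by (auto simp: rr_def field_simps)

lemma rr_tendsto: "rr \<longlonglongrightarrow> 1"
  unfolding rr_def by real_asymp

text \<open>Weights tending to \<open>1\<close> that make all frequency integrals absolutely convergent.  Their inverse
transform \<open>Kn\<close> is a product of a Gauss and a Poisson kernel, hence a positive approximate
identity.\<close>

definition wt :: "nat \<Rightarrow> real \<times> int \<Rightarrow> real" where
  "wt n q = exp (- (fst q / (real n + 1))\<^sup>2 / 2) * rr n ^ nat \<bar>snd q\<bar>"

definition Kn :: "nat \<Rightarrow> real \<times> real \<Rightarrow> real \<times> real \<Rightarrow> real" where
  "Kn n p' p = (2 * pi * normal_density 0 (1 / (real n + 1)) (fst p' - fst p)) * poisson (rr n) ((snd p' - snd p) / L)"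

lemma wt_measurable [measurable]: "wt n \<in> borel_measurable freq"
proof -
  have [measurable]: "(\<lambda>q. rr n ^ nat \<bar>snd q\<bar>) \<in> borel_measurable freq"
    by (rule measurable_int_fun)
  show ?thesis unfolding wt_def by measurable
qed

lemma wt_bounds: "0 \<le> wt n q" "wt n q \<le> 1"
  unfolding wt_def using rr_bounds[of n] by (auto intro!: mult_le_one power_le_one)

lemma wt_tendsto: "(\<lambda>n. wt n q) \<longlonglongrightarrow> 1"
proof -
  have "filterlim (\<lambda>n. real n + 1) at_infinity sequentially"
    by (intro filterlim_at_top_imp_at_infinity) real_asymp
  then have "(\<lambda>n. exp (- (fst q / (real n + 1))\<^sup>2 / 2)) \<longlonglongrightarrow> exp (- 0\<^sup>2 / 2)"
    by (intro tendsto_intros tendsto_divide_0[OF tendsto_const]) auto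
  then have "(\<lambda>n. exp (- (fst q / (real n + 1))\<^sup>2 / 2)) \<longlonglongrightarrow> 1" by simp
  from tendsto_mult[OF this tendsto_power[OF rr_tendsto, of "nat \<bar>snd q\<bar>"]]
  show ?thesis unfolding wt_def by simp
qed

lemma int_sf: "sigma_finite_measure (count_space (UNIV :: int set))"
  by (rule sigma_finite_measure_count_space_countable) simp

lemma wt_integrable: "integrable freq (\<lambda>q. complex_of_real (wt n q))"
proof -
  have "integrable freq (\<lambda>q. complex_of_real (exp (- (fst q / (real n + 1))\<^sup>2 / 2)) * complex_of_real (rr n ^ nat \<bar>snd q\<bar>))"
    unfolding freq_def
    by (rule product_integral(1)[OF lborel.sigma_finite_measure_axioms int_sf])
       (use gauss_integrable[of "real n + 1"] poisson_sum(1)[of "rr n" 0] rr_bounds[of n] in auto)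
  then show ?thesis by (simp add: wt_def)
qed

lemma emode_mult_cnj: "emode L p q * cnj (emode L p' q)
   = iexp ((fst p' - fst p) * fst q) * iexp ((snd p' - snd p) / L * real_of_int (snd q))"
  unfolding emode_def exp_cnj exp_add[symmetric]
  by (rule arg_cong[where f=exp]) (simp add: algebra_simps diff_divide_distrib)

lemma wt_kernel: "(\<integral>q. complex_of_real (wt n q) * (emode L p q * cnj (emode L p' q)) \<partial>freq) = complex_of_real (Kn n p' p)"
proof -
  let ?\<nu> = "real n + 1" and ?x = "fst p' - fst p" and ?y = "(snd p' - snd p) / L"
  have "(\<integral>q. complex_of_real (wt n q) * (emode L p q * cnj (emode L p' q)) \<partial>freq)
      = (\<integral>q. (complex_of_real (exp (- (fst q / ?\<nu>)\<^sup>2 / 2)) * iexp (?x * fst q)) *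
           (complex_of_real (rr n ^ nat \<bar>snd q\<bar>) * iexp (?y * real_of_int (snd q))) \<partial>freq)"
    unfolding emode_mult_cnj wt_def of_real_mult by (simp only: mult_ac)
  also have "\<dots> = (\<integral>\<xi>. complex_of_real (exp (- (\<xi> / ?\<nu>)\<^sup>2 / 2)) * iexp (?x * \<xi>) \<partial>lborel) *
     (\<integral>k. complex_of_real (rr n ^ nat \<bar>k\<bar>) * iexp (?y * real_of_int k) \<partial>count_space UNIV)"
    unfolding freq_def
  proof (rule product_integral(2)[OF lborel.sigma_finite_measure_axioms int_sf])
    show "integrable lborel (\<lambda>\<xi>. complex_of_real (exp (- (\<xi> / ?\<nu>)\<^sup>2 / 2)) * iexp (?x * \<xi>))"
      by (rule Bochner_Integration.integrable_bound[OF gauss_integrable[of ?\<nu>]]) (auto simp: norm_mult norm_exp_i_times simp flip: of_real_mult of_real_diff)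
    show "integrable (count_space UNIV) (\<lambda>k. complex_of_real (rr n ^ nat \<bar>k\<bar>) * iexp (?y * real_of_int k))"
      by (rule poisson_sum(1)) (rule rr_bounds)+
  qed
  also have "\<dots> = complex_of_real (Kn n p' p)"
    by (subst gauss_transform, simp, subst poisson_sum(2)[OF rr_bounds(2,3)], simp add: Kn_def)
  finally show ?thesis .
qed

lemma Kn_nonneg: "0 \<le> Kn n p' p"
  unfolding Kn_def by (intro mult_nonneg_nonneg poisson_nonneg rr_bounds) (auto simp: normal_density_nonneg)

lemma poisson_measurable [measurable]: "poisson r \<in> borel_measurable borel"
  unfolding poisson_def[abs_def] by measurable

lemma Kn_measurable [measurable]:
  "(\<lambda>(p, p'). Kn n p' p) \<in> borel_measurable (Cy \<Otimes>\<^sub>M Cy)"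
  "(\<lambda>p'. Kn n p' p) \<in> borel_measurable Cy" "Kn n p' \<in> borel_measurable Cy"
  unfolding Kn_def[abs_def] split_beta' by measurable

lemma Kn_sym: "Kn n p' p = Kn n p p'"
proof -
  have "(snd p' - snd p) / L = - ((snd p - snd p') / L)" by (simp add: diff_divide_distrib)
  then show ?thesis unfolding Kn_def by (simp add: poisson_even normal_density_def power2_commute)
qed

lemma pair_Yc_integral:
  fixes f h :: "real \<Rightarrow> real"
  assumes "integrable lborel f" "integrable Yc h"
  shows "(\<integral>p. f (fst p) * h (snd p) \<partial>Cy) = (\<integral>x. f x \<partial>lborel) * (\<integral>y. h y \<partial>Yc)"
    "integrable Cy (\<lambda>p. f (fst p) * h (snd p))"
  unfolding cylinder_eq_pair
  by (rule product_integral[OF lborel.sigma_finite_measure_axioms Yc.sigma_finite_measure_axioms assms])+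

lemma gauss_shift: "integrable lborel (\<lambda>x'. 2 * pi * normal_density 0 s (x' - x))"
  "s > 0 \<Longrightarrow> (\<integral>x'. 2 * pi * normal_density 0 s (x' - x) \<partial>lborel) = 2 * pi" if "s > 0"
proof -
  have "normal_density 0 s (x' - x) = normal_density x s x'" for x' by (simp add: normal_density_def)
  then show "integrable lborel (\<lambda>x'. 2 * pi * normal_density 0 s (x' - x))"
    "(\<integral>x'. 2 * pi * normal_density 0 s (x' - x) \<partial>lborel) = 2 * pi"
    using that by simp_all
qed

lemma poisson_Yc_integrable: "integrable Yc (\<lambda>y'. poisson (rr n) ((y' - y) / L))"
  by (rule Yc.integrable_const_bound[where B="(1 - (rr n)\<^sup>2) / (1 - rr n)\<^sup>2"])
     (use poisson_nonneg poisson_le rr_bounds in \<open>auto intro!: measurable_Yc\<close>)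

lemma Kn_mass: "(\<integral>p'. Kn n p' p \<partial>Cy) = 4 * pi\<^sup>2 * L" "integrable Cy (\<lambda>p'. Kn n p' p)"
proof -
  have s: "1 / (real n + 1) > 0" by simp
  show "integrable Cy (\<lambda>p'. Kn n p' p)"
    unfolding Kn_def by (rule pair_Yc_integral(2)[OF gauss_shift(1)[OF s] poisson_Yc_integrable])
  show "(\<integral>p'. Kn n p' p \<partial>Cy) = 4 * pi\<^sup>2 * L"
    unfolding Kn_def
    by (subst pair_Yc_integral(1)[OF gauss_shift(1)[OF s] poisson_Yc_integrable])
       (simp only: gauss_shift(2)[OF s s] poisson_mass[OF rr_bounds(2,3)], simp add: power2_eq_square)
qed

lemma Kn_nn_mass: "(\<integral>\<^sup>+p'. ennreal (Kn n p' p) \<partial>Cy) = ennreal (4 * pi\<^sup>2 * L)"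
  by (subst nn_integral_eq_integral) (auto simp: Kn_mass Kn_nonneg)

text \<open>Inserting the definition of both transforms and exchanging integrals turns the weight on the
frequency side into its kernel on the physical side.\<close>

lemma weighted_pairing:
  assumes u: "integrable Cy u" and g: "integrable Cy g"
  shows "(\<integral>q. complex_of_real (wt n q) * (F1 L u q * cnj (F1 L g q)) \<partial>freq)
    = complex_of_real ((1 / (2 * pi * L))\<^sup>2 * (\<integral>p. u p * (\<integral>p'. g p' * Kn n p' p \<partial>Cy) \<partial>Cy))"
proof -
  let ?c = "complex_of_real (1 / (2 * pi * L))"
  have [measurable]: "u \<in> borel_measurable Cy" "g \<in> borel_measurable Cy" using u g by auto
  define W where "W q = complex_of_real (wt n q) * cnj (F1 L g q)" for q
  have W: "integrable freq W"
  proof (rule Bochner_Integration.integrable_bound)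
    show "integrable freq (\<lambda>q. 1 / (2 * pi * L) * (\<integral>p. \<bar>g p\<bar> \<partial>Cy) * complex_of_real (wt n q))"
      by (intro integrable_mult_right wt_integrable)
    show "W \<in> borel_measurable freq" unfolding W_def[abs_def]
      by (intro borel_measurable_times measurable_compose[OF measurable_F1 cnj_measurable]
         borel_measurable_of_real wt_measurable) measurable
    have "norm (W q) \<le> norm (1 / (2 * pi * L) * (\<integral>p. \<bar>g p\<bar> \<partial>Cy) * complex_of_real (wt n q))" for q
    proof -
      have "norm (W q) = wt n q * norm (F1 L g q)" using wt_bounds[of n q] by (simp add: W_def norm_mult)
      also have "\<dots> \<le> wt n q * (1 / (2 * pi * L) * (\<integral>p. \<bar>g p\<bar> \<partial>Cy))"
        by (intro mult_left_mono norm_F1_le g wt_bounds)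
      also have "\<dots> = norm (1 / (2 * pi * L) * (\<integral>p. \<bar>g p\<bar> \<partial>Cy) * complex_of_real (wt n q))"
        using wt_bounds[of n q] L_pos by (simp add: norm_mult norm_divide mult_ac)
      finally show ?thesis .
    qed
    then show "AE q in freq. norm (W q) \<le> norm (1 / (2 * pi * L) * (\<integral>p. \<bar>g p\<bar> \<partial>Cy) * complex_of_real (wt n q))" by simp
  qed
  have inner: "(\<integral>q. W q * emode L p q \<partial>freq) = complex_of_real (1 / (2 * pi * L) * (\<integral>p'. g p' * Kn n p' p \<partial>Cy))" for p
  proof -
    have cF: "cnj (F1 L g q) = ?c * (\<integral>p'. complex_of_real (g p') * cnj (emode L p' q) \<partial>Cy)" for q
    proof -
      have "(\<integral>p'. complex_of_real (g p') * cnj (emode L p' q) \<partial>Cy) = (\<integral>p'. cnj (complex_of_real (g p') * emode L p' q) \<partial>Cy)"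
        by (simp only: complex_cnj_mult complex_cnj_complex_of_real)
      also have "\<dots> = cnj (\<integral>p'. complex_of_real (g p') * emode L p' q \<partial>Cy)" by (rule Bochner_Integration.integral_cnj)
      finally show ?thesis by (simp add: F1_def)
    qed
    have "(\<integral>q. W q * emode L p q \<partial>freq) = (\<integral>q. ?c * ((complex_of_real (wt n q) * emode L p q) * (\<integral>p'. complex_of_real (g p') * cnj (emode L p' q) \<partial>Cy)) \<partial>freq)"
      unfolding W_def cF by (simp only: mult_ac)
    also have "\<dots> = ?c * (\<integral>q. (complex_of_real (wt n q) * emode L p q) * (\<integral>p'. complex_of_real (g p') * cnj (emode L p' q) \<partial>Cy) \<partial>freq)"
      by (rule integral_mult_right_zero)
    also have "(\<integral>q. (complex_of_real (wt n q) * emode L p q) * (\<integral>p'. complex_of_real (g p') * cnj (emode L p' q) \<partial>Cy) \<partial>freq)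
        = (\<integral>p'. complex_of_real (g p') * (\<integral>q. (complex_of_real (wt n q) * emode L p q) * cnj (emode L p' q) \<partial>freq) \<partial>Cy)"
    proof (rule Fubini_bounded_kernel[where B=1])
      show "integrable Cy (\<lambda>p. complex_of_real (g p))" using g by simp
      show "integrable freq (\<lambda>q. complex_of_real (wt n q) * emode L p q)"
        by (rule Bochner_Integration.integrable_bound[OF wt_integrable[of n]]) (auto simp: norm_mult)
      show "(\<lambda>(p, q). cnj (emode L p q)) \<in> borel_measurable (Cy \<Otimes>\<^sub>M freq)"
        unfolding split_beta' by (rule measurable_compose[OF _ cnj_measurable]) (use measurable_emode(1) in \<open>simp add: split_beta'\<close>)
    qed (auto intro: Cy.sigma_finite_measure_axioms freq.sigma_finite_measure_axioms)
    also have "\<dots> = (\<integral>p'. complex_of_real (g p' * Kn n p' p) \<partial>Cy)"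
      by (simp add: mult.assoc wt_kernel)
    finally show ?thesis by (simp only: integral_complex_of_real of_real_mult[symmetric])
  qed
  have "(\<integral>q. complex_of_real (wt n q) * (F1 L u q * cnj (F1 L g q)) \<partial>freq)
     = (\<integral>q. ?c * (W q * (\<integral>p. complex_of_real (u p) * emode L p q \<partial>Cy)) \<partial>freq)"
    unfolding W_def F1_def[of L u] by (simp only: mult_ac)
  also have "\<dots> = ?c * (\<integral>q. W q * (\<integral>p. complex_of_real (u p) * emode L p q \<partial>Cy) \<partial>freq)"
    by (rule integral_mult_right_zero)
  also have "(\<integral>q. W q * (\<integral>p. complex_of_real (u p) * emode L p q \<partial>Cy) \<partial>freq)
    = (\<integral>p. complex_of_real (u p) * (\<integral>q. W q * emode L p q \<partial>freq) \<partial>Cy)"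
    by (rule Fubini_bounded_kernel[where B=1])
       (use u W measurable_emode(1) in \<open>auto intro: Cy.sigma_finite_measure_axioms freq.sigma_finite_measure_axioms\<close>)
  also have "\<dots> = (\<integral>p. complex_of_real (1 / (2 * pi * L) * (u p * (\<integral>p'. g p' * Kn n p' p \<partial>Cy))) \<partial>Cy)"
    unfolding inner by (intro Bochner_Integration.integral_cong refl) (simp add: mult_ac)
  also have "\<dots> = complex_of_real (1 / (2 * pi * L) * (\<integral>p. u p * (\<integral>p'. g p' * Kn n p' p \<partial>Cy) \<partial>Cy))"
    unfolding integral_complex_of_real integral_mult_right_zero ..
  finally show ?thesis by (simp add: power2_eq_square mult_ac)
qed

text \<open>Convolution with a positive kernel of fixed mass is bounded on \<open>L\<^sup>2\<close>: estimate the product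
\<open>|u p| |u p'|\<close> by half the sum of the squares and integrate the kernel first in one variable,
then in the other.\<close>

lemma Young:
  assumes u: "u \<in> L2 Cy"
  shows "\<bar>\<integral>p. u p * (\<integral>p'. u p' * Kn n p' p \<partial>Cy) \<partial>Cy\<bar> \<le> 4 * pi\<^sup>2 * L * (L2_norm Cy u)\<^sup>2"
proof -
  have [measurable]: "u \<in> borel_measurable Cy" using u by (rule L2_measurable)
  let ?m = "ennreal (4 * pi\<^sup>2 * L)" and ?N = "ennreal ((L2_norm Cy u)\<^sup>2)"
  have "ennreal (norm (\<integral>p. u p * (\<integral>p'. u p' * Kn n p' p \<partial>Cy) \<partial>Cy))
      \<le> (\<integral>\<^sup>+p. ennreal (norm (u p * (\<integral>p'. u p' * Kn n p' p \<partial>Cy))) \<partial>Cy)"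
    by (rule norm_integral_le_nn)
  also have "\<dots> \<le> (\<integral>\<^sup>+p. ennreal \<bar>u p\<bar> * (\<integral>\<^sup>+p'. ennreal (\<bar>u p'\<bar> * Kn n p' p) \<partial>Cy) \<partial>Cy)"
  proof (rule nn_integral_mono)
    fix p
    have "ennreal (norm (\<integral>p'. u p' * Kn n p' p \<partial>Cy)) \<le> (\<integral>\<^sup>+p'. ennreal (\<bar>u p'\<bar> * Kn n p' p) \<partial>Cy)"
      using norm_integral_le_nn[of Cy "\<lambda>p'. u p' * Kn n p' p"] by (simp add: abs_mult Kn_nonneg)
    then show "ennreal (norm (u p * (\<integral>p'. u p' * Kn n p' p \<partial>Cy))) \<le> ennreal \<bar>u p\<bar> * (\<integral>\<^sup>+p'. ennreal (\<bar>u p'\<bar> * Kn n p' p) \<partial>Cy)"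
      by (simp add: abs_mult ennreal_mult mult_left_mono)
  qed
  also have "\<dots> = (\<integral>\<^sup>+p. (\<integral>\<^sup>+p'. ennreal (\<bar>u p\<bar> * (\<bar>u p'\<bar> * Kn n p' p)) \<partial>Cy) \<partial>Cy)"
    by (intro nn_integral_cong, subst nn_integral_cmult[symmetric])
       (auto simp: ennreal_mult Kn_nonneg)
  also have "\<dots> \<le> (\<integral>\<^sup>+p. (\<integral>\<^sup>+p'. ennreal ((u p)\<^sup>2 / 2) * ennreal (Kn n p' p) + ennreal ((u p')\<^sup>2 / 2 * Kn n p' p) \<partial>Cy) \<partial>Cy)"
  proof (intro nn_integral_mono)
    fix p p'
    have "\<bar>u p\<bar> * \<bar>u p'\<bar> \<le> (u p)\<^sup>2 / 2 + (u p')\<^sup>2 / 2"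
      using sum_squares_bound[of "\<bar>u p\<bar>" "\<bar>u p'\<bar>"] by simp
    then have "\<bar>u p\<bar> * \<bar>u p'\<bar> * Kn n p' p \<le> ((u p)\<^sup>2 / 2 + (u p')\<^sup>2 / 2) * Kn n p' p"
      by (intro mult_right_mono Kn_nonneg)
    then show "ennreal (\<bar>u p\<bar> * (\<bar>u p'\<bar> * Kn n p' p)) \<le> ennreal ((u p)\<^sup>2 / 2) * ennreal (Kn n p' p) + ennreal ((u p')\<^sup>2 / 2 * Kn n p' p)"
      by (simp add: ennreal_mult[symmetric] ennreal_plus[symmetric] Kn_nonneg algebra_simps ennreal_leI del: ennreal_plus)
  qed
  also have "\<dots> = (\<integral>\<^sup>+p. ennreal ((u p)\<^sup>2 / 2) * ?m + (\<integral>\<^sup>+p'. ennreal ((u p')\<^sup>2 / 2 * Kn n p' p) \<partial>Cy) \<partial>Cy)"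
    by (intro nn_integral_cong, subst nn_integral_add) (auto simp: nn_integral_cmult Kn_nn_mass)
  also have "\<dots> = (\<integral>\<^sup>+p. ennreal ((u p)\<^sup>2 / 2) * ?m \<partial>Cy) + (\<integral>\<^sup>+p. (\<integral>\<^sup>+p'. ennreal ((u p')\<^sup>2 / 2 * Kn n p' p) \<partial>Cy) \<partial>Cy)"
  proof (rule nn_integral_add)
    have "(\<lambda>p. \<integral>\<^sup>+p'. (case (p, p') of (p, p') \<Rightarrow> ennreal ((u p')\<^sup>2 / 2 * Kn n p' p)) \<partial>Cy) \<in> borel_measurable Cy"
      by (rule Cy.borel_measurable_nn_integral) measurable
    then show "(\<lambda>p. \<integral>\<^sup>+p'. ennreal ((u p')\<^sup>2 / 2 * Kn n p' p) \<partial>Cy) \<in> borel_measurable Cy" by simp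
  qed measurable
  also have "(\<integral>\<^sup>+p. (\<integral>\<^sup>+p'. ennreal ((u p')\<^sup>2 / 2 * Kn n p' p) \<partial>Cy) \<partial>Cy)
     = (\<integral>\<^sup>+p'. (\<integral>\<^sup>+p. ennreal ((u p')\<^sup>2 / 2 * Kn n p' p) \<partial>Cy) \<partial>Cy)"
    by (rule CC.Fubini'[symmetric]) measurable
  also have "\<dots> = (\<integral>\<^sup>+p'. ennreal ((u p')\<^sup>2 / 2) * ?m \<partial>Cy)"
  proof (rule nn_integral_cong)
    fix p'
    have "(\<integral>\<^sup>+p. ennreal ((u p')\<^sup>2 / 2 * Kn n p' p) \<partial>Cy) = (\<integral>\<^sup>+p. ennreal ((u p')\<^sup>2 / 2) * ennreal (Kn n p p') \<partial>Cy)"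
      by (intro nn_integral_cong, subst Kn_sym[of n p'], subst ennreal_mult[symmetric]) (auto simp: Kn_nonneg)
    then show "(\<integral>\<^sup>+p. ennreal ((u p')\<^sup>2 / 2 * Kn n p' p) \<partial>Cy) = ennreal ((u p')\<^sup>2 / 2) * ?m"
      by (simp only: nn_integral_cmult[OF measurable_compose[OF Kn_measurable(2) measurable_ennreal]] Kn_nn_mass)
  qed
  also have "(\<integral>\<^sup>+p. ennreal ((u p)\<^sup>2 / 2) * ?m \<partial>Cy) = ennreal (1/2) * ?N * ?m"
  proof -
    have "(\<integral>\<^sup>+p. ennreal ((u p)\<^sup>2 / 2) \<partial>Cy) = (\<integral>\<^sup>+p. ennreal (1/2) * ennreal ((norm (u p))\<^sup>2) \<partial>Cy)"
      by (intro nn_integral_cong) (subst ennreal_mult[symmetric], auto)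
    also have "\<dots> = ennreal (1/2) * ?N" by (subst nn_integral_cmult) (auto simp: nn_sq_L2[OF u, simplified])
    finally show ?thesis by (simp add: nn_integral_multc)
  qed
  also have "ennreal (1/2) * ?N * ?m + ennreal (1/2) * ?N * ?m = ennreal (4 * pi\<^sup>2 * L * (L2_norm Cy u)\<^sup>2)"
  proof -
    have n: "0 \<le> (L2_norm Cy u)\<^sup>2" "0 \<le> 4 * pi\<^sup>2 * L" using L_pos by auto
    have "ennreal (1/2) * ?N * ?m = ennreal (1/2 * (L2_norm Cy u)\<^sup>2 * (4 * pi\<^sup>2 * L))"
      by (simp only: ennreal_mult''[symmetric, OF n(1)] ennreal_mult''[symmetric, OF n(2)])
    then show ?thesis using n L_pos by (simp add: ennreal_plus[symmetric] mult_ac del: ennreal_plus)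
  qed
  finally show ?thesis
    using L_pos by (subst (asm) ennreal_le_iff) auto
qed

text \<open>The bound holds uniformly for the weighted norms, and the weights increase to \<open>1\<close> in the limit, so
Fatou's lemma gives it for the full norm.\<close>

lemma Bessel:
  assumes u: "integrable Cy u" "u \<in> L2 Cy"
  shows "F1 L u \<in> L2 freq" "(L2_norm freq (F1 L u))\<^sup>2 \<le> 1 / L * (L2_norm Cy u)\<^sup>2"
proof -
  have [measurable]: "u \<in> borel_measurable Cy" using u by auto
  let ?B = "1 / L * (L2_norm Cy u)\<^sup>2"
  have n: "(\<integral>\<^sup>+q. ennreal (wt n q * (norm (F1 L u q))\<^sup>2) \<partial>freq) \<le> ennreal ?B" for n
  proof -
    have eq: "complex_of_real (wt n q) * (F1 L u q * cnj (F1 L u q)) = complex_of_real (wt n q * (norm (F1 L u q))\<^sup>2)" for q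
      by (simp only: of_real_mult complex_norm_square)
    have i: "integrable freq (\<lambda>q. wt n q * (norm (F1 L u q))\<^sup>2)"
    proof (rule Bochner_Integration.integrable_bound)
      show "integrable freq (\<lambda>q. (1 / (2 * pi * L) * (\<integral>p. \<bar>u p\<bar> \<partial>Cy))\<^sup>2 * wt n q)"
        using wt_integrable[of n, unfolded complex_of_real_integrable_eq] by (rule integrable_mult_right)
      show "AE q in freq. norm (wt n q * (norm (F1 L u q))\<^sup>2) \<le> norm ((1 / (2 * pi * L) * (\<integral>p. \<bar>u p\<bar> \<partial>Cy))\<^sup>2 * wt n q)"
      proof (rule AE_I2)
        fix q
        have "(norm (F1 L u q))\<^sup>2 \<le> (1 / (2 * pi * L) * (\<integral>p. \<bar>u p\<bar> \<partial>Cy))\<^sup>2"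
          by (intro power_mono norm_F1_le u) auto
        from mult_right_mono[OF this wt_bounds(1)[of n q]]
        have A: "(norm (F1 L u q))\<^sup>2 * wt n q \<le> (1 / (2 * pi * L) * (\<integral>p. \<bar>u p\<bar> \<partial>Cy))\<^sup>2 * wt n q" .
        have "norm (wt n q * (norm (F1 L u q))\<^sup>2) = (norm (F1 L u q))\<^sup>2 * wt n q"
          using wt_bounds[of n q] by (simp add: abs_mult)
        also note A
        also have "(1 / (2 * pi * L) * (\<integral>p. \<bar>u p\<bar> \<partial>Cy))\<^sup>2 * wt n q \<le> norm ((1 / (2 * pi * L) * (\<integral>p. \<bar>u p\<bar> \<partial>Cy))\<^sup>2 * wt n q)"
          unfolding real_norm_def by (rule abs_ge_self)
        finally show "norm (wt n q * (norm (F1 L u q))\<^sup>2) \<le> norm ((1 / (2 * pi * L) * (\<integral>p. \<bar>u p\<bar> \<partial>Cy))\<^sup>2 * wt n q)" .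
      qed
    qed measurable
    have "complex_of_real (\<integral>q. wt n q * (norm (F1 L u q))\<^sup>2 \<partial>freq)
       = complex_of_real ((1 / (2 * pi * L))\<^sup>2 * (\<integral>p. u p * (\<integral>p'. u p' * Kn n p' p \<partial>Cy) \<partial>Cy))"
      using weighted_pairing[OF u(1) u(1), of n] unfolding eq integral_complex_of_real .
    then have "(\<integral>q. wt n q * (norm (F1 L u q))\<^sup>2 \<partial>freq)
        = (1 / (2 * pi * L))\<^sup>2 * (\<integral>p. u p * (\<integral>p'. u p' * Kn n p' p \<partial>Cy) \<partial>Cy)"
      by (simp only: of_real_eq_iff)
    also have "\<dots> \<le> (1 / (2 * pi * L))\<^sup>2 * (4 * pi\<^sup>2 * L * (L2_norm Cy u)\<^sup>2)"
      using Young[OF u(2), of n] by (intro mult_left_mono) auto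
    also have "\<dots> = ?B" using L_pos by (simp add: power2_eq_square field_simps)
    finally show ?thesis
      by (subst nn_integral_eq_integral[OF i]) (auto simp: wt_bounds intro!: ennreal_leI)
  qed
  have "(\<integral>\<^sup>+q. ennreal ((norm (F1 L u q))\<^sup>2) \<partial>freq) = (\<integral>\<^sup>+q. liminf (\<lambda>n. ennreal (wt n q * (norm (F1 L u q))\<^sup>2)) \<partial>freq)"
  proof (rule nn_integral_cong)
    fix q
    have "(\<lambda>n. ennreal (wt n q * (norm (F1 L u q))\<^sup>2)) \<longlonglongrightarrow> ennreal (1 * (norm (F1 L u q))\<^sup>2)"
      by (intro tendsto_intros wt_tendsto)
    then show "ennreal ((norm (F1 L u q))\<^sup>2) = liminf (\<lambda>n. ennreal (wt n q * (norm (F1 L u q))\<^sup>2))"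
      by (intro lim_imp_Liminf[OF trivial_limit_sequentially, symmetric]) simp
  qed
  also have "\<dots> \<le> liminf (\<lambda>n. \<integral>\<^sup>+q. ennreal (wt n q * (norm (F1 L u q))\<^sup>2) \<partial>freq)"
    by (rule nn_integral_liminf) measurable
  also have "\<dots> \<le> ennreal ?B" by (rule Liminf_le) (use n in auto)
  finally have *: "(\<integral>\<^sup>+q. ennreal ((norm (F1 L u q))\<^sup>2) \<partial>freq) \<le> ennreal ?B" .
  then have "integrable freq (\<lambda>q. (norm (F1 L u q))\<^sup>2)"
    by (intro integrableI_bounded) (auto simp: less_top[symmetric] top_unique)
  then show m: "F1 L u \<in> L2 freq" by (intro L2I) auto
  show "(L2_norm freq (F1 L u))\<^sup>2 \<le> ?B"
    using * unfolding nn_sq_L2[OF m] using L_pos by (subst (asm) ennreal_le_iff) auto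
qed

lemma AE_Cy_fst:
  assumes [measurable]: "Measurable.pred borel P" and "AE x in lborel. P x"
  shows "AE p in Cy. P (fst p)"
proof -
  have "AE p in (lborel \<Otimes>\<^sub>M Yc). P (fst p)"
  proof (rule XY.AE_pair_measure)
    have [measurable]: "Measurable.pred lborel P" by simp
    show "{p \<in> space (lborel \<Otimes>\<^sub>M Yc). P (fst p)} \<in> sets (lborel \<Otimes>\<^sub>M Yc)" by measurable
  qed (use assms(2) in auto)
  then show ?thesis by (simp only: cylinder_eq_pair)
qed

lemma AE_Cy_snd:
  assumes [measurable]: "Measurable.pred borel P" and "AE y in lborel. P y"
  shows "AE p in Cy. P (snd p)"
proof -
  have Y: "AE y in Yc. P y"
    using assms(2) by (subst AE_restrict_space_iff) auto
  have [measurable]: "Measurable.pred Yc P" by (rule measurable_restrict_space1) simp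
  have "AE p in (lborel \<Otimes>\<^sub>M Yc). P (snd p)"
  proof (rule XY.AE_pair_measure)
    show "{p \<in> space (lborel \<Otimes>\<^sub>M Yc). P (snd p)} \<in> sets (lborel \<Otimes>\<^sub>M Yc)" by measurable
  qed (use Y in auto)
  then show ?thesis by (simp only: cylinder_eq_pair)
qed

text \<open>After rescaling the Gaussian to unit width, the indicator is evaluated at points tending to \<open>x\<close>.\<close>

lemma gauss_concentrates:
  assumes "x \<noteq> a" "x \<noteq> b"
  shows "(\<lambda>n. \<integral>x'. indicator {a<..<b} x' * (2 * pi * normal_density 0 (1 / (real n + 1)) (x' - x)) \<partial>lborel)
    \<longlonglongrightarrow> 2 * pi * indicator {a<..<b} x"
proof -
  have eq: "(\<integral>x'. indicator {a<..<b} x' * (2 * pi * normal_density 0 (1 / (real n + 1)) (x' - x)) \<partial>lborel)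
      = (\<integral>s. 2 * pi * indicator {a<..<b} (x + s / (real n + 1)) * std_normal_density s \<partial>lborel)" for n
  proof -
    have "1 / (real n + 1) * (indicator {a<..<b} (x + 1 / (real n + 1) * s) * (2 * pi * normal_density 0 (1 / (real n + 1)) ((x + 1 / (real n + 1) * s) - x)))
      = 2 * pi * indicator {a<..<b} (x + s / (real n + 1)) * std_normal_density s" for s
    proof -
      have "normal_density 0 (1 / (real n + 1)) (s / (real n + 1)) = (real n + 1) * std_normal_density s"
        by (simp add: normal_density_def power_divide real_sqrt_mult real_sqrt_divide)
      then show ?thesis by simp
    qed
    then show ?thesis
      by (subst lborel_integral_real_affine[where c="1 / (real n + 1)" and t=x]) (simp_all flip: integral_mult_right_zero)
  qed
  have "(\<lambda>n. \<integral>s. 2 * pi * indicator {a<..<b} (x + s / (real n + 1)) * std_normal_density s \<partial>lborel)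
    \<longlonglongrightarrow> (\<integral>s. 2 * pi * indicator {a<..<b} x * std_normal_density s \<partial>lborel)"
  proof (rule integral_dominated_convergence[where w="\<lambda>s. 2 * pi * std_normal_density s"])
    show "AE s in lborel. (\<lambda>n. 2 * pi * indicator {a<..<b} (x + s / (real n + 1)) * std_normal_density s)
        \<longlonglongrightarrow> 2 * pi * indicator {a<..<b} x * std_normal_density s"
    proof (rule AE_I2)
      fix s :: real
      have inf: "filterlim (\<lambda>n. real n + 1) at_infinity sequentially"
        by (intro filterlim_at_top_imp_at_infinity) real_asymp
      have "(\<lambda>n. x + s / (real n + 1)) \<longlonglongrightarrow> x + 0"
        by (intro tendsto_add tendsto_const tendsto_divide_0[OF tendsto_const inf])
      then have l: "(\<lambda>n. x + s / (real n + 1)) \<longlonglongrightarrow> x" by simp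
      have "eventually (\<lambda>n. indicator {a<..<b} (x + s / (real n + 1)) = (indicator {a<..<b} x :: real)) sequentially"
      proof (cases "a < x \<and> x < b")
        case True
        then show ?thesis using order_tendstoD[OF l]
          by (auto elim!: eventually_elim2[OF order_tendstoD(1)[OF l, of a] order_tendstoD(2)[OF l, of b]])
      next
        case False
        then consider "x < a" | "b < x" using assms by linarith
        then show ?thesis
        proof cases
          case 1 show ?thesis using order_tendstoD(2)[OF l 1] by eventually_elim (use 1 in auto)
        next
          case 2 show ?thesis using order_tendstoD(1)[OF l 2] by eventually_elim (use 2 in auto)
        qed
      qed
      then have "(\<lambda>n. indicator {a<..<b} (x + s / (real n + 1))) \<longlonglongrightarrow> (indicator {a<..<b} x :: real)"
        by (rule tendsto_eventually)
      then show "(\<lambda>n. 2 * pi * indicator {a<..<b} (x + s / (real n + 1)) * std_normal_density s)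
        \<longlonglongrightarrow> 2 * pi * indicator {a<..<b} x * std_normal_density s"
        by (intro tendsto_intros)
    qed
  qed (auto simp: indicator_def)
  then show ?thesis unfolding eq by (simp add: integral_mult_right_zero)
qed

text \<open>The kernel has total mass \<open>2\<pi>L\<close> and tends to zero uniformly away from \<open>y\<close>, so the integral over the
interval sees all of the mass or none of it.\<close>

lemma poisson_concentrates:
  assumes y: "0 < y" "y < 2 * pi * L" "y \<noteq> c" "y \<noteq> d"
  shows "(\<lambda>n. \<integral>y'. indicator {c<..<d} y' * poisson (rr n) ((y' - y) / L) \<partial>Yc)
    \<longlonglongrightarrow> 2 * pi * L * indicator {c<..<d} y"
proof -
  obtain \<rho> where \<rho>: "0 < \<rho>" "\<rho> < y" "\<rho> < 2 * pi * L - y"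
    and loc: "\<And>y'. \<bar>y' - y\<bar> < \<rho> \<Longrightarrow> indicator {c<..<d} y' = (indicator {c<..<d} y :: real)"
  proof -
    define \<rho> where "\<rho> = min (min y (2 * pi * L - y)) (min \<bar>y - c\<bar> \<bar>y - d\<bar>) / 2"
    have m: "\<rho> * 2 = min (min y (2 * pi * L - y)) (min \<bar>y - c\<bar> \<bar>y - d\<bar>)" by (simp add: \<rho>_def)
    have pos: "\<rho> > 0" using y by (auto simp: \<rho>_def)
    have *: "\<rho> * 2 \<le> y" "\<rho> * 2 \<le> 2 * pi * L - y" "\<rho> * 2 \<le> \<bar>y - c\<bar>" "\<rho> * 2 \<le> \<bar>y - d\<bar>"
      unfolding m by auto
    show ?thesis
    proof (rule that[of \<rho>])
      show "\<rho> > 0" "\<rho> < y" "\<rho> < 2 * pi * L - y" using pos * by linarith+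
      fix y' assume "\<bar>y' - y\<bar> < \<rho>"
      then have "c < y' \<longleftrightarrow> c < y" "y' < d \<longleftrightarrow> y < d" using * pos by linarith+
      then show "indicator {c<..<d} y' = (indicator {c<..<d} y :: real)" by (simp add: indicator_def)
    qed
  qed
  define C where "C = cos (\<rho> / L)"
  have "\<rho> / L < pi" using \<rho> y L_pos by (simp add: field_simps)
  then have C: "C < 1" unfolding C_def using cos_monotone_0_pi[of 0 "\<rho> / L"] \<rho> L_pos by simp
  have away: "cos ((y' - y) / L) \<le> C" if "\<rho> \<le> \<bar>y' - y\<bar>" "y' \<in> Ydom" for y'
  proof -
    have r: "\<rho> / L \<le> \<bar>y' - y\<bar> / L" using that L_pos by (intro divide_right_mono) auto
    have "\<bar>y' - y\<bar> \<le> 2 * pi * L - \<rho>" using that \<rho> by auto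
    then have r2: "\<bar>y' - y\<bar> / L \<le> 2 * pi - \<rho> / L" using L_pos by (simp add: field_simps)
    have e: "cos ((y' - y) / L) = cos (\<bar>y' - y\<bar> / L)" 
    proof -
      have "\<bar>y' - y\<bar> / L = \<bar>(y' - y) / L\<bar>" using L_pos by (simp add: abs_divide)
      then show ?thesis by (simp only: cos_abs_real)
    qed
    show ?thesis
    proof (cases "\<bar>y' - y\<bar> / L \<le> pi")
      case True
      then show ?thesis unfolding e C_def using r \<rho> L_pos by (intro cos_monotone_0_pi_le) auto
    next
      case False
      have "cos (2 * pi - \<bar>y' - y\<bar> / L) \<le> cos (\<rho> / L)"
        using False r2 \<rho> L_pos by (intro cos_monotone_0_pi_le) auto
      then show ?thesis unfolding e C_def by (simp add: cos_diff)
    qed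
  qed
  let ?i = "\<lambda>n. \<integral>y'. indicator {c<..<d} y' * poisson (rr n) ((y' - y) / L) \<partial>Yc"
  have mI: "(\<lambda>y'. indicator {c<..<d} y' :: real) \<in> borel_measurable Yc" by (rule measurable_Yc) measurable
  have int: "integrable Yc (\<lambda>y'. indicator {c<..<d} y' * poisson (rr n) ((y' - y) / L))" for n
    by (rule Bochner_Integration.integrable_bound[OF poisson_Yc_integrable[of n y]])
       (use mI in \<open>auto simp: indicator_def intro!: borel_measurable_times measurable_Yc\<close>)
  have bound: "norm (?i n - 2 * pi * L * indicator {c<..<d} y) \<le> (2 * pi * L) * ((1 - (rr n)\<^sup>2) / (1 - C))" for n
  proof -
    let ?P = "\<lambda>y'. poisson (rr n) ((y' - y) / L)"
    have "?i n - 2 * pi * L * indicator {c<..<d} y = ?i n - (\<integral>y'. indicator {c<..<d} y * ?P y' \<partial>Yc)"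
      using poisson_mass[OF rr_bounds(2,3), of n y] by simp
    also have "\<dots> = (\<integral>y'. indicator {c<..<d} y' * ?P y' - indicator {c<..<d} y * ?P y' \<partial>Yc)"
      by (rule Bochner_Integration.integral_diff[symmetric, OF int]) (intro integrable_mult_right poisson_Yc_integrable)
    finally have e: "?i n - 2 * pi * L * indicator {c<..<d} y = (\<integral>y'. indicator {c<..<d} y' * ?P y' - indicator {c<..<d} y * ?P y' \<partial>Yc)" .
    have "norm (\<integral>y'. indicator {c<..<d} y' * ?P y' - indicator {c<..<d} y * ?P y' \<partial>Yc) \<le> (\<integral>y'. (1 - (rr n)\<^sup>2) / (1 - C) \<partial>Yc)"
    proof (rule Bochner_Integration.integral_norm_bound_integral)
      show "integrable Yc (\<lambda>y'. indicator {c<..<d} y' * ?P y' - indicator {c<..<d} y * ?P y')"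
        by (intro Bochner_Integration.integrable_diff int integrable_mult_right poisson_Yc_integrable)
      fix y' assume "y' \<in> space Yc"
      then have y': "y' \<in> Ydom" by simp
      have B: "(1 - (rr n)\<^sup>2) / (1 - C) \<ge> 0" using C rr_bounds[of n] by (auto intro!: divide_nonneg_nonneg simp: power_le_one)
      show "norm (indicator {c<..<d} y' * ?P y' - indicator {c<..<d} y * ?P y') \<le> (1 - (rr n)\<^sup>2) / (1 - C)"
      proof (cases "\<bar>y' - y\<bar> < \<rho>")
        case True then show ?thesis using loc[OF True] B by simp
      next
        case False
        then have "?P y' \<le> (1 - (rr n)\<^sup>2) / (1 - C)"
          by (intro poisson_le_away away rr_bounds C y') auto
        moreover have "norm (indicator {c<..<d} y' * ?P y' - indicator {c<..<d} y * ?P y') \<le> ?P y'"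
          using poisson_nonneg[OF rr_bounds(2,3)] by (auto simp: indicator_def)
        ultimately show ?thesis by linarith
      qed
    qed simp
    also have "\<dots> = (2 * pi * L) * ((1 - (rr n)\<^sup>2) / (1 - C))"
      by (simp only: lebesgue_integral_const space_Yc measure_Yc real_scaleR_def)
    finally show ?thesis by (simp only: e)
  qed
  have "(\<lambda>n. (2 * pi * L) * ((1 - (rr n)\<^sup>2) / (1 - C))) \<longlonglongrightarrow> (2 * pi * L) * ((1 - 1\<^sup>2) / (1 - C))"
    by (intro tendsto_intros rr_tendsto) (use C in auto)
  then have "(\<lambda>n. (2 * pi * L) * ((1 - (rr n)\<^sup>2) / (1 - C))) \<longlonglongrightarrow> 0" by simp
  then have "(\<lambda>n. ?i n - 2 * pi * L * indicator {c<..<d} y) \<longlonglongrightarrow> 0"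
    by (rule Lim_null_comparison[rotated]) (rule always_eventually, rule allI, rule bound)
  then show ?thesis by (rule LIM_zero_cancel)
qed

text \<open>Indicators of boxes, in the product form to which the one-dimensional limits apply.\<close>

definition brect :: "real \<times> real \<Rightarrow> real \<times> real \<Rightarrow> real \<times> real \<Rightarrow> real" where
  "brect a b p = indicator {fst a<..<fst b} (fst p) * indicator {snd a<..<snd b} (snd p)"

lemma brect_box: "brect a b = indicator (box a b)"
  by (auto simp: brect_def box_prod indicator_def fun_eq_iff mem_Times_iff)

lemma Kn_concentrates:
  "AE p in Cy. (\<lambda>n. \<integral>p'. brect a b p' * Kn n p' p \<partial>Cy) \<longlonglongrightarrow> 4 * pi\<^sup>2 * L * brect a b p"
proof -
  have "AE p in Cy. fst p \<noteq> fst a" by (rule AE_Cy_fst) (auto simp: AE_lborel_singleton)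
  moreover have "AE p in Cy. fst p \<noteq> fst b" by (rule AE_Cy_fst) (auto simp: AE_lborel_singleton)
  moreover have "AE p in Cy. snd p \<noteq> snd a" by (rule AE_Cy_snd) (auto simp: AE_lborel_singleton)
  moreover have "AE p in Cy. snd p \<noteq> snd b" by (rule AE_Cy_snd) (auto simp: AE_lborel_singleton)
  moreover have "AE p in Cy. snd p \<noteq> 0" by (rule AE_Cy_snd) (auto simp: AE_lborel_singleton)
  ultimately show ?thesis using AE_space
  proof eventually_elim
    case (elim p)
    have s: "1 / (real n + 1) > 0" for n by simp
    have eq: "(\<integral>p'. brect a b p' * Kn n p' p \<partial>Cy)
       = (\<integral>x'. indicator {fst a<..<fst b} x' * (2 * pi * normal_density 0 (1 / (real n + 1)) (x' - fst p)) \<partial>lborel)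
         * (\<integral>y'. indicator {snd a<..<snd b} y' * poisson (rr n) ((y' - snd p) / L) \<partial>Yc)" for n
    proof -
      have "(\<integral>p'. brect a b p' * Kn n p' p \<partial>Cy)
        = (\<integral>p'. (indicator {fst a<..<fst b} (fst p') * (2 * pi * normal_density 0 (1 / (real n + 1)) (fst p' - fst p)))
         * (indicator {snd a<..<snd b} (snd p') * poisson (rr n) ((snd p' - snd p) / L)) \<partial>Cy)"
        unfolding brect_def Kn_def by (simp only: mult_ac)
      also have "\<dots> = (\<integral>x'. indicator {fst a<..<fst b} x' * (2 * pi * normal_density 0 (1 / (real n + 1)) (x' - fst p)) \<partial>lborel)
         * (\<integral>y'. indicator {snd a<..<snd b} y' * poisson (rr n) ((y' - snd p) / L) \<partial>Yc)"
      proof (rule pair_Yc_integral(1))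
        show "integrable lborel (\<lambda>x'. indicator {fst a<..<fst b} x' * (2 * pi * normal_density 0 (1 / (real n + 1)) (x' - fst p)))"
          by (rule Bochner_Integration.integrable_bound[OF gauss_shift(1)[OF s[of n], of "fst p"]])
             (auto simp: indicator_def)
        have mI: "(\<lambda>y'. indicator {snd a<..<snd b} y' :: real) \<in> borel_measurable Yc" by (rule measurable_Yc) measurable
        show "integrable Yc (\<lambda>y'. indicator {snd a<..<snd b} y' * poisson (rr n) ((y' - snd p) / L))"
          by (rule Bochner_Integration.integrable_bound[OF poisson_Yc_integrable[of n "snd p"]])
             (use mI in \<open>auto simp: indicator_def intro!: borel_measurable_times measurable_Yc\<close>)
      qed
      finally show ?thesis .
    qed
    have y: "0 < snd p" "snd p < 2 * pi * L" using elim(5,6) by (auto simp: mem_Times_iff)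
    have "(\<lambda>n. \<integral>p'. brect a b p' * Kn n p' p \<partial>Cy) \<longlonglongrightarrow>
        (2 * pi * indicator {fst a<..<fst b} (fst p)) * (2 * pi * L * indicator {snd a<..<snd b} (snd p))"
      unfolding eq by (intro tendsto_mult gauss_concentrates poisson_concentrates elim y)
    then show ?case by (simp add: brect_def power2_eq_square mult_ac)
  qed
qed

lemma brect_measurable [measurable]: "brect a b \<in> borel_measurable Cy"
  unfolding brect_def[abs_def] by measurable

lemma brect_integrable: "integrable Cy (brect a b)"
proof -
  have "integrable lborel (indicator {fst a<..<fst b} :: real \<Rightarrow> real)" 
    using emeasure_lborel_box_finite[of "fst a" "fst b"] by (intro integrable_real_indicator) (auto simp: box_real)
  moreover have "integrable Yc (\<lambda>y. indicator {snd a<..<snd b} y :: real)"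
    by (rule Yc.integrable_const_bound[where B=1]) (auto simp: indicator_def intro!: measurable_Yc)
  ultimately show ?thesis unfolding brect_def[abs_def] by (rule pair_Yc_integral(2))
qed

lemma bounded_integrable_L2:
  assumes "integrable M f" "\<And>x. \<bar>f x\<bar> \<le> B"
  shows "(f :: 'a \<Rightarrow> real) \<in> L2 M"
proof (rule L2I)
  show "f \<in> borel_measurable M" using assms by auto
  show "integrable M (\<lambda>x. (norm (f x))\<^sup>2)"
  proof (rule Bochner_Integration.integrable_bound)
    show "integrable M (\<lambda>x. B * f x)" using assms by auto
    have "(f x)\<^sup>2 \<le> \<bar>B * f x\<bar>" for x
    proof -
      have "\<bar>f x\<bar> * \<bar>f x\<bar> \<le> \<bar>B\<bar> * \<bar>f x\<bar>" using assms(2)[of x] by (intro mult_right_mono) auto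
      then show ?thesis by (simp add: abs_mult power2_eq_square)
    qed
    then show "AE x in M. norm ((norm (f x))\<^sup>2) \<le> norm (B * f x)" by simp
  qed (use assms in auto)
qed

text \<open>Plancherel's identity for the pair \<open>u, g\<close>.  Keeping \<open>u\<close> fixed, it is extended in \<open>g\<close> from boxes to
all of \<open>L\<^sup>1 \<inter> L\<^sup>2\<close> by measure theory; this avoids density of smooth functions.\<close>

definition paired :: "(real \<times> real \<Rightarrow> real) \<Rightarrow> (real \<times> real \<Rightarrow> real) \<Rightarrow> bool" where
  "paired u g \<longleftrightarrow> (\<integral>q. F1 L u q * cnj (F1 L g q) \<partial>freq) = complex_of_real (1 / L * (\<integral>p. u p * g p \<partial>Cy))"

text \<open>Both sides are limits of the weighted identity: on the frequency side by dominated convergence, the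
product of the transforms being integrable by Bessel's inequality, and on the physical side because
the kernels concentrate.\<close>

lemma paired_brect:
  assumes u: "integrable Cy u" "u \<in> L2 Cy"
  shows "paired u (brect a b)"
  unfolding paired_def
proof (rule LIMSEQ_unique)
  let ?g = "brect a b"
  have g01: "\<bar>?g p\<bar> \<le> 1" for p by (simp add: brect_def indicator_def)
  have gL2: "?g \<in> L2 Cy" by (rule bounded_integrable_L2[OF brect_integrable g01])
  have [measurable]: "u \<in> borel_measurable Cy" using u by auto
  have Fi: "integrable freq (\<lambda>q. F1 L u q * cnj (F1 L ?g q))"
    by (intro L2_integrable_mult L2_cnj Bessel u gL2 brect_integrable)
  show "(\<lambda>n. \<integral>q. complex_of_real (wt n q) * (F1 L u q * cnj (F1 L ?g q)) \<partial>freq)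
      \<longlonglongrightarrow> (\<integral>q. F1 L u q * cnj (F1 L ?g q) \<partial>freq)"
  proof (rule integral_dominated_convergence[where w="\<lambda>q. norm (F1 L u q * cnj (F1 L ?g q))"])
    show "integrable freq (\<lambda>q. norm (F1 L u q * cnj (F1 L ?g q)))" using Fi by (rule integrable_norm)
    show "(\<lambda>q. F1 L u q * cnj (F1 L ?g q)) \<in> borel_measurable freq" using Fi by auto
    then show "(\<lambda>q. complex_of_real (wt n q) * (F1 L u q * cnj (F1 L ?g q))) \<in> borel_measurable freq" for n
      by measurable
    show "AE q in freq. (\<lambda>n. complex_of_real (wt n q) * (F1 L u q * cnj (F1 L ?g q))) \<longlonglongrightarrow> F1 L u q * cnj (F1 L ?g q)"
    proof (rule AE_I2)
      fix q
      have "(\<lambda>n. complex_of_real (wt n q) * (F1 L u q * cnj (F1 L ?g q))) \<longlonglongrightarrow> complex_of_real 1 * (F1 L u q * cnj (F1 L ?g q))"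
        by (intro tendsto_intros wt_tendsto)
      then show "(\<lambda>n. complex_of_real (wt n q) * (F1 L u q * cnj (F1 L ?g q))) \<longlonglongrightarrow> F1 L u q * cnj (F1 L ?g q)" by simp
    qed
    show "AE q in freq. norm (complex_of_real (wt n q) * (F1 L u q * cnj (F1 L ?g q))) \<le> norm (F1 L u q * cnj (F1 L ?g q))" for n
      using wt_bounds[of n] by (intro AE_I2) (simp add: norm_mult mult_left_le_one_le)
  qed
  have "(\<lambda>n. \<integral>p. u p * (\<integral>p'. ?g p' * Kn n p' p \<partial>Cy) \<partial>Cy) \<longlonglongrightarrow> (\<integral>p. u p * (4 * pi\<^sup>2 * L * ?g p) \<partial>Cy)"
  proof (rule integral_dominated_convergence[where w="\<lambda>p. \<bar>u p\<bar> * (4 * pi\<^sup>2 * L)"])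
    show "integrable Cy (\<lambda>p. \<bar>u p\<bar> * (4 * pi\<^sup>2 * L))" using u by auto
    show "AE p in Cy. (\<lambda>n. u p * (\<integral>p'. ?g p' * Kn n p' p \<partial>Cy)) \<longlonglongrightarrow> u p * (4 * pi\<^sup>2 * L * ?g p)"
      using Kn_concentrates[of a b] by eventually_elim (intro tendsto_intros)
    fix n
    have "(\<lambda>p. \<integral>p'. (case (p, p') of (p, p') \<Rightarrow> ?g p' * Kn n p' p) \<partial>Cy) \<in> borel_measurable Cy"
      by (rule Cy.borel_measurable_lebesgue_integral) measurable
    then show "(\<lambda>p. u p * (\<integral>p'. ?g p' * Kn n p' p \<partial>Cy)) \<in> borel_measurable Cy" by simp
    show "AE p in Cy. norm (u p * (\<integral>p'. ?g p' * Kn n p' p \<partial>Cy)) \<le> \<bar>u p\<bar> * (4 * pi\<^sup>2 * L)"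
    proof (rule AE_I2)
      fix p
      have i: "integrable Cy (\<lambda>p'. ?g p' * Kn n p' p)"
        by (rule Bochner_Integration.integrable_bound[OF Kn_mass(2)[of n p]])
           (auto simp: brect_def indicator_def)
      have "norm (\<integral>p'. ?g p' * Kn n p' p \<partial>Cy) \<le> (\<integral>p'. Kn n p' p \<partial>Cy)"
        by (rule Bochner_Integration.integral_norm_bound_integral[OF i Kn_mass(2)])
           (use Kn_nonneg in \<open>auto simp: brect_def indicator_def\<close>)
      then show "norm (u p * (\<integral>p'. ?g p' * Kn n p' p \<partial>Cy)) \<le> \<bar>u p\<bar> * (4 * pi\<^sup>2 * L)"
        by (simp add: abs_mult Kn_mass mult_left_mono)
    qed
  qed measurable
  then have "(\<lambda>n. complex_of_real ((1 / (2 * pi * L))\<^sup>2 * (\<integral>p. u p * (\<integral>p'. ?g p' * Kn n p' p \<partial>Cy) \<partial>Cy)))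
     \<longlonglongrightarrow> complex_of_real ((1 / (2 * pi * L))\<^sup>2 * (\<integral>p. u p * (4 * pi\<^sup>2 * L * ?g p) \<partial>Cy))"
    by (intro tendsto_intros)
  also have "(\<integral>p. u p * (4 * pi\<^sup>2 * L * ?g p) \<partial>Cy) = (4 * pi\<^sup>2 * L) * (\<integral>p. u p * ?g p \<partial>Cy)"
    by (subst integral_mult_right_zero[symmetric]) (simp only: mult_ac)
  also have "(1 / (2 * pi * L))\<^sup>2 * ((4 * pi\<^sup>2 * L) * (\<integral>p. u p * ?g p \<partial>Cy)) = 1 / L * (\<integral>p. u p * ?g p \<partial>Cy)"
    using L_pos by (simp add: power2_eq_square field_simps)
  finally show "(\<lambda>n. \<integral>q. complex_of_real (wt n q) * (F1 L u q * cnj (F1 L ?g q)) \<partial>freq)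
      \<longlonglongrightarrow> complex_of_real (1 / L * (\<integral>p. u p * ?g p \<partial>Cy))"
    by (simp only: weighted_pairing[OF u(1) brect_integrable])
qed

text \<open>Bessel's inequality makes both sides continuous in \<open>g\<close> for the \<open>L\<^sup>2\<close> norm.\<close>

lemma paired_limit:
  assumes u: "integrable Cy u" "u \<in> L2 Cy"
    and g: "\<And>n. integrable Cy (g n)" "\<And>n. g n \<in> L2 Cy"
    and g0: "integrable Cy g0" "g0 \<in> L2 Cy"
    and lim: "L2_tendsto Cy g g0 sequentially"
    and p: "\<And>n. paired u (g n)"
  shows "paired u g0"
  unfolding paired_def
proof (rule LIMSEQ_unique)
  have F: "L2_tendsto freq (\<lambda>n q. cnj (F1 L (g n) q)) (\<lambda>q. cnj (F1 L g0 q)) sequentially"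
    unfolding L2_tendsto_def
  proof (intro conjI always_eventually allI)
    have eq: "(\<lambda>q. cnj (F1 L (g n) q) - cnj (F1 L g0 q)) = (\<lambda>q. cnj (F1 L (\<lambda>p. g n p - g0 p) q))" for n
      by (simp add: F1_diff g g0)
    have i: "integrable Cy (\<lambda>p. g n p - g0 p)" "(\<lambda>p. g n p - g0 p) \<in> L2 Cy" for n
      using g[of n] g0 by (auto intro: L2_diff)
    show "(\<lambda>q. cnj (F1 L (g n) q) - cnj (F1 L g0 q)) \<in> L2 freq" for n
      unfolding eq by (intro L2_cnj Bessel i)
    have b: "L2_norm freq (\<lambda>q. cnj (F1 L (g n) q) - cnj (F1 L g0 q)) \<le> sqrt (1 / L) * L2_norm Cy (\<lambda>p. g n p - g0 p)" for n
    proof (rule power2_le_imp_le)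
      show "(L2_norm freq (\<lambda>q. cnj (F1 L (g n) q) - cnj (F1 L g0 q)))\<^sup>2 \<le> (sqrt (1 / L) * L2_norm Cy (\<lambda>p. g n p - g0 p))\<^sup>2"
        unfolding eq using Bessel(2)[OF i[of n]] L_pos
        by (simp add: L2_norm_sq power_mult_distrib)
    qed (use L_pos in auto)
    show "(\<lambda>n. L2_norm freq (\<lambda>q. cnj (F1 L (g n) q) - cnj (F1 L g0 q))) \<longlonglongrightarrow> 0"
    proof (rule tendsto_sandwich[of "\<lambda>_. 0"])
      show "(\<lambda>n. sqrt (1 / L) * L2_norm Cy (\<lambda>p. g n p - g0 p)) \<longlonglongrightarrow> 0"
        using tendsto_mult[OF tendsto_const[of "sqrt (1/L)"] L2_tendstoD(2)[OF lim]] by simp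
    qed (use b in auto)
  qed
  have u': "L2_tendsto M (\<lambda>n. f) f sequentially" for M and f :: "'a \<Rightarrow> 'b::real_normed_vector"
    by (simp add: L2_tendsto_def L2_def)
  show "(\<lambda>n. \<integral>q. F1 L u q * cnj (F1 L (g n) q) \<partial>freq) \<longlonglongrightarrow> (\<integral>q. F1 L u q * cnj (F1 L g0 q) \<partial>freq)"
    by (rule L2_tendsto_integral_mult[OF u' F]) (intro L2_cnj Bessel u g0)+
  have "(\<lambda>n. \<integral>p. u p * g n p \<partial>Cy) \<longlonglongrightarrow> (\<integral>p. u p * g0 p \<partial>Cy)"
    by (rule L2_tendsto_integral_mult[OF u' lim u(2) g0(2)])
  then have "(\<lambda>n. complex_of_real (1 / L * (\<integral>p. u p * g n p \<partial>Cy))) \<longlonglongrightarrow> complex_of_real (1 / L * (\<integral>p. u p * g0 p \<partial>Cy))"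
    by (intro tendsto_intros)
  then show "(\<lambda>n. \<integral>q. F1 L u q * cnj (F1 L (g n) q) \<partial>freq) \<longlonglongrightarrow> complex_of_real (1 / L * (\<integral>p. u p * g0 p \<partial>Cy))"
    using p by (simp only: paired_def)
qed

lemma paired_add:
  assumes "integrable Cy u" "u \<in> L2 Cy" "integrable Cy g" "g \<in> L2 Cy" "integrable Cy h" "h \<in> L2 Cy"
    "paired u g" "paired u h"
  shows "paired u (\<lambda>p. g p + h p)"
proof -
  have i: "integrable freq (\<lambda>q. F1 L u q * cnj (F1 L g q))" "integrable freq (\<lambda>q. F1 L u q * cnj (F1 L h q))"
    by (intro L2_integrable_mult L2_cnj Bessel assms)+
  have "(\<integral>q. F1 L u q * cnj (F1 L (\<lambda>p. g p + h p) q) \<partial>freq) = (\<integral>q. F1 L u q * cnj (F1 L g q) + F1 L u q * cnj (F1 L h q) \<partial>freq)"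
    by (simp add: F1_add assms distrib_left)
  also have "\<dots> = (\<integral>q. F1 L u q * cnj (F1 L g q) \<partial>freq) + (\<integral>q. F1 L u q * cnj (F1 L h q) \<partial>freq)"
    by (rule Bochner_Integration.integral_add[OF i])
  also have "\<dots> = complex_of_real (1 / L * ((\<integral>p. u p * g p \<partial>Cy) + (\<integral>p. u p * h p \<partial>Cy)))"
    using assms(7,8) unfolding paired_def by (simp add: distrib_left)
  also have "(\<integral>p. u p * g p \<partial>Cy) + (\<integral>p. u p * h p \<partial>Cy) = (\<integral>p. u p * (g p + h p) \<partial>Cy)"
    by (simp add: distrib_left L2_integrable_mult assms)
  finally show ?thesis unfolding paired_def .
qed

lemma paired_cmult:
  assumes "paired u g"
  shows "paired u (\<lambda>p. c * g p)"
proof -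
  have "(\<integral>q. F1 L u q * cnj (F1 L (\<lambda>p. c * g p) q) \<partial>freq) = (\<integral>q. complex_of_real c * (F1 L u q * cnj (F1 L g q)) \<partial>freq)"
    by (simp only: F1_cmult complex_cnj_mult complex_cnj_complex_of_real mult_ac)
  also have "\<dots> = complex_of_real c * (\<integral>q. F1 L u q * cnj (F1 L g q) \<partial>freq)"
    by (rule integral_mult_right_zero)
  also have "\<dots> = complex_of_real (1 / L * (c * (\<integral>p. u p * g p \<partial>Cy)))"
    using assms unfolding paired_def by simp
  also have "c * (\<integral>p. u p * g p \<partial>Cy) = (\<integral>p. u p * (c * g p) \<partial>Cy)"
    by (subst integral_mult_right_zero[symmetric]) (simp only: mult_ac)
  finally show ?thesis unfolding paired_def .
qed

lemma paired_diff:
  assumes "integrable Cy u" "u \<in> L2 Cy" "integrable Cy g" "g \<in> L2 Cy" "integrable Cy h" "h \<in> L2 Cy"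
    "paired u g" "paired u h"
  shows "paired u (\<lambda>p. g p - h p)"
  using paired_add[of u g "\<lambda>p. (-1) * h p"] paired_cmult[of u h "-1"] assms L2_uminus[of h] by simp

text \<open>A restriction to bounded boxes makes every Borel set of finite measure, so that the sets whose
  indicator is correctly paired form a Dynkin system containing all boxes.\<close>

definition cut :: "nat \<Rightarrow> (real \<times> real) set" where
  "cut m = box (- real m, -1) (real m, 2 * pi * L + 1)"

lemma cut_props: "cut m \<in> sets borel" "integrable Cy (indicator (cut m) :: _ \<Rightarrow> real)"
  using brect_integrable[of "(- real m, -1)" "(real m, 2 * pi * L + 1)"]
  by (auto simp: cut_def brect_box)

lemma UNIV_borel: "UNIV \<in> sets borel" by simp

lemma box_Int_box: "\<exists>e f. box a b \<inter> box c d = box e (f :: real \<times> real)"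
  by (intro exI[of _ "(max (fst a) (fst c), max (snd a) (snd c))"] exI[of _ "(min (fst b) (fst d), min (snd b) (snd d))"])
     (auto simp: box_prod mem_Times_iff)

lemma ind_props:
  assumes "A \<in> sets borel"
  shows "integrable Cy (indicator (A \<inter> cut m) :: _ \<Rightarrow> real)" "(indicator (A \<inter> cut m) :: _ \<Rightarrow> real) \<in> L2 Cy"
proof -
  show i: "integrable Cy (indicator (A \<inter> cut m) :: _ \<Rightarrow> real)"
  proof (rule Bochner_Integration.integrable_bound[OF cut_props(2)])
    show "(indicator (A \<inter> cut m) :: _ \<Rightarrow> real) \<in> borel_measurable Cy"
      by (rule borel_measurable_CyI) (use assms cut_props in measurable)
  qed (auto simp: indicator_def)
  show "(indicator (A \<inter> cut m) :: _ \<Rightarrow> real) \<in> L2 Cy"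
    by (rule bounded_integrable_L2[OF i, where B=1]) (auto simp: indicator_def)
qed

lemma paired_indicator:
  assumes u: "integrable Cy u" "u \<in> L2 Cy"
    and A: "A \<in> sets borel"
  shows "paired u (indicator (A \<inter> cut m))"
proof -
  let ?G = "range (\<lambda>(a, b). box a b) :: (real \<times> real) set set"
  have sig: "sets (borel :: (real \<times> real) measure) = sigma_sets UNIV ?G"
    unfolding borel_eq_box by (subst sets_measure_of) auto
  have IS: "Int_stable ?G"
  proof (rule Int_stableI)
    fix a b :: "(real \<times> real) set" assume "a \<in> ?G" "b \<in> ?G"
    then obtain a1 a2 b1 b2 where "a = box a1 a2" "b = box b1 b2" by auto
    then show "a \<inter> b \<in> ?G" using box_Int_box[of a1 a2 b1 b2] by auto
  qed
  have sub: "?G \<subseteq> Pow UNIV" by simp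
  from A have "A \<in> sigma_sets UNIV ?G" by (simp add: sig)
  from IS sub this show ?thesis
  proof (induction A rule: sigma_sets_induct_disjoint)
    case (basic A)
    then obtain a b where "A = box a b" by auto
    moreover obtain c d where "box a b \<inter> cut m = box c d"
      using box_Int_box[of a b] unfolding cut_def by blast
    ultimately show ?case using paired_brect[OF u, of c d] by (simp add: brect_box)
  next
    case empty
    show ?case by (simp add: paired_def F1_def)
  next
    case (compl A)
    then have A: "A \<in> sets borel" by (simp add: sig)
    have "paired u (\<lambda>p. indicator (UNIV \<inter> cut m) p - indicator (A \<inter> cut m) p)"
    proof (rule paired_diff[OF u ind_props[OF UNIV_borel] ind_props[OF A] _ compl(2)])
      show "paired u (indicator (UNIV \<inter> cut m))"
        using paired_brect[OF u, of "(- real m, -1)" "(real m, 2 * pi * L + 1)"] by (simp add: cut_def brect_box)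
    qed
    also have "(\<lambda>p. indicator (UNIV \<inter> cut m) p - indicator (A \<inter> cut m) p) = (indicator ((UNIV - A) \<inter> cut m) :: _ \<Rightarrow> real)"
      by (auto simp: indicator_def fun_eq_iff)
    finally show ?case .
  next
    case (union A)
    then have A: "A i \<in> sets borel" for i by (auto simp: sig)
    have fin: "paired u (indicator ((\<Union>i<n. A i) \<inter> cut m))" for n
    proof (induction n)
      case 0 show ?case by (simp add: paired_def F1_def)
    next
      case (Suc n)
      have m: "(\<Union>i<n. A i) \<in> sets borel" using A by auto
      have "paired u (\<lambda>p. indicator ((\<Union>i<n. A i) \<inter> cut m) p + indicator (A n \<inter> cut m) p)"
        by (rule paired_add[OF u ind_props[OF m] ind_props[OF A] Suc union(3)])
      also have "(\<lambda>p. indicator ((\<Union>i<n. A i) \<inter> cut m) p + indicator (A n \<inter> cut m) p) = (indicator ((\<Union>i<Suc n. A i) \<inter> cut m) :: _ \<Rightarrow> real)"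
      proof
        fix p
        show "indicator ((\<Union>i<n. A i) \<inter> cut m) p + indicator (A n \<inter> cut m) p = (indicator ((\<Union>i<Suc n. A i) \<inter> cut m) p :: real)"
        proof -
          have "p \<notin> A n" if "i < n" "p \<in> A i" for i
            using union(1) that unfolding disjoint_family_on_def by (metis IntI UNIV_I empty_iff less_irrefl)
          then show ?thesis by (auto simp: indicator_def lessThan_Suc)
        qed
      qed
      finally show ?case .
    qed
    have m: "(\<Union>i. A i) \<in> sets borel" "(\<Union>i<n. A i) \<in> sets borel" for n using A by auto
    show ?case
    proof (rule paired_limit[OF u ind_props[OF m(2)] ind_props[OF m(1)] _ fin])
      show "L2_tendsto Cy (\<lambda>n. indicator ((\<Union>i<n. A i) \<inter> cut m)) (indicator ((\<Union>i. A i) \<inter> cut m) :: _ \<Rightarrow> real) sequentially"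
      proof (rule L2_dominated)
        show "(indicator ((\<Union>i<n. A i) \<inter> cut m) :: _ \<Rightarrow> real) \<in> borel_measurable Cy" for n
          using ind_props(1)[OF m(2)[of n]] by auto
        show "(indicator ((\<Union>i. A i) \<inter> cut m) :: _ \<Rightarrow> real) \<in> borel_measurable Cy"
          using ind_props(1)[OF m(1)] by auto
        show "(indicator (UNIV \<inter> cut m) :: _ \<Rightarrow> real) \<in> L2 Cy"
          using ind_props(2)[OF UNIV_borel] .
        show "AE x in Cy. (\<lambda>n. indicator ((\<Union>i<n. A i) \<inter> cut m) x) \<longlonglongrightarrow> (indicator ((\<Union>i. A i) \<inter> cut m) x :: real)"
        proof (rule AE_I2)
          fix x
          have "(\<lambda>n. indicator (\<Union>i<n. A i) x * indicator (cut m) x) \<longlonglongrightarrow> (indicator (\<Union>i. A i) x * indicator (cut m) x :: real)"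
            by (intro tendsto_intros LIMSEQ_indicator_UN)
          then show "(\<lambda>n. indicator ((\<Union>i<n. A i) \<inter> cut m) x) \<longlonglongrightarrow> (indicator ((\<Union>i. A i) \<inter> cut m) x :: real)"
            by (simp add: indicator_inter_arith)
        qed
      qed (auto simp: indicator_def)
    qed
  qed
qed

lemma paired_nonneg:
  assumes u: "integrable Cy u" "u \<in> L2 Cy"
    and g: "g \<in> borel_measurable Cy" "\<And>x. 0 \<le> g x"
  shows "(\<lambda>p. g p * indicator (cut m) p) \<in> L2 Cy \<longrightarrow> paired u (\<lambda>p. g p * indicator (cut m) p)"
proof -
  have cm: "(indicator (cut m) :: _ \<Rightarrow> real) \<in> borel_measurable Cy" using cut_props(2)[of m] by auto
  have cL2: "(indicator (cut m) :: _ \<Rightarrow> real) \<in> L2 Cy"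
    using ind_props(2)[OF UNIV_borel] by simp
  have int: "integrable Cy (\<lambda>p. h p * indicator (cut m) p)" if "(\<lambda>p. h p * indicator (cut m) p) \<in> L2 Cy" for h :: "_ \<Rightarrow> real"
  proof -
    have "integrable Cy (\<lambda>p. (h p * indicator (cut m) p) * indicator (cut m) p)"
      using L2_integrable_mult[OF that cL2] .
    moreover have "(\<lambda>p. (h p * indicator (cut m) p) * indicator (cut m) p) = (\<lambda>p. h p * indicator (cut m) p)"
      by (auto simp: indicator_def fun_eq_iff)
    ultimately show ?thesis by simp
  qed
  have dom: "(\<lambda>p. h p * indicator (cut m) p) \<in> L2 Cy"
    if "(\<lambda>p. k p * indicator (cut m) p) \<in> L2 Cy" "h \<in> borel_measurable Cy" "\<And>x. x \<in> space Cy \<Longrightarrow> 0 \<le> h x \<and> h x \<le> k x"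
    for h k :: "_ \<Rightarrow> real"
  proof (rule L2_norm_mono(1)[OF that(1)])
    show "(\<lambda>p. h p * indicator (cut m) p) \<in> borel_measurable Cy"
      using that(2) cm by measurable
    show "AE p in Cy. norm (h p * indicator (cut m) p) \<le> norm (k p * indicator (cut m) p)"
    proof (rule AE_I2)
      fix p assume "p \<in> space Cy"
      from that(3)[OF this] have "\<bar>h p\<bar> \<le> \<bar>k p\<bar>" by linarith
      then show "norm (h p * indicator (cut m) p) \<le> norm (k p * indicator (cut m) p)"
        by (simp add: abs_mult mult_right_mono)
    qed
  qed
  from g show ?thesis
  proof (induction rule: borel_measurable_induct_real)
    case (set A)
    then obtain A0 where A0: "A0 \<in> sets borel" "A = A0 \<inter> (UNIV \<times> Ydom)" by (auto simp: sets_Cy)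
    have F: "F1 L (\<lambda>p. indicator A p * indicator (cut m) p) = F1 L (indicator (A0 \<inter> cut m))"
      unfolding F1_def fun_eq_iff
      by (intro allI arg_cong2[where f="(*)"] refl Bochner_Integration.integral_cong) (auto simp: indicator_def A0(2))
    moreover have "(\<integral>p. u p * (indicator A p * indicator (cut m) p) \<partial>Cy) = (\<integral>p. u p * indicator (A0 \<inter> cut m) p \<partial>Cy)"
      by (intro Bochner_Integration.integral_cong refl) (auto simp: indicator_def A0(2))
    ultimately show ?case using paired_indicator[OF u A0(1), of m] by (simp add: paired_def)
  next
    case (mult h c)
    show ?case
    proof (cases "c = 0")
      case True then show ?thesis by (simp add: paired_def F1_def)
    next
      case False
      show ?thesis
      proof
        assume "(\<lambda>p. c * h p * indicator (cut m) p) \<in> L2 Cy"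
        from L2_cmult(1)[OF this, of "1/c"] False have "(\<lambda>p. h p * indicator (cut m) p) \<in> L2 Cy" by simp
        with mult have "paired u (\<lambda>p. h p * indicator (cut m) p)" by simp
        from paired_cmult[OF this, of c] show "paired u (\<lambda>p. c * h p * indicator (cut m) p)" by (simp add: mult.assoc)
      qed
    qed
  next
    case (add h k)
    show ?case
    proof
      assume s: "(\<lambda>p. (k p + h p) * indicator (cut m) p) \<in> L2 Cy"
      have h: "(\<lambda>p. h p * indicator (cut m) p) \<in> L2 Cy" and k: "(\<lambda>p. k p * indicator (cut m) p) \<in> L2 Cy"
        by (rule dom[OF s]; use add in simp)+
      have "paired u (\<lambda>p. k p * indicator (cut m) p + h p * indicator (cut m) p)"
        by (rule paired_add[OF u int[OF k] k int[OF h] h]) (use h k add in auto)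
      then show "paired u (\<lambda>p. (k p + h p) * indicator (cut m) p)" by (simp add: distrib_right)
    qed
  next
    case (seq h)
    have le: "h i x \<le> g x" if "x \<in> space Cy" for i x
      using incseq_le[of "\<lambda>i. h i x" "g x" i] seq(3) seq(4)[OF that] unfolding incseq_def le_fun_def by blast
    show ?case
    proof
      assume s: "(\<lambda>p. g p * indicator (cut m) p) \<in> L2 Cy"
      have hi: "(\<lambda>p. h i p * indicator (cut m) p) \<in> L2 Cy" for i
        by (rule dom[OF s]) (use seq le in auto)
      show "paired u (\<lambda>p. g p * indicator (cut m) p)"
      proof (rule paired_limit[OF u int[OF hi] hi int[OF s] s])
        show "paired u (\<lambda>p. h i p * indicator (cut m) p)" for i using seq(5) hi by simp
        show "L2_tendsto Cy (\<lambda>i p. h i p * indicator (cut m) p) (\<lambda>p. g p * indicator (cut m) p) sequentially"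
        proof (rule L2_dominated[OF _ _ s])
          show "(\<lambda>p. h i p * indicator (cut m) p) \<in> borel_measurable Cy" for i using hi by (rule L2_measurable)
          show "(\<lambda>p. g p * indicator (cut m) p) \<in> borel_measurable Cy" using s by (rule L2_measurable)
          show "AE x in Cy. (\<lambda>n. h n x * indicator (cut m) x) \<longlonglongrightarrow> g x * indicator (cut m) x"
            by (intro AE_I2 tendsto_intros seq(4))
          show "AE x in Cy. norm (h n x * indicator (cut m) x - g x * indicator (cut m) x) \<le> norm (g x * indicator (cut m) x)" for n
          proof (rule AE_I2)
            fix x assume "x \<in> space Cy"
            from le[OF this, of n] seq(2)[of n x] have "\<bar>h n x - g x\<bar> \<le> \<bar>g x\<bar>" by linarith
            then show "norm (h n x * indicator (cut m) x - g x * indicator (cut m) x) \<le> norm (g x * indicator (cut m) x)"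
              by (simp add: indicator_def)
          qed
        qed
      qed
    qed
  qed
qed

text \<open>The positive and negative parts of \<open>g\<close>, cut off to bounded boxes, are limits of step functions; the
  cut-off is removed by another limit in \<open>L\<^sup>2\<close>.\<close>

lemma Plancherel_paired:
  assumes u: "integrable Cy u" "u \<in> L2 Cy" and g: "integrable Cy g" "g \<in> L2 Cy"
  shows "paired u g"
proof -
  have [measurable]: "g \<in> borel_measurable Cy" using g by auto
  have cm [measurable]: "(indicator (cut m) :: _ \<Rightarrow> real) \<in> borel_measurable Cy" for m using cut_props(2)[of m] by auto
  have in_cut: "eventually (\<lambda>m. p \<in> cut m) sequentially" if "p \<in> space Cy" for p
  proof -
    obtain n where n: "\<bar>fst p\<bar> < real n" using reals_Archimedean2 by blast
    show ?thesis using eventually_ge_at_top[of n]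
      by eventually_elim (use n that in \<open>auto simp: cut_def box_prod mem_Times_iff\<close>)
  qed
  have main: "paired u h" if h: "integrable Cy h" "h \<in> L2 Cy" "\<And>x. 0 \<le> h x" for h
  proof (rule paired_limit[OF u _ _ h(1,2)])
    have [measurable]: "h \<in> borel_measurable Cy" using h by auto
    let ?h = "\<lambda>m p. h p * indicator (cut m) p"
    show i: "integrable Cy (?h m)" for m
      by (rule Bochner_Integration.integrable_bound[OF h(1)], measurable) (auto simp: indicator_def)
    show l: "?h m \<in> L2 Cy" for m
      by (rule L2_norm_mono(1)[OF h(2)], measurable) (auto simp: indicator_def)
    show "paired u (?h m)" for m using paired_nonneg[OF u _ h(3), where m=m] l by auto
    show "L2_tendsto Cy ?h h sequentially"
    proof (rule L2_dominated[OF _ _ h(2)])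
      show "AE x in Cy. (\<lambda>m. ?h m x) \<longlonglongrightarrow> h x"
      proof (rule AE_I2)
        fix x assume "x \<in> space Cy"
        from in_cut[OF this] have "eventually (\<lambda>m. ?h m x = h x) sequentially"
          by eventually_elim simp
        then show "(\<lambda>m. ?h m x) \<longlonglongrightarrow> h x" by (rule tendsto_eventually)
      qed
      show "AE x in Cy. norm (?h m x - h x) \<le> norm (h x)" for m
        by (auto simp: indicator_def)
    qed measurable
  qed
  have pm: "paired u (\<lambda>p. max 0 (g p) - max 0 (- g p))"
  proof (rule paired_diff[OF u])
    show i1: "integrable Cy (\<lambda>p. max 0 (g p))" "integrable Cy (\<lambda>p. max 0 (- g p))" using g by auto
    show i2: "(\<lambda>p. max 0 (g p)) \<in> L2 Cy" "(\<lambda>p. max 0 (- g p)) \<in> L2 Cy"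
      by (rule L2_norm_mono(1)[OF g(2)]; auto)+
    show "paired u (\<lambda>p. max 0 (g p))" "paired u (\<lambda>p. max 0 (- g p))"
      using i1 i2 by (auto intro: main)
  qed
  have "(\<lambda>p. max 0 (g p) - max 0 (- g p)) = g" by (auto simp: fun_eq_iff max_def)
  with pm show ?thesis by simp
qed

end

section \<open>The Fourier transform\<close>

lemma L2_tendsto_add:
  fixes f f' :: "'i \<Rightarrow> 'a \<Rightarrow> 'b::{banach, second_countable_topology}"
  assumes "L2_tendsto M f g F" "L2_tendsto M f' g' F"
  shows "L2_tendsto M (\<lambda>i x. f i x + f' i x) (\<lambda>x. g x + g' x) F"
  unfolding L2_tendsto_def
proof
  note e = L2_tendstoD(1)[OF assms(1)] L2_tendstoD(1)[OF assms(2)]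
  have eq: "(\<lambda>x. f i x + f' i x - (g x + g' x)) = (\<lambda>x. (f i x - g x) + (f' i x - g' x))" for i
    by (auto simp: algebra_simps)
  show "eventually (\<lambda>i. (\<lambda>x. f i x + f' i x - (g x + g' x)) \<in> L2 M) F"
    using e by eventually_elim (simp only: eq, rule L2_add)
  show "((\<lambda>i. L2_norm M (\<lambda>x. f i x + f' i x - (g x + g' x))) \<longlongrightarrow> 0) F"
  proof (rule Lim_null_comparison)
    show "eventually (\<lambda>i. norm (L2_norm M (\<lambda>x. f i x + f' i x - (g x + g' x)))
      \<le> L2_norm M (\<lambda>x. f i x - g x) + L2_norm M (\<lambda>x. f' i x - g' x)) F"
      using e
    proof eventually_elim
      case (elim i)
      from L2_triangle[OF elim] show ?case by (simp only: eq real_norm_def abs_of_nonneg[OF L2_norm_nonneg])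
    qed
    show "((\<lambda>i. L2_norm M (\<lambda>x. f i x - g x) + L2_norm M (\<lambda>x. f' i x - g' x)) \<longlongrightarrow> 0) F"
      using tendsto_add[OF L2_tendstoD(2)[OF assms(1)] L2_tendstoD(2)[OF assms(2)]] by simp
  qed
qed

lemma L2_tendsto_cmult:
  fixes f :: "'i \<Rightarrow> 'a \<Rightarrow> 'b::{real_normed_field, banach, second_countable_topology}"
  assumes "L2_tendsto M f g F" and m: "m \<in> borel_measurable M" and b: "\<And>x. norm (m x) \<le> B"
  shows "L2_tendsto M (\<lambda>i x. m x * f i x) (\<lambda>x. m x * g x) F"
  unfolding L2_tendsto_def
proof
  note [measurable] = m
  have eq: "(\<lambda>x. m x * f i x - m x * g x) = (\<lambda>x. m x * (f i x - g x))" for i by (auto simp: algebra_simps)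
  have B: "norm (m x) \<le> \<bar>B\<bar>" for x using b[of x] by linarith
  have *: "(\<lambda>x. m x * h x) \<in> L2 M \<and> L2_norm M (\<lambda>x. m x * h x) \<le> \<bar>B\<bar> * L2_norm M h" if h: "h \<in> L2 M" for h
  proof -
    have [measurable]: "h \<in> borel_measurable M" using h by (rule L2_measurable)
    have le: "AE x in M. norm (m x * h x) \<le> norm (\<bar>B\<bar> *\<^sub>R h x)"
      using B by (intro AE_I2) (simp add: norm_mult mult_right_mono)
    have m: "(\<lambda>x. m x * h x) \<in> borel_measurable M" by measurable
    from L2_norm_mono[OF L2_scaleR(1)[OF h] m le] show ?thesis
      using L2_scaleR(2)[OF h, of "\<bar>B\<bar>"] by simp
  qed
  show "eventually (\<lambda>i. (\<lambda>x. m x * f i x - m x * g x) \<in> L2 M) F"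
    using L2_tendstoD(1)[OF assms(1)] by eventually_elim (use * in \<open>simp add: eq\<close>)
  show "((\<lambda>i. L2_norm M (\<lambda>x. m x * f i x - m x * g x)) \<longlongrightarrow> 0) F"
  proof (rule Lim_null_comparison)
    show "eventually (\<lambda>i. norm (L2_norm M (\<lambda>x. m x * f i x - m x * g x)) \<le> \<bar>B\<bar> * L2_norm M (\<lambda>x. f i x - g x)) F"
      using L2_tendstoD(1)[OF assms(1)] by eventually_elim (use * in \<open>simp add: eq\<close>)
    show "((\<lambda>i. \<bar>B\<bar> * L2_norm M (\<lambda>x. f i x - g x)) \<longlongrightarrow> 0) F"
      using tendsto_mult[OF tendsto_const[of "\<bar>B\<bar>"] L2_tendstoD(2)[OF assms(1)]] by simp
  qed
qed

lemma L2_tendsto_const: "L2_tendsto M (\<lambda>_. f) f F"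
  by (simp add: L2_tendsto_def L2_def)

lemma L2_tendsto_diff:
  fixes f f' :: "'i \<Rightarrow> 'a \<Rightarrow> 'b::{real_normed_field, banach, second_countable_topology}"
  assumes "L2_tendsto M f g F" "L2_tendsto M f' g' F"
  shows "L2_tendsto M (\<lambda>i x. f i x - f' i x) (\<lambda>x. g x - g' x) F"
  using L2_tendsto_add[OF assms(1) L2_tendsto_cmult[OF assms(2), of "\<lambda>_. -1" 1]] by simp

text \<open>Transforms are determined only up to null sets, so limits have to be transported along almost everywhere
equality.\<close>

lemma L2_tendsto_cong:
  assumes "L2_tendsto M f g F" "\<And>i. f i \<in> borel_measurable M" "\<And>i. f' i \<in> borel_measurable M"
    "g \<in> borel_measurable M" "g' \<in> borel_measurable M"
    "\<And>i. AE x in M. f i x = f' i x" "AE x in M. g x = g' x"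
  shows "L2_tendsto M f' (g' :: 'a \<Rightarrow> 'b::{banach, second_countable_topology}) F"
  unfolding L2_tendsto_def
proof
  note [measurable] = assms(2,3,4,5)
  have n: "AE x in M. f' i x - g' x = f i x - g x" for i
    using assms(6)[of i] assms(7) by eventually_elim simp
  show "eventually (\<lambda>i. (\<lambda>x. f' i x - g' x) \<in> L2 M) F"
    using L2_tendstoD(1)[OF assms(1)]
    by eventually_elim (rule L2_cong_AE[OF _ _ n], assumption, measurable)
  have "L2_norm M (\<lambda>x. f' i x - g' x) = L2_norm M (\<lambda>x. f i x - g x)" for i
    by (rule L2_norm_cong_AE) (use n[of i] in auto)
  then show "((\<lambda>i. L2_norm M (\<lambda>x. f' i x - g' x)) \<longlongrightarrow> 0) F"
    using L2_tendstoD(2)[OF assms(1)] by simp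
qed

context period begin

text \<open>The factor \<open>1/L\<close> comes from the normalisation of the transform: \<open>(2\<pi>L)\<^sup>-\<^sup>2\<close> against the mass
\<open>4\<pi>\<^sup>2L\<close> of the kernel.\<close>

lemma F1_isometry:
  assumes "integrable Cy u" "u \<in> L2 Cy"
  shows "L2_norm freq (F1 L u) = sqrt (1 / L) * L2_norm Cy u"
proof -
  have "(\<integral>q. complex_of_real ((norm (F1 L u q))\<^sup>2) \<partial>freq) = (\<integral>q. F1 L u q * cnj (F1 L u q) \<partial>freq)"
    by (simp only: complex_norm_square)
  also have "\<dots> = complex_of_real (1 / L * (\<integral>p. u p * u p \<partial>Cy))"
    using Plancherel_paired[OF assms assms] by (simp only: paired_def)
  finally have "(\<integral>q. (norm (F1 L u q))\<^sup>2 \<partial>freq) = 1 / L * (\<integral>p. (norm (u p))\<^sup>2 \<partial>Cy)"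
    by (simp only: integral_complex_of_real of_real_eq_iff) (simp add: power2_eq_square)
  then show ?thesis unfolding L2_norm_def by (simp add: real_sqrt_mult real_sqrt_divide)
qed

definition cutx :: "real \<Rightarrow> (real \<times> real \<Rightarrow> real) \<Rightarrow> real \<times> real \<Rightarrow> real" where
  "cutx R u p = indicator ({-R..R} \<times> UNIV) p * u p"

lemma cutx_measurable [measurable (raw)]:
  assumes [measurable]: "u \<in> borel_measurable Cy" shows "cutx R u \<in> borel_measurable Cy"
proof -
  have "(indicator ({-R..R} \<times> UNIV) :: _ \<Rightarrow> real) \<in> borel_measurable Cy"
    by (rule borel_measurable_CyI) (simp add: borel_prod[symmetric])
  then show ?thesis unfolding cutx_def[abs_def] by measurable
qed

lemma cutx_L2:
  assumes u: "u \<in> L2 Cy"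
  shows "cutx R u \<in> L2 Cy" "integrable Cy (cutx R u)"
proof -
  have [measurable]: "u \<in> borel_measurable Cy" using u by (rule L2_measurable)
  show c: "cutx R u \<in> L2 Cy"
    by (rule L2_norm_mono(1)[OF u]) (auto simp: cutx_def indicator_def)
  have "integrable Cy (\<lambda>p. indicator {-R..R} (fst p) * 1 :: real)"
    by (rule pair_Yc_integral(2)) (auto intro!: integrable_real_indicator simp: emeasure_lborel_Icc_eq)
  then have i: "integrable Cy (\<lambda>p. indicator {-R..R} (fst p) :: real)" by simp
  have "(\<lambda>p. indicator {-R..R} (fst p) :: real) \<in> L2 Cy"
    by (rule bounded_integrable_L2[OF i, where B=1]) (auto simp: indicator_def)
  from L2_integrable_mult[OF this c] show "integrable Cy (cutx R u)"
    by (rule Bochner_Integration.integrable_cong[THEN iffD1, rotated 2]) (auto simp: cutx_def indicator_def)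
qed

lemma cutx_tendsto:
  assumes u: "u \<in> L2 Cy"
  shows "L2_tendsto Cy (\<lambda>R. cutx R u) u at_top"
  unfolding L2_tendsto_def
proof
  have [measurable]: "u \<in> borel_measurable Cy" using u by (rule L2_measurable)
  show "eventually (\<lambda>R. (\<lambda>p. cutx R u p - u p) \<in> L2 Cy) at_top"
    by (intro always_eventually allI L2_diff cutx_L2 u)
  show "((\<lambda>R. L2_norm Cy (\<lambda>p. cutx R u p - u p)) \<longlongrightarrow> 0) at_top"
  proof (rule tendsto_at_topI_sequentially)
    fix X :: "nat \<Rightarrow> real" assume X: "filterlim X at_top sequentially"
    have "L2_tendsto Cy (\<lambda>n. cutx (X n) u) u sequentially"
    proof (rule L2_dominated[OF _ _ u])
      show "AE p in Cy. (\<lambda>n. cutx (X n) u p) \<longlonglongrightarrow> u p"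
      proof (rule AE_I2)
        fix p :: "real \<times> real"
        have "eventually (\<lambda>n. X n \<ge> \<bar>fst p\<bar>) sequentially" using X by (simp add: filterlim_at_top)
        then have "eventually (\<lambda>n. cutx (X n) u p = u p) sequentially"
          by eventually_elim (auto simp: cutx_def mem_Times_iff indicator_def)
        then show "(\<lambda>n. cutx (X n) u p) \<longlonglongrightarrow> u p" by (rule tendsto_eventually)
      qed
    qed (auto simp: cutx_def indicator_def)
    then show "(\<lambda>n. L2_norm Cy (\<lambda>p. cutx (X n) u p - u p)) \<longlonglongrightarrow> 0" by (rule L2_tendstoD(2))
  qed
qed

lemma fourier_trunc_cutx: "fourier_trunc L R u = F1 L (cutx R u)"
  unfolding fourier_trunc_eq cutx_def[abs_def] ..

lemma F1_diff_norm:
  assumes "integrable Cy u" "u \<in> L2 Cy" "integrable Cy v" "v \<in> L2 Cy"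
  shows "(\<lambda>q. F1 L u q - F1 L v q) \<in> L2 freq"
    "L2_norm freq (\<lambda>q. F1 L u q - F1 L v q) = sqrt (1 / L) * L2_norm Cy (\<lambda>p. u p - v p)"
proof -
  have e: "(\<lambda>q. F1 L u q - F1 L v q) = F1 L (\<lambda>p. u p - v p)" using F1_diff[OF assms(1,3)] by auto
  have i: "integrable Cy (\<lambda>p. u p - v p)" "(\<lambda>p. u p - v p) \<in> L2 Cy" using assms by (auto intro: L2_diff)
  show "(\<lambda>q. F1 L u q - F1 L v q) \<in> L2 freq" unfolding e by (rule Bessel(1)[OF i])
  show "L2_norm freq (\<lambda>q. F1 L u q - F1 L v q) = sqrt (1 / L) * L2_norm Cy (\<lambda>p. u p - v p)"
    unfolding e by (rule F1_isometry[OF i])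
qed

text \<open>The transforms of the truncations are Cauchy by the isometry.  Completeness yields a limit along the
integers, and the rate of convergence of the truncations extends it to all real cut-offs.\<close>

lemma fourier_exists:
  assumes u: "u \<in> L2 Cy"
  shows "\<exists>U. U \<in> L2 freq \<and> L2_tendsto freq (\<lambda>R. fourier_trunc L R u) U at_top"
proof -
  let ?d = "\<lambda>R. L2_norm Cy (\<lambda>p. cutx R u p - u p)"
  have d: "(?d \<longlongrightarrow> 0) at_top" using L2_tendstoD(2)[OF cutx_tendsto[OF u]] .
  have c: "L2_norm freq (\<lambda>q. F1 L (cutx R u) q - F1 L (cutx S u) q) \<le> sqrt (1 / L) * (?d R + ?d S)" for R S
  proof -
    have "L2_norm Cy (\<lambda>p. cutx R u p - cutx S u p) \<le> ?d R + ?d S"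
      using L2_triangle_diff[of "cutx R u" u Cy "cutx S u"] L2_diff[OF cutx_L2(1)[OF u] u] L2_diff[OF u cutx_L2(1)[OF u]]
        L2_norm_minus_commute[of Cy u "cutx S u"] by simp
    then show ?thesis using L_pos
      by (subst F1_diff_norm(2)) (auto intro!: cutx_L2 u mult_left_mono)
  qed
  have small: "\<exists>N. \<forall>R\<ge>N. sqrt (1 / L) * ?d R < e" if "e > 0" for e
  proof -
    have "((\<lambda>R. sqrt (1 / L) * ?d R) \<longlongrightarrow> sqrt (1 / L) * 0) at_top" by (intro tendsto_intros d)
    from order_tendstoD(2)[OF this, of e] that show ?thesis by (simp add: eventually_at_top_linorder)
  qed
  obtain U where U: "U \<in> L2 freq" "L2_tendsto freq (\<lambda>n. F1 L (cutx (real n) u)) U sequentially"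
  proof (rule L2_complete)
    show "F1 L (cutx (real n) u) \<in> L2 freq" for n by (intro Bessel cutx_L2 u)
    fix e :: real assume "e > 0"
    then obtain N where N: "\<And>R. R \<ge> N \<Longrightarrow> sqrt (1 / L) * ?d R < e / 2" using small[of "e/2"] by auto
    show "\<exists>N. \<forall>m\<ge>N. \<forall>n\<ge>N. L2_norm freq (\<lambda>q. F1 L (cutx (real m) u) q - F1 L (cutx (real n) u) q) < e"
    proof (intro exI allI impI)
      fix m n assume "m \<ge> nat \<lceil>N\<rceil>" "n \<ge> nat \<lceil>N\<rceil>"
      then have "N \<le> real m" "N \<le> real n" by linarith+
      from N[OF this(1)] N[OF this(2)] c[of "real m" "real n"]
      show "L2_norm freq (\<lambda>q. F1 L (cutx (real m) u) q - F1 L (cutx (real n) u) q) < e"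
        by (simp add: distrib_left)
    qed
  qed blast
  have "L2_tendsto freq (\<lambda>R. F1 L (cutx R u)) U at_top"
    unfolding L2_tendsto_def
  proof
    have m: "(\<lambda>q. F1 L (cutx R u) q - U q) \<in> L2 freq" for R by (intro L2_diff U Bessel cutx_L2 u)
    then show "eventually (\<lambda>R. (\<lambda>q. F1 L (cutx R u) q - U q) \<in> L2 freq) at_top" by simp
    have b: "L2_norm freq (\<lambda>q. F1 L (cutx R u) q - U q) \<le> sqrt (1 / L) * ?d R" for R
    proof (rule tendsto_lowerbound)
      have dn: "(\<lambda>n. ?d (real n)) \<longlonglongrightarrow> 0" by (rule filterlim_compose[OF d]) (rule filterlim_real_sequentially)
      have "(\<lambda>n. sqrt (1 / L) * (?d R + ?d (real n)) + L2_norm freq (\<lambda>q. F1 L (cutx (real n) u) q - U q)) \<longlonglongrightarrow> sqrt (1 / L) * (?d R + 0) + 0"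
        by (intro tendsto_intros dn L2_tendstoD(2)[OF U(2)])
      then show "(\<lambda>n. sqrt (1 / L) * (?d R + ?d (real n)) + L2_norm freq (\<lambda>q. F1 L (cutx (real n) u) q - U q)) \<longlonglongrightarrow> sqrt (1 / L) * ?d R"
        by simp
      show "eventually (\<lambda>n. L2_norm freq (\<lambda>q. F1 L (cutx R u) q - U q) \<le> sqrt (1 / L) * (?d R + ?d (real n)) + L2_norm freq (\<lambda>q. F1 L (cutx (real n) u) q - U q)) sequentially"
      proof (intro always_eventually allI)
        fix n
        have "L2_norm freq (\<lambda>q. F1 L (cutx R u) q - U q) \<le> L2_norm freq (\<lambda>q. F1 L (cutx R u) q - F1 L (cutx (real n) u) q)
           + L2_norm freq (\<lambda>q. F1 L (cutx (real n) u) q - U q)"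
          by (intro L2_triangle_diff m F1_diff_norm cutx_L2 u)
        with c[of R "real n"] show "L2_norm freq (\<lambda>q. F1 L (cutx R u) q - U q) \<le> sqrt (1 / L) * (?d R + ?d (real n)) + L2_norm freq (\<lambda>q. F1 L (cutx (real n) u) q - U q)"
          by linarith
      qed
    qed simp
    show "((\<lambda>R. L2_norm freq (\<lambda>q. F1 L (cutx R u) q - U q)) \<longlongrightarrow> 0) at_top"
    proof (rule Lim_null_comparison)
      show "eventually (\<lambda>R. norm (L2_norm freq (\<lambda>q. F1 L (cutx R u) q - U q)) \<le> sqrt (1 / L) * ?d R) at_top"
        using b by simp
      show "((\<lambda>R. sqrt (1 / L) * ?d R) \<longlongrightarrow> 0) at_top" using tendsto_mult[OF tendsto_const[of "sqrt (1/L)"] d] by simp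
    qed
  qed
  with U(1) show ?thesis unfolding fourier_trunc_cutx by blast
qed

lemma fourier_L2: "u \<in> L2 Cy \<Longrightarrow> fourier L u \<in> L2 freq"
  and fourier_tendsto: "u \<in> L2 Cy \<Longrightarrow> L2_tendsto freq (\<lambda>R. F1 L (cutx R u)) (fourier L u) at_top"
  using someI_ex[OF fourier_exists] unfolding fourier_def fourier_trunc_cutx by blast+

lemma fourier_measurable [measurable]: "u \<in> L2 Cy \<Longrightarrow> fourier L u \<in> borel_measurable freq"
  by (rule L2_measurable[OF fourier_L2])

lemma fourier_eqI:
  assumes "u \<in> L2 Cy" "U \<in> L2 freq" "L2_tendsto freq (\<lambda>R. F1 L (cutx R u)) U at_top"
  shows "AE q in freq. fourier L u q = U q"
  by (rule L2_tendsto_unique[OF fourier_tendsto[OF assms(1)] assms(3) _ fourier_L2[OF assms(1)] assms(2)]) simp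

lemma fourier_F1:
  assumes u: "integrable Cy u" "u \<in> L2 Cy"
  shows "AE q in freq. fourier L u q = F1 L u q"
proof (rule fourier_eqI[OF u(2) Bessel(1)[OF u]])
  show "L2_tendsto freq (\<lambda>R. F1 L (cutx R u)) (F1 L u) at_top"
    unfolding L2_tendsto_def
  proof
    show "eventually (\<lambda>R. (\<lambda>q. F1 L (cutx R u) q - F1 L u q) \<in> L2 freq) at_top"
      by (intro always_eventually allI F1_diff_norm cutx_L2 u)
    have "((\<lambda>R. sqrt (1 / L) * L2_norm Cy (\<lambda>p. cutx R u p - u p)) \<longlongrightarrow> 0) at_top"
      using tendsto_mult[OF tendsto_const[of "sqrt (1/L)"] L2_tendstoD(2)[OF cutx_tendsto[OF u(2)]]] by simp
    then show "((\<lambda>R. L2_norm freq (\<lambda>q. F1 L (cutx R u) q - F1 L u q)) \<longlongrightarrow> 0) at_top"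
      by (subst F1_diff_norm(2)) (auto intro: cutx_L2 u)
  qed
qed

lemma fourier_add:
  assumes u: "u \<in> L2 Cy" and v: "v \<in> L2 Cy"
  shows "AE q in freq. fourier L (\<lambda>p. u p + v p) q = fourier L u q + fourier L v q"
proof (rule fourier_eqI[OF L2_add[OF u v] L2_add[OF fourier_L2[OF u] fourier_L2[OF v]]])
  have e: "cutx R (\<lambda>p. u p + v p) = (\<lambda>p. cutx R u p + cutx R v p)" for R
    by (auto simp: cutx_def fun_eq_iff distrib_left)
  show "L2_tendsto freq (\<lambda>R. F1 L (cutx R (\<lambda>p. u p + v p))) (\<lambda>x. fourier L u x + fourier L v x) at_top"
  proof -
    have "F1 L (\<lambda>p. cutx R u p + cutx R v p) = (\<lambda>x. F1 L (cutx R u) x + F1 L (cutx R v) x)" for R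
      by (rule ext, rule F1_add) (rule cutx_L2 u v)+
    then show ?thesis unfolding e using L2_tendsto_add[OF fourier_tendsto[OF u] fourier_tendsto[OF v]] by simp
  qed
qed

lemma fourier_cmult:
  assumes u: "u \<in> L2 Cy"
  shows "AE q in freq. fourier L (\<lambda>p. c * u p) q = complex_of_real c * fourier L u q"
proof (rule fourier_eqI[OF L2_cmult(1)[OF u] L2_cmult(1)[OF fourier_L2[OF u]]])
  have e: "cutx R (\<lambda>p. c * u p) = (\<lambda>p. c * cutx R u p)" for R
    by (auto simp: cutx_def fun_eq_iff)
  show "L2_tendsto freq (\<lambda>R. F1 L (cutx R (\<lambda>p. c * u p))) (\<lambda>x. complex_of_real c * fourier L u x) at_top"
    unfolding e using L2_tendsto_cmult[OF fourier_tendsto[OF u], of "\<lambda>_. complex_of_real c" "\<bar>c\<bar>"]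
    by (simp add: F1_cmult[abs_def])
qed

lemma fourier_diff:
  assumes u: "u \<in> L2 Cy" and v: "v \<in> L2 Cy"
  shows "AE q in freq. fourier L (\<lambda>p. u p - v p) q = fourier L u q - fourier L v q"
  using fourier_add[OF u L2_cmult(1)[OF v, of "-1"]] fourier_cmult[OF v, of "-1"]
  by eventually_elim simp

lemma fourier_cong:
  assumes "u \<in> borel_measurable Cy" "v \<in> borel_measurable Cy" "AE p in Cy. u p = v p"
  shows "fourier L u = fourier L v"
proof -
  have "F1 L (cutx R u) = F1 L (cutx R v)" for R
    by (rule F1_cong_AE) (use assms in \<open>auto simp: cutx_def\<close>)
  then show ?thesis unfolding fourier_def fourier_trunc_cutx by simp
qed

lemma fourier_isometry:
  assumes u: "u \<in> L2 Cy"
  shows "L2_norm freq (fourier L u) = sqrt (1 / L) * L2_norm Cy u"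
proof (rule tendsto_unique[OF _ L2_tendsto_norm[OF fourier_tendsto[OF u] fourier_L2[OF u]]])
  have "((\<lambda>R. sqrt (1 / L) * L2_norm Cy (cutx R u)) \<longlongrightarrow> sqrt (1 / L) * L2_norm Cy u) at_top"
    by (intro tendsto_intros L2_tendsto_norm[OF cutx_tendsto[OF u] u])
  then show "((\<lambda>R. L2_norm freq (F1 L (cutx R u))) \<longlongrightarrow> sqrt (1 / L) * L2_norm Cy u) at_top"
    by (simp add: F1_isometry cutx_L2 u)
qed simp

lemma fourier_inner:
  assumes u: "u \<in> L2 Cy" and v: "v \<in> L2 Cy"
  shows "(\<integral>q. fourier L u q * cnj (fourier L v q) \<partial>freq) = complex_of_real (1 / L * (\<integral>p. u p * v p \<partial>Cy))"
proof (rule tendsto_unique)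
  have cn: "L2_tendsto freq (\<lambda>R q. cnj (F1 L (cutx R v) q)) (\<lambda>q. cnj (fourier L v q)) at_top"
    unfolding L2_tendsto_def
  proof
    have e: "(\<lambda>q. cnj (F1 L (cutx R v) q) - cnj (fourier L v q)) = (\<lambda>q. cnj (F1 L (cutx R v) q - fourier L v q))" for R by simp
    show "eventually (\<lambda>R. (\<lambda>q. cnj (F1 L (cutx R v) q) - cnj (fourier L v q)) \<in> L2 freq) at_top"
      unfolding e using L2_tendstoD(1)[OF fourier_tendsto[OF v]] by eventually_elim (rule L2_cnj)
    have "L2_norm freq (\<lambda>q. cnj (F1 L (cutx R v) q) - cnj (fourier L v q)) = L2_norm freq (\<lambda>q. F1 L (cutx R v) q - fourier L v q)" for R
      unfolding e by (simp only: L2_norm_def complex_mod_cnj)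
    then show "((\<lambda>R. L2_norm freq (\<lambda>q. cnj (F1 L (cutx R v) q) - cnj (fourier L v q))) \<longlongrightarrow> 0) at_top"
      using L2_tendstoD(2)[OF fourier_tendsto[OF v]] by simp
  qed
  show "((\<lambda>R. \<integral>q. F1 L (cutx R u) q * cnj (F1 L (cutx R v) q) \<partial>freq) \<longlongrightarrow> (\<integral>q. fourier L u q * cnj (fourier L v q) \<partial>freq)) at_top"
    by (rule L2_tendsto_integral_mult[OF fourier_tendsto[OF u] cn fourier_L2[OF u] L2_cnj[OF fourier_L2[OF v]]])
  have "((\<lambda>R. complex_of_real (1 / L * (\<integral>p. cutx R u p * cutx R v p \<partial>Cy))) \<longlongrightarrow> complex_of_real (1 / L * (\<integral>p. u p * v p \<partial>Cy))) at_top"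
    by (intro tendsto_intros L2_tendsto_integral_mult cutx_tendsto u v)
  moreover have "(\<integral>q. F1 L (cutx R u) q * cnj (F1 L (cutx R v) q) \<partial>freq) = complex_of_real (1 / L * (\<integral>p. cutx R u p * cutx R v p \<partial>Cy))" for R
    using Plancherel_paired[OF cutx_L2(2,1)[OF u] cutx_L2(2,1)[OF v], of R R] by (simp only: paired_def)
  ultimately show "((\<lambda>R. \<integral>q. F1 L (cutx R u) q * cnj (F1 L (cutx R v) q) \<partial>freq) \<longlongrightarrow> complex_of_real (1 / L * (\<integral>p. u p * v p \<partial>Cy))) at_top"
    by simp
qed simp

lemma fourier_diff_norm:
  assumes u: "u \<in> L2 Cy" and v: "v \<in> L2 Cy"
  shows "L2_norm Cy (\<lambda>p. u p - v p) = sqrt L * L2_norm freq (\<lambda>q. fourier L u q - fourier L v q)"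
proof -
  have "L2_norm freq (\<lambda>q. fourier L u q - fourier L v q) = L2_norm freq (fourier L (\<lambda>p. u p - v p))"
    by (rule L2_norm_cong_AE)
       (use fourier_diff[OF u v] fourier_L2[OF u] fourier_L2[OF v] fourier_L2[OF L2_diff[OF u v]] in \<open>auto dest: L2_measurable\<close>)
  also have "\<dots> = sqrt (1 / L) * L2_norm Cy (\<lambda>p. u p - v p)" by (rule fourier_isometry[OF L2_diff[OF u v]])
  finally show ?thesis using L_pos by (simp add: real_sqrt_divide)
qed

lemma fourier_inj:
  assumes u: "u \<in> L2 Cy" and v: "v \<in> L2 Cy" and "AE q in freq. fourier L u q = fourier L v q"
  shows "AE p in Cy. u p = v p"
proof -
  have "L2_norm freq (\<lambda>q. fourier L u q - fourier L v q) = 0"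
    using assms(3) L2_norm_eq_0_iff[OF L2_diff[OF fourier_L2[OF u] fourier_L2[OF v]]] by simp
  then have "L2_norm Cy (\<lambda>p. u p - v p) = 0" using fourier_diff_norm[OF u v] by simp
  then show ?thesis using L2_norm_eq_0_iff[OF L2_diff[OF u v]] by simp
qed

lemma fourier_continuous:
  assumes f: "\<And>i. f i \<in> L2 Cy" and g: "g \<in> L2 Cy" and lim: "L2_tendsto Cy f g F"
  shows "L2_tendsto freq (\<lambda>i. fourier L (f i)) (fourier L g) F"
  unfolding L2_tendsto_def
proof
  show "eventually (\<lambda>i. (\<lambda>q. fourier L (f i) q - fourier L g q) \<in> L2 freq) F"
    by (intro always_eventually allI L2_diff fourier_L2 f g)
  have "((\<lambda>i. L2_norm Cy (\<lambda>p. f i p - g p) / sqrt L) \<longlongrightarrow> 0 / sqrt L) F"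
    by (intro tendsto_intros L2_tendstoD(2)[OF lim]) (use L_pos in auto)
  moreover have "L2_norm freq (\<lambda>q. fourier L (f i) q - fourier L g q) = L2_norm Cy (\<lambda>p. f i p - g p) / sqrt L" for i
    using fourier_diff_norm[OF f g, of i] L_pos by simp
  ultimately show "((\<lambda>i. L2_norm freq (\<lambda>q. fourier L (f i) q - fourier L g q)) \<longlongrightarrow> 0) F" by simp
qed

end

section \<open>Translations and derivatives in \<open>x\<close>\<close>

lemma L2_tendsto_null_mult:
  fixes f :: "'i \<Rightarrow> 'a \<Rightarrow> 'b::{real_normed_field, banach, second_countable_topology}"
  assumes "L2_tendsto M f (\<lambda>_. 0) F" and m: "\<And>i. m i \<in> borel_measurable M" and b: "\<And>i x. norm (m i x) \<le> B"
  shows "L2_tendsto M (\<lambda>i x. m i x * f i x) (\<lambda>_. 0) F"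
  unfolding L2_tendsto_def
proof
  note [measurable] = m
  have B: "norm (m i x) \<le> \<bar>B\<bar>" for i x using b[of i x] by linarith
  have *: "(\<lambda>x. m i x * h x) \<in> L2 M \<and> L2_norm M (\<lambda>x. m i x * h x) \<le> \<bar>B\<bar> * L2_norm M h" if h: "h \<in> L2 M" for h i
  proof -
    have [measurable]: "h \<in> borel_measurable M" using h by (rule L2_measurable)
    have le: "AE x in M. norm (m i x * h x) \<le> norm (\<bar>B\<bar> *\<^sub>R h x)"
      using B by (intro AE_I2) (simp add: norm_mult mult_right_mono)
    have m: "(\<lambda>x. m i x * h x) \<in> borel_measurable M" by measurable
    from L2_norm_mono[OF L2_scaleR(1)[OF h] m le] show ?thesis
      using L2_scaleR(2)[OF h, of "\<bar>B\<bar>"] by simp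
  qed
  note e = L2_tendstoD[OF assms(1), simplified]
  show "eventually (\<lambda>i. (\<lambda>x. m i x * f i x - 0) \<in> L2 M) F"
    using e(1) by eventually_elim (use * in simp)
  show "((\<lambda>i. L2_norm M (\<lambda>x. m i x * f i x - 0)) \<longlongrightarrow> 0) F"
  proof (rule Lim_null_comparison)
    show "eventually (\<lambda>i. norm (L2_norm M (\<lambda>x. m i x * f i x - 0)) \<le> \<bar>B\<bar> * L2_norm M (f i)) F"
      using e(1) by eventually_elim (use * in simp)
    show "((\<lambda>i. \<bar>B\<bar> * L2_norm M (f i)) \<longlongrightarrow> 0) F"
      using tendsto_mult[OF tendsto_const[of "\<bar>B\<bar>"] e(2)] by simp
  qed
qed

lemma L2_tendsto_null_iff: "L2_tendsto M (\<lambda>i x. f i x - g x) (\<lambda>_. 0) F \<longleftrightarrow> L2_tendsto M f g F"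
  by (simp add: L2_tendsto_def)

lemma L2_bounded_mult:
  fixes f :: "'a \<Rightarrow> 'b::{real_normed_field, banach, second_countable_topology}"
  assumes h: "f \<in> L2 M" and m: "m \<in> borel_measurable M" and b: "AE x in M. norm (m x) \<le> B"
  shows "(\<lambda>x. m x * f x) \<in> L2 M"
proof (rule L2_norm_mono(1)[OF L2_scaleR(1)[OF h, of "\<bar>B\<bar>"]])
  have [measurable]: "f \<in> borel_measurable M" using h by (rule L2_measurable)
  show "(\<lambda>x. m x * f x) \<in> borel_measurable M" using m by measurable
  show "AE x in M. norm (m x * f x) \<le> norm (\<bar>B\<bar> *\<^sub>R f x)"
    using b by eventually_elim (auto simp: norm_mult intro!: mult_right_mono)
qed

text \<open>Limits along a real parameter are reduced to sequences, to which dominated convergence applies.\<close>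

lemma L2_tendsto_atI:
  fixes f :: "real \<Rightarrow> 'a \<Rightarrow> 'b::{banach, second_countable_topology}"
  assumes "\<And>h. (\<lambda>x. f h x - g x) \<in> L2 M"
    and "\<And>X. (\<And>n. X n \<noteq> a) \<Longrightarrow> X \<longlonglongrightarrow> a \<Longrightarrow> L2_tendsto M (\<lambda>n. f (X n)) g sequentially"
  shows "L2_tendsto M f g (at a)"
  unfolding L2_tendsto_def
proof
  show "eventually (\<lambda>h. (\<lambda>x. f h x - g x) \<in> L2 M) (at a)" using assms(1) by simp
  show "((\<lambda>h. L2_norm M (\<lambda>x. f h x - g x)) \<longlongrightarrow> 0) (at a)"
    unfolding tendsto_at_iff_sequentially
  proof (intro allI impI)
    fix X assume "\<forall>i. X i \<in> UNIV - {a}" "X \<longlonglongrightarrow> a"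
    then show "((\<lambda>h. L2_norm M (\<lambda>x. f h x - g x)) \<circ> X) \<longlonglongrightarrow> 0"
      using L2_tendstoD(2)[OF assms(2)[of X]] by (simp add: o_def)
  qed
qed

context period begin

definition shift :: "real \<Rightarrow> (real \<times> real \<Rightarrow> 'b) \<Rightarrow> real \<times> real \<Rightarrow> 'b" where
  "shift h u p = u (fst p + h, snd p)"

lemma shift_map_measurable: "(\<lambda>p. (fst p + h, snd p)) \<in> measurable Cy Cy"
  unfolding cylinder_eq_pair by measurable

text \<open>Translation invariance of the measure on the cylinder is the source of integration by parts below.\<close>

lemma distr_shift: "distr Cy Cy (\<lambda>p. (fst p + h, snd p)) = Cy"
proof -
  have a: "distr lborel lborel (\<lambda>x::real. x + h) = lborel"
    using lborel_distr_plus[of h] by (simp add: add.commute[of _ h] cong: distr_cong)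
  have b: "distr Yc Yc (\<lambda>y. y) = Yc" by (simp add: distr_id2)
  have "distr lborel lborel (\<lambda>x. x + h) \<Otimes>\<^sub>M distr Yc Yc (\<lambda>y. y) = distr (lborel \<Otimes>\<^sub>M Yc) (lborel \<Otimes>\<^sub>M Yc) (\<lambda>(x, y). (x + h, y))"
    by (rule pair_measure_distr) (auto simp: b intro: Yc.sigma_finite_measure_axioms)
  then show ?thesis unfolding a b cylinder_eq_pair by (simp add: split_beta')
qed

lemma shift_measurable [measurable (raw)]:
  "f \<in> measurable Cy N \<Longrightarrow> shift h f \<in> measurable Cy N"
  unfolding shift_def[abs_def] by (rule measurable_compose[OF shift_map_measurable])

lemma shift_integral:
  fixes f :: "real \<times> real \<Rightarrow> 'b::{banach, second_countable_topology}"
  assumes "f \<in> borel_measurable Cy"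
  shows "(\<integral>p. shift h f p \<partial>Cy) = (\<integral>p. f p \<partial>Cy)" "integrable Cy (shift h f) \<longleftrightarrow> integrable Cy f"
  using integral_distr[OF shift_map_measurable assms, of h] integrable_distr_eq[OF shift_map_measurable assms, of h]
  unfolding distr_shift shift_def[abs_def] by simp_all

lemma shift_L2:
  fixes u :: "real \<times> real \<Rightarrow> 'b::{banach, second_countable_topology}"
  assumes "u \<in> L2 Cy"
  shows "shift h u \<in> L2 Cy" "L2_norm Cy (shift h u) = L2_norm Cy u"
proof -
  have [measurable]: "u \<in> borel_measurable Cy" using assms by (rule L2_measurable)
  have e: "(\<lambda>p. (norm (shift h u p))\<^sup>2) = shift h (\<lambda>p. (norm (u p))\<^sup>2)" by (auto simp: shift_def)
  have m: "(\<lambda>p. (norm (u p))\<^sup>2) \<in> borel_measurable Cy" by measurable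
  show "shift h u \<in> L2 Cy"
    by (rule L2I) (use shift_integral(2)[OF m, of h] L2_integrable_sq[OF assms] in \<open>auto simp: e\<close>)
  show "L2_norm Cy (shift h u) = L2_norm Cy u"
    unfolding L2_norm_def e shift_integral(1)[OF m] ..
qed

lemma F1_shift:
  assumes "integrable Cy u"
  shows "F1 L (shift h u) q = iexp (h * fst q) * F1 L u q"
proof -
  have [measurable]: "u \<in> borel_measurable Cy" using assms by auto
  have e: "emode L p q = iexp (h * fst q) * emode L (fst p + h, snd p) q" for p
    unfolding emode_def exp_add[symmetric] by (rule arg_cong[where f=exp]) (simp add: algebra_simps)
  have "(\<lambda>p. complex_of_real (shift h u p) * emode L p q)
      = (\<lambda>p. iexp (h * fst q) * shift h (\<lambda>p. complex_of_real (u p) * emode L p q) p)"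
    by (rule ext, subst e) (simp only: shift_def mult_ac)
  then have "(\<integral>p. complex_of_real (shift h u p) * emode L p q \<partial>Cy)
      = (\<integral>p. iexp (h * fst q) * shift h (\<lambda>p. complex_of_real (u p) * emode L p q) p \<partial>Cy)" by simp
  also have "\<dots> = iexp (h * fst q) * (\<integral>p. shift h (\<lambda>p. complex_of_real (u p) * emode L p q) p \<partial>Cy)"
    by (rule integral_mult_right_zero)
  also have "(\<integral>p. shift h (\<lambda>p. complex_of_real (u p) * emode L p q) p \<partial>Cy) = (\<integral>p. complex_of_real (u p) * emode L p q \<partial>Cy)"
    by (rule shift_integral(1)) measurable
  finally show ?thesis unfolding F1_def by (simp add: mult_ac)
qed

lemma iexp_measurable [measurable]: "(\<lambda>q. iexp (h * fst q)) \<in> borel_measurable freq"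
  by measurable

lemma fourier_shift:
  assumes u: "u \<in> L2 Cy"
  shows "AE q in freq. fourier L (shift h u) q = iexp (h * fst q) * fourier L u q"
proof (rule L2_tendsto_unique[where F=at_top])
  let ?g = "\<lambda>R q. iexp (h * fst q) * F1 L (cutx R u) q"
  have b: "norm (iexp (h * fst q)) \<le> 1" for q :: "real \<times> int" by (simp only: norm_exp_i_times order_refl)
  show "L2_tendsto freq ?g (\<lambda>q. iexp (h * fst q) * fourier L u q) at_top"
    by (rule L2_tendsto_cmult[OF fourier_tendsto[OF u] iexp_measurable b])
  have s: "L2_tendsto Cy (\<lambda>R. shift h (cutx R u)) (shift h u) at_top"
  proof -
    have "(\<lambda>p. shift h (cutx R u) p - shift h u p) = shift h (\<lambda>p. cutx R u p - u p)" for R by (auto simp: shift_def)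
    then show ?thesis using L2_tendstoD(2)[OF cutx_tendsto[OF u]]
      by (simp add: L2_tendsto_def shift_L2 L2_diff cutx_L2 u)
  qed
  show "L2_tendsto freq ?g (fourier L (shift h u)) at_top"
  proof (rule L2_tendsto_cong[OF fourier_continuous[OF _ _ s]])
    show i: "shift h (cutx R u) \<in> L2 Cy" "shift h u \<in> L2 Cy" for R by (intro shift_L2 cutx_L2 u)+
    show "fourier L (shift h (cutx R u)) \<in> borel_measurable freq" for R by (rule fourier_measurable[OF i(1)])
    have [measurable]: "F1 L (cutx R u) \<in> borel_measurable freq" for R
      by (rule L2_measurable[OF Bessel(1)[OF cutx_L2(2,1)[OF u]]])
    show "?g R \<in> borel_measurable freq" for R by measurable
    show "fourier L (shift h u) \<in> borel_measurable freq" "fourier L (shift h u) \<in> borel_measurable freq"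
      by (rule fourier_measurable[OF i(2)])+
    show "AE q in freq. fourier L (shift h (cutx R u)) q = ?g R q" for R
    proof -
      have "integrable Cy (shift h (cutx R u))" using shift_integral(2)[of "cutx R u" h] cutx_L2[OF u, of R] by (auto dest: L2_measurable)
      from fourier_F1[OF this i(1)] show ?thesis by eventually_elim (simp only: F1_shift[OF cutx_L2(2)[OF u]])
    qed
  qed simp
  show "fourier L (shift h u) \<in> L2 freq" by (intro fourier_L2 shift_L2 u)
  show "(\<lambda>q. iexp (h * fst q) * fourier L u q) \<in> L2 freq"
    by (rule L2_bounded_mult[OF fourier_L2[OF u] iexp_measurable, where B=1]) (use b in simp)
qed simp

definition dquot :: "real \<Rightarrow> (real \<times> real \<Rightarrow> real) \<Rightarrow> real \<times> real \<Rightarrow> real" where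
  "dquot h u p = (1 / h) * (shift h u p - u p)"

lemma dquot_L2: "u \<in> L2 Cy \<Longrightarrow> dquot h u \<in> L2 Cy"
  unfolding dquot_def[abs_def] by (intro L2_cmult L2_diff shift_L2)

definition mult_dq :: "real \<Rightarrow> real \<times> int \<Rightarrow> complex" where
  "mult_dq h q = complex_of_real (1 / h) * (iexp (h * fst q) - 1)"

lemma mult_dq_measurable [measurable]: "mult_dq h \<in> borel_measurable freq"
  unfolding mult_dq_def[abs_def] by measurable

lemma fourier_dquot:
  assumes u: "u \<in> L2 Cy"
  shows "AE q in freq. fourier L (dquot h u) q = mult_dq h q * fourier L u q"
proof -
  have s: "shift h u \<in> L2 Cy" by (rule shift_L2(1)[OF u])
  have 1: "AE q in freq. fourier L (dquot h u) q = complex_of_real (1/h) * fourier L (\<lambda>p. shift h u p - u p) q"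
    unfolding dquot_def[abs_def] by (rule fourier_cmult[OF L2_diff[OF s u]])
  have 2: "AE q in freq. fourier L (\<lambda>p. shift h u p - u p) q = fourier L (shift h u) q - fourier L u q"
    by (rule fourier_diff[OF s u])
  show ?thesis using 1 2 fourier_shift[OF u, of h]
  proof eventually_elim
    case (elim q)
    show ?case unfolding elim mult_dq_def left_diff_distrib mult.assoc by simp
  qed
qed

text \<open>The bound does not depend on \<open>h\<close>, so it serves as the majorant for the limit \<open>h \<rightarrow> 0\<close>.\<close>

lemma mult_dq_bound: "norm (mult_dq h q) \<le> \<bar>fst q\<bar>"
proof (cases "h = 0")
  case False
  have "norm (iexp (h * fst q) - 1) \<le> \<bar>h * fst q\<bar>" using iexp_approx1[of "h * fst q" 0] by simp
  then have "\<bar>1 / h\<bar> * norm (iexp (h * fst q) - 1) \<le> \<bar>1 / h\<bar> * \<bar>h * fst q\<bar>" by (rule mult_left_mono) simp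
  also have "\<bar>1 / h\<bar> * \<bar>h * fst q\<bar> = \<bar>fst q\<bar>" using False by (simp add: abs_mult)
  finally show ?thesis unfolding mult_dq_def norm_mult norm_of_real .
qed (simp add: mult_dq_def)

lemma mult_dq_tendsto:
  assumes "X \<longlonglongrightarrow> 0" "\<And>n. X n \<noteq> (0::real)"
  shows "(\<lambda>n. mult_dq (X n) q) \<longlonglongrightarrow> \<i> * complex_of_real (fst q)"
proof -
  let ?c = "\<i> * complex_of_real (fst q)"
  have "((\<lambda>z. exp (?c * z)) has_field_derivative ?c * exp (?c * 0)) (at 0)"
    by (auto intro!: derivative_eq_intros)
  then have "((\<lambda>z. (exp (?c * (0 + z)) - exp (?c * 0)) / z) \<longlongrightarrow> ?c) (at 0)"
    using DERIV_D by fastforce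
  moreover have "(\<lambda>n. complex_of_real (X n)) \<longlonglongrightarrow> complex_of_real 0" by (intro tendsto_intros assms)
  ultimately have "((\<lambda>z. (exp (?c * (0 + z)) - exp (?c * 0)) / z) \<circ> (\<lambda>n. complex_of_real (X n))) \<longlonglongrightarrow> ?c"
    using assms(2) unfolding tendsto_at_iff_sequentially by auto
  moreover have "((\<lambda>z. (exp (?c * (0 + z)) - exp (?c * 0)) / z) \<circ> (\<lambda>n. complex_of_real (X n))) = (\<lambda>n. mult_dq (X n) q)"
    by (simp add: fun_eq_iff mult_dq_def mult_ac)
  ultimately show ?thesis by simp
qed

text \<open>The relation defining \<^const>\<open>dx\<close>.  Working with the relation avoids the choice operator, whose value is
determined only almost everywhere and only when a derivative exists.\<close>

definition has_dx :: "(real \<times> real \<Rightarrow> real) \<Rightarrow> (real \<times> real \<Rightarrow> real) \<Rightarrow> bool" where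
  "has_dx u v \<longleftrightarrow> u \<in> L2 Cy \<and> v \<in> L2 Cy \<and> (AE q in freq. fourier L v q = \<i> * complex_of_real (fst q) * fourier L u q)"

lemma mult_dq_L2_tendsto:
  assumes U: "U \<in> L2 freq" and V: "(\<lambda>q. \<i> * complex_of_real (fst q) * U q) \<in> L2 freq"
    and X: "X \<longlonglongrightarrow> 0" "\<And>n. X n \<noteq> 0"
  shows "L2_tendsto freq (\<lambda>n q. mult_dq (X n) q * U q) (\<lambda>q. \<i> * complex_of_real (fst q) * U q) sequentially"
proof (rule L2_dominated)
  have [measurable]: "U \<in> borel_measurable freq" using U by (rule L2_measurable)
  show "(\<lambda>q. mult_dq (X n) q * U q) \<in> borel_measurable freq" for n by measurable
  show "(\<lambda>q. \<i> * complex_of_real (fst q) * U q) \<in> borel_measurable freq" using V by (rule L2_measurable)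
  show "(\<lambda>q. 2 * (\<i> * complex_of_real (fst q) * U q)) \<in> L2 freq" by (rule L2_cmult[OF V])
  show "AE q in freq. (\<lambda>n. mult_dq (X n) q * U q) \<longlonglongrightarrow> \<i> * complex_of_real (fst q) * U q"
    by (intro AE_I2 tendsto_intros mult_dq_tendsto X)
  show "AE q in freq. norm (mult_dq (X n) q * U q - \<i> * complex_of_real (fst q) * U q) \<le> norm (2 * (\<i> * complex_of_real (fst q) * U q))" for n
  proof (rule AE_I2)
    fix q
    have "norm (mult_dq (X n) q - \<i> * complex_of_real (fst q)) \<le> \<bar>fst q\<bar> + \<bar>fst q\<bar>"
      by (rule order.trans[OF norm_triangle_ineq4]) (use mult_dq_bound[of "X n" q] in \<open>simp add: norm_mult\<close>)
    then have "norm (mult_dq (X n) q - \<i> * complex_of_real (fst q)) * norm (U q) \<le> (2 * \<bar>fst q\<bar>) * norm (U q)"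
      by (intro mult_right_mono) auto
    then show "norm (mult_dq (X n) q * U q - \<i> * complex_of_real (fst q) * U q) \<le> norm (2 * (\<i> * complex_of_real (fst q) * U q))"
      by (simp add: norm_mult[symmetric] left_diff_distrib) (simp add: norm_mult)
  qed
qed

lemma has_dx_L2_fourier: "has_dx u v \<Longrightarrow> (\<lambda>q. \<i> * complex_of_real (fst q) * fourier L u q) \<in> L2 freq"
  unfolding has_dx_def by (elim conjE, rule L2_cong_AE[OF fourier_L2[of v]]) auto

lemma has_dx_quotient:
  assumes "has_dx u v"
  shows "L2_tendsto Cy (\<lambda>h. dquot h u) v (at 0)"
proof (rule L2_tendsto_atI)
  have u: "u \<in> L2 Cy" and v: "v \<in> L2 Cy" and f: "AE q in freq. fourier L v q = \<i> * complex_of_real (fst q) * fourier L u q"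
    using assms by (auto simp: has_dx_def)
  show i: "(\<lambda>p. dquot h u p - v p) \<in> L2 Cy" for h by (intro L2_diff dquot_L2 u v)
  fix X :: "nat \<Rightarrow> real" assume X: "\<And>n. X n \<noteq> 0" "X \<longlonglongrightarrow> 0"
  have "L2_tendsto freq (\<lambda>n. fourier L (dquot (X n) u)) (fourier L v) sequentially"
  proof (rule L2_tendsto_cong[OF mult_dq_L2_tendsto[OF fourier_L2[OF u] has_dx_L2_fourier[OF assms] X(2,1)]])
    have [measurable]: "fourier L u \<in> borel_measurable freq" by (rule fourier_measurable[OF u])
    show "(\<lambda>q. mult_dq (X n) q * fourier L u q) \<in> borel_measurable freq" for n by measurable
    show "fourier L (dquot (X n) u) \<in> borel_measurable freq" for n by (intro fourier_measurable dquot_L2 u)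
    show "(\<lambda>q. \<i> * complex_of_real (fst q) * fourier L u q) \<in> borel_measurable freq" by measurable
    show "fourier L v \<in> borel_measurable freq" by (rule fourier_measurable[OF v])
    show "AE q in freq. mult_dq (X n) q * fourier L u q = fourier L (dquot (X n) u) q" for n
      using fourier_dquot[OF u, of "X n"] by auto
    show "AE q in freq. \<i> * complex_of_real (fst q) * fourier L u q = fourier L v q" using f by auto
  qed
  from tendsto_mult[OF tendsto_const[of "sqrt L"] L2_tendstoD(2)[OF this]]
  have "(\<lambda>n. L2_norm Cy (\<lambda>p. dquot (X n) u p - v p)) \<longlonglongrightarrow> 0"
    by (simp add: fourier_diff_norm dquot_L2 u v)
  with i show "L2_tendsto Cy (\<lambda>n. dquot (X n) u) v sequentially" by (simp add: L2_tendsto_def)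
qed

text \<open>Difference quotients are Cauchy in \<open>L\<^sup>2\<close> because their Fourier transforms converge.\<close>

lemma has_dx_exists:
  assumes u: "u \<in> L2 Cy" and f: "(\<lambda>q. \<i> * complex_of_real (fst q) * fourier L u q) \<in> L2 freq"
  shows "\<exists>v. has_dx u v"
proof -
  define X where "X n = 1 / (real n + 1)" for n
  have X: "X \<longlonglongrightarrow> 0" "X n \<noteq> 0" for n unfolding X_def by real_asymp simp
  let ?V = "\<lambda>q. \<i> * complex_of_real (fst q) * fourier L u q"
  have [measurable]: "fourier L u \<in> borel_measurable freq" by (rule fourier_measurable[OF u])
  have lim: "L2_tendsto freq (\<lambda>n. fourier L (dquot (X n) u)) ?V sequentially"
  proof (rule L2_tendsto_cong[OF mult_dq_L2_tendsto[OF fourier_L2[OF u] f X]])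
    show "(\<lambda>q. mult_dq (X n) q * fourier L u q) \<in> borel_measurable freq" for n by measurable
    show "fourier L (dquot (X n) u) \<in> borel_measurable freq" for n by (intro fourier_measurable dquot_L2 u)
    show "?V \<in> borel_measurable freq" "?V \<in> borel_measurable freq" by measurable
    show "AE q in freq. mult_dq (X n) q * fourier L u q = fourier L (dquot (X n) u) q" for n
      using fourier_dquot[OF u, of "X n"] by auto
  qed simp
  have dL: "fourier L (dquot (X n) u) \<in> L2 freq" for n by (intro fourier_L2 dquot_L2 u)
  obtain v where v: "v \<in> L2 Cy" "L2_tendsto Cy (\<lambda>n. dquot (X n) u) v sequentially"
  proof (rule L2_complete)
    show "dquot (X n) u \<in> L2 Cy" for n by (rule dquot_L2[OF u])
    fix e :: real assume "e > 0"
    have "(\<lambda>n. sqrt L * L2_norm freq (\<lambda>q. fourier L (dquot (X n) u) q - ?V q)) \<longlonglongrightarrow> sqrt L * 0"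
      by (intro tendsto_intros L2_tendstoD(2)[OF lim])
    from order_tendstoD(2)[OF this, of "e/2"] \<open>e > 0\<close> obtain N where
      N: "\<And>n. n \<ge> N \<Longrightarrow> sqrt L * L2_norm freq (\<lambda>q. fourier L (dquot (X n) u) q - ?V q) < e / 2"
      by (auto simp: eventually_at_top_linorder)
    show "\<exists>N. \<forall>m\<ge>N. \<forall>n\<ge>N. L2_norm Cy (\<lambda>p. dquot (X m) u p - dquot (X n) u p) < e"
    proof (intro exI allI impI)
      fix m n assume mn: "m \<ge> N" "n \<ge> N"
      have "L2_norm freq (\<lambda>q. fourier L (dquot (X m) u) q - fourier L (dquot (X n) u) q)
        \<le> L2_norm freq (\<lambda>q. fourier L (dquot (X m) u) q - ?V q) + L2_norm freq (\<lambda>q. ?V q - fourier L (dquot (X n) u) q)"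
        by (intro L2_triangle_diff L2_diff dL f)
      also have "L2_norm freq (\<lambda>q. ?V q - fourier L (dquot (X n) u) q) = L2_norm freq (\<lambda>q. fourier L (dquot (X n) u) q - ?V q)"
        by (rule L2_norm_minus_commute)
      finally have "sqrt L * L2_norm freq (\<lambda>q. fourier L (dquot (X m) u) q - fourier L (dquot (X n) u) q)
        \<le> sqrt L * (L2_norm freq (\<lambda>q. fourier L (dquot (X m) u) q - ?V q) + L2_norm freq (\<lambda>q. fourier L (dquot (X n) u) q - ?V q))"
        using L_pos by (intro mult_left_mono) auto
      then show "L2_norm Cy (\<lambda>p. dquot (X m) u p - dquot (X n) u p) < e"
        using N[OF mn(1)] N[OF mn(2)] by (subst fourier_diff_norm) (auto intro: dquot_L2 u simp: distrib_left)
    qed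
  qed blast
  have "AE q in freq. fourier L v q = ?V q"
    by (rule L2_tendsto_unique[OF fourier_continuous[OF dquot_L2[OF u] v] lim _ fourier_L2[OF v(1)] f]) simp
  then show ?thesis using u v(1) by (auto simp: has_dx_def)
qed

lemma has_dx_unique:
  assumes "has_dx u v" "has_dx u w" shows "AE p in Cy. v p = w p"
proof (rule fourier_inj)
  show "v \<in> L2 Cy" "w \<in> L2 Cy" using assms by (auto simp: has_dx_def)
  have "AE q in freq. fourier L v q = \<i> * complex_of_real (fst q) * fourier L u q"
    "AE q in freq. fourier L w q = \<i> * complex_of_real (fst q) * fourier L u q" using assms by (auto simp: has_dx_def)
  then show "AE q in freq. fourier L v q = fourier L w q" by eventually_elim simp
qed

lemma dx_has_dx: "has_dx u v \<Longrightarrow> has_dx u (dx L u)"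
proof -
  assume a: "has_dx u v"
  have e: "(AE (\<xi>, k) in freq. fourier L v (\<xi>, k) = \<i> * complex_of_real \<xi> * fourier L u (\<xi>, k))
     \<longleftrightarrow> (AE q in freq. fourier L v q = \<i> * complex_of_real (fst q) * fourier L u q)" for v
    by (simp add: split_beta')
  have "\<exists>v. v \<in> L2 Cy \<and> (AE (\<xi>, k) in freq. fourier L v (\<xi>, k) = \<i> * complex_of_real \<xi> * fourier L u (\<xi>, k))"
    using a unfolding has_dx_def e by blast
  from someI_ex[OF this] have "dx L u \<in> L2 Cy \<and> (AE (\<xi>, k) in freq. fourier L (dx L u) (\<xi>, k) = \<i> * complex_of_real \<xi> * fourier L u (\<xi>, k))"
    unfolding dx_def .
  then show "has_dx u (dx L u)" using a unfolding has_dx_def e by blast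
qed

lemma has_dx_diff:
  assumes "has_dx u u'" "has_dx v v'"
  shows "has_dx (\<lambda>p. u p - v p) (\<lambda>p. u' p - v' p)"
proof -
  have u: "u \<in> L2 Cy" "u' \<in> L2 Cy" "v \<in> L2 Cy" "v' \<in> L2 Cy"
    and a: "AE q in freq. fourier L u' q = \<i> * complex_of_real (fst q) * fourier L u q"
      "AE q in freq. fourier L v' q = \<i> * complex_of_real (fst q) * fourier L v q"
    using assms by (auto simp: has_dx_def)
  have "AE q in freq. fourier L (\<lambda>p. u' p - v' p) q = \<i> * complex_of_real (fst q) * fourier L (\<lambda>p. u p - v p) q"
    using a fourier_diff[OF u(2,4)] fourier_diff[OF u(1,3)] by eventually_elim (simp add: right_diff_distrib)
  then show ?thesis using u by (auto simp: has_dx_def intro: L2_diff)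
qed

lemma has_dx_cong:
  assumes "has_dx u v" "w \<in> borel_measurable Cy" "AE p in Cy. u p = w p"
  shows "has_dx w v"
proof -
  have u: "u \<in> L2 Cy" using assms by (auto simp: has_dx_def)
  have "fourier L u = fourier L w" by (rule fourier_cong) (use u assms in \<open>auto dest: L2_measurable\<close>)
  moreover have "w \<in> L2 Cy" by (rule L2_cong_AE[OF u]) (use assms in auto)
  ultimately show ?thesis using assms(1) by (simp add: has_dx_def)
qed

lemma shift_tendsto:
  assumes "has_dx u v"
  shows "L2_tendsto Cy (\<lambda>h. shift h u) u (at 0)"
proof -
  have u: "u \<in> L2 Cy" and v: "v \<in> L2 Cy" using assms by (auto simp: has_dx_def)
  have m: "(\<lambda>p. shift h u p - u p) \<in> L2 Cy" for h by (intro L2_diff shift_L2 u)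
  have "((\<lambda>h. \<bar>h\<bar> * L2_norm Cy (dquot h u)) \<longlongrightarrow> \<bar>0\<bar> * L2_norm Cy v) (at 0)"
    by (intro tendsto_intros L2_tendsto_norm[OF has_dx_quotient[OF assms] v])
  moreover have "eventually (\<lambda>h. \<bar>h\<bar> * L2_norm Cy (dquot h u) = L2_norm Cy (\<lambda>p. shift h u p - u p)) (at (0::real))"
    unfolding eventually_at_filter
    unfolding dquot_def[abs_def] L2_cmult(2)[OF m] by (intro always_eventually allI impI) (simp add: abs_divide)
  ultimately have "((\<lambda>h. L2_norm Cy (\<lambda>p. shift h u p - u p)) \<longlongrightarrow> 0) (at 0)"
    by (subst (asm) filterlim_cong[OF refl refl]) auto
  with m show ?thesis by (simp add: L2_tendsto_def)
qed

text \<open>The integral over the cylinder of the derivative of a product of three bounded functions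
  vanishes: it is the limit of the integrals of difference quotients, which vanish by translation
  invariance.\<close>

lemma integral_dx_product_bounded:
  assumes a: "has_dx a a'" and b: "has_dx b b'" and c: "has_dx c c'"
    and B: "\<And>p. \<bar>a p\<bar> \<le> B" "\<And>p. \<bar>b p\<bar> \<le> B" "\<And>p. \<bar>c p\<bar> \<le> B"
  shows "(\<integral>p. a' p * (b p * c p) \<partial>Cy) + (\<integral>p. b' p * (a p * c p) \<partial>Cy) + (\<integral>p. c' p * (a p * b p) \<partial>Cy) = 0"
proof (rule tendsto_unique)
  have L: "a \<in> L2 Cy" "a' \<in> L2 Cy" "b \<in> L2 Cy" "b' \<in> L2 Cy" "c \<in> L2 Cy" "c' \<in> L2 Cy"
    using a b c by (auto simp: has_dx_def)
  have [measurable]: "a \<in> borel_measurable Cy" "b \<in> borel_measurable Cy" "c \<in> borel_measurable Cy"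
    using L by (auto dest: L2_measurable)
  have bL: "(\<lambda>p. f p * g p) \<in> L2 Cy" if "f \<in> borel_measurable Cy" "\<And>p. \<bar>f p\<bar> \<le> B" "g \<in> L2 Cy" for f g :: "_ \<Rightarrow> real"
    by (rule L2_bounded_mult[OF that(3,1), where B=B]) (use that in simp)
  have Bs: "\<bar>shift h a p\<bar> \<le> B" "\<bar>shift h b p\<bar> \<le> B" "\<bar>shift h c p\<bar> \<le> B" for h p using B by (auto simp: shift_def)
  have n: "L2_tendsto Cy (\<lambda>h p. shift h u p - u p) (\<lambda>_. 0) (at 0)" if "has_dx u v" for u v
    unfolding L2_tendsto_null_iff by (rule shift_tendsto[OF that])
  have s1: "L2_tendsto Cy (\<lambda>h p. a p * shift h c p) (\<lambda>p. a p * c p) (at 0)"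
    by (rule L2_tendsto_cmult[OF shift_tendsto[OF c]]) (use B in auto)
  have s2: "L2_tendsto Cy (\<lambda>h p. shift h b p * shift h c p) (\<lambda>p. b p * c p) (at 0)"
  proof -
    have "L2_tendsto Cy (\<lambda>h p. shift h c p * (shift h b p - b p) + b p * (shift h c p - c p)) (\<lambda>p. 0 + 0) (at 0)"
      by (intro L2_tendsto_add L2_tendsto_null_mult[where B=B] n[OF b] n[OF c]) (use B Bs in auto)
    also have "(\<lambda>h p. shift h c p * (shift h b p - b p) + b p * (shift h c p - c p)) = (\<lambda>h p. shift h b p * shift h c p - b p * c p)"
      by (auto simp: fun_eq_iff algebra_simps)
    finally show ?thesis unfolding add_0 L2_tendsto_null_iff .
  qed
  show "((\<lambda>h. (\<integral>p. dquot h a p * (shift h b p * shift h c p) \<partial>Cy) + (\<integral>p. dquot h b p * (a p * shift h c p) \<partial>Cy) + (\<integral>p. dquot h c p * (a p * b p) \<partial>Cy))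
    \<longlongrightarrow> (\<integral>p. a' p * (b p * c p) \<partial>Cy) + (\<integral>p. b' p * (a p * c p) \<partial>Cy) + (\<integral>p. c' p * (a p * b p) \<partial>Cy)) (at 0)"
    by (intro tendsto_add L2_tendsto_integral_mult has_dx_quotient a b c s1 s2 L2_tendsto_const bL L B; measurable)
  have "(\<integral>p. dquot h a p * (shift h b p * shift h c p) \<partial>Cy) + (\<integral>p. dquot h b p * (a p * shift h c p) \<partial>Cy) + (\<integral>p. dquot h c p * (a p * b p) \<partial>Cy) = 0" for h
  proof -
    have i: "integrable Cy (\<lambda>p. dquot h a p * (shift h b p * shift h c p))" "integrable Cy (\<lambda>p. dquot h b p * (a p * shift h c p))"
      "integrable Cy (\<lambda>p. dquot h c p * (a p * b p))"
      by (intro L2_integrable_mult dquot_L2 bL L shift_L2 B Bs; measurable)+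
    have abc: "integrable Cy (\<lambda>p. a p * (b p * c p))" by (intro L2_integrable_mult bL L B) measurable
    have abcm: "(\<lambda>p. a p * (b p * c p)) \<in> borel_measurable Cy" by measurable
    have "(\<integral>p. dquot h a p * (shift h b p * shift h c p) \<partial>Cy) + (\<integral>p. dquot h b p * (a p * shift h c p) \<partial>Cy) + (\<integral>p. dquot h c p * (a p * b p) \<partial>Cy)
      = (\<integral>p. dquot h a p * (shift h b p * shift h c p) + dquot h b p * (a p * shift h c p) + dquot h c p * (a p * b p) \<partial>Cy)"
      using i by simp
    also have "\<dots> = (\<integral>p. (1/h) * (shift h (\<lambda>p. a p * (b p * c p)) p - a p * (b p * c p)) \<partial>Cy)"
    proof (rule Bochner_Integration.integral_cong[OF refl])
      fix p
      have "(1/h) * (A - a p) * (B * C) + (1/h) * (B - b p) * (a p * C) + (1/h) * (C - c p) * (a p * b p) = (1/h) * (A * (B * C) - a p * (b p * c p))" for A B C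
        by (simp only: right_diff_distrib left_diff_distrib mult_ac)
      then show "dquot h a p * (shift h b p * shift h c p) + dquot h b p * (a p * shift h c p) + dquot h c p * (a p * b p) = (1/h) * (shift h (\<lambda>p. a p * (b p * c p)) p - a p * (b p * c p))"
        unfolding dquot_def shift_def .
    qed
    also have "\<dots> = (1/h) * (\<integral>p. shift h (\<lambda>p. a p * (b p * c p)) p - a p * (b p * c p) \<partial>Cy)"
      by (rule integral_mult_right_zero)
    also have "(\<integral>p. shift h (\<lambda>p. a p * (b p * c p)) p - a p * (b p * c p) \<partial>Cy) = 0"
      using abc shift_integral[OF abcm, of h] by simp
    finally show ?thesis by simp
  qed
  then show "((\<lambda>h. (\<integral>p. dquot h a p * (shift h b p * shift h c p) \<partial>Cy) + (\<integral>p. dquot h b p * (a p * shift h c p) \<partial>Cy) + (\<integral>p. dquot h c p * (a p * b p) \<partial>Cy)) \<longlongrightarrow> 0) (at 0)"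
    by simp
qed simp

end

section \<open>Functions in \<open>Z\<^sup>2\<close>\<close>

lemma L2_tendsto_compose:
  assumes "L2_tendsto M f g F" "filterlim \<phi> F G"
  shows "L2_tendsto M (\<lambda>i. f (\<phi> i)) g G"
  unfolding L2_tendsto_def
proof
  show "eventually (\<lambda>i. (\<lambda>x. f (\<phi> i) x - g x) \<in> L2 M) G"
    by (rule eventually_compose_filterlim[OF L2_tendstoD(1)[OF assms(1)] assms(2)])
  show "((\<lambda>i. L2_norm M (\<lambda>x. f (\<phi> i) x - g x)) \<longlongrightarrow> 0) G"
    by (rule filterlim_compose[OF L2_tendstoD(2)[OF assms(1)] assms(2)])
qed

context period begin

lemma AE_freq_fst: "AE q in freq. fst q \<noteq> 0"
proof -
  interpret A: sigma_finite_measure "count_space (UNIV :: int set)" by (rule int_sf)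
  interpret pair_sigma_finite lborel "count_space (UNIV :: int set)" ..
  show ?thesis unfolding freq_def
  proof (rule AE_pair_measure)
    show "{x \<in> space (lborel \<Otimes>\<^sub>M count_space (UNIV :: int set)). fst x \<noteq> 0} \<in> sets (lborel \<Otimes>\<^sub>M count_space (UNIV :: int set))"
      by measurable
    show "AE x in lborel. AE y in count_space (UNIV :: int set). fst (x :: real, y) \<noteq> 0"
      using AE_lborel_singleton[of "0 :: real"] by eventually_elim simp
  qed
qed

lemma Z2_weight_eq: "Z2_weight q = 1 + (fst q)\<^sup>2 + (real_of_int (snd q) / fst q)\<^sup>2"
  by (simp only: Z2_weight_def split_beta power2_abs)

lemma Z2_weight_measurable [measurable]: "Z2_weight \<in> borel_measurable freq"
proof -
  have [measurable]: "(\<lambda>q. real_of_int (snd q)) \<in> borel_measurable freq" by (rule measurable_int_fun)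
  show ?thesis unfolding Z2_weight_eq[abs_def] by measurable
qed

lemma Z2_weight_ge: "1 \<le> Z2_weight q" "\<bar>fst q\<bar> \<le> Z2_weight q" "fst q \<noteq> 0 \<Longrightarrow> \<bar>real_of_int (snd q)\<bar> \<le> Z2_weight q"
proof -
  show "1 \<le> Z2_weight q" unfolding Z2_weight_eq by simp
  have "2 * \<bar>fst q\<bar> * 1 \<le> \<bar>fst q\<bar>\<^sup>2 + 1\<^sup>2" by (rule sum_squares_bound)
  then have "2 * \<bar>fst q\<bar> \<le> (fst q)\<^sup>2 + 1" by simp
  then show "\<bar>fst q\<bar> \<le> Z2_weight q" 
    unfolding Z2_weight_eq using zero_le_power2[of "real_of_int (snd q) / fst q"] zero_le_power2[of "fst q"]
    unfolding power2_abs by linarith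
  assume "fst q \<noteq> 0"
  then have "\<bar>real_of_int (snd q)\<bar> = \<bar>fst q\<bar> * \<bar>real_of_int (snd q) / fst q\<bar>" by (simp add: abs_divide)
  also have "2 * \<dots> \<le> \<bar>fst q\<bar>\<^sup>2 + \<bar>real_of_int (snd q) / fst q\<bar>\<^sup>2"
    using sum_squares_bound[of "\<bar>fst q\<bar>" "\<bar>real_of_int (snd q) / fst q\<bar>"] by (simp only: mult.assoc)
  finally show "\<bar>real_of_int (snd q)\<bar> \<le> Z2_weight q" unfolding Z2_weight_eq power2_abs by linarith
qed

text \<open>The two summands of the weight balance: its square dominates a product of powers larger than
  \<open>1\<close> of \<open>|\<xi>|\<close> and \<open>|k|\<close>, so that the inverse of the weight is square-summable.\<close>

lemma Z2_weight_lower: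
  assumes "fst q \<noteq> 0"
  shows "(1 + \<bar>fst q\<bar>) powr (-4/3) * (1 + \<bar>real_of_int (snd q)\<bar>) powr (-4/3) * 4 \<ge> (1 / Z2_weight q)\<^sup>2"
proof -
  define x where "x = \<bar>fst q\<bar>"
  define k where "k = \<bar>real_of_int (snd q)\<bar>"
  define w where "w = Z2_weight q"
  have x: "x > 0" and k: "k = 0 \<or> k \<ge> 1" and w1: "w \<ge> 1" using assms Z2_weight_ge(1)[of q]
    by (auto simp: x_def k_def w_def)
  have k0: "k \<ge> 0" by (simp add: k_def)
  have w: "w = (1 + x\<^sup>2) + (k / x)\<^sup>2" by (simp add: w_def Z2_weight_eq x_def k_def power_divide)
  have sx: "(1 + x)\<^sup>2 \<le> 2 * (1 + x\<^sup>2)" using sum_squares_bound[of 1 x] by (simp add: power2_sum)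
  have "(1 + x)\<^sup>2 * (1 + k)\<^sup>2 \<le> 8 * w^3"
  proof (cases "k = 0")
    case True
    have "1 + x\<^sup>2 \<le> w^3" using w True w1 power_increasing[of 1 3 w] by simp
    then show ?thesis using sx True by (simp, smt (verit) zero_le_power2)
  next
    case False
    then have k1: "k \<ge> 1" using k by auto
    have A: "0 \<le> (k/x)\<^sup>2" "0 \<le> 1 + x\<^sup>2" by auto
    have "(1 + x\<^sup>2) * k\<^sup>2 = (1 + x\<^sup>2) * (x\<^sup>2 * (k / x)\<^sup>2)" using x by (simp add: power_divide)
    also have "\<dots> \<le> (1 + x\<^sup>2) * ((1 + x\<^sup>2) * (k / x)\<^sup>2)"
      by (intro mult_left_mono mult_right_mono) auto
    also have "\<dots> \<le> w * (w * w)" using A unfolding w by (intro mult_mono) auto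
    finally have B: "(1 + x\<^sup>2) * k\<^sup>2 \<le> w^3" by (simp add: power3_eq_cube mult.assoc)
    have "(1 + k)\<^sup>2 \<le> (2 * k)\<^sup>2" using k1 by (intro power_mono) auto
    then have "(1 + x)\<^sup>2 * (1 + k)\<^sup>2 \<le> (2 * (1 + x\<^sup>2)) * (4 * k\<^sup>2)"
      using sx by (intro mult_mono) (auto simp: power_mult_distrib)
    also have "\<dots> = 8 * ((1 + x\<^sup>2) * k\<^sup>2)" by simp
    also have "\<dots> \<le> 8 * w^3" using B by (rule mult_left_mono) simp
    finally show ?thesis .
  qed
  then have "((1 + x)\<^sup>2 * (1 + k)\<^sup>2) powr (2/3) \<le> (8 * w^3) powr (2/3)"
    by (intro powr_mono2) auto
  also have "(8 * w^3) powr (2/3) = 4 * w\<^sup>2"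
  proof -
    have "8 * w^3 = (2 * w) powr 3" using w1 by (simp add: powr_numeral power_mult_distrib)
    then have "(8 * w^3) powr (2/3) = (2 * w) powr 2" by (simp add: powr_powr)
    then show ?thesis using w1 by (simp add: powr_numeral power_mult_distrib)
  qed
  also have "((1 + x)\<^sup>2 * (1 + k)\<^sup>2) powr (2/3) = (1 + x) powr (4/3) * (1 + k) powr (4/3)"
  proof -
    have "((1 + x)\<^sup>2 * (1 + k)\<^sup>2) = ((1 + x) * (1 + k)) powr 2" using x k0 by (simp add: powr_numeral power_mult_distrib)
    then have "((1 + x)\<^sup>2 * (1 + k)\<^sup>2) powr (2/3) = ((1 + x) * (1 + k)) powr (4/3)" by (simp add: powr_powr)
    then show ?thesis using x k0 by (simp add: powr_mult)
  qed
  finally have "(1 + x) powr (4/3) * (1 + k) powr (4/3) \<le> 4 * w\<^sup>2" .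
  then have "1 / (4 * w\<^sup>2) \<le> 1 / ((1 + x) powr (4/3) * (1 + k) powr (4/3))"
    using x k by (intro divide_left_mono mult_pos_pos) (use w1 k0 in auto)
  also have "\<dots> = (1 + x) powr (-4/3) * (1 + k) powr (-4/3)" by (simp add: powr_minus_divide)
  finally show ?thesis by (simp add: x_def k_def w_def power_divide field_simps)
qed

lemma integrable_even_FTC:
  fixes f F :: "real \<Rightarrow> real"
  assumes [measurable]: "f \<in> borel_measurable borel" and F: "\<And>x. 0 \<le> x \<Longrightarrow> DERIV F x :> f x"
    and nn: "\<And>x. 0 \<le> x \<Longrightarrow> 0 \<le> f x" and lim: "(F \<longlongrightarrow> T) at_top"
  shows "integrable lborel (\<lambda>x. f \<bar>x\<bar>)"
proof (rule integrableI_bounded)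
  have "(\<integral>\<^sup>+x. ennreal (f x) * indicator {0..} x \<partial>lborel) = ennreal (T - F 0)"
    by (rule nn_integral_FTC_atLeast[OF assms(1) F nn lim])
  then have fin: "(\<integral>\<^sup>+x. ennreal (f x) * indicator {0..} x \<partial>lborel) < \<infinity>" by (simp only:) simp
  have "(\<integral>\<^sup>+x. ennreal (norm (f \<bar>x\<bar>)) \<partial>lborel)
      \<le> (\<integral>\<^sup>+x. ennreal (f x) * indicator {0..} x + ennreal (f (0 + (-1) * x)) * indicator {0..} (0 + (-1) * x) \<partial>lborel)"
  proof (rule nn_integral_mono)
    fix x :: real
    have "norm (f \<bar>x\<bar>) = f \<bar>x\<bar>" using nn[of "\<bar>x\<bar>"] by simp
    then show "ennreal (norm (f \<bar>x\<bar>)) \<le> ennreal (f x) * indicator {0..} x + ennreal (f (0 + (-1) * x)) * indicator {0..} (0 + (-1) * x)"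
      by (cases "0 \<le> x") simp_all
  qed
  also have "\<dots> = (\<integral>\<^sup>+x. ennreal (f x) * indicator {0..} x \<partial>lborel) + (\<integral>\<^sup>+x. ennreal (f (0 + (-1) * x)) * indicator {0..} (0 + (-1) * x) \<partial>lborel)"
    by (rule nn_integral_add) measurable
  also have "(\<integral>\<^sup>+x. ennreal (f (0 + (-1) * x)) * indicator {0..} (0 + (-1) * x) \<partial>lborel) = (\<integral>\<^sup>+x. ennreal (f x) * indicator {0..} x \<partial>lborel)"
    using nn_integral_real_affine[of "\<lambda>x. ennreal (f x) * indicator {0..} x" "-1" 0] by simp
  also have "(\<integral>\<^sup>+x. ennreal (f x) * indicator {0..} x \<partial>lborel) + (\<integral>\<^sup>+x. ennreal (f x) * indicator {0..} x \<partial>lborel) < \<infinity>"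
    using fin by simp
  finally show "(\<integral>\<^sup>+x. ennreal (norm (f \<bar>x\<bar>)) \<partial>lborel) < \<infinity>" .
qed measurable

lemma powr_integrable: "integrable lborel (\<lambda>x::real. (1 + \<bar>x\<bar>) powr (-4/3))"
proof (rule integrable_even_FTC[where f="\<lambda>x. (1 + x) powr (-4/3)" and F="\<lambda>x. -3 * (1 + x) powr (-1/3)" and T=0])
  show "(\<lambda>x::real. (1 + x) powr (-4/3)) \<in> borel_measurable borel" by measurable
  show "DERIV (\<lambda>x. -3 * (1 + x) powr (-1/3)) x :> (1 + x) powr (-4/3)" if "0 \<le> x" for x :: real
    using that by (auto intro!: derivative_eq_intros)
  show "((\<lambda>x::real. -3 * (1 + x) powr (-1/3)) \<longlongrightarrow> 0) at_top" by real_asymp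
qed simp

lemma powr_int_integrable: "integrable (count_space UNIV) (\<lambda>k::int. (1 + \<bar>real_of_int k\<bar>) powr (-4/3))"
proof -
  let ?f = "\<lambda>k::int. (1 + \<bar>real_of_int k\<bar>) powr (-4/3)"
  have s: "summable (\<lambda>n. real (Suc n) powr (-4/3))"
    by (subst summable_Suc_iff) (simp add: summable_real_powr_iff)
  have U: "(UNIV :: int set) = range int \<union> range (\<lambda>n. - int n)"
  proof -
    have "k \<in> range int \<union> range (\<lambda>n. - int n)" for k
      by (cases "k \<ge> 0") (auto intro: range_eqI[of _ _ "nat k"] range_eqI[of _ _ "nat (- k)"])
    then show ?thesis by auto
  qed
  have "Infinite_Set_Sum.abs_summable_on ?f (range int)"
    by (rule abs_summable_on_reindex) (use s in \<open>simp add: abs_summable_on_nat_iff' add.commute\<close>)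
  moreover have "Infinite_Set_Sum.abs_summable_on ?f (range (\<lambda>n. - int n))"
    by (rule abs_summable_on_reindex) (use s in \<open>simp add: abs_summable_on_nat_iff' add.commute\<close>)
  ultimately have "Infinite_Set_Sum.abs_summable_on ?f UNIV" unfolding U by (rule abs_summable_on_union)
  then show ?thesis by (simp add: abs_summable_on_def)
qed

lemma inverse_weight_L2: "(\<lambda>q. complex_of_real (1 / Z2_weight q)) \<in> L2 freq"
proof (rule L2I)
  show "(\<lambda>q. complex_of_real (1 / Z2_weight q)) \<in> borel_measurable freq" by measurable
  show "integrable freq (\<lambda>q. (norm (complex_of_real (1 / Z2_weight q)))\<^sup>2)"
  proof (rule Bochner_Integration.integrable_bound)
    show "integrable freq (\<lambda>q. (1 + \<bar>fst q\<bar>) powr (-4/3) * (1 + \<bar>real_of_int (snd q)\<bar>) powr (-4/3) * 4)"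
      unfolding freq_def
      by (intro integrable_mult_left product_integral(1)[OF lborel.sigma_finite_measure_axioms int_sf powr_integrable powr_int_integrable])
    show "AE q in freq. norm ((norm (complex_of_real (1 / Z2_weight q)))\<^sup>2) \<le> norm ((1 + \<bar>fst q\<bar>) powr (-4/3) * (1 + \<bar>real_of_int (snd q)\<bar>) powr (-4/3) * 4)"
      using AE_freq_fst
    proof eventually_elim
      case (elim q)
      have "norm ((norm (complex_of_real (1 / Z2_weight q)))\<^sup>2) = (1 / Z2_weight q)\<^sup>2"
        by (simp only: norm_of_real real_norm_def power2_abs abs_power2)
      also have "\<dots> \<le> (1 + \<bar>fst q\<bar>) powr (-4/3) * (1 + \<bar>real_of_int (snd q)\<bar>) powr (-4/3) * 4" by (rule Z2_weight_lower[OF elim])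
      also have "\<dots> \<le> norm ((1 + \<bar>fst q\<bar>) powr (-4/3) * (1 + \<bar>real_of_int (snd q)\<bar>) powr (-4/3) * 4)"
        unfolding real_norm_def by (rule abs_ge_self)
      finally show ?case .
    qed
  qed measurable
qed

lemma Z2_D:
  assumes "u \<in> Z2 L"
  shows "u \<in> L2 Cy" "(\<lambda>q. complex_of_real (Z2_weight q) * fourier L u q) \<in> L2 freq"
  using assms by (auto simp: Z2_def)

text \<open>The weight dominates \<open>|\<xi>|\<close>, since \<open>2|\<xi>| \<le> 1 + \<xi>\<^sup>2\<close>.\<close>

lemma Z2_has_dx:
  assumes "u \<in> Z2 L" shows "has_dx u (dx L u)"
proof -
  have [measurable]: "fourier L u \<in> borel_measurable freq" by (rule fourier_measurable[OF Z2_D(1)[OF assms]])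
  have "(\<lambda>q. \<i> * complex_of_real (fst q) * fourier L u q) \<in> L2 freq"
  proof (rule L2_norm_mono(1)[OF Z2_D(2)[OF assms]])
    show "AE q in freq. norm (\<i> * complex_of_real (fst q) * fourier L u q) \<le> norm (complex_of_real (Z2_weight q) * fourier L u q)"
    proof (rule AE_I2)
      fix q
      have "\<bar>fst q\<bar> \<le> \<bar>Z2_weight q\<bar>" using Z2_weight_ge(2)[of q] by linarith
      then show "norm (\<i> * complex_of_real (fst q) * fourier L u q) \<le> norm (complex_of_real (Z2_weight q) * fourier L u q)"
        by (simp add: norm_mult mult_right_mono)
    qed
  qed measurable
  from has_dx_exists[OF Z2_D(1)[OF assms] this] show ?thesis using dx_has_dx by blast
qed

text \<open>Boundedness is obtained by duality: testing against the sign of \<open>u\<close> on the set where \<open>|u|\<close>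
  exceeds the \<open>L\<^sup>1\<close> norm of the transform shows that this set is null.\<close>

lemma fourier_integrable_bounded:
  assumes u: "u \<in> L2 Cy" and f: "integrable freq (fourier L u)"
  shows "AE p in Cy. \<bar>u p\<bar> \<le> 1 / (2 * pi) * (\<integral>q. norm (fourier L u q) \<partial>freq)"
proof -
  define K where "K = 1 / (2 * pi) * (\<integral>q. norm (fourier L u q) \<partial>freq)"
  have K0: "K \<ge> 0" by (simp add: K_def)
  have [measurable]: "u \<in> borel_measurable Cy" using u by (rule L2_measurable)
  have "AE p in Cy. \<not> (\<bar>u p\<bar> > K \<and> \<bar>fst p\<bar> \<le> real n)" for n
  proof -
    define A where "A p = (if \<bar>u p\<bar> > K \<and> \<bar>fst p\<bar> \<le> real n then 1 else 0 :: real)" for p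
    define \<phi> where "\<phi> p = sgn (u p) * A p" for p
    have [measurable]: "A \<in> borel_measurable Cy" unfolding A_def[abs_def] by measurable
    have [measurable]: "\<phi> \<in> borel_measurable Cy" unfolding \<phi>_def[abs_def] by measurable
    have "integrable Cy (\<lambda>p. indicator {- real n..real n} (fst p) * 1 :: real)"
      by (rule pair_Yc_integral(2)) (auto intro!: integrable_real_indicator simp: emeasure_lborel_Icc_eq)
    then have iA: "integrable Cy A"
      by (rule Bochner_Integration.integrable_bound) (auto simp: A_def indicator_def abs_le_iff)
    have i\<phi>: "integrable Cy \<phi>"
      by (rule Bochner_Integration.integrable_bound[OF iA]) (auto simp: \<phi>_def A_def sgn_if)
    have L\<phi>: "\<phi> \<in> L2 Cy" by (rule bounded_integrable_L2[OF i\<phi>, where B=1]) (auto simp: \<phi>_def A_def sgn_if)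
    have iu: "integrable Cy (\<lambda>p. \<bar>u p\<bar> * A p)"
      using L2_integrable_mult[OF u L\<phi>] by (rule Bochner_Integration.integrable_cong[OF refl, THEN iffD1, rotated]) (auto simp: \<phi>_def abs_sgn mult.assoc)
    have "1 / L * (\<integral>p. \<bar>u p\<bar> * A p \<partial>Cy) = norm (complex_of_real (1 / L * (\<integral>p. u p * \<phi> p \<partial>Cy)))"
    proof -
      have "(\<integral>p. u p * \<phi> p \<partial>Cy) = (\<integral>p. \<bar>u p\<bar> * A p \<partial>Cy)"
        by (rule Bochner_Integration.integral_cong) (auto simp: \<phi>_def abs_sgn mult.assoc)
      moreover have "(\<integral>p. \<bar>u p\<bar> * A p \<partial>Cy) \<ge> 0" by (rule Bochner_Integration.integral_nonneg) (auto simp: A_def)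
      ultimately show ?thesis using L_pos by (simp only: norm_of_real) simp
    qed
    also have "complex_of_real (1 / L * (\<integral>p. u p * \<phi> p \<partial>Cy)) = (\<integral>q. fourier L u q * cnj (fourier L \<phi> q) \<partial>freq)"
      by (rule fourier_inner[OF u L\<phi>, symmetric])
    also have "norm (\<integral>q. fourier L u q * cnj (fourier L \<phi> q) \<partial>freq) \<le> (\<integral>q. norm (fourier L u q) * (1 / (2 * pi * L) * (\<integral>p. A p \<partial>Cy)) \<partial>freq)"
    proof (rule order.trans[OF integral_norm_bound], rule integral_mono_AE)
      show "integrable freq (\<lambda>q. norm (fourier L u q * cnj (fourier L \<phi> q)))"
        by (intro integrable_norm L2_integrable_mult fourier_L2 L2_cnj u L\<phi>)
      show "integrable freq (\<lambda>q. norm (fourier L u q) * (1 / (2 * pi * L) * (\<integral>p. A p \<partial>Cy)))"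
        using f by (intro integrable_mult_left integrable_norm)
      have "norm (F1 L \<phi> q) \<le> 1 / (2 * pi * L) * (\<integral>p. A p \<partial>Cy)" for q
      proof -
        have "(\<integral>p. \<bar>\<phi> p\<bar> \<partial>Cy) \<le> (\<integral>p. A p \<partial>Cy)"
        proof (rule integral_mono)
          show "integrable Cy (\<lambda>p. \<bar>\<phi> p\<bar>)" using i\<phi> by auto
          show "\<bar>\<phi> p\<bar> \<le> A p" for p by (simp add: \<phi>_def A_def sgn_if)
        qed (rule iA)
        then have "1 / (2 * pi * L) * (\<integral>p. \<bar>\<phi> p\<bar> \<partial>Cy) \<le> 1 / (2 * pi * L) * (\<integral>p. A p \<partial>Cy)"
          using L_pos by (intro mult_left_mono) auto
        with norm_F1_le[OF i\<phi>, of q] show ?thesis by linarith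
      qed
      then show "AE q in freq. norm (fourier L u q * cnj (fourier L \<phi> q)) \<le> norm (fourier L u q) * (1 / (2 * pi * L) * (\<integral>p. A p \<partial>Cy))"
        using fourier_F1[OF i\<phi> L\<phi>] by (elim eventually_mono) (simp only: norm_mult complex_mod_cnj, rule mult_left_mono, auto)
    qed
    also have "\<dots> = 1 / L * (K * (\<integral>p. A p \<partial>Cy))" by (simp add: K_def)
    finally have "(\<integral>p. \<bar>u p\<bar> * A p \<partial>Cy) \<le> (\<integral>p. K * A p \<partial>Cy)" using L_pos by (simp add: divide_right_mono field_simps)
    then have le0: "(\<integral>p. (\<bar>u p\<bar> - K) * A p \<partial>Cy) \<le> 0" using iu iA by (simp add: left_diff_distrib)
    have i: "integrable Cy (\<lambda>p. (\<bar>u p\<bar> - K) * A p)" using iu iA by (simp add: left_diff_distrib)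
    have nn: "AE p in Cy. 0 \<le> (\<bar>u p\<bar> - K) * A p" by (auto simp: A_def)
    have "(\<integral>p. (\<bar>u p\<bar> - K) * A p \<partial>Cy) = 0"
      using le0 integral_nonneg_AE[OF nn] by linarith
    then have "AE p in Cy. (\<bar>u p\<bar> - K) * A p = 0" using integral_nonneg_eq_0_iff_AE[OF i nn] by simp
    then show ?thesis by eventually_elim (auto simp: A_def split: if_splits)
  qed
  then have "AE p in Cy. \<forall>n::nat. \<not> (\<bar>u p\<bar> > K \<and> \<bar>fst p\<bar> \<le> real n)" unfolding AE_all_countable by (rule allI)
  then show ?thesis unfolding K_def[symmetric]
  proof eventually_elim
    case (elim p)
    obtain n where "\<bar>fst p\<bar> \<le> real n" using real_arch_simple by blast
    with elim show ?case by (meson not_less)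
  qed
qed

text \<open>The transform is the product of the square-integrable functions \<open>1/\<close>weight and weight times transform,
hence integrable.\<close>

lemma Z2_bounded:
  assumes "u \<in> Z2 L"
  obtains K where "AE p in Cy. \<bar>u p\<bar> \<le> K"
proof -
  have "integrable freq (\<lambda>q. complex_of_real (1 / Z2_weight q) * (complex_of_real (Z2_weight q) * fourier L u q))"
    by (rule L2_integrable_mult[OF inverse_weight_L2 Z2_D(2)[OF assms]])
  also have "(\<lambda>q. complex_of_real (1 / Z2_weight q) * (complex_of_real (Z2_weight q) * fourier L u q)) = fourier L u"
  proof
    fix q show "complex_of_real (1 / Z2_weight q) * (complex_of_real (Z2_weight q) * fourier L u q) = fourier L u q"
      using Z2_weight_ge(1)[of q] by simp
  qed
  finally show ?thesis using that fourier_integrable_bounded[OF Z2_D(1)[OF assms]] by blast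
qed

text \<open>Clipping the functions at their essential bounds changes them on null sets only and makes
the bounds hold everywhere.\<close>

lemma integral_dx_product:
  assumes a: "has_dx a a'" and b: "has_dx b b'" and c: "has_dx c c'"
    and B: "AE p in Cy. \<bar>a p\<bar> \<le> A" "AE p in Cy. \<bar>b p\<bar> \<le> B" "AE p in Cy. \<bar>c p\<bar> \<le> C"
  shows "(\<integral>p. a' p * (b p * c p) \<partial>Cy) + (\<integral>p. b' p * (a p * c p) \<partial>Cy) + (\<integral>p. c' p * (a p * b p) \<partial>Cy) = 0"
proof -
  define K where "K = \<bar>A\<bar> + \<bar>B\<bar> + \<bar>C\<bar>"
  define clip where "clip f p = max (- K) (min K (f p))" for f :: "real \<times> real \<Rightarrow> real" and p
  have K0: "K \<ge> 0" by (simp add: K_def)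
  have cb: "\<bar>clip f p\<bar> \<le> K" for f p using K0 by (auto simp: clip_def)
  have [measurable]: "a \<in> borel_measurable Cy" "b \<in> borel_measurable Cy" "c \<in> borel_measurable Cy"
    "a' \<in> borel_measurable Cy" "b' \<in> borel_measurable Cy" "c' \<in> borel_measurable Cy"
    using a b c by (auto simp: has_dx_def dest: L2_measurable)
  have cm [measurable]: "clip f \<in> borel_measurable Cy" if "f \<in> borel_measurable Cy" for f
    unfolding clip_def[abs_def] using that by measurable
  have ae: "AE p in Cy. a p = clip a p" "AE p in Cy. b p = clip b p" "AE p in Cy. c p = clip c p"
    subgoal using B(1) by (rule eventually_mono) (auto simp: clip_def K_def)
    subgoal using B(2) by (rule eventually_mono) (auto simp: clip_def K_def)
    subgoal using B(3) by (rule eventually_mono) (auto simp: clip_def K_def)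
    done
  have "(\<integral>p. a' p * (clip b p * clip c p) \<partial>Cy) + (\<integral>p. b' p * (clip a p * clip c p) \<partial>Cy) + (\<integral>p. c' p * (clip a p * clip b p) \<partial>Cy) = 0"
    by (rule integral_dx_product_bounded[OF has_dx_cong[OF a cm ae(1)] has_dx_cong[OF b cm ae(2)] has_dx_cong[OF c cm ae(3)] cb cb cb]) measurable
  moreover have "(\<integral>p. a' p * (clip b p * clip c p) \<partial>Cy) = (\<integral>p. a' p * (b p * c p) \<partial>Cy)"
    "(\<integral>p. b' p * (clip a p * clip c p) \<partial>Cy) = (\<integral>p. b' p * (a p * c p) \<partial>Cy)"
    "(\<integral>p. c' p * (clip a p * clip b p) \<partial>Cy) = (\<integral>p. c' p * (a p * b p) \<partial>Cy)"
    by (rule integral_cong_AE, measurable, use ae in eventually_elim, simp)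
      (rule integral_cong_AE, measurable, use ae in eventually_elim, simp)+
  ultimately show ?thesis by simp
qed

lemma Z2_nonlinearity_L2: "u \<in> Z2 L \<Longrightarrow> (\<lambda>p. u p * dx L u p) \<in> L2 Cy"
proof -
  assume u: "u \<in> Z2 L"
  obtain K where "AE p in Cy. \<bar>u p\<bar> \<le> K" using Z2_bounded[OF u] .
  moreover have "dx L u \<in> L2 Cy" using Z2_has_dx[OF u] by (simp add: has_dx_def)
  moreover have "u \<in> borel_measurable Cy" using Z2_D(1)[OF u] by (rule L2_measurable)
  ultimately show ?thesis by (intro L2_bounded_mult[where B=K]) auto
qed

text \<open>With \<open>w = u - v\<close> the integrand is \<open>w w w\<^sub>x + v w w\<^sub>x + v\<^sub>x w\<^sup>2\<close>.  The first term is the derivative of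
\<open>w\<^sup>3/3\<close>, and the second equals \<open>v (w\<^sup>2)\<^sub>x / 2\<close>, which integrates to \<open>- \<integral> v\<^sub>x w\<^sup>2 / 2\<close>.  Only the slope of
\<open>v\<close> remains, which makes the estimate below asymmetric in the two solutions.\<close>

lemma nonlinear_energy:
  assumes u: "u \<in> Z2 L" and v: "v \<in> Z2 L"
  defines "w \<equiv> \<lambda>p. u p - v p"
  shows "(\<integral>p. w p * (u p * dx L u p - v p * dx L v p) \<partial>Cy) = 1 / 2 * (\<integral>p. dx L v p * (w p * w p) \<partial>Cy)"
proof -
  define w' where "w' p = dx L u p - dx L v p" for p
  have du: "has_dx u (dx L u)" and dv: "has_dx v (dx L v)" using u v by (auto intro: Z2_has_dx)
  have dw: "has_dx w w'" unfolding w_def w'_def[abs_def] by (rule has_dx_diff[OF du dv])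
  obtain A B where A: "AE p in Cy. \<bar>u p\<bar> \<le> A" and B: "AE p in Cy. \<bar>v p\<bar> \<le> B" using Z2_bounded u v by metis
  have C: "AE p in Cy. \<bar>w p\<bar> \<le> A + B" using A B by eventually_elim (auto simp: w_def)
  have L: "w \<in> L2 Cy" "w' \<in> L2 Cy" "v \<in> L2 Cy" "dx L v \<in> L2 Cy" using dv dw by (auto simp: has_dx_def)
  have m: "w \<in> borel_measurable Cy" "v \<in> borel_measurable Cy" using L by (auto dest: L2_measurable)
  have ww: "(\<lambda>p. w p * w p) \<in> L2 Cy" by (rule L2_bounded_mult[OF L(1) m(1), where B="A + B"]) (use C in auto)
  have vw: "(\<lambda>p. v p * w p) \<in> L2 Cy" by (rule L2_bounded_mult[OF L(1) m(2), where B=B]) (use B in auto)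
  have i: "integrable Cy (\<lambda>p. w' p * (w p * w p))" "integrable Cy (\<lambda>p. w' p * (v p * w p))" "integrable Cy (\<lambda>p. dx L v p * (w p * w p))"
    by (intro L2_integrable_mult L ww vw)+
  have t1: "(\<integral>p. w' p * (w p * w p) \<partial>Cy) = 0" using integral_dx_product[OF dw dw dw C C C] by simp
  have t2: "(\<integral>p. dx L v p * (w p * w p) \<partial>Cy) + 2 * (\<integral>p. w' p * (v p * w p) \<partial>Cy) = 0" using integral_dx_product[OF dv dw dw B C C] by simp
  have "(\<integral>p. w p * (u p * dx L u p - v p * dx L v p) \<partial>Cy) = (\<integral>p. w' p * (v p * w p) + dx L v p * (w p * w p) + w' p * (w p * w p) \<partial>Cy)"
    by (rule Bochner_Integration.integral_cong) (auto simp: w_def w'_def algebra_simps)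
  also have "\<dots> = (\<integral>p. w' p * (v p * w p) \<partial>Cy) + (\<integral>p. dx L v p * (w p * w p) \<partial>Cy) + (\<integral>p. w' p * (w p * w p) \<partial>Cy)"
    using i by simp
  finally show ?thesis using t1 t2 by simp
qed

end

section \<open>Uniqueness against solutions with bounded slope\<close>

lemma L2_tendsto_cnj:
  assumes "L2_tendsto M f g F"
  shows "L2_tendsto M (\<lambda>i x. cnj (f i x)) (\<lambda>x. cnj (g x)) F"
  unfolding L2_tendsto_def
proof
  have e: "(\<lambda>x. cnj (f i x) - cnj (g x)) = (\<lambda>x. cnj (f i x - g x))" for i by simp
  show "eventually (\<lambda>i. (\<lambda>x. cnj (f i x) - cnj (g x)) \<in> L2 M) F"
    unfolding e using L2_tendstoD(1)[OF assms] by eventually_elim (rule L2_cnj)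
  have "L2_norm M (\<lambda>x. cnj (f i x) - cnj (g x)) = L2_norm M (\<lambda>x. f i x - g x)" for i
    unfolding e by (simp only: L2_norm_def complex_mod_cnj)
  then show "((\<lambda>i. L2_norm M (\<lambda>x. cnj (f i x) - cnj (g x))) \<longlongrightarrow> 0) F"
    using L2_tendstoD(2)[OF assms] by simp
qed

context period begin

text \<open>The weight of \<open>H\<^sup>-\<^sup>1\<close>, the norm in which solutions are differentiable in time.\<close>

definition H1m :: "real \<times> int \<Rightarrow> real" where "H1m q = Hs_weight L (-1) q"

lemma H1m_eq: "H1m q = 1 / sqrt (1 + (fst q)\<^sup>2 + (real_of_int (snd q) / L)\<^sup>2)"
proof -
  have "0 \<le> 1 + (fst q)\<^sup>2 + (real_of_int (snd q) / L)\<^sup>2" by simp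
  then show ?thesis
    unfolding H1m_def Hs_weight_def split_beta by (simp add: powr_minus_divide powr_half_sqrt)
qed

lemma one_le_H1_arg: "1 \<le> 1 + (fst q)\<^sup>2 + (real_of_int (snd q) / L)\<^sup>2" by simp

lemma H1m_bounds: "0 < H1m q" "H1m q \<le> 1"
proof -
  have "0 < 1 / sqrt a \<and> 1 / sqrt a \<le> 1" if "1 \<le> a" for a :: real using that by auto
  from this[OF one_le_H1_arg[of q]] show "0 < H1m q" "H1m q \<le> 1" unfolding H1m_eq by auto
qed

lemma H1m_measurable [measurable]: "H1m \<in> borel_measurable freq"
proof -
  have [measurable]: "(\<lambda>q. real_of_int (snd q)) \<in> borel_measurable freq" by (rule measurable_int_fun)
  show ?thesis unfolding H1m_eq[abs_def] by measurable
qed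

text \<open>The weight of \<open>H\<^sup>1\<close> divided by that of \<open>Z\<^sup>2\<close>; its boundedness says that \<open>Z\<^sup>2\<close> is contained in \<open>H\<^sup>1\<close>,
so that elements of \<open>Z\<^sup>2\<close> can be paired with the time derivative.  The set \<open>\<xi> = 0\<close>, where the weight of \<open>Z\<^sup>2\<close> is
not meaningful, is null.\<close>

definition ratio :: "real \<times> int \<Rightarrow> real" where
  "ratio q = (if fst q = 0 then 0 else 1 / (H1m q * Z2_weight q))"

lemma ratio_measurable [measurable]: "ratio \<in> borel_measurable freq"
  unfolding ratio_def[abs_def] by measurable

lemma ratio_bound: "\<bar>ratio q\<bar> \<le> 2 + 1 / L"
proof (cases "fst q = 0")
  case False
  let ?w = "Z2_weight q" and ?k = "\<bar>real_of_int (snd q)\<bar>"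
  have w: "1 \<le> ?w" "\<bar>fst q\<bar> \<le> ?w" "?k \<le> ?w" using Z2_weight_ge[of q] False by auto
  have "1 / H1m q = sqrt (1 + (fst q)\<^sup>2 + (real_of_int (snd q) / L)\<^sup>2)" by (simp add: H1m_eq)
  also have "\<dots> \<le> (2 + 1 / L) * ?w"
  proof (rule real_le_lsqrt)
    have "1 + (fst q)\<^sup>2 + (real_of_int (snd q) / L)\<^sup>2 \<le> ?w\<^sup>2 + ?w\<^sup>2 + (?w / L)\<^sup>2"
    proof (intro add_mono)
      show "1 \<le> ?w\<^sup>2" using w by simp
      show "(fst q)\<^sup>2 \<le> ?w\<^sup>2" using w by (intro abs_le_square_iff[THEN iffD1]) auto
      show "(real_of_int (snd q) / L)\<^sup>2 \<le> (?w / L)\<^sup>2"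
        using w L_pos by (intro abs_le_square_iff[THEN iffD1]) (auto simp: abs_divide intro!: divide_right_mono)
    qed
    also have "\<dots> \<le> ((2 + 1 / L) * ?w)\<^sup>2"
    proof -
      have "((2 + 1 / L) * ?w)\<^sup>2 = 4 * ?w\<^sup>2 + 4 * (1/L) * ?w\<^sup>2 + (?w / L)\<^sup>2"
        by (simp add: power2_eq_square algebra_simps)
      moreover have "0 \<le> ?w\<^sup>2" "0 \<le> 4 * (1/L) * ?w\<^sup>2" using L_pos by auto
      ultimately show ?thesis by linarith
    qed
    finally show "1 + (fst q)\<^sup>2 + (real_of_int (snd q) / L)\<^sup>2 \<le> ((2 + 1 / L) * ?w)\<^sup>2" .
  qed (use w L_pos in auto)
  finally have "1 / H1m q / ?w \<le> 2 + 1 / L" using w by (subst pos_divide_le_eq) auto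
  moreover have "0 \<le> 1 / H1m q / ?w" using w H1m_bounds[of q] by simp
  ultimately show ?thesis using False by (simp add: ratio_def mult.commute)
qed (use L_pos in \<open>simp add: ratio_def\<close>)

lemma KPI_rhs_eq:
  "KPI_rhs L u q = \<i> * complex_of_real (fst q + fst q ^ 3 + (real_of_int (snd q) / L)\<^sup>2 / fst q) * fourier L u q
     - fourier L (\<lambda>p. u p * dx L u p) q"
proof (cases "fst q = 0")
  case True
  then show ?thesis by (cases q) (simp add: KPI_rhs_def)
next
  case False
  have 1: "(\<i> * complex_of_real (fst q)) ^ 3 = - \<i> * complex_of_real (fst q) ^ 3"
  proof -
    have "\<i> ^ 3 = - \<i>" by (simp add: power3_eq_cube)
    then show ?thesis by (simp add: power_mult_distrib)
  qed
  have 2: "(\<i> * complex_of_real (real_of_int (snd q) / L))\<^sup>2 / (\<i> * complex_of_real (fst q))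
     = \<i> * complex_of_real ((real_of_int (snd q) / L)\<^sup>2 / fst q)"
  proof -
    have "(\<i> * a)\<^sup>2 = \<i> * (\<i> * a\<^sup>2)" for a :: complex by (simp add: power_mult_distrib flip: mult.assoc)
    then show ?thesis by (simp only: mult_divide_mult_cancel_left[OF complex_i_not_zero]) simp
  qed
  show ?thesis
    unfolding KPI_rhs_def split_beta Let_def prod.collapse 1 2 by (simp add: algebra_simps)
qed

text \<open>The evolution equation enters only through the time derivative of the squared \<open>L\<^sup>2\<close> distance of
  two solutions; the dispersive terms have purely imaginary symbols and drop out.\<close>

lemma energy_derivative:
  assumes u: "KPI_solution L u\<^sub>0 u" and v: "KPI_solution L v\<^sub>0 v"
  defines "E \<equiv> \<lambda>t. (L2_norm freq (\<lambda>q. fourier L (u t) q - fourier L (v t) q))\<^sup>2"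
  shows "(E has_real_derivative - (1 / L) * (\<integral>p. dx L (v t) p * ((u t p - v t p) * (u t p - v t p)) \<partial>Cy)) (at t)"
proof -
  have uZ: "u s \<in> Z2 L" and vZ: "v s \<in> Z2 L" for s using u v by (auto simp: KPI_solution_def)
  define W where "W s q = fourier L (u s) q - fourier L (v s) q" for s q
  define R where "R q = KPI_rhs L (u t) q - KPI_rhs L (v t) q" for q
  have WL2: "W s \<in> L2 freq" for s unfolding W_def[abs_def] by (intro L2_diff fourier_L2 Z2_D uZ vZ)
  have [measurable]: "W s \<in> borel_measurable freq" for s using WL2 by (rule L2_measurable)
  let ?z = "\<lambda>q. complex_of_real (Z2_weight q)" and ?m = "\<lambda>q. complex_of_real (H1m q)"
  have zW: "(\<lambda>q. ?z q * W s q) \<in> L2 freq" for s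
    using L2_diff[OF Z2_D(2)[OF uZ[of s]] Z2_D(2)[OF vZ[of s]]] by (simp add: W_def right_diff_distrib)
  have "L2_tendsto freq (\<lambda>s q. ?z q * W s q) (\<lambda>q. ?z q * W t q) (at t)"
    using L2_tendsto_diff[of freq "\<lambda>s q. ?z q * fourier L (u s) q" "\<lambda>q. ?z q * fourier L (u t) q" "at t"
        "\<lambda>s q. ?z q * fourier L (v s) q" "\<lambda>q. ?z q * fourier L (v t) q"] u v
    unfolding KPI_solution_def W_def right_diff_distrib by simp
  from L2_tendsto_compose[OF this, of "\<lambda>h. h + t" "at 0"]
  have c: "L2_tendsto freq (\<lambda>h q. ?z q * W (h + t) q) (\<lambda>q. ?z q * W t q) (at 0)"
    using at_to_0[of t] by (simp add: filterlim_def)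
  have c2: "L2_tendsto freq (\<lambda>h q. complex_of_real (ratio q) * (?z q * W (h + t) q + ?z q * W t q))
     (\<lambda>q. complex_of_real (ratio q) * (?z q * W t q + ?z q * W t q)) (at 0)"
  proof (rule L2_tendsto_cmult[OF L2_tendsto_add[OF c L2_tendsto_const]])
    show "norm (complex_of_real (ratio q)) \<le> 2 + 1 / L" for q using ratio_bound[of q] by simp
  qed measurable
  \<comment> \<open>The increment of the squared norm is the real part of a product of a sum and a difference; the sum is
    weighted as in \<open>H\<^sup>1\<close> and the difference quotient as in \<open>H\<^sup>-\<^sup>1\<close>, so that the weights cancel.\<close>
  define A where "A h q = cnj (complex_of_real (ratio q) * (?z q * W (h + t) q + ?z q * W t q))" for h q
  define A0 where "A0 q = cnj (complex_of_real (ratio q) * (?z q * W t q + ?z q * W t q))" for q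
  have A: "L2_tendsto freq A A0 (at 0)"
    unfolding A_def[abs_def] A0_def[abs_def] by (rule L2_tendsto_cnj[OF c2])
  have A0L: "A0 \<in> L2 freq"
  proof -
    have "(\<lambda>q. complex_of_real (ratio q) * (?z q * W t q + ?z q * W t q)) \<in> L2 freq"
      by (rule L2_bounded_mult[OF L2_add[OF zW zW], where B="2 + 1 / L"]) (use ratio_bound in auto)
    then show ?thesis unfolding A0_def[abs_def] by (rule L2_cnj)
  qed
  define D where "D h q = ?m q * ((W (t + h) q - W t q) / complex_of_real h)" for h q
  define D0 where "D0 q = ?m q * R q" for q
  have D: "L2_tendsto freq D D0 (at 0)"
  proof -
    have "L2_tendsto freq
        (\<lambda>h q. ?m q * ((fourier L (u (t + h)) q - fourier L (u t) q) / complex_of_real h) - ?m q * ((fourier L (v (t + h)) q - fourier L (v t) q) / complex_of_real h))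
        (\<lambda>q. ?m q * KPI_rhs L (u t) q - ?m q * KPI_rhs L (v t) q) (at 0)"
      by (rule L2_tendsto_diff) (use u v in \<open>auto simp: KPI_solution_def H1m_def\<close>)
    moreover have "(\<lambda>h q. ?m q * ((fourier L (u (t + h)) q - fourier L (u t) q) / complex_of_real h) - ?m q * ((fourier L (v (t + h)) q - fourier L (v t) q) / complex_of_real h)) = D"
      by (auto simp: fun_eq_iff D_def W_def right_diff_distrib diff_divide_distrib)
    moreover have "(\<lambda>q. ?m q * KPI_rhs L (u t) q - ?m q * KPI_rhs L (v t) q) = D0"
      by (auto simp: D0_def R_def right_diff_distrib)
    ultimately show ?thesis by simp
  qed
  have DL: "D h \<in> L2 freq" for h
  proof -
    have "(\<lambda>q. (?m q * complex_of_real (1 / h)) * (W (t + h) q - W t q)) \<in> L2 freq"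
    proof (rule L2_bounded_mult[OF L2_diff[OF WL2 WL2], where B="\<bar>1/h\<bar>"])
      show "AE q in freq. norm (?m q * complex_of_real (1 / h)) \<le> \<bar>1 / h\<bar>"
      proof (rule AE_I2)
        fix q
        have "\<bar>H1m q\<bar> * \<bar>1 / h\<bar> \<le> 1 * \<bar>1 / h\<bar>" using H1m_bounds[of q] by (intro mult_right_mono) auto
        then show "norm (?m q * complex_of_real (1 / h)) \<le> \<bar>1 / h\<bar>" by (simp only: norm_mult norm_of_real mult_1)
      qed
    qed measurable
    then show ?thesis by (simp add: D_def[abs_def] field_simps)
  qed
  have D0L: "D0 \<in> L2 freq"
  proof -
    obtain h where "(\<lambda>q. D h q - D0 q) \<in> L2 freq"
      using eventually_happens[OF L2_tendstoD(1)[OF D]] by auto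
    from L2_diff_cancel[OF this DL] show ?thesis .
  qed
  have lim: "((\<lambda>h. Re (\<integral>q. A h q * D h q \<partial>freq)) \<longlongrightarrow> Re (\<integral>q. A0 q * D0 q \<partial>freq)) (at 0)"
    by (intro tendsto_Re L2_tendsto_integral_mult A D A0L D0L)
  have cancel: "complex_of_real (ratio q) * ?z q * ?m q = 1" if "fst q \<noteq> 0" for q
  proof -
    have "ratio q * Z2_weight q * H1m q = 1" using that H1m_bounds[of q] Z2_weight_ge(1)[of q] by (simp add: ratio_def)
    then show ?thesis by (metis of_real_1 of_real_mult)
  qed
  have AL: "A h \<in> L2 freq" for h
  proof -
    have "(\<lambda>q. complex_of_real (ratio q) * (?z q * W (h + t) q + ?z q * W t q)) \<in> L2 freq"
      by (rule L2_bounded_mult[OF L2_add[OF zW zW], where B="2 + 1 / L"]) (use ratio_bound in auto)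
    then show ?thesis unfolding A_def[abs_def] by (rule L2_cnj)
  qed
  have quot: "(E (t + h) - E t) / h = Re (\<integral>q. A h q * D h q \<partial>freq)" for h
  proof -
    have pw: "Re (A h q * D h q) = ((norm (W (t + h) q))\<^sup>2 - (norm (W t q))\<^sup>2) / h" if q: "fst q \<noteq> 0" for q
    proof -
      have "A h q * D h q = (complex_of_real (ratio q) * ?z q * ?m q) * (cnj (W (t + h) q + W t q) * (W (t + h) q - W t q)) / complex_of_real h"
      proof -
        have alg: "r * (z * a + z * b) * (m * (c / d)) = (r * z * m) * ((a + b) * c) / d" for r z a b m c d :: complex
          by (simp add: distrib_left distrib_right mult_ac add_divide_distrib)
        show ?thesis unfolding A_def D_def complex_cnj_mult complex_cnj_complex_of_real complex_cnj_add add.commute[of h t]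
          by (rule alg)
      qed
      also have "\<dots> = cnj (W (t + h) q + W t q) * (W (t + h) q - W t q) / complex_of_real h" by (simp only: cancel[OF q] mult_1)
      also have "Re \<dots> = Re (cnj (W (t + h) q + W t q) * (W (t + h) q - W t q)) / h" by (rule Re_divide_of_real)
      also have "Re (cnj (W (t + h) q + W t q) * (W (t + h) q - W t q)) = (norm (W (t + h) q))\<^sup>2 - (norm (W t q))\<^sup>2"
        unfolding cmod_power2 times_complex.sel cnj.sel plus_complex.sel minus_complex.sel by algebra
      finally show ?thesis .
    qed
    have i: "integrable freq (\<lambda>q. A h q * D h q)" by (rule L2_integrable_mult[OF AL DL])
    have "Re (\<integral>q. A h q * D h q \<partial>freq) = (\<integral>q. Re (A h q * D h q) \<partial>freq)" by (rule integral_bounded_linear[OF bounded_linear_Re i, symmetric])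
    also have "\<dots> = (\<integral>q. ((norm (W (t + h) q))\<^sup>2 - (norm (W t q))\<^sup>2) / h \<partial>freq)"
    proof (rule integral_cong_AE)
      show "AE q in freq. Re (A h q * D h q) = ((norm (W (t + h) q))\<^sup>2 - (norm (W t q))\<^sup>2) / h"
        using AE_freq_fst by eventually_elim (rule pw)
      show "(\<lambda>q. Re (A h q * D h q)) \<in> borel_measurable freq"
        by (rule borel_measurable_integrable[OF integrable_bounded_linear[OF bounded_linear_Re i]])
    qed measurable
    also have "\<dots> = ((\<integral>q. (norm (W (t + h) q))\<^sup>2 \<partial>freq) - (\<integral>q. (norm (W t q))\<^sup>2 \<partial>freq)) / h"
      using L2_integrable_sq[OF WL2] by simp
    finally show ?thesis unfolding E_def L2_norm_sq W_def by simp
  qed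
  have "((\<lambda>h. (E (t + h) - E t) / h) \<longlongrightarrow> Re (\<integral>q. A0 q * D0 q \<partial>freq)) (at 0)"
    unfolding quot by (rule lim)
  then have deriv: "(E has_real_derivative Re (\<integral>q. A0 q * D0 q \<partial>freq)) (at t)" by (simp add: DERIV_def)
  define N where "N p = u t p * dx L (u t) p - v t p * dx L (v t) p" for p
  define w where "w p = u t p - v t p" for p
  have NL: "N \<in> L2 Cy" unfolding N_def[abs_def] by (intro L2_diff Z2_nonlinearity_L2 uZ vZ)
  have wL: "w \<in> L2 Cy" unfolding w_def[abs_def] by (intro L2_diff Z2_D uZ vZ)
  have "Re (\<integral>q. A0 q * D0 q \<partial>freq) = (\<integral>q. Re (A0 q * D0 q) \<partial>freq)"
    by (rule integral_bounded_linear[OF bounded_linear_Re L2_integrable_mult[OF A0L D0L], symmetric])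
  also have "\<dots> = (\<integral>q. - 2 * Re (fourier L N q * cnj (fourier L w q)) \<partial>freq)"
  proof (rule integral_cong_AE)
    show "AE q in freq. Re (A0 q * D0 q) = - 2 * Re (fourier L N q * cnj (fourier L w q))"
      using AE_freq_fst fourier_diff[OF Z2_nonlinearity_L2[OF uZ[of t]] Z2_nonlinearity_L2[OF vZ[of t]]]
        fourier_diff[OF Z2_D(1)[OF uZ[of t]] Z2_D(1)[OF vZ[of t]]]
    proof eventually_elim
      case (elim q)
      define s where "s = fst q + fst q ^ 3 + (real_of_int (snd q) / L)\<^sup>2 / fst q"
      have w: "W t q = fourier L w q" using elim(3) by (simp add: W_def w_def[abs_def])
      have Rq: "R q = \<i> * complex_of_real s * fourier L w q - fourier L N q"
        unfolding R_def KPI_rhs_eq s_def[symmetric] N_def[abs_def] w_def[abs_def] elim(2,3) by (simp add: algebra_simps)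
      have "A0 q * D0 q = (complex_of_real (ratio q) * ?z q * ?m q) * (2 * cnj (W t q) * R q)"
        by (simp add: A0_def D0_def mult_ac)
      also have "\<dots> = 2 * cnj (W t q) * R q" by (simp only: cancel[OF elim(1)] mult_1)
      also have "Re \<dots> = - 2 * Re (fourier L N q * cnj (fourier L w q))"
        unfolding w Rq by (simp add: algebra_simps)
      finally show ?case .
    qed
    show "(\<lambda>q. Re (A0 q * D0 q)) \<in> borel_measurable freq"
      by (rule borel_measurable_integrable[OF integrable_bounded_linear[OF bounded_linear_Re L2_integrable_mult[OF A0L D0L]]])
    show "(\<lambda>q. - 2 * Re (fourier L N q * cnj (fourier L w q))) \<in> borel_measurable freq"
      by (intro borel_measurable_times borel_measurable_const borel_measurable_integrable[OF integrable_bounded_linear[OF bounded_linear_Re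
          L2_integrable_mult[OF fourier_L2[OF NL] L2_cnj[OF fourier_L2[OF wL]]]]])
  qed
  also have "\<dots> = - 2 * (\<integral>q. Re (fourier L N q * cnj (fourier L w q)) \<partial>freq)"
    by (rule integral_mult_right_zero)
  also have "(\<integral>q. Re (fourier L N q * cnj (fourier L w q)) \<partial>freq) = Re (\<integral>q. fourier L N q * cnj (fourier L w q) \<partial>freq)"
    by (rule integral_bounded_linear[OF bounded_linear_Re L2_integrable_mult[OF fourier_L2[OF NL] L2_cnj[OF fourier_L2[OF wL]]]])
  also have "\<dots> = 1 / L * (\<integral>p. N p * w p \<partial>Cy)" unfolding fourier_inner[OF NL wL] by simp
  also have "(\<integral>p. N p * w p \<partial>Cy) = 1 / 2 * (\<integral>p. dx L (v t) p * (w p * w p) \<partial>Cy)"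
    using nonlinear_energy[OF uZ[of t] vZ[of t]] by (simp add: N_def w_def mult.commute)
  finally show ?thesis using deriv by (simp add: w_def)
qed

text \<open>The squared distance \<open>E\<close> satisfies \<open>E' \<le> K E\<close> and vanishes at time zero, so Gronwall's inequality gives \<open>E = 0\<close>.\<close>

lemma KPI_uniqueness:
  assumes u: "KPI_solution L u\<^sub>0 u" and v: "KPI_solution L u\<^sub>0 v" and T: "0 \<le> T"
    and K: "\<And>t. 0 \<le> t \<Longrightarrow> t \<le> T \<Longrightarrow> AE p in Cy. \<bar>dx L (v t) p\<bar> \<le> K"
  shows "AE p in Cy. u T p = v T p"
proof -
  have uL: "u s \<in> L2 Cy" and vL: "v s \<in> L2 Cy" and vZ: "v s \<in> Z2 L" for s using u v by (auto simp: KPI_solution_def Z2_def)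
  define E where "E t = (L2_norm freq (\<lambda>q. fourier L (u t) q - fourier L (v t) q))\<^sup>2" for t
  define E' where "E' t = - (1 / L) * (\<integral>p. dx L (v t) p * ((u t p - v t p) * (u t p - v t p)) \<partial>Cy)" for t
  have dE: "(E has_real_derivative E' t) (at t)" for t
    unfolding E_def[abs_def] E'_def by (rule energy_derivative[OF u v])
  have E_phys: "E t = 1 / L * (\<integral>p. (u t p - v t p)\<^sup>2 \<partial>Cy)" for t
  proof -
    have "(L2_norm Cy (\<lambda>p. u t p - v t p))\<^sup>2 = L * E t"
      unfolding E_def fourier_diff_norm[OF uL vL] using L_pos by (simp add: power_mult_distrib)
    then show ?thesis using L_pos by (simp add: L2_norm_sq field_simps)
  qed
  have E'_le: "E' t \<le> K * E t" if t: "0 \<le> t" "t \<le> T" for t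
  proof -
    have w: "(\<lambda>p. u t p - v t p) \<in> L2 Cy" by (intro L2_diff uL vL)
    have i: "integrable Cy (\<lambda>p. (u t p - v t p)\<^sup>2)" using L2_integrable_sq[OF w] by simp
    have m: "(\<lambda>p. dx L (v t) p * ((u t p - v t p) * (u t p - v t p))) \<in> borel_measurable Cy"
      using w Z2_has_dx[OF vZ] L2_measurable[OF w] by (auto simp: has_dx_def intro!: borel_measurable_times dest: L2_measurable)
    have le: "AE p in Cy. \<bar>dx L (v t) p * ((u t p - v t p) * (u t p - v t p))\<bar> \<le> K * (u t p - v t p)\<^sup>2"
      using K[OF t] by eventually_elim (auto simp: abs_mult power2_eq_square intro!: mult_right_mono)
    have iK: "integrable Cy (\<lambda>p. K * (u t p - v t p)\<^sup>2)" using i by simp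
    have i2: "integrable Cy (\<lambda>p. dx L (v t) p * ((u t p - v t p) * (u t p - v t p)))"
      by (rule Bochner_Integration.integrable_bound[OF iK m]) (use le in \<open>eventually_elim, simp\<close>)
    have "- (\<integral>p. dx L (v t) p * ((u t p - v t p) * (u t p - v t p)) \<partial>Cy)
       = (\<integral>p. - (dx L (v t) p * ((u t p - v t p) * (u t p - v t p))) \<partial>Cy)" by simp
    also have "\<dots> \<le> (\<integral>p. K * (u t p - v t p)\<^sup>2 \<partial>Cy)"
      by (rule integral_mono_AE) (use i2 iK le in \<open>auto elim!: eventually_mono\<close>)
    also have "\<dots> = K * (\<integral>p. (u t p - v t p)\<^sup>2 \<partial>Cy)" by simp
    finally have "1 / L * (- (\<integral>p. dx L (v t) p * ((u t p - v t p) * (u t p - v t p)) \<partial>Cy)) \<le> 1 / L * (K * (\<integral>p. (u t p - v t p)\<^sup>2 \<partial>Cy))"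
      using L_pos by (intro mult_left_mono) auto
    then show ?thesis unfolding E'_def E_phys by simp
  qed
  have E0: "E 0 = 0"
  proof -
    have "AE p in Cy. u 0 p - v 0 p = 0" using u v unfolding KPI_solution_def by auto
    then have "(\<integral>p. (u 0 p - v 0 p)\<^sup>2 \<partial>Cy) = 0"
      by (intro integral_eq_zero_AE) (auto elim: eventually_mono)
    then show ?thesis by (simp add: E_phys)
  qed
  have "E T * exp (- K * T) \<le> E 0 * exp (- K * 0)"
  proof (rule DERIV_nonpos_imp_nonincreasing[OF T])
    fix t assume t: "0 \<le> t" "t \<le> T"
    have "((\<lambda>t. E t * exp (- K * t)) has_real_derivative (E' t - K * E t) * exp (- K * t)) (at t)"
      by (auto intro!: derivative_eq_intros dE simp: algebra_simps)
    moreover have "(E' t - K * E t) * exp (- K * t) \<le> 0" using E'_le[OF t] by (intro mult_nonpos_nonneg) auto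
    ultimately show "\<exists>y. ((\<lambda>t. E t * exp (- K * t)) has_real_derivative y) (at t) \<and> y \<le> 0" by blast
  qed
  then have "E T \<le> 0" using E0 by (simp add: mult_le_0_iff)
  then have "L2_norm freq (\<lambda>q. fourier L (u T) q - fourier L (v T) q) = 0" by (simp add: E_def)
  then have "L2_norm Cy (\<lambda>p. u T p - v T p) = 0" using fourier_diff_norm[OF uL vL] by simp
  then show ?thesis using L2_norm_eq_0_iff[OF L2_diff[OF uL vL]] by simp
qed

end

section \<open>An exact solution that leaves the line soliton\<close>

text \<open>Differentiation along a vector covers the three partial derivatives at once, so that each rule below is
proved once and commutation of derivatives is a symmetry in two directions.\<close>

definition D :: "'a::real_vector \<Rightarrow> ('a \<Rightarrow> real) \<Rightarrow> 'a \<Rightarrow> real" where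
  "D e f p = deriv (\<lambda>s. f (p + s *\<^sub>R e)) 0"

definition has_D :: "'a::real_vector \<Rightarrow> ('a \<Rightarrow> real) \<Rightarrow> ('a \<Rightarrow> real) \<Rightarrow> bool" where
  "has_D e f f' \<longleftrightarrow> (\<forall>p. ((\<lambda>s. f (p + s *\<^sub>R e)) has_real_derivative f' p) (at 0))"

lemma D_eqI: "has_D e f f' \<Longrightarrow> D e f = f'"
  by (auto simp: has_D_def D_def fun_eq_iff intro: DERIV_imp_deriv)

lemma has_D_along:
  assumes "has_D e f f'"
  shows "((\<lambda>s. f (p + s *\<^sub>R e)) has_real_derivative f' (p + s *\<^sub>R e)) (at s)"
proof -
  have "((\<lambda>h. f ((p + s *\<^sub>R e) + h *\<^sub>R e)) has_real_derivative f' (p + s *\<^sub>R e)) (at 0)"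
    using assms by (simp add: has_D_def)
  then have "((\<lambda>h. f (p + (h + s) *\<^sub>R e)) has_real_derivative f' (p + s *\<^sub>R e)) (at 0)"
    by (simp add: scaleR_add_left add.assoc add.commute[of "s *\<^sub>R e"])
  then show ?thesis using DERIV_shift[of "\<lambda>s. f (p + s *\<^sub>R e)" "f' (p + s *\<^sub>R e)" 0 s] by simp
qed

lemma has_D_const: "has_D e (\<lambda>p. c) (\<lambda>p. 0)" by (simp add: has_D_def)

lemma has_D_add: "has_D e f f' \<Longrightarrow> has_D e g g' \<Longrightarrow> has_D e (\<lambda>p. f p + g p) (\<lambda>p. f' p + g' p)"
  by (auto simp: has_D_def intro: DERIV_add)

lemma has_D_mult:
  assumes "has_D e f f'" "has_D e g g'"
  shows "has_D e (\<lambda>p. f p * g p) (\<lambda>p. f' p * g p + f p * g' p)"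
  unfolding has_D_def
proof
  fix p
  show "((\<lambda>s. f (p + s *\<^sub>R e) * g (p + s *\<^sub>R e)) has_real_derivative f' p * g p + f p * g' p) (at 0)"
    using DERIV_mult[OF assms[unfolded has_D_def, rule_format, of p]] by (simp add: mult.commute)
qed

lemma has_D_divide:
  assumes "has_D e f f'" "has_D e g g'" "\<And>p. g p \<noteq> 0"
  shows "has_D e (\<lambda>p. f p / g p) (\<lambda>p. f' p / g p - f p / g p * (g' p / g p))"
  unfolding has_D_def
proof
  fix p
  have "((\<lambda>s. f (p + s *\<^sub>R e) / g (p + s *\<^sub>R e)) has_real_derivative
      (f' p * g (p + 0 *\<^sub>R e) - f (p + 0 *\<^sub>R e) * g' p) / (g (p + 0 *\<^sub>R e) * g (p + 0 *\<^sub>R e))) (at 0)"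
    using assms by (intro DERIV_divide) (auto simp: has_D_def)
  then show "((\<lambda>s. f (p + s *\<^sub>R e) / g (p + s *\<^sub>R e)) has_real_derivative f' p / g p - f p / g p * (g' p / g p)) (at 0)"
    using assms(3)[of p] by (simp add: diff_divide_distrib)
qed

locale unstable = period +
  fixes \<kappa> :: real
  assumes kappa: "0 < \<kappa>" "\<kappa> < 1/2" and wavenumber: "1 / L = sqrt 3 * (1/4 - \<kappa>\<^sup>2)"
begin

definition "\<mu> = 1/2 + \<kappa>"
definition "\<sigma> = \<kappa> - 4 * \<kappa>^3"
definition "l = 1 / L"
definition "\<alpha> = (1 + 2 * \<kappa>)\<^sup>2 / (8 * \<kappa>)"

lemma sigma_pos: "\<sigma> > 0"
proof -
  have "\<kappa>\<^sup>2 < (1/2)\<^sup>2" using kappa by (intro power_strict_mono) auto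
  then have "\<kappa> * (1 - 4 * \<kappa>\<^sup>2) > 0" using kappa by (intro mult_pos_pos) (auto simp: power_divide)
  then show ?thesis by (simp add: \<sigma>_def power3_eq_cube power2_eq_square algebra_simps)
qed

lemma l_sq: "l\<^sup>2 = 3 * (1/4 - \<kappa>\<^sup>2)\<^sup>2"
  unfolding l_def wavenumber by (simp add: power_mult_distrib)

lemma alpha_eq: "\<alpha> * (8 * \<kappa>) = (1 + 2 * \<kappa>)\<^sup>2"
  using kappa by (simp add: \<alpha>_def)

type_synonym pt = "real \<times> real \<times> real"

abbreviation tc :: "pt \<Rightarrow> real" where "tc p \<equiv> fst p"
abbreviation xc :: "pt \<Rightarrow> real" where "xc p \<equiv> fst (snd p)"
abbreviation yc :: "pt \<Rightarrow> real" where "yc p \<equiv> snd (snd p)"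

definition E1 :: "pt \<Rightarrow> real" where "E1 p = exp (xc p)"
definition Ec :: "pt \<Rightarrow> real" where "Ec p = exp (\<mu> * xc p + \<sigma> * tc p) * cos (l * yc p)"
definition Es :: "pt \<Rightarrow> real" where "Es p = exp (\<mu> * xc p + \<sigma> * tc p) * sin (l * yc p)"
definition E3 :: "pt \<Rightarrow> real" where "E3 p = exp (2 * \<kappa> * xc p + 2 * \<sigma> * tc p)"

text \<open>The exponents and the frequency of the cosine are those of the growing mode of the equation
linearised at \<open>Q\<close>, which is \<open>\<sigma>\<close>-exponential in time; \<open>tau0\<close> belongs to \<open>Q\<close> itself.  The coefficient \<open>\<alpha>\<close>
of the last exponential is fixed by the interaction of the modes.\<close>

definition tau :: "pt \<Rightarrow> real" where "tau p = 1 + E1 p + 2 * Ec p + \<alpha> * E3 p"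
definition tau0 :: "pt \<Rightarrow> real" where "tau0 p = 1 + E1 p"

definition "\<beta> = (1 - 2 * \<kappa>)\<^sup>2 / (8 * \<kappa>)"
definition "\<gamma> = \<beta> / (2 + \<beta>)"

lemma beta_pos: "\<beta> > 0" using kappa by (simp add: \<beta>_def)

text \<open>The excess of \<open>\<alpha>\<close> over \<open>1\<close> keeps \<open>tau\<close> positive.\<close>

lemma alpha_beta: "\<alpha> = 1 + \<beta>"
  using kappa by (simp add: \<alpha>_def \<beta>_def field_simps power2_eq_square)

lemma gamma_pos: "\<gamma> > 0" using beta_pos by (simp add: \<gamma>_def)

text \<open>The quadratic form \<open>(r - s)\<^sup>2 + \<beta> s\<^sup>2\<close> bounds \<open>tau\<close> from below, whatever the sign of the cosine;
  \<open>\<gamma>\<close> is its determinant divided by its trace, hence below its smallest eigenvalue.\<close>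

lemma tau_lower: "tau p \<ge> \<gamma> * (1 + E1 p + E3 p)"
proof -
  define r where "r = exp (xc p / 2)"
  define s where "s = exp (\<kappa> * xc p + \<sigma> * tc p)"
  have rs: "r > 0" "s > 0" by (auto simp: r_def s_def)
  have E1: "E1 p = r\<^sup>2" by (simp add: E1_def r_def flip: exp_double)
  have E3: "E3 p = s\<^sup>2" by (simp add: E3_def s_def distrib_left flip: exp_double)
  have Ec: "Ec p = r * s * cos (l * yc p)"
    by (simp add: Ec_def r_def s_def \<mu>_def algebra_simps flip: exp_add)
  have "r * s * cos (l * yc p) \<ge> r * s * (-1)" using rs by (intro mult_left_mono) auto
  then have "tau p \<ge> 1 + r\<^sup>2 - 2 * (r * s) + (1 + \<beta>) * s\<^sup>2"
    unfolding tau_def E1 E3 Ec alpha_beta by simp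
  moreover have "1 + r\<^sup>2 - 2 * (r * s) + (1 + \<beta>) * s\<^sup>2 \<ge> \<gamma> * (1 + r\<^sup>2 + s\<^sup>2)"
  proof -
    have b: "2 + \<beta> > 0" using beta_pos by simp
    have "(2 + \<beta>) * (1 + r\<^sup>2 - 2 * (r * s) + (1 + \<beta>) * s\<^sup>2) - \<beta> * (1 + r\<^sup>2 + s\<^sup>2)
        = 2 + 2 * (r - (1 + \<beta> / 2) * s)\<^sup>2 + (\<beta>\<^sup>2 / 2) * s\<^sup>2"
      by (simp add: power2_eq_square algebra_simps)
    also have "\<dots> \<ge> 0" by (intro add_nonneg_nonneg mult_nonneg_nonneg) auto
    finally have "\<beta> * (1 + r\<^sup>2 + s\<^sup>2) \<le> (2 + \<beta>) * (1 + r\<^sup>2 - 2 * (r * s) + (1 + \<beta>) * s\<^sup>2)" by simp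
    then show ?thesis using b by (simp add: \<gamma>_def pos_divide_le_eq mult.commute)
  qed
  ultimately show ?thesis by (simp add: E1 E3)
qed

lemma E_pos: "E1 p > 0" "E3 p > 0" by (auto simp: E1_def E3_def)

lemma tau_pos: "tau p > 0"
proof -
  have "\<gamma> * (1 + E1 p + E3 p) > 0" using gamma_pos E_pos[of p] by (intro mult_pos_pos) auto
  with tau_lower[of p] show ?thesis by linarith
qed

lemma tau0_pos: "tau0 p > 0" using E_pos(1)[of p] by (simp add: tau0_def)

text \<open>The exponentials divided by \<open>tau\<close>.  Every derivative of a polynomial in these quotients is again such a
polynomial, so smoothness, boundedness and decay of all derivatives of \<open>U\<close> follow by induction
on polynomials.\<close>

definition G1 :: "pt \<Rightarrow> real" where "G1 p = E1 p / tau p"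
definition Gc :: "pt \<Rightarrow> real" where "Gc p = Ec p / tau p"
definition Gs :: "pt \<Rightarrow> real" where "Gs p = Es p / tau p"
definition G3 :: "pt \<Rightarrow> real" where "G3 p = E3 p / tau p"
definition F0 :: "pt \<Rightarrow> real" where "F0 p = E1 p / tau0 p"

lemma Gcs: "Gc p * Gc p + Gs p * Gs p = G1 p * G3 p"
proof -
  have "Ec p * Ec p + Es p * Es p = (exp (\<mu> * xc p + \<sigma> * tc p))\<^sup>2 * ((cos (l * yc p))\<^sup>2 + (sin (l * yc p))\<^sup>2)"
    by (simp only: Ec_def Es_def power2_eq_square) algebra
  also have "\<dots> = E1 p * E3 p"
    by (simp add: E1_def E3_def \<mu>_def algebra_simps flip: exp_add exp_double)
  finally show ?thesis by (simp add: Gc_def Gs_def G1_def G3_def flip: add_divide_distrib)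
qed

lemma has_D_E1: "has_D e E1 (\<lambda>p. xc e * E1 p)"
  unfolding has_D_def E1_def by (auto intro!: derivative_eq_intros)

lemma has_D_E3: "has_D e E3 (\<lambda>p. (2 * \<kappa> * xc e + 2 * \<sigma> * tc e) * E3 p)"
  unfolding has_D_def E3_def by (auto intro!: derivative_eq_intros)

lemma has_D_Ec: "has_D e Ec (\<lambda>p. (\<mu> * xc e + \<sigma> * tc e) * Ec p - l * yc e * Es p)"
  unfolding has_D_def Ec_def Es_def by (auto intro!: derivative_eq_intros simp: algebra_simps)

lemma has_D_Es: "has_D e Es (\<lambda>p. (\<mu> * xc e + \<sigma> * tc e) * Es p + l * yc e * Ec p)"
  unfolding has_D_def Ec_def Es_def by (auto intro!: derivative_eq_intros simp: algebra_simps)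

text \<open>The logarithmic derivative of \<open>tau\<close> along \<open>e\<close>, as a combination of the quotients.\<close>

definition Phi :: "pt \<Rightarrow> pt \<Rightarrow> real" where
  "Phi e p = xc e * G1 p + 2 * ((\<mu> * xc e + \<sigma> * tc e) * Gc p + (- (l * yc e)) * Gs p) + \<alpha> * (2 * \<kappa> * xc e + 2 * \<sigma> * tc e) * G3 p"

lemma has_D_tau: "has_D e tau (\<lambda>p. Phi e p * tau p)"
proof -
  have "has_D e (\<lambda>p. (1 + E1 p) + 2 * Ec p + \<alpha> * E3 p)
    (\<lambda>p. (0 + xc e * E1 p) + (0 * Ec p + 2 * ((\<mu> * xc e + \<sigma> * tc e) * Ec p - l * yc e * Es p)) + (0 * E3 p + \<alpha> * ((2 * \<kappa> * xc e + 2 * \<sigma> * tc e) * E3 p)))"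
    by (intro has_D_add has_D_mult has_D_const has_D_E1 has_D_Ec has_D_E3)
  moreover have "(\<lambda>p. (0 + xc e * E1 p) + (0 * Ec p + 2 * ((\<mu> * xc e + \<sigma> * tc e) * Ec p - l * yc e * Es p)) + (0 * E3 p + \<alpha> * ((2 * \<kappa> * xc e + 2 * \<sigma> * tc e) * E3 p)))
     = (\<lambda>p. Phi e p * tau p)"
  proof
    fix p
    have "G1 p * tau p = E1 p" "Gc p * tau p = Ec p" "Gs p * tau p = Es p" "G3 p * tau p = E3 p"
      using tau_pos[of p] by (auto simp: G1_def Gc_def Gs_def G3_def)
    show "(0 + xc e * E1 p) + (0 * Ec p + 2 * ((\<mu> * xc e + \<sigma> * tc e) * Ec p - l * yc e * Es p)) + (0 * E3 p + \<alpha> * ((2 * \<kappa> * xc e + 2 * \<sigma> * tc e) * E3 p)) = Phi e p * tau p"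
      by (simp add: Phi_def algebra_simps flip: \<open>G1 p * tau p = E1 p\<close> \<open>Gc p * tau p = Ec p\<close> \<open>Gs p * tau p = Es p\<close> \<open>G3 p * tau p = E3 p\<close>)
  qed
  ultimately show ?thesis by (simp add: tau_def[abs_def])
qed

lemma has_D_quot:
  assumes "has_D e f f'"
  shows "has_D e (\<lambda>p. f p / tau p) (\<lambda>p. f' p / tau p + (-1) * (f p / tau p * Phi e p))"
proof -
  have "has_D e (\<lambda>p. f p / tau p) (\<lambda>p. f' p / tau p - f p / tau p * (Phi e p * tau p / tau p))"
    by (rule has_D_divide[OF assms has_D_tau]) (use tau_pos in \<open>simp add: less_imp_neq[symmetric]\<close>)
  moreover have "Phi e p * tau p / tau p = Phi e p" for p using tau_pos[of p] by simp
  ultimately show ?thesis by simp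
qed

lemma has_D_G1: "has_D e G1 (\<lambda>p. xc e * G1 p + (-1) * (G1 p * Phi e p))"
  using has_D_quot[OF has_D_E1[of e]] by (simp add: G1_def[abs_def])

lemma has_D_G3: "has_D e G3 (\<lambda>p. (2 * \<kappa> * xc e + 2 * \<sigma> * tc e) * G3 p + (-1) * (G3 p * Phi e p))"
  using has_D_quot[OF has_D_E3[of e]] by (simp add: G3_def[abs_def])

lemma has_D_Gc: "has_D e Gc (\<lambda>p. (\<mu> * xc e + \<sigma> * tc e) * Gc p + (- (l * yc e)) * Gs p + (-1) * (Gc p * Phi e p))"
  using has_D_quot[OF has_D_Ec[of e]] by (simp add: Gc_def[abs_def] Gs_def[abs_def] diff_divide_distrib)

lemma has_D_Gs: "has_D e Gs (\<lambda>p. (\<mu> * xc e + \<sigma> * tc e) * Gs p + (l * yc e) * Gc p + (-1) * (Gs p * Phi e p))"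
  using has_D_quot[OF has_D_Es[of e]] by (simp add: Gc_def[abs_def] Gs_def[abs_def] add_divide_distrib)

lemma has_D_F0: "has_D e F0 (\<lambda>p. xc e * (F0 p * (1 + (-1) * F0 p)))"
proof -
  have t: "has_D e tau0 (\<lambda>p. 0 + xc e * E1 p)" unfolding tau0_def[abs_def] by (intro has_D_add has_D_const has_D_E1)
  have "has_D e (\<lambda>p. E1 p / tau0 p) (\<lambda>p. xc e * E1 p / tau0 p - E1 p / tau0 p * ((0 + xc e * E1 p) / tau0 p))"
    by (rule has_D_divide[OF has_D_E1 t]) (use tau0_pos in \<open>simp add: less_imp_neq[symmetric]\<close>)
  then show ?thesis by (simp add: F0_def[abs_def] right_diff_distrib mult_ac)
qed

text \<open>The polynomials in the quotients, with \<open>F0\<close>, the corresponding quotient for the soliton, adjoined.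
The class is closed under differentiation.\<close>

inductive alg :: "(pt \<Rightarrow> real) \<Rightarrow> bool" where
  alg_const: "alg (\<lambda>p. c)"
| alg_G1: "alg G1" | alg_Gc: "alg Gc" | alg_Gs: "alg Gs" | alg_G3: "alg G3" | alg_F0: "alg F0"
| alg_add: "alg f \<Longrightarrow> alg g \<Longrightarrow> alg (\<lambda>p. f p + g p)"
| alg_mult: "alg f \<Longrightarrow> alg g \<Longrightarrow> alg (\<lambda>p. f p * g p)"

lemmas alg_intros = alg.intros

lemma alg_Phi: "alg (Phi e)"
  unfolding Phi_def[abs_def] by (intro alg_intros)

lemma alg_has_D_ex: "alg f \<Longrightarrow> \<exists>f'. alg f' \<and> has_D e f f'"
proof (induction rule: alg.induct)
  case (alg_const c) show ?case using has_D_const alg.alg_const by blast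
next
  case alg_G1 show ?case by (rule exI, rule conjI[OF _ has_D_G1]) (intro alg_intros alg_Phi)
next
  case alg_Gc show ?case by (rule exI, rule conjI[OF _ has_D_Gc]) (intro alg_intros alg_Phi)
next
  case alg_Gs show ?case by (rule exI, rule conjI[OF _ has_D_Gs]) (intro alg_intros alg_Phi)
next
  case alg_G3 show ?case by (rule exI, rule conjI[OF _ has_D_G3]) (intro alg_intros alg_Phi)
next
  case alg_F0 show ?case by (rule exI, rule conjI[OF _ has_D_F0]) (intro alg_intros)
next
  case (alg_add f g) then show ?case using has_D_add alg.alg_add by blast
next
  case (alg_mult f g)
  then obtain f' g' where "alg f'" "has_D e f f'" "alg g'" "has_D e g g'" by blast
  with alg_mult show ?case by (intro exI[of _ "\<lambda>p. f' p * g p + f p * g' p"] conjI has_D_mult alg_intros)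
qed

lemma alg_has_D: "alg f \<Longrightarrow> has_D e f (D e f)"
  using alg_has_D_ex[of f e] D_eqI by blast

lemma alg_D: "alg f \<Longrightarrow> alg (D e f)"
  using alg_has_D_ex[of f e] D_eqI by blast

lemma D_const: "D e (\<lambda>p. c) = (\<lambda>p. 0)" for e :: pt by (rule D_eqI[OF has_D_const])

lemma D_add: "alg f \<Longrightarrow> alg g \<Longrightarrow> D e (\<lambda>p. f p + g p) = (\<lambda>p. D e f p + D e g p)"
  by (rule D_eqI[OF has_D_add[OF alg_has_D alg_has_D]])

lemma D_mult: "alg f \<Longrightarrow> alg g \<Longrightarrow> D e (\<lambda>p. f p * g p) = (\<lambda>p. D e f p * g p + f p * D e g p)"
  by (rule D_eqI[OF has_D_mult[OF alg_has_D alg_has_D]])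

lemmas D_gen = D_eqI[OF has_D_G1] D_eqI[OF has_D_Gc] D_eqI[OF has_D_Gs] D_eqI[OF has_D_G3] D_eqI[OF has_D_F0]

lemma D_cmult: "alg f \<Longrightarrow> D e (\<lambda>p. c * f p) = (\<lambda>p. c * D e f p)"
  using D_mult[OF alg_const[of c]] by (simp add: D_const)

lemma D_Phi: "D e (Phi e') = (\<lambda>p. xc e' * D e G1 p + 2 * ((\<mu> * xc e' + \<sigma> * tc e') * D e Gc p + (- (l * yc e')) * D e Gs p) + \<alpha> * (2 * \<kappa> * xc e' + 2 * \<sigma> * tc e') * D e G3 p)"
  unfolding Phi_def[abs_def]
  by (subst D_add D_cmult | (intro alg_intros))+ (rule refl)

text \<open>The Hessian of \<open>log tau\<close> is symmetric.\<close>

lemma D_Phi_sym: "D e (Phi e') = D e' (Phi e)"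
  unfolding D_Phi D_gen Phi_def by (rule ext) algebra

lemma D_comm_gen:
  "D e (D e' G1) = D e' (D e G1)" "D e (D e' Gc) = D e' (D e Gc)" "D e (D e' Gs) = D e' (D e Gs)"
  "D e (D e' G3) = D e' (D e G3)" "D e (D e' F0) = D e' (D e F0)"
proof -
  have F1: "D e (D e' G1) = (\<lambda>p. xc e' * D e G1 p + (-1) * (D e G1 p * Phi e' p + G1 p * D e (Phi e') p))" for e e'
    unfolding D_gen(1)[of e'] by (subst D_add D_cmult D_mult | (intro alg_intros alg_Phi))+ (rule refl)
  show "D e (D e' G1) = D e' (D e G1)"
    unfolding F1[of e e'] F1[of e' e] D_Phi_sym[of e' e]
    unfolding D_gen by (simp add: fun_eq_iff algebra_simps)
  have F2: "D e (D e' G3) = (\<lambda>p. (2 * \<kappa> * xc e' + 2 * \<sigma> * tc e') * D e G3 p + (-1) * (D e G3 p * Phi e' p + G3 p * D e (Phi e') p))" for e e'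
    unfolding D_gen(4)[of e'] by (subst D_add D_cmult D_mult | (intro alg_intros alg_Phi))+ (rule refl)
  show "D e (D e' G3) = D e' (D e G3)"
    unfolding F2[of e e'] F2[of e' e] D_Phi_sym[of e' e]
    unfolding D_gen by (simp add: fun_eq_iff algebra_simps)
  have F3: "D e (D e' Gc) = (\<lambda>p. (\<mu> * xc e' + \<sigma> * tc e') * D e Gc p + (- (l * yc e')) * D e Gs p + (-1) * (D e Gc p * Phi e' p + Gc p * D e (Phi e') p))" for e e'
    unfolding D_gen(2)[of e'] by (subst D_add D_cmult D_mult | (intro alg_intros alg_Phi))+ (rule refl)
  show "D e (D e' Gc) = D e' (D e Gc)"
    unfolding F3[of e e'] F3[of e' e] D_Phi_sym[of e' e]
    unfolding D_gen by (simp add: fun_eq_iff algebra_simps)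
  have F4: "D e (D e' Gs) = (\<lambda>p. (\<mu> * xc e' + \<sigma> * tc e') * D e Gs p + (l * yc e') * D e Gc p + (-1) * (D e Gs p * Phi e' p + Gs p * D e (Phi e') p))" for e e'
    unfolding D_gen(3)[of e'] by (subst D_add D_cmult D_mult | (intro alg_intros alg_Phi))+ (rule refl)
  show "D e (D e' Gs) = D e' (D e Gs)"
    unfolding F4[of e e'] F4[of e' e] D_Phi_sym[of e' e]
    unfolding D_gen by (simp add: fun_eq_iff algebra_simps)
  have F5: "D e (D e' F0) = (\<lambda>p. xc e' * (D e F0 p * (1 + (-1) * F0 p) + F0 p * (0 + (-1) * D e F0 p)))" for e e'
    unfolding D_gen(5)[of e'] by (subst D_add D_cmult D_mult D_const | (intro alg_intros alg_Phi))+ (rule refl)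
  show "D e (D e' F0) = D e' (D e F0)"
    unfolding F5[of e e'] F5[of e' e]
    unfolding D_gen by (simp add: fun_eq_iff algebra_simps)
qed

lemma D_comm: "alg f \<Longrightarrow> D e (D e' f) = D e' (D e f)"
proof (induction rule: alg.induct)
  case (alg_const c) show ?case by (simp add: D_const)
next
  case (alg_add f g)
  then show ?case by (simp add: D_add alg_D)
next
  case (alg_mult f g)
  then show ?case by (simp add: D_add D_mult alg_D alg_intros fun_eq_iff algebra_simps)
qed (rule D_comm_gen)+

definition et :: pt where "et = (1, 0, 0)"
definition ex :: pt where "ex = (0, 1, 0)"
definition ey :: pt where "ey = (0, 0, 1)"

text \<open>\<open>mom n\<close> is the \<open>n\<close>-th \<open>x\<close>-derivative of \<open>tau\<close> divided by \<open>tau\<close>.\<close>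

definition mom :: "nat \<Rightarrow> pt \<Rightarrow> real" where
  "mom n p = G1 p + 2 * \<mu> ^ n * Gc p + \<alpha> * (2 * \<kappa>) ^ n * G3 p"

lemma alg_mom: "alg (mom n)" unfolding mom_def[abs_def] by (intro alg_intros)

lemma mom_1: "mom 1 = Phi ex" by (simp add: mom_def Phi_def ex_def fun_eq_iff mult_ac)

lemma D_mom: "D ex (mom n) = (\<lambda>p. mom (Suc n) p + (-1) * (mom n p * mom 1 p))"
proof -
  have "D ex (mom n) = (\<lambda>p. D ex G1 p + 2 * \<mu> ^ n * D ex Gc p + \<alpha> * (2 * \<kappa>) ^ n * D ex G3 p)"
    unfolding mom_def[abs_def] by (subst D_add D_cmult | (intro alg_intros))+ (rule refl)
  then show ?thesis unfolding D_gen mom_1 by (simp add: mom_def ex_def fun_eq_iff algebra_simps)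
qed

text \<open>Expanding the bilinear form over pairs of exponentials, the coefficient of each pair is the
  dispersion polynomial at the difference of the two exponents.\<close>

lemma hirota_identity:
  fixes g1 gc g3 q m s a k lam :: real
  assumes "q = g1 * g3 - gc * gc"
  shows "2 * m * s * gc + 4 * a * k * s * g3 - (g1 + 2 * m ^ 1 * gc + a * (2 * k) ^ 1 * g3) * (2 * s * gc + 2 * a * s * g3)
      - ((g1 + 2 * m ^ 2 * gc + a * (2 * k) ^ 2 * g3) - (g1 + 2 * m ^ 1 * gc + a * (2 * k) ^ 1 * g3) * (g1 + 2 * m ^ 1 * gc + a * (2 * k) ^ 1 * g3))
      + ((g1 + 2 * m ^ 4 * gc + a * (2 * k) ^ 4 * g3) - 4 * (g1 + 2 * m ^ 3 * gc + a * (2 * k) ^ 3 * g3) * (g1 + 2 * m ^ 1 * gc + a * (2 * k) ^ 1 * g3)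
        + 3 * (g1 + 2 * m ^ 2 * gc + a * (2 * k) ^ 2 * g3) * (g1 + 2 * m ^ 2 * gc + a * (2 * k) ^ 2 * g3))
      + 2 * lam * gc + 4 * lam * q
    = 2 * gc * (1 - g1 - 2 * gc - a * g3) * (m * s - m\<^sup>2 + m^4 + lam)
      + a * g3 * (1 - g1 - 2 * gc - a * g3) * (4 * k * s - 4 * k\<^sup>2 + 16 * k^4)
      + 2 * g1 * gc * ((m - 1) * s - (m - 1)\<^sup>2 + (m - 1)^4 + lam)
      + 2 * a * gc * g3 * ((2 * k - m) * s - (2 * k - m)\<^sup>2 + (2 * k - m)^4 + lam)
      + g1 * g3 * (a * (2 * (2 * k - 1) * s - (2 * k - 1)\<^sup>2 + (2 * k - 1)^4) + 4 * lam)"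
  unfolding assms by (simp add: power2_eq_square power3_eq_cube power4_eq_xxxx algebra_simps)

text \<open>Hirota's bilinear form of the equation, divided by the square of \<open>tau\<close>.\<close>

lemma bilinear:
  "D et (Phi ex) p + (-1) * D ex (Phi ex) p + D ex (D ex (D ex (Phi ex))) p
     + 6 * (D ex (Phi ex) p * D ex (Phi ex) p) + (-1) * D ey (Phi ey) p = 0"
proof -
  define M where "M = mom"
  have M: "alg (M n)" for n by (simp add: M_def alg_mom)
  have DM: "D ex (M n) = (\<lambda>p. M (Suc n) p + (-1) * (M n p * M 1 p))" for n unfolding M_def by (rule D_mom)
  have d1: "D ex (Phi ex) = (\<lambda>p. M 2 p + (-1) * (M 1 p * M 1 p))"
    using DM[of 1] unfolding M_def mom_1[symmetric] by (simp only: numeral_2_eq_2 One_nat_def)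
  have DM1: "D ex (M 1) p = M 2 p - M 1 p * M 1 p" and DM2: "D ex (M 2) p = M 3 p - M 2 p * M 1 p"
    and DM3: "D ex (M 3) p = M 4 p - M 3 p * M 1 p" for p
    using DM[of 1] DM[of 2] DM[of 3] by (simp_all add: numeral_eq_Suc)
  have "D ex (D ex (Phi ex)) = (\<lambda>p. D ex (M 2) p + (-1) * (D ex (M 1) p * M 1 p + M 1 p * D ex (M 1) p))"
    unfolding d1 by (subst D_add D_cmult D_mult | (intro alg_intros M))+ (rule refl)
  then have d2: "D ex (D ex (Phi ex)) = (\<lambda>p. M 3 p + ((-3) * (M 1 p * M 2 p) + 2 * (M 1 p * (M 1 p * M 1 p))))"
    unfolding DM1 DM2 by (simp add: fun_eq_iff algebra_simps)
  have "D ex (D ex (D ex (Phi ex))) = (\<lambda>p. D ex (M 3) p + ((-3) * (D ex (M 1) p * M 2 p + M 1 p * D ex (M 2) p)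
      + 2 * (D ex (M 1) p * (M 1 p * M 1 p) + M 1 p * (D ex (M 1) p * M 1 p + M 1 p * D ex (M 1) p))))"
    unfolding d2 by (subst D_add D_cmult D_mult | (intro alg_intros M))+ (rule refl)
  then have d3: "D ex (D ex (D ex (Phi ex))) p = M 4 p - 4 * M 3 p * M 1 p - 3 * M 2 p * M 2 p + 12 * M 2 p * M 1 p * M 1 p - 6 * M 1 p * M 1 p * M 1 p * M 1 p"
    unfolding DM1 DM2 DM3 by (simp add: algebra_simps)
  have t: "D et (Phi ex) p = 2 * \<mu> * \<sigma> * Gc p + 4 * \<alpha> * \<kappa> * \<sigma> * G3 p - M 1 p * (2 * \<sigma> * Gc p + 2 * \<alpha> * \<sigma> * G3 p)"
    unfolding D_Phi D_gen M_def mom_1 by (simp add: et_def ex_def Phi_def algebra_simps)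
  have y: "D ey (Phi ey) p = - 2 * l\<^sup>2 * Gc p - 4 * l\<^sup>2 * (Gs p * Gs p)"
    unfolding D_Phi D_gen by (simp add: ey_def Phi_def algebra_simps power2_eq_square)
  have lhs: "D et (Phi ex) p + (-1) * D ex (Phi ex) p + D ex (D ex (D ex (Phi ex))) p
     + 6 * (D ex (Phi ex) p * D ex (Phi ex) p) + (-1) * D ey (Phi ey) p
   = 2 * \<mu> * \<sigma> * Gc p + 4 * \<alpha> * \<kappa> * \<sigma> * G3 p - M 1 p * (2 * \<sigma> * Gc p + 2 * \<alpha> * \<sigma> * G3 p)
     - (M 2 p - M 1 p * M 1 p) + (M 4 p - 4 * M 3 p * M 1 p + 3 * M 2 p * M 2 p) + 2 * l\<^sup>2 * Gc p + 4 * l\<^sup>2 * (Gs p * Gs p)"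
    unfolding t d3 y unfolding d1 by algebra
  have Gs: "Gs p * Gs p = G1 p * G3 p - Gc p * Gc p" using Gcs[of p] by simp
  have h1: "\<mu> * \<sigma> - \<mu>\<^sup>2 + \<mu>^4 + l\<^sup>2 = 0"
    and h2: "(\<mu> - 1) * \<sigma> - (\<mu> - 1)\<^sup>2 + (\<mu> - 1)^4 + l\<^sup>2 = 0"
    and h2': "(2 * \<kappa> - \<mu>) * \<sigma> - (2 * \<kappa> - \<mu>)\<^sup>2 + (2 * \<kappa> - \<mu>)^4 + l\<^sup>2 = 0"
    and h3: "4 * \<kappa> * \<sigma> - 4 * \<kappa>\<^sup>2 + 16 * \<kappa>^4 = 0"
    \<comment> \<open>the dispersion relation for the pairs that occur only once\<close>
    unfolding \<mu>_def \<sigma>_def l_sq by algebra+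
  \<comment> \<open>The product of the first and last exponential also arises from the square of the cosine and sine
    terms; balancing the two contributions determines \<open>\<alpha>\<close>.\<close>
  have h4: "\<alpha> * (2 * (2 * \<kappa> - 1) * \<sigma> - (2 * \<kappa> - 1)\<^sup>2 + (2 * \<kappa> - 1)^4) + 4 * l\<^sup>2 = 0"
  proof -
    have "2 * (2 * \<kappa> - 1) * \<sigma> - (2 * \<kappa> - 1)\<^sup>2 + (2 * \<kappa> - 1)^4 = (8 * \<kappa>) * (- 3/4 * (1 - 2 * \<kappa>)\<^sup>2)"
      unfolding \<sigma>_def by algebra
    then have "\<alpha> * (2 * (2 * \<kappa> - 1) * \<sigma> - (2 * \<kappa> - 1)\<^sup>2 + (2 * \<kappa> - 1)^4) = (\<alpha> * (8 * \<kappa>)) * (- 3/4 * (1 - 2 * \<kappa>)\<^sup>2)"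
      by (simp only: mult.assoc)
    then show ?thesis unfolding alpha_eq l_sq by algebra
  qed
  show ?thesis
    unfolding lhs M_def mom_def using hirota_identity[OF Gs, of \<mu> \<sigma> \<alpha> \<kappa> "l\<^sup>2"]
    unfolding h1 h2 h2' h3 mult_zero_right add_0_left using h4 by algebra
qed

definition U :: "pt \<Rightarrow> real" where "U p = 12 * D ex (Phi ex) p"
definition B :: "pt \<Rightarrow> real" where "B p = 12 * D ey (Phi ey) p"

lemma alg_U: "alg U" unfolding U_def[abs_def] by (intro alg_intros alg_D alg_Phi)

text \<open>This is twelve times the \<open>x\<close>-derivative of the bilinear equation.  The function \<open>B\<close>, twelve times the second \<open>y\<close>-derivative of \<open>log tau\<close>, plays the role of \<open>\<partial>\<^sub>x\<^sup>-\<^sup>2 U\<^sub>y\<^sub>y\<close>.\<close>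

lemma evolution: "D et U p = D ex U p - U p * D ex U p - D ex (D ex (D ex U)) p + D ex B p"
proof -
  let ?P = "D ex (Phi ex)"
  have P: "alg ?P" "alg (Phi ex)" "alg (Phi ey)" "alg (D ey (Phi ey))" by (intro alg_D alg_Phi)+
  have z: "D ex (\<lambda>p. D et (Phi ex) p + (-1) * ?P p + D ex (D ex ?P) p + 6 * (?P p * ?P p) + (-1) * D ey (Phi ey) p) = D ex (\<lambda>p. 0)"
    using bilinear by (intro arg_cong[where f="D ex"]) (auto simp: fun_eq_iff)
  have e: "D ex (\<lambda>p. D et (Phi ex) p + (-1) * ?P p + D ex (D ex ?P) p + 6 * (?P p * ?P p) + (-1) * D ey (Phi ey) p)
     = (\<lambda>p. D ex (D et (Phi ex)) p + (-1) * D ex ?P p + D ex (D ex (D ex ?P)) p + 6 * (D ex ?P p * ?P p + ?P p * D ex ?P p) + (-1) * D ex (D ey (Phi ey)) p)"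
    by (subst D_add D_cmult D_mult | (intro alg_intros alg_D P))+ (rule refl)
  have "D ex (D et (Phi ex)) p + (-1) * D ex ?P p + D ex (D ex (D ex ?P)) p + 6 * (D ex ?P p * ?P p + ?P p * D ex ?P p) + (-1) * D ex (D ey (Phi ey)) p = 0"
    using fun_cong[OF trans[OF e[symmetric] z], of p] by (simp only: D_const)
  moreover have "D ex (D et (Phi ex)) = D et ?P" by (rule D_comm[OF P(2)])
  ultimately have *: "D et ?P p = D ex ?P p - D ex (D ex (D ex ?P)) p - 12 * (?P p * D ex ?P p) + D ex (D ey (Phi ey)) p" by simp
  have u: "D e U = (\<lambda>p. 12 * D e ?P p)" for e unfolding U_def[abs_def] by (rule D_cmult[OF P(1)])
  have b: "D ex B = (\<lambda>p. 12 * D ex (D ey (Phi ey)) p)" unfolding B_def[abs_def] by (rule D_cmult[OF P(4)])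
  have u3: "D ex (D ex (D ex U)) = (\<lambda>p. 12 * D ex (D ex (D ex ?P)) p)"
    unfolding u by (subst D_cmult | (intro alg_intros alg_D P))+ (rule refl)
  show ?thesis unfolding u3 unfolding u b U_def * by algebra
qed

text \<open>Both sides are the same fourth derivative of \<open>12 log tau\<close>.\<close>

lemma yy_U: "D ey (D ey U) = D ex (D ex B)"
proof -
  have "D ey (D ey (D ex (Phi ex))) = D ex (D ex (D ey (Phi ey)))"
    by (metis D_comm D_Phi_sym alg_D alg_Phi)
  moreover have "D ey (D ey U) = (\<lambda>p. 12 * D ey (D ey (D ex (Phi ex))) p)"
    unfolding U_def[abs_def] by (subst D_cmult | (intro alg_D alg_Phi))+ (rule refl)
  moreover have "D ex (D ex B) = (\<lambda>p. 12 * D ex (D ex (D ey (Phi ey))) p)"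
    unfolding B_def[abs_def] by (subst D_cmult | (intro alg_D alg_Phi))+ (rule refl)
  ultimately show ?thesis by simp
qed

end

section \<open>Decay of the algebra of derivatives\<close>

text \<open>If a sequence converges both in \<open>L\<^sup>2\<close> and pointwise almost everywhere, Fatou's lemma shows that the limits agree.\<close>

lemma L2_tendsto_pointwise:
  fixes f :: "nat \<Rightarrow> 'a \<Rightarrow> 'b::{banach, second_countable_topology}"
  assumes L: "L2_tendsto M f g sequentially" and p: "AE x in M. (\<lambda>n. f n x) \<longlonglongrightarrow> h x"
    and [measurable]: "\<And>n. f n \<in> borel_measurable M" "g \<in> borel_measurable M" "h \<in> borel_measurable M"
  shows "AE x in M. g x = h x"
proof -
  have "(\<integral>\<^sup>+x. ennreal ((norm (h x - g x))\<^sup>2) \<partial>M) = (\<integral>\<^sup>+x. liminf (\<lambda>n. ennreal ((norm (f n x - g x))\<^sup>2)) \<partial>M)"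
  proof (rule nn_integral_cong_AE, use p in eventually_elim)
    case (elim x)
    have "(\<lambda>n. ennreal ((norm (f n x - g x))\<^sup>2)) \<longlonglongrightarrow> ennreal ((norm (h x - g x))\<^sup>2)" by (intro tendsto_intros elim)
    then show ?case by (rule lim_imp_Liminf[OF trivial_limit_sequentially, symmetric])
  qed
  also have "\<dots> \<le> liminf (\<lambda>n. \<integral>\<^sup>+x. ennreal ((norm (f n x - g x))\<^sup>2) \<partial>M)"
    by (rule nn_integral_liminf) measurable
  also have "liminf (\<lambda>n. \<integral>\<^sup>+x. ennreal ((norm (f n x - g x))\<^sup>2) \<partial>M) = 0"
  proof (rule lim_imp_Liminf)
    have "(\<lambda>n. ennreal ((L2_norm M (\<lambda>x. f n x - g x))\<^sup>2)) \<longlonglongrightarrow> ennreal (0\<^sup>2)"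
      by (intro tendsto_intros L2_tendstoD(2)[OF L])
    moreover have "eventually (\<lambda>n. ennreal ((L2_norm M (\<lambda>x. f n x - g x))\<^sup>2) = (\<integral>\<^sup>+x. ennreal ((norm (f n x - g x))\<^sup>2) \<partial>M)) sequentially"
      using L2_tendstoD(1)[OF L] by eventually_elim (simp add: nn_sq_L2)
    ultimately show "(\<lambda>n. \<integral>\<^sup>+x. ennreal ((norm (f n x - g x))\<^sup>2) \<partial>M) \<longlonglongrightarrow> 0"
      by (simp add: filterlim_cong[OF refl refl])
  qed simp
  finally have "(\<integral>\<^sup>+x. ennreal ((norm (h x - g x))\<^sup>2) \<partial>M) = 0" by simp
  then have "AE x in M. ennreal ((norm (h x - g x))\<^sup>2) = 0" by (subst (asm) nn_integral_0_iff_AE) auto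
  then show ?thesis by eventually_elim simp
qed

text \<open>Taylor's formula with a cruder constant, obtained by applying the mean value inequality twice.\<close>

lemma taylor_bound:
  fixes \<phi> :: "real \<Rightarrow> real"
  assumes 1: "\<And>s. (\<phi> has_real_derivative \<phi>' s) (at s)" and 2: "\<And>s. (\<phi>' has_real_derivative \<phi>'' s) (at s)"
    and M: "\<And>s. \<bar>s\<bar> \<le> \<bar>h\<bar> \<Longrightarrow> \<bar>\<phi>'' s\<bar> \<le> M"
  shows "\<bar>\<phi> h - \<phi> 0 - h * \<phi>' 0\<bar> \<le> h\<^sup>2 * M"
proof -
  let ?S = "{- \<bar>h\<bar>..\<bar>h\<bar>}"
  have M0: "M \<ge> 0" using M[of 0] by simp
  have b: "\<bar>\<phi>' s - \<phi>' 0\<bar> \<le> M * \<bar>h\<bar>" if s: "s \<in> ?S" for s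
  proof -
    have "norm (\<phi>' s - \<phi>' 0) \<le> M * norm (s - 0)"
      by (rule field_differentiable_bound[of ?S \<phi>' \<phi>'']) (use s 2 M in \<open>auto intro: has_field_derivative_at_within\<close>)
    also have "\<dots> \<le> M * \<bar>h\<bar>" using s M0 by (intro mult_left_mono) auto
    finally show ?thesis by simp
  qed
  have "norm ((\<phi> h - h * \<phi>' 0) - (\<phi> 0 - 0 * \<phi>' 0)) \<le> (M * \<bar>h\<bar>) * norm (h - 0)"
  proof (rule field_differentiable_bound[of ?S "\<lambda>s. \<phi> s - s * \<phi>' 0" "\<lambda>s. \<phi>' s - \<phi>' 0"])
    fix s assume "s \<in> ?S"
    show "((\<lambda>s. \<phi> s - s * \<phi>' 0) has_field_derivative \<phi>' s - \<phi>' 0) (at s within ?S)"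
      by (auto intro!: derivative_eq_intros has_field_derivative_at_within[OF 1])
  qed (use b in auto)
  then show ?thesis by (simp add: power2_eq_square mult_ac abs_mult algebra_simps)
qed

context unstable begin

text \<open>The slowest exponential rate in \<open>x\<close> among the quotients \<open>Gc\<close>, \<open>Gs\<close>, \<open>G3\<close> and the soliton, towards either
infinity.\<close>

definition c :: real where "c = min (2 * \<kappa>) (1/2 - \<kappa>)"

lemma c_pos: "c > 0" using kappa by (simp add: c_def)

lemma c_le: "c \<le> 2 * \<kappa>" "c \<le> 1/2 - \<kappa>" by (simp_all add: c_def)

text \<open>For the flag \<open>True\<close> this is the ideal generated by the quotients that carry a growing exponential in
time; it contains the deviation of \<open>U\<close> from the soliton and controls its decay as \<open>t \<rightarrow> -\<infinity>\<close>.  For the flag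
\<open>False\<close> the soliton is added, and only the decay in \<open>x\<close> is left.  Both ideals are closed under
differentiation.  The quotient \<open>G1\<close> is in neither of them, since it tends to \<open>1\<close> as \<open>x \<rightarrow> \<infinity>\<close>.\<close>

inductive idl :: "bool \<Rightarrow> (pt \<Rightarrow> real) \<Rightarrow> bool" where
  idl_Gc: "idl b Gc" | idl_Gs: "idl b Gs" | idl_G3: "idl b G3"
| idl_F0: "idl False (\<lambda>p. F0 p * (1 + (-1) * F0 p))"
| idl_add: "idl b f \<Longrightarrow> idl b g \<Longrightarrow> idl b (\<lambda>p. f p + g p)"
| idl_mult: "idl b f \<Longrightarrow> alg g \<Longrightarrow> idl b (\<lambda>p. f p * g p)"

lemma idl_cmult: "idl b f \<Longrightarrow> idl b (\<lambda>p. k * f p)"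
  using idl_mult[OF _ alg_const[of k]] by (simp add: mult.commute)

lemma idl_mult2: "alg g \<Longrightarrow> idl b f \<Longrightarrow> idl b (\<lambda>p. g p * f p)"
  using idl_mult[of b f g] by (simp add: mult.commute)

lemma idl_alg: "idl b f \<Longrightarrow> alg f"
  by (induction rule: idl.induct) (intro alg_intros; assumption)+

lemma idl_weaken: "idl b f \<Longrightarrow> idl False f"
  by (induction rule: idl.induct) (rule idl.intros; assumption)+

lemma idl_D: "idl b f \<Longrightarrow> idl b (D e f)"
proof (induction rule: idl.induct)
  case (idl_Gc b) show ?case unfolding D_gen by (intro idl.idl_add idl_cmult idl.idl_Gc idl.idl_Gs idl_mult alg_Phi)
next
  case (idl_Gs b) show ?case unfolding D_gen by (intro idl.idl_add idl_cmult idl.idl_Gc idl.idl_Gs idl_mult alg_Phi)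
next
  case (idl_G3 b) show ?case unfolding D_gen by (intro idl.idl_add idl_cmult idl.idl_G3 idl_mult alg_Phi)
next
  case idl_F0
  have "D e (\<lambda>p. F0 p * (1 + (-1) * F0 p)) = (\<lambda>p. D e F0 p * (1 + (-1) * F0 p) + F0 p * (0 + (-1) * D e F0 p))"
    by (subst D_mult D_add D_cmult D_const | (intro alg_intros))+ (rule refl)
  also have "\<dots> = (\<lambda>p. xc e * ((F0 p * (1 + (-1) * F0 p)) * (1 + (-2) * F0 p)))"
    unfolding D_gen by (simp add: fun_eq_iff algebra_simps)
  finally show ?case by (simp only:) (intro idl_cmult idl_mult idl.idl_F0 alg_intros)
next
  case (idl_add b f g)
  then show ?case by (simp add: D_add idl_alg idl.idl_add)
next
  case (idl_mult b f g)
  then show ?case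
    by (simp add: D_mult idl_alg) (intro idl.idl_add idl.idl_mult alg_D; assumption)
qed

lemma alg_bounded: "alg f \<Longrightarrow> \<exists>C. \<forall>p. \<bar>f p\<bar> \<le> C"
proof (induction rule: alg.induct)
  case (alg_const c) then show ?case by auto
next
  have le: "x / tau p \<le> 1 / \<gamma>" if "x \<le> 1 + E1 p + E3 p" for x p
  proof -
    have "\<gamma> * x \<le> tau p"
      by (rule order.trans[OF mult_left_mono[OF that less_imp_le[OF gamma_pos]] tau_lower])
    then show ?thesis using gamma_pos tau_pos[of p] by (simp add: field_simps)
  qed
  {
    case alg_G1
    show ?case using le[of "E1 _"] E_pos tau_pos by (auto simp: G1_def less_imp_le intro!: exI[of _ "1/\<gamma>"])
  next
    case alg_G3
    show ?case using le[of "E3 _"] E_pos tau_pos by (auto simp: G3_def less_imp_le intro!: exI[of _ "1/\<gamma>"])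
  next
    have *: "exp (\<mu> * xc p + \<sigma> * tc p) \<le> 1 + E1 p + E3 p" for p
    proof -
      have "2 * (exp (xc p / 2) * exp (\<kappa> * xc p + \<sigma> * tc p)) \<le> (exp (xc p / 2))\<^sup>2 + (exp (\<kappa> * xc p + \<sigma> * tc p))\<^sup>2"
        using sum_squares_bound[of "exp (xc p / 2)" "exp (\<kappa> * xc p + \<sigma> * tc p)"] by (simp only: mult.assoc)
      moreover have "exp (xc p / 2) * exp (\<kappa> * xc p + \<sigma> * tc p) = exp (\<mu> * xc p + \<sigma> * tc p)"
        by (simp add: \<mu>_def algebra_simps flip: exp_add)
      moreover have "(exp (xc p / 2))\<^sup>2 = E1 p" "(exp (\<kappa> * xc p + \<sigma> * tc p))\<^sup>2 = E3 p"
        by (simp_all add: E1_def E3_def distrib_left flip: exp_double)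
      ultimately show ?thesis using exp_gt_zero[of "\<mu> * xc p + \<sigma> * tc p"] by linarith
    qed
    have c1: "\<bar>exp a * t / tau p\<bar> \<le> 1 / \<gamma>" if "exp a \<le> 1 + E1 p + E3 p" "\<bar>t\<bar> \<le> 1" for a t p
    proof -
      have "\<bar>exp a * t / tau p\<bar> = exp a / tau p * \<bar>t\<bar>" using tau_pos[of p] by (simp add: abs_mult)
      also have "\<dots> \<le> exp a / tau p * 1" using that tau_pos[of p] by (intro mult_left_mono) auto
      finally show ?thesis using le[OF that(1)] by simp
    qed
    case alg_Gc
    show ?case using c1[OF *] by (auto simp: Gc_def Ec_def intro!: exI[of _ "1/\<gamma>"])
    case alg_Gs
    show ?case using c1[OF *] by (auto simp: Gs_def Es_def intro!: exI[of _ "1/\<gamma>"])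
  }
next
  case alg_F0
  have "\<bar>F0 p\<bar> \<le> 1" for p using E_pos(1)[of p] by (simp add: F0_def tau0_def)
  then show ?case by blast
next
  case (alg_add f g)
  then obtain A B where "\<And>p. \<bar>f p\<bar> \<le> A" "\<And>p. \<bar>g p\<bar> \<le> B" by blast
  then have "\<bar>f p + g p\<bar> \<le> A + B" for p by (meson abs_triangle_ineq add_mono order_trans)
  then show ?case by blast
next
  case (alg_mult f g)
  then obtain A B where AB: "\<And>p. \<bar>f p\<bar> \<le> A" "\<And>p. \<bar>g p\<bar> \<le> B" by blast
  have "\<bar>f p * g p\<bar> \<le> A * B" for p
    unfolding abs_mult using AB[of p] by (intro mult_mono) auto
  then show ?case by blast
qed

definition rate :: "bool \<Rightarrow> real" where "rate b = (if b then \<sigma> else 0)"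

lemma rate_nonneg: "rate b \<ge> 0" using sigma_pos by (simp add: rate_def)

lemma exp_profile:
  assumes "c \<le> a" "a \<le> 1 - c"
  shows "exp (a * x) / (1 + exp x) \<le> exp (- c * \<bar>x\<bar>)"
proof -
  have "exp (a * x) \<le> exp (- c * \<bar>x\<bar>) * max 1 (exp x)"
  proof (cases "x \<ge> 0")
    case True
    have "a * x \<le> (1 - c) * x" using assms True by (intro mult_right_mono)
    then have "a * x \<le> - c * x + x" by (simp add: algebra_simps)
    then have "exp (a * x) \<le> exp (- c * x + x)" by (simp only: exp_le_cancel_iff)
    also have "\<dots> = exp (- c * \<bar>x\<bar>) * max 1 (exp x)" using True by (simp add: exp_add[symmetric] max_def)
    finally show ?thesis .
  next
    case False
    have "a * x \<le> c * x" using assms False by (intro mult_right_mono_neg) auto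
    then show ?thesis using False by (simp add: max_def)
  qed
  also have "\<dots> \<le> exp (- c * \<bar>x\<bar>) * (1 + exp x)" by (intro mult_left_mono) auto
  finally show ?thesis by (simp add: pos_divide_le_eq add_pos_pos)
qed

text \<open>The lower bound on \<open>tau\<close> by \<open>1 + e\<^sup>x\<close> leaves a quotient of exponentials in \<open>x\<close> whose exponent lies strictly
between \<open>0\<close> and \<open>1\<close>, and multiplication by a bounded function preserves the estimate.  Growing exponentials
in time are harmless for \<open>t \<le> T\<close>.\<close>

lemma idl_decay: "idl b f \<Longrightarrow> \<exists>C\<ge>0. \<forall>p. tc p \<le> T \<longrightarrow> \<bar>f p\<bar> \<le> C * (exp (rate b * tc p) * exp (- c * \<bar>xc p\<bar>))"
proof (induction rule: idl.induct)
  have t: "z / tau p \<le> 1 / \<gamma> * (z / (1 + exp (xc p)))" if "z \<ge> 0" for z p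
  proof -
    have "\<gamma> * (1 + exp (xc p)) \<le> tau p" using tau_lower[of p] E_pos(2)[of p] gamma_pos
      by (smt (verit) E1_def distrib_left mult_pos_pos)
    then have "z / tau p \<le> z / (\<gamma> * (1 + exp (xc p)))"
      using that gamma_pos tau_pos[of p] by (intro divide_left_mono mult_pos_pos) (auto intro: add_pos_pos)
    then show ?thesis by simp
  qed
  have er: "exp (\<sigma> * tc p) \<le> (1 + exp (\<sigma> * T)) * exp (rate b * tc p)" if "tc p \<le> T" for p b
  proof (cases b)
    case False
    have "exp (\<sigma> * tc p) \<le> exp (\<sigma> * T)" using that sigma_pos by simp
    then have "exp (\<sigma> * tc p) \<le> 1 + exp (\<sigma> * T)" by (rule order.trans) simp
    then show ?thesis using False by (simp add: rate_def)
  qed (simp add: rate_def add_pos_pos)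
  have main: "\<bar>exp (a * xc p + j * (\<sigma> * tc p)) * q / tau p\<bar> \<le> 1 / \<gamma> * ((1 + exp (\<sigma> * T)) * (1 + exp (\<sigma> * T))) * (exp (rate b * tc p) * exp (- c * \<bar>xc p\<bar>))"
    if "tc p \<le> T" "c \<le> a" "a \<le> 1 - c" "\<bar>q\<bar> \<le> 1" "j = 1 \<or> j = 2" for a j q p b
  proof -
    have e1: "exp (\<sigma> * tc p) \<le> 1 + exp (\<sigma> * T)"
    proof -
      have "exp (\<sigma> * tc p) \<le> exp (\<sigma> * T)" using that sigma_pos by simp
      then show ?thesis by (rule order.trans) simp
    qed
    have ej: "exp (j * (\<sigma> * tc p)) \<le> (1 + exp (\<sigma> * T)) * ((1 + exp (\<sigma> * T)) * exp (rate b * tc p))"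
    proof (cases "j = 1")
      case True
      have "1 * ((1 + exp (\<sigma> * T)) * exp (rate b * tc p)) \<le> (1 + exp (\<sigma> * T)) * ((1 + exp (\<sigma> * T)) * exp (rate b * tc p))"
        by (intro mult_right_mono) (auto intro!: mult_nonneg_nonneg add_nonneg_nonneg)
      with er[OF that(1), of b] True show ?thesis by simp
    next
      case False
      then have "exp (j * (\<sigma> * tc p)) = exp (\<sigma> * tc p) * exp (\<sigma> * tc p)" using that(5) by (simp flip: exp_add)
      also have "\<dots> \<le> (1 + exp (\<sigma> * T)) * ((1 + exp (\<sigma> * T)) * exp (rate b * tc p))"
        using e1 er[OF that(1), of b] by (intro mult_mono) (auto intro!: add_nonneg_nonneg)
      finally show ?thesis .
    qed
    have "\<bar>exp (a * xc p + j * (\<sigma> * tc p)) * q / tau p\<bar> = exp (a * xc p) * exp (j * (\<sigma> * tc p)) / tau p * \<bar>q\<bar>"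
      using tau_pos[of p] by (simp add: abs_mult exp_add)
    also have "\<dots> \<le> exp (a * xc p) * exp (j * (\<sigma> * tc p)) / tau p * 1"
      using that tau_pos[of p] by (intro mult_left_mono) auto
    also have "\<dots> \<le> 1 / \<gamma> * (exp (a * xc p) * exp (j * (\<sigma> * tc p)) / (1 + exp (xc p)))"
      using t[of "exp (a * xc p) * exp (j * (\<sigma> * tc p))" p] by simp
    also have "\<dots> = 1 / \<gamma> * (exp (j * (\<sigma> * tc p)) * (exp (a * xc p) / (1 + exp (xc p))))" by simp
    also have "\<dots> \<le> 1 / \<gamma> * (((1 + exp (\<sigma> * T)) * ((1 + exp (\<sigma> * T)) * exp (rate b * tc p))) * exp (- c * \<bar>xc p\<bar>))"
      using gamma_pos exp_profile[OF that(2,3), of "xc p"] ej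
      by (intro mult_left_mono mult_mono) (auto intro!: mult_nonneg_nonneg add_nonneg_nonneg divide_nonneg_nonneg)
    finally show ?thesis by (simp only: mult_ac)
  qed
  have cn: "0 \<le> 1 / \<gamma> * ((1 + exp (\<sigma> * T)) * (1 + exp (\<sigma> * T)))"
    using gamma_pos by (intro mult_nonneg_nonneg add_nonneg_nonneg) auto
  {
    case (idl_Gc b)
    show ?case
      using main[of _ \<mu> "cos (l * yc _)" 1 b] cn kappa
      by (intro exI[of _ "1 / \<gamma> * ((1 + exp (\<sigma> * T)) * (1 + exp (\<sigma> * T)))"]) (auto simp: Gc_def Ec_def \<mu>_def c_def)
  next
    case (idl_Gs b)
    show ?case
      using main[of _ \<mu> "sin (l * yc _)" 1 b] cn kappa
      by (intro exI[of _ "1 / \<gamma> * ((1 + exp (\<sigma> * T)) * (1 + exp (\<sigma> * T)))"]) (auto simp: Gs_def Es_def \<mu>_def c_def)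
  next
    case (idl_G3 b)
    show ?case
      using main[of _ "2 * \<kappa>" 1 2 b] cn kappa
      by (intro exI[of _ "1 / \<gamma> * ((1 + exp (\<sigma> * T)) * (1 + exp (\<sigma> * T)))"]) (auto simp: G3_def E3_def c_def mult.assoc)
  }
next
  case idl_F0
  have "\<bar>F0 p * (1 + (-1) * F0 p)\<bar> \<le> 1 * (exp (rate False * tc p) * exp (- c * \<bar>xc p\<bar>))" for p
  proof -
    have pos: "1 + exp (xc p) > 0" by (intro add_pos_pos) auto
    have "F0 p * (1 + (-1) * F0 p) = exp (1/2 * xc p) / (1 + exp (xc p)) * (exp (1/2 * xc p) / (1 + exp (xc p)))"
    proof -
      have "1 + (-1) * F0 p = 1 / (1 + exp (xc p))" using pos by (simp add: F0_def tau0_def E1_def field_simps)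
      moreover have "exp (xc p) = exp (1/2 * xc p) * exp (1/2 * xc p)" by (simp flip: exp_add)
      ultimately show ?thesis by (simp add: F0_def tau0_def E1_def)
    qed
    also have "\<bar>\<dots>\<bar> \<le> exp (- c * \<bar>xc p\<bar>) * 1"
    proof -
      define r where "r = exp (1/2 * xc p) / (1 + exp (xc p))"
      have "exp (1/2 * xc p) / (1 + exp (xc p)) \<le> exp (- c * \<bar>xc p\<bar>)"
        by (rule exp_profile) (use kappa c_le in linarith)+
      then have r: "r \<le> exp (- c * \<bar>xc p\<bar>)" unfolding r_def .
      have e: "exp (- c * \<bar>xc p\<bar>) \<le> 1" using c_pos by simp
      have r0: "0 \<le> r" unfolding r_def by (intro divide_nonneg_pos pos) auto
      have "r * r \<le> exp (- c * \<bar>xc p\<bar>) * 1"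
        by (rule mult_mono[OF r order.trans[OF r e] exp_ge_zero r0])
      with r0 show ?thesis unfolding r_def[symmetric] by simp
    qed
    finally show ?thesis by (simp add: rate_def)
  qed
  then show ?case by (intro exI[of _ 1]) auto
next
  case (idl_add b f g)
  then obtain A B where AB: "A \<ge> 0" "B \<ge> 0" "\<And>p. tc p \<le> T \<Longrightarrow> \<bar>f p\<bar> \<le> A * (exp (rate b * tc p) * exp (- c * \<bar>xc p\<bar>))"
    "\<And>p. tc p \<le> T \<Longrightarrow> \<bar>g p\<bar> \<le> B * (exp (rate b * tc p) * exp (- c * \<bar>xc p\<bar>))" by blast
  have "\<bar>f p + g p\<bar> \<le> (A + B) * (exp (rate b * tc p) * exp (- c * \<bar>xc p\<bar>))" if "tc p \<le> T" for p
    using AB(3,4)[OF that] unfolding distrib_right by linarith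
  with AB show ?case by (intro exI[of _ "A + B"]) auto
next
  case (idl_mult b f g)
  then obtain A where A: "A \<ge> 0" "\<And>p. tc p \<le> T \<Longrightarrow> \<bar>f p\<bar> \<le> A * (exp (rate b * tc p) * exp (- c * \<bar>xc p\<bar>))" by blast
  obtain B where B: "\<And>p. \<bar>g p\<bar> \<le> B" using alg_bounded idl_mult by blast
  have B0: "B \<ge> 0" using B[of undefined] by linarith
  have "\<bar>f p * g p\<bar> \<le> (A * B) * (exp (rate b * tc p) * exp (- c * \<bar>xc p\<bar>))" if "tc p \<le> T" for p
  proof -
    have "\<bar>f p\<bar> * \<bar>g p\<bar> \<le> (A * (exp (rate b * tc p) * exp (- c * \<bar>xc p\<bar>))) * B"
      using A(2)[OF that] B[of p] A(1) by (intro mult_mono) auto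
    then show ?thesis by (simp only: abs_mult mult_ac)
  qed
  with A(1) B0 show ?case by (intro exI[of _ "A * B"]) auto
qed

lemma alg_periodic: "alg f \<Longrightarrow> f (t, x, y + 2 * pi * L) = f (t, x, y)"
proof (induction rule: alg.induct)
  have "l * (y + 2 * pi * L) = l * y + 2 * pi" using L_pos by (simp add: l_def field_simps)
  then have "cos (l * (y + 2 * pi * L)) = cos (l * y)" "sin (l * (y + 2 * pi * L)) = sin (l * y)" by simp_all
  then have E: "Ec (t, x, y + 2 * pi * L) = Ec (t, x, y)" "Es (t, x, y + 2 * pi * L) = Es (t, x, y)"
    "E1 (t, x, y + 2 * pi * L) = E1 (t, x, y)" "E3 (t, x, y + 2 * pi * L) = E3 (t, x, y)"
    by (simp_all add: Ec_def Es_def E1_def E3_def)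
  { case alg_G1 show ?case by (simp add: G1_def tau_def E) next
    case alg_Gc show ?case by (simp add: Gc_def tau_def E) next
    case alg_Gs show ?case by (simp add: Gs_def tau_def E) next
    case alg_G3 show ?case by (simp add: G3_def tau_def E) next
    case alg_F0 show ?case by (simp add: F0_def tau0_def E) }
qed simp_all

lemma alg_continuous: "alg f \<Longrightarrow> continuous_on UNIV f"
proof (induction rule: alg.induct)
  have E: "continuous_on UNIV E1" "continuous_on UNIV Ec" "continuous_on UNIV Es" "continuous_on UNIV E3"
    unfolding E1_def[abs_def] Ec_def[abs_def] Es_def[abs_def] E3_def[abs_def] by (intro continuous_intros)+
  have t: "continuous_on UNIV tau" unfolding tau_def[abs_def] by (intro continuous_intros E)
  have t0: "continuous_on UNIV tau0" unfolding tau0_def[abs_def] by (intro continuous_intros E)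
  have n: "tau p \<noteq> 0" "tau0 p \<noteq> 0" for p using tau_pos[of p] tau0_pos[of p] by auto
  { case alg_G1 show ?case unfolding G1_def[abs_def] by (intro continuous_intros E t) (use n in auto) next
    case alg_Gc show ?case unfolding Gc_def[abs_def] by (intro continuous_intros E t) (use n in auto) next
    case alg_Gs show ?case unfolding Gs_def[abs_def] by (intro continuous_intros E t) (use n in auto) next
    case alg_G3 show ?case unfolding G3_def[abs_def] by (intro continuous_intros E t) (use n in auto) next
    case alg_F0 show ?case unfolding F0_def[abs_def] by (intro continuous_intros E t0) (use n in auto) }
qed (intro continuous_intros; assumption)+

end

section \<open>Square-integrable time slices\<close>

context unstable begin

definition slice :: "(pt \<Rightarrow> real) \<Rightarrow> real \<Rightarrow> real \<times> real \<Rightarrow> real" where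
  "slice f t p = f (t, p)"

text \<open>The common majorant in \<open>x\<close>, which turns pointwise estimates into estimates in \<open>L\<^sup>2\<close>.\<close>

definition wc :: "real \<times> real \<Rightarrow> real" where "wc p = exp (- c * \<bar>fst p\<bar>)"

lemma wc_nonneg: "0 \<le> wc p" "wc p \<le> 1" using c_pos by (auto simp: wc_def)

lemma wc_integrable: "integrable Cy wc"
proof -
  have "integrable lborel (\<lambda>x. exp (- c * \<bar>x\<bar>))"
  proof (rule integrable_even_FTC[where f="\<lambda>x. exp (- c * x)" and F="\<lambda>x. - exp (- c * x) / c" and T=0])
    show "DERIV (\<lambda>x. - exp (- c * x) / c) x :> exp (- c * x)" for x
      using c_pos by (auto intro!: derivative_eq_intros)
    show "((\<lambda>x. - exp (- c * x) / c) \<longlongrightarrow> 0) at_top" using c_pos by real_asymp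
  qed auto
  from pair_Yc_integral(2)[OF this, of "\<lambda>_. 1"] show ?thesis by (simp add: wc_def[abs_def])
qed

lemma wc_L2: "wc \<in> L2 Cy"
  by (rule bounded_integrable_L2[OF wc_integrable, where B=1]) (use wc_nonneg in simp)

lemma wc_bound:
  assumes [measurable]: "h \<in> borel_measurable Cy" and le: "\<And>p. \<bar>h p\<bar> \<le> K * wc p"
  shows "integrable Cy h" "h \<in> L2 Cy" "L2_norm Cy h \<le> \<bar>K\<bar> * L2_norm Cy wc"
proof -
  have *: "\<bar>h p\<bar> \<le> \<bar>K * wc p\<bar>" for p using le[of p] by linarith
  show "integrable Cy h"
    by (rule Bochner_Integration.integrable_bound[of _ "\<lambda>p. K * wc p"]) (use wc_integrable * in auto)
  from L2_norm_mono[OF L2_cmult(1)[OF wc_L2, of K], of h] *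
  show "h \<in> L2 Cy" "L2_norm Cy h \<le> \<bar>K\<bar> * L2_norm Cy wc" by (auto simp: L2_cmult(2)[OF wc_L2])
qed

lemma L2_tendsto_wc:
  assumes m: "\<And>h. f h \<in> borel_measurable Cy" "g \<in> borel_measurable Cy"
    and le: "\<And>h p. h \<noteq> 0 \<Longrightarrow> \<bar>h\<bar> \<le> 1 \<Longrightarrow> \<bar>f h p - g p\<bar> \<le> \<bar>h\<bar> * (K * wc p)"
  shows "L2_tendsto Cy f g (at (0::real))"
proof -
  have ev: "eventually (\<lambda>h::real. h \<noteq> 0 \<and> \<bar>h\<bar> \<le> 1) (at 0)"
    unfolding eventually_at by (intro exI[of _ 1]) auto
  have b: "(\<lambda>p. f h p - g p) \<in> L2 Cy \<and> L2_norm Cy (\<lambda>p. f h p - g p) \<le> \<bar>h\<bar> * (\<bar>K\<bar> * L2_norm Cy wc)"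
    if "h \<noteq> 0 \<and> \<bar>h\<bar> \<le> 1" for h
  proof -
    have m': "(\<lambda>p. f h p - g p) \<in> borel_measurable Cy" using m by (intro borel_measurable_diff)
    have "\<bar>f h p - g p\<bar> \<le> (\<bar>h\<bar> * K) * wc p" for p using le[of h p] that by (simp add: mult.assoc)
    from wc_bound(2,3)[OF m' this] show ?thesis by (simp add: abs_mult mult.assoc)
  qed
  show ?thesis unfolding L2_tendsto_def
  proof
    show "eventually (\<lambda>h. (\<lambda>p. f h p - g p) \<in> L2 Cy) (at 0)" using ev by eventually_elim (use b in blast)
    show "((\<lambda>h. L2_norm Cy (\<lambda>p. f h p - g p)) \<longlongrightarrow> 0) (at 0)"
    proof (rule Lim_null_comparison)
      show "eventually (\<lambda>h. norm (L2_norm Cy (\<lambda>p. f h p - g p)) \<le> \<bar>h\<bar> * (\<bar>K\<bar> * L2_norm Cy wc)) (at 0)"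
        using ev by eventually_elim (use b in simp)
      have "((\<lambda>h::real. \<bar>h\<bar> * (\<bar>K\<bar> * L2_norm Cy wc)) \<longlongrightarrow> \<bar>0\<bar> * (\<bar>K\<bar> * L2_norm Cy wc)) (at 0)"
        by (intro tendsto_intros)
      then show "((\<lambda>h::real. \<bar>h\<bar> * (\<bar>K\<bar> * L2_norm Cy wc)) \<longlongrightarrow> 0) (at 0)" by simp
    qed
  qed
qed

lemma slice_measurable: "alg f \<Longrightarrow> slice f t \<in> borel_measurable Cy"
  unfolding slice_def[abs_def]
  by (intro borel_measurable_CyI borel_measurable_continuous_onI continuous_on_compose2[OF alg_continuous] continuous_intros) auto

text \<open>On unit neighbourhoods the decay is uniform, so it also bounds the remainder of Taylor expansions
whose intermediate points vary.\<close>

lemma idl_near: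
  assumes "idl b f"
  obtains M where "M \<ge> 0" "\<And>p q. \<bar>tc p - t\<bar> \<le> 1 \<Longrightarrow> \<bar>xc p - fst q\<bar> \<le> 1 \<Longrightarrow> \<bar>f p\<bar> \<le> M * wc q"
proof -
  obtain C where C: "C \<ge> 0" "\<And>p. tc p \<le> t + 1 \<Longrightarrow> \<bar>f p\<bar> \<le> C * (exp (rate b * tc p) * exp (- c * \<bar>xc p\<bar>))"
    using idl_decay[OF assms, of "t + 1"] by blast
  show ?thesis
  proof (rule that[of "C * (exp (rate b * (t + 1)) * exp c)"])
    show "0 \<le> C * (exp (rate b * (t + 1)) * exp c)" using C by simp
    fix p :: pt and q :: "real \<times> real" assume a: "\<bar>tc p - t\<bar> \<le> 1" "\<bar>xc p - fst q\<bar> \<le> 1"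
    then have t: "tc p \<le> t + 1" by linarith
    have 1: "exp (rate b * tc p) \<le> exp (rate b * (t + 1))" using t rate_nonneg[of b] by (simp add: mult_left_mono)
    have "c * \<bar>fst q\<bar> \<le> c * (1 + \<bar>xc p\<bar>)" using a c_pos by (intro mult_left_mono) auto
    then have 2: "exp (- c * \<bar>xc p\<bar>) \<le> exp c * wc q" by (simp add: wc_def distrib_left flip: exp_add)
    have "\<bar>f p\<bar> \<le> C * (exp (rate b * tc p) * exp (- c * \<bar>xc p\<bar>))" by (rule C(2)[OF t])
    also have "\<dots> \<le> C * (exp (rate b * (t + 1)) * (exp c * wc q))"
      using 1 2 C(1) by (intro mult_left_mono mult_mono) auto
    finally show "\<bar>f p\<bar> \<le> C * (exp (rate b * (t + 1)) * exp c) * wc q" by (simp only: mult.assoc)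
  qed
qed

lemma idl_slice: "idl b f \<Longrightarrow> slice f t \<in> L2 Cy" "idl b f \<Longrightarrow> integrable Cy (slice f t)"
proof -
  assume f: "idl b f"
  obtain M where M: "\<And>p q. \<bar>tc p - t\<bar> \<le> 1 \<Longrightarrow> \<bar>xc p - fst q\<bar> \<le> 1 \<Longrightarrow> \<bar>f p\<bar> \<le> M * wc q" using idl_near[OF f, where t=t] by blast
  have "\<bar>slice f t q\<bar> \<le> M * wc q" for q using M[of "(t, q)" q] by (simp add: slice_def)
  from wc_bound[OF slice_measurable[OF idl_alg[OF f]] this]
  show "slice f t \<in> L2 Cy" "integrable Cy (slice f t)" by auto
qed

lemma idl_slice_norm:
  assumes f: "idl b f"
  shows "\<exists>C\<ge>0. \<forall>t\<le>T. L2_norm Cy (slice f t) \<le> C * exp (rate b * t)"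
proof -
  obtain C where C: "C \<ge> 0" "\<And>p. tc p \<le> T \<Longrightarrow> \<bar>f p\<bar> \<le> C * (exp (rate b * tc p) * exp (- c * \<bar>xc p\<bar>))"
    using idl_decay[OF f, of T] by blast
  have "L2_norm Cy (slice f t) \<le> (C * L2_norm Cy wc) * exp (rate b * t)" if "t \<le> T" for t
  proof -
    have "\<bar>slice f t q\<bar> \<le> (C * exp (rate b * t)) * wc q" for q using C(2)[of "(t, q)"] that by (simp add: slice_def wc_def mult.assoc)
    from wc_bound(3)[OF slice_measurable[OF idl_alg[OF f]] this] C(1) show ?thesis by (simp add: abs_mult mult_ac)
  qed
  then show ?thesis using C(1) by (intro exI[of _ "C * L2_norm Cy wc"]) auto
qed

lemma idl_taylor:
  assumes f: "idl b f" and e: "\<bar>tc e\<bar> \<le> 1" "\<bar>xc e\<bar> \<le> 1"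
  obtains M where "M \<ge> 0" "\<And>h q. \<bar>h\<bar> \<le> 1 \<Longrightarrow> \<bar>f ((t, q) + h *\<^sub>R e) - f (t, q) - h * D e f (t, q)\<bar> \<le> h\<^sup>2 * (M * wc q)"
proof -
  obtain M where M: "M \<ge> 0" "\<And>p q. \<bar>tc p - t\<bar> \<le> 1 \<Longrightarrow> \<bar>xc p - fst q\<bar> \<le> 1 \<Longrightarrow> \<bar>D e (D e f) p\<bar> \<le> M * wc q"
    using idl_near[OF idl_D[OF idl_D[OF f, of e], of e], where t=t] by blast
  show ?thesis
  proof (rule that[OF M(1)])
    fix h :: real and q :: "real \<times> real" assume h: "\<bar>h\<bar> \<le> 1"
    have a: "alg f" by (rule idl_alg[OF f])
    have "\<bar>f ((t, q) + h *\<^sub>R e) - f ((t, q) + 0 *\<^sub>R e) - h * D e f ((t, q) + 0 *\<^sub>R e)\<bar> \<le> h\<^sup>2 * (M * wc q)"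
    proof (rule taylor_bound[where \<phi>="\<lambda>s. f ((t, q) + s *\<^sub>R e)" and \<phi>'="\<lambda>s. D e f ((t, q) + s *\<^sub>R e)" and \<phi>''="\<lambda>s. D e (D e f) ((t, q) + s *\<^sub>R e)"])
      show "((\<lambda>s. f ((t, q) + s *\<^sub>R e)) has_real_derivative D e f ((t, q) + s *\<^sub>R e)) (at s)" for s
        by (rule has_D_along[OF alg_has_D[OF a]])
      show "((\<lambda>s. D e f ((t, q) + s *\<^sub>R e)) has_real_derivative D e (D e f) ((t, q) + s *\<^sub>R e)) (at s)" for s
        by (rule has_D_along[OF alg_has_D[OF alg_D[OF a]]])
      fix s :: real assume "\<bar>s\<bar> \<le> \<bar>h\<bar>"
      then have s: "\<bar>s\<bar> \<le> 1" using h by linarith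
      have "\<bar>s * tc e\<bar> \<le> 1" "\<bar>s * xc e\<bar> \<le> 1" using s e by (simp_all add: abs_mult mult_le_one)
      then show "\<bar>D e (D e f) ((t, q) + s *\<^sub>R e)\<bar> \<le> M * wc q" by (intro M(2)) auto
    qed
    then show "\<bar>f ((t, q) + h *\<^sub>R e) - f (t, q) - h * D e f (t, q)\<bar> \<le> h\<^sup>2 * (M * wc q)" by simp
  qed
qed

lemma quotient_bound:
  fixes h r :: real
  assumes "h \<noteq> 0" "\<bar>a - h * d\<bar> \<le> h\<^sup>2 * r"
  shows "\<bar>1 / h * a - d\<bar> \<le> \<bar>h\<bar> * r"
proof -
  have "\<bar>h\<bar> * \<bar>1 / h * a - d\<bar> = \<bar>a - h * d\<bar>" using assms(1) by (simp add: right_diff_distrib flip: abs_mult)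
  also have "\<dots> \<le> \<bar>h\<bar> * (\<bar>h\<bar> * r)" using assms(2) by (simp add: power2_eq_square flip: abs_mult mult.assoc)
  finally show ?thesis using assms(1) by simp
qed

lemma dquot_slice:
  assumes f: "idl b f"
  shows "L2_tendsto Cy (\<lambda>h. dquot h (slice f t)) (slice (D ex f) t) (at 0)"
proof -
  obtain M where M: "\<And>h q. \<bar>h\<bar> \<le> 1 \<Longrightarrow> \<bar>f ((t, q) + h *\<^sub>R ex) - f (t, q) - h * D ex f (t, q)\<bar> \<le> h\<^sup>2 * (M * wc q)"
    by (rule idl_taylor[OF f, of ex t]) (auto simp: ex_def)
  have [measurable]: "slice f t \<in> borel_measurable Cy" by (rule slice_measurable[OF idl_alg[OF f]])
  show ?thesis
  proof (rule L2_tendsto_wc)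
    show "dquot h (slice f t) \<in> borel_measurable Cy" for h unfolding dquot_def[abs_def] by measurable
    show "slice (D ex f) t \<in> borel_measurable Cy" by (rule slice_measurable[OF alg_D[OF idl_alg[OF f]]])
    fix h :: real and q assume h: "h \<noteq> 0" "\<bar>h\<bar> \<le> 1"
    have "dquot h (slice f t) q = 1 / h * (f ((t, q) + h *\<^sub>R ex) - f (t, q))"
      by (cases q) (simp add: dquot_def slice_def shift_def ex_def)
    then show "\<bar>dquot h (slice f t) q - slice (D ex f) t q\<bar> \<le> \<bar>h\<bar> * (M * wc q)"
      using quotient_bound[OF h(1) M[OF h(2), of q]] by (simp add: slice_def)
  qed
qed

lemma time_quotient_slice:
  assumes f: "idl b f"
  shows "L2_tendsto Cy (\<lambda>h p. 1 / h * (slice f (t + h) p - slice f t p)) (slice (D et f) t) (at 0)"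
proof -
  obtain M where M: "\<And>h q. \<bar>h\<bar> \<le> 1 \<Longrightarrow> \<bar>f ((t, q) + h *\<^sub>R et) - f (t, q) - h * D et f (t, q)\<bar> \<le> h\<^sup>2 * (M * wc q)"
    by (rule idl_taylor[OF f, of et t]) (auto simp: et_def)
  have [measurable]: "slice f t \<in> borel_measurable Cy" for t by (rule slice_measurable[OF idl_alg[OF f]])
  show ?thesis
  proof (rule L2_tendsto_wc)
    show "(\<lambda>p. 1 / h * (slice f (t + h) p - slice f t p)) \<in> borel_measurable Cy" for h by measurable
    show "slice (D et f) t \<in> borel_measurable Cy" by (rule slice_measurable[OF alg_D[OF idl_alg[OF f]]])
    fix h :: real and q assume h: "h \<noteq> 0" "\<bar>h\<bar> \<le> 1"
    show "\<bar>1 / h * (slice f (t + h) q - slice f t q) - slice (D et f) t q\<bar> \<le> \<bar>h\<bar> * (M * wc q)"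
      using quotient_bound[OF h(1) M[OF h(2), of q]] by (cases q) (simp add: slice_def et_def)
  qed
qed

lemma slice_continuous:
  assumes f: "idl b f"
  shows "L2_tendsto Cy (\<lambda>h. slice f (t + h)) (slice f t) (at 0)"
proof -
  obtain M where M: "M \<ge> 0" "\<And>h q. \<bar>h\<bar> \<le> 1 \<Longrightarrow> \<bar>f ((t, q) + h *\<^sub>R et) - f (t, q) - h * D et f (t, q)\<bar> \<le> h\<^sup>2 * (M * wc q)"
    by (rule idl_taylor[OF f, of et t]) (auto simp: et_def)
  obtain N where N: "\<And>p q. \<bar>tc p - t\<bar> \<le> 1 \<Longrightarrow> \<bar>xc p - fst q\<bar> \<le> 1 \<Longrightarrow> \<bar>D et f p\<bar> \<le> N * wc q"
    using idl_near[OF idl_D[OF f, of et], where t=t] by blast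
  show ?thesis
  proof (rule L2_tendsto_wc)
    show "slice f (t + h) \<in> borel_measurable Cy" "slice f t \<in> borel_measurable Cy" for h by (rule slice_measurable[OF idl_alg[OF f]])+
    fix h :: real and q assume h: "h \<noteq> 0" "\<bar>h\<bar> \<le> 1"
    have 1: "\<bar>h\<bar> * \<bar>D et f (t, q)\<bar> \<le> \<bar>h\<bar> * (N * wc q)" using N[of "(t, q)" q] by (intro mult_left_mono) auto
    have "\<bar>h\<bar> * \<bar>h\<bar> \<le> 1 * \<bar>h\<bar>" using h by (intro mult_right_mono) auto
    then have "h\<^sup>2 * (M * wc q) \<le> \<bar>h\<bar> * (M * wc q)" using M(1) wc_nonneg[of q]
      by (intro mult_right_mono) (auto simp: power2_eq_square)
    with M(2)[OF h(2), of q] have 2: "\<bar>f ((t, q) + h *\<^sub>R et) - f (t, q) - h * D et f (t, q)\<bar> \<le> \<bar>h\<bar> * (M * wc q)" by linarith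
    have "slice f (t + h) q - slice f t q = (f ((t, q) + h *\<^sub>R et) - f (t, q) - h * D et f (t, q)) + h * D et f (t, q)"
      by (cases q) (simp add: slice_def et_def)
    also have "\<bar>\<dots>\<bar> \<le> \<bar>h\<bar> * (M * wc q) + \<bar>h\<bar> * (N * wc q)"
      using 1 2 by (intro order.trans[OF abs_triangle_ineq] add_mono) (auto simp: abs_mult)
    finally show "\<bar>slice f (t + h) q - slice f t q\<bar> \<le> \<bar>h\<bar> * ((M + N) * wc q)" by (simp add: distrib_left distrib_right)
  qed
qed

text \<open>Difference quotients converge in \<open>L\<^sup>2\<close> to the classical derivative, while their Fourier transforms converge pointwise
to multiplication by \<open>i \<xi>\<close>; the two limits agree.\<close>

lemma has_dx_slice:
  assumes f: "idl b f"
  shows "has_dx (slice f t) (slice (D ex f) t)"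
  unfolding has_dx_def
proof (intro conjI)
  show u: "slice f t \<in> L2 Cy" and v: "slice (D ex f) t \<in> L2 Cy" by (rule idl_slice[OF f] idl_slice[OF idl_D[OF f]])+
  define X where "X n = 1 / (real n + 1)" for n
  have X: "X \<longlonglongrightarrow> 0" "X n \<noteq> 0" for n unfolding X_def by real_asymp simp
  have at: "filterlim X (at 0) sequentially" using X by (simp add: filterlim_at)
  have [measurable]: "fourier L (slice f t) \<in> borel_measurable freq" by (rule fourier_measurable[OF u])
  show "AE q in freq. fourier L (slice (D ex f) t) q = \<i> * complex_of_real (fst q) * fourier L (slice f t) q"
  proof (rule L2_tendsto_pointwise)
    show "L2_tendsto freq (\<lambda>n. fourier L (dquot (X n) (slice f t))) (fourier L (slice (D ex f) t)) sequentially"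
      by (rule fourier_continuous[OF dquot_L2[OF u] v L2_tendsto_compose[OF dquot_slice[OF f] at]])
    have "AE q in freq. \<forall>n. fourier L (dquot (X n) (slice f t)) q = mult_dq (X n) q * fourier L (slice f t) q"
      unfolding AE_all_countable by (intro allI fourier_dquot u)
    then show "AE q in freq. (\<lambda>n. fourier L (dquot (X n) (slice f t)) q) \<longlonglongrightarrow> \<i> * complex_of_real (fst q) * fourier L (slice f t) q"
    proof eventually_elim
      case (elim q)
      then show ?case by (simp only:) (intro tendsto_intros mult_dq_tendsto X)
    qed
    show "fourier L (dquot (X n) (slice f t)) \<in> borel_measurable freq" for n by (intro fourier_measurable dquot_L2 u)
    show "fourier L (slice (D ex f) t) \<in> borel_measurable freq" by (rule fourier_measurable[OF v])
  qed measurable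
qed

text \<open>In \<open>y\<close> the functions are smooth and periodic, so integration by parts on one period has no boundary
terms.\<close>

lemma fourier_dy_slice:
  assumes f: "idl b f"
  shows "AE q in freq. fourier L (slice (D ey f) t) q = \<i> * complex_of_real (real_of_int (snd q) / L) * fourier L (slice f t) q"
proof -
  have a: "alg f" by (rule idl_alg[OF f])
  note i = idl_slice(2)[OF f, of t] idl_slice(2)[OF idl_D[OF f, of ey], of t]
  note l = idl_slice(1)[OF f, of t] idl_slice(1)[OF idl_D[OF f, of ey], of t]
  have F: "F1 L (slice (D ey f) t) q = \<i> * complex_of_real (real_of_int (snd q) / L) * F1 L (slice f t) q" for q
  proof -
    let ?d = "- (\<i> * complex_of_real (real_of_int (snd q) / L))"
    let ?g = "\<lambda>p. complex_of_real (slice (D ey f) t p) * emode L p q + complex_of_real (slice f t p) * (?d * emode L p q)"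
    have int: "integrable Cy (\<lambda>p. complex_of_real (slice (D ey f) t p) * emode L p q)"
      "integrable Cy (\<lambda>p. complex_of_real (slice f t p) * (?d * emode L p q))"
      using integrable_emode[OF i(2), of q] integrable_mult_right[OF integrable_emode[OF i(1), of q], of ?d]
      by (simp_all add: mult_ac)
    have inner: "(\<integral>y. ?g (x, y) \<partial>Yc) = 0" for x
    proof -
      let ?F = "\<lambda>y. complex_of_real (slice f t (x, y)) * emode L (x, y) q"
      have "(\<integral>y. ?g (x, y) \<partial>Yc) = ?F (2 * pi * L) - ?F 0"
      proof (rule Yc_FTC)
        fix y
        have 1: "((\<lambda>s. f ((t, x, 0) + s *\<^sub>R ey)) has_real_derivative D ey f ((t, x, 0) + y *\<^sub>R ey)) (at y)"
          by (rule has_D_along[OF alg_has_D[OF a]])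
        then have 1: "((\<lambda>y. slice f t (x, y)) has_real_derivative slice (D ey f) t (x, y)) (at y)"
          by (simp add: slice_def ey_def)
        have 2: "((\<lambda>y. emode L (x, y) q) has_vector_derivative ?d * emode L (x, y) q) (at y)"
        proof -
          have "((\<lambda>z. exp (- \<i> * (complex_of_real (x * fst q) + z * complex_of_real (real_of_int (snd q) / L)))) has_field_derivative
             ?d * exp (- \<i> * (complex_of_real (x * fst q) + complex_of_real y * complex_of_real (real_of_int (snd q) / L)))) (at (complex_of_real y))"
            using L_pos by (auto intro!: derivative_eq_intros)
          from has_vector_derivative_real_field[OF this] show ?thesis by (simp add: emode_def)
        qed
        have 3: "((\<lambda>y. complex_of_real (slice f t (x, y))) has_vector_derivative complex_of_real (slice (D ey f) t (x, y))) (at y)"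
          using 1 by (intro has_vector_derivative_of_real) (simp add: has_real_derivative_iff_has_vector_derivative)
        show "(?F has_vector_derivative ?g (x, y)) (at y)"
          using has_vector_derivative_mult[OF 3 2] by (simp add: add.commute)
      next
        have c: "continuous_on UNIV (\<lambda>y. slice h t (x, y))" if "alg h" for h
          unfolding slice_def by (intro continuous_on_compose2[OF alg_continuous[OF that]] continuous_intros) auto
        have e: "continuous_on UNIV (\<lambda>y. emode L (x, y) q)" unfolding emode_def using L_pos by (intro continuous_intros) auto
        show "continuous_on UNIV (\<lambda>y. ?g (x, y))"
          by (intro continuous_intros c[OF a] c[OF alg_D[OF a]] e)
      qed
      also have "\<dots> = 0"
      proof -
        have "slice f t (x, 2 * pi * L) = slice f t (x, 0)" using alg_periodic[OF a, of t x 0] by (simp add: slice_def)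
        moreover have "emode L (x, 2 * pi * L) q = emode L (x, 0) q"
        proof -
          have "emode L (x, 2 * pi * L) q = emode L (x, 0) q * exp ((2 * of_int (- snd q) * pi) * \<i>)"
            using L_pos unfolding emode_def exp_add[symmetric] by (intro arg_cong[where f=exp]) (simp add: algebra_simps)
          also have "exp ((2 * of_int (- snd q) * pi) * \<i>) = 1" by (rule exp_integer_2pi) simp
          finally show ?thesis by simp
        qed
        ultimately show ?thesis by simp
      qed
      finally show ?thesis .
    qed
    have "(\<integral>p. ?g p \<partial>Cy) = (\<integral>x. \<integral>y. ?g (x, y) \<partial>Yc \<partial>lborel)"
    proof -
      have "integrable (lborel \<Otimes>\<^sub>M Yc) ?g" using int unfolding cylinder_eq_pair[symmetric] by (rule Bochner_Integration.integrable_add)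
      from XY.integral_fst'[OF this] show ?thesis unfolding cylinder_eq_pair by simp
    qed
    also have "\<dots> = 0" by (simp only: inner) simp
    finally have "(\<integral>p. complex_of_real (slice (D ey f) t p) * emode L p q \<partial>Cy) + (\<integral>p. complex_of_real (slice f t p) * (?d * emode L p q) \<partial>Cy) = 0"
      by (simp only: Bochner_Integration.integral_add[OF int])
    moreover have "(\<lambda>p. complex_of_real (slice f t p) * (?d * emode L p q)) = (\<lambda>p. ?d * (complex_of_real (slice f t p) * emode L p q))"
      by (simp only: mult_ac)
    then have "(\<integral>p. complex_of_real (slice f t p) * (?d * emode L p q) \<partial>Cy) = ?d * (\<integral>p. complex_of_real (slice f t p) * emode L p q \<partial>Cy)"
      by (simp only: integral_mult_right_zero)
    moreover have "A = z * I" if "A + B = 0" "B = - z * I" for A B z I :: complex using that by (simp add: eq_neg_iff_add_eq_0[symmetric])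
    ultimately have "(\<integral>p. complex_of_real (slice (D ey f) t p) * emode L p q \<partial>Cy) = \<i> * complex_of_real (real_of_int (snd q) / L) * (\<integral>p. complex_of_real (slice f t p) * emode L p q \<partial>Cy)"
      by blast
    then show ?thesis unfolding F1_def by (simp only: mult_ac)
  qed
  from fourier_F1[OF i(1) l(1)] fourier_F1[OF i(2) l(2)] show ?thesis by eventually_elim (simp only: F)
qed

end

section \<open>The exact solution solves the Cauchy problem\<close>

context unstable begin

text \<open>\<open>12 \<partial>\<^sub>x\<^sup>2 log (1 + e\<^sup>x)\<close>, that is \<^const>\<open>Q\<close> in terms of the generators.\<close>

definition soliton :: "pt \<Rightarrow> real" where "soliton p = 12 * (F0 p * (1 + (-1) * F0 p))"

lemma slice_soliton: "slice soliton t = Q"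
proof
  fix p :: "real \<times> real"
  define r where "r = exp (fst p / 2)"
  have r: "r > 0" "r * r + 1 > 0" by (auto simp: r_def intro!: add_pos_pos)
  have e: "exp (fst p) = r * r" by (simp add: r_def flip: exp_add)
  have c: "1 / cosh (fst p / 2) = 2 * r / (r * r + 1)"
    using r unfolding cosh_field_def exp_minus r_def[symmetric] by (simp add: field_simps)
  have f: "F0 (t, p) = r * r / (r * r + 1)" by (simp add: F0_def E1_def tau0_def e add.commute)
  have o: "1 + (-1) * F0 (t, p) = 1 / (r * r + 1)" unfolding f using r by (simp add: field_simps)
  have "slice soliton t p = 12 * (r * r / (r * r + 1) * (1 / (r * r + 1)))"
    unfolding slice_def soliton_def o unfolding f ..
  also have "\<dots> = 3 * (2 * r / (r * r + 1))\<^sup>2" by (simp add: power2_eq_square)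
  also have "\<dots> = Q p" by (simp only: Q_def split_beta c)
  finally show "slice soliton t p = Q p" .
qed

lemma idl_soliton: "idl False soliton"
  unfolding soliton_def[abs_def] by (intro idl_cmult idl.idl_F0)

definition deviation :: "pt \<Rightarrow> real" where "deviation p = U p - soliton p"

text \<open>\<open>U\<close> and the soliton are \<open>12 \<partial>\<^sub>x\<close> of the logarithmic derivatives of \<open>tau\<close> and \<open>tau0\<close>.  Subtracting these, the
quotients \<open>G1\<close> and \<open>F0\<close> combine into a multiple of \<open>tau0 - tau\<close>, whose terms all grow in time.\<close>

lemma idl_deviation: "idl True deviation"
proof -
  let ?V = "\<lambda>p. Phi ex p + (-1) * F0 p"
  have "?V p = F0 p * ((-2) * Gc p + (- \<alpha>) * G3 p) + ((2 * \<mu>) * Gc p + (2 * \<alpha> * \<kappa>) * G3 p)" for p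
  proof -
    have "G1 p - F0 p = E1 p * (tau0 p - tau p) / (tau p * tau0 p)"
      using tau_pos[of p] tau0_pos[of p] by (simp add: G1_def F0_def field_simps)
    also have "tau0 p - tau p = (-2) * Ec p + (- \<alpha>) * E3 p" by (simp add: tau_def tau0_def)
    also have "E1 p * ((-2) * Ec p + (- \<alpha>) * E3 p) / (tau p * tau0 p) = F0 p * ((-2) * Gc p + (- \<alpha>) * G3 p)"
      by (simp add: F0_def Gc_def G3_def add_divide_distrib diff_divide_distrib algebra_simps)
    finally show ?thesis by (simp add: Phi_def ex_def algebra_simps)
  qed
  then have "idl True ?V"
    by (simp only:) (intro idl.idl_add idl_mult2 idl_cmult idl.idl_Gc idl.idl_G3 alg_intros)
  then have "idl True (\<lambda>p. 12 * D ex ?V p)" by (intro idl_cmult idl_D)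
  moreover have "D ex ?V = (\<lambda>p. D ex (Phi ex) p + (-1) * D ex F0 p)"
    by (subst D_add D_cmult | (intro alg_intros alg_Phi))+ (rule refl)
  moreover have "D ex F0 = (\<lambda>p. F0 p * (1 + (-1) * F0 p))" unfolding D_gen by (simp add: ex_def)
  ultimately show ?thesis by (simp add: deviation_def[abs_def] U_def soliton_def algebra_simps)
qed

lemma idl_U: "idl False U"
  using idl.idl_add[OF idl_weaken[OF idl_deviation] idl_soliton] by (simp add: deviation_def)

lemma idl_B: "idl False B"
proof -
  have "Phi ey = (\<lambda>p. (-2 * l) * Gs p)" by (simp add: Phi_def ey_def fun_eq_iff)
  then have "idl False (\<lambda>p. 12 * D ey (Phi ey) p)" by (simp only:) (intro idl_cmult idl_D idl.idl_Gs)
  then show ?thesis by (simp add: B_def[abs_def])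
qed

lemma fourier_slice_add:
  assumes "idl b f" "idl b' g"
  shows "AE q in freq. fourier L (slice (\<lambda>p. f p + g p) t) q = fourier L (slice f t) q + fourier L (slice g t) q"
  using fourier_add[OF idl_slice(1)[OF assms(1)] idl_slice(1)[OF assms(2)], of t t] by (simp add: slice_def[abs_def])

lemma fourier_slice_cmult:
  assumes "idl b f"
  shows "AE q in freq. fourier L (slice (\<lambda>p. k * f p) t) q = complex_of_real k * fourier L (slice f t) q"
  using fourier_cmult[OF idl_slice(1)[OF assms], of k t] by (simp add: slice_def[abs_def])

lemma fourier_slice_dx:
  assumes "idl b f"
  shows "AE q in freq. fourier L (slice (D ex f) t) q = \<i> * complex_of_real (fst q) * fourier L (slice f t) q"
  using has_dx_slice[OF assms] by (auto simp: has_dx_def)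

lemma i_mult_sq: "\<i> * x * (\<i> * x * z) = - x\<^sup>2 * z" for x z :: complex
proof -
  have "\<i> * x * (\<i> * x * z) = (\<i> * \<i>) * (x * x * z)" by (simp only: mult_ac)
  then show ?thesis by (simp add: power2_eq_square)
qed

lemma fourier_slice_dxx:
  assumes "idl b f"
  shows "AE q in freq. fourier L (slice (D ex (D ex f)) t) q = complex_of_real (- (fst q)\<^sup>2) * fourier L (slice f t) q"
  using fourier_slice_dx[OF assms, of t] fourier_slice_dx[OF idl_D[OF assms], of ex t]
  by eventually_elim (simp only: i_mult_sq of_real_minus of_real_power)

lemma fourier_slice_dyy:
  assumes "idl b f"
  shows "AE q in freq. fourier L (slice (D ey (D ey f)) t) q = complex_of_real (- (real_of_int (snd q) / L)\<^sup>2) * fourier L (slice f t) q"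
  using fourier_dy_slice[OF assms, of t] fourier_dy_slice[OF idl_D[OF assms], of ey t]
  by eventually_elim (simp only: i_mult_sq of_real_minus of_real_power)

text \<open>Dividing by \<open>\<xi>\<^sup>2\<close> is legitimate because \<open>B\<close> itself is square-integrable: it realises \<open>\<partial>\<^sub>x\<^sup>-\<^sup>2 U\<^sub>y\<^sub>y\<close>.\<close>

lemma fourier_B:
  "AE q in freq. fourier L (slice B t) q = complex_of_real ((real_of_int (snd q) / L / fst q)\<^sup>2) * fourier L (slice U t) q"
  using fourier_slice_dxx[OF idl_B, of t] fourier_slice_dyy[OF idl_U, of t] AE_freq_fst
proof eventually_elim
  case (elim q)
  let ?x = "complex_of_real (fst q)" and ?k = "complex_of_real (real_of_int (snd q) / L)"
  have "?x\<^sup>2 * fourier L (slice B t) q = ?k\<^sup>2 * fourier L (slice U t) q"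
    using elim(1,2) unfolding yy_U by simp
  moreover have "?x \<noteq> 0" using elim(3) by simp
  ultimately have "fourier L (slice B t) q = ?k\<^sup>2 * fourier L (slice U t) q / ?x\<^sup>2"
    by (simp add: nonzero_eq_divide_eq mult.commute)
  moreover have "complex_of_real ((real_of_int (snd q) / L / fst q)\<^sup>2) = (?k / ?x)\<^sup>2" by (simp only: of_real_power of_real_divide)
  moreover have "(?k / ?x)\<^sup>2 = ?k\<^sup>2 / ?x\<^sup>2" by (rule power_divide)
  ultimately show ?case by (simp only: times_divide_eq_left)
qed

text \<open>The function \<open>(1 - \<partial>\<^sub>x\<^sup>2 + L\<^sup>2 \<partial>\<^sub>x\<^sup>-\<^sup>2 \<partial>\<^sub>y\<^sup>2) U\<close>, whose transform is the \<open>Z\<^sup>2\<close> weight times that of \<open>U\<close>.  The factor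
\<open>L\<^sup>2\<close> accounts for the weight being in \<open>k/\<xi>\<close> instead of \<open>k/(L\<xi>)\<close>.\<close>

definition ZU :: "pt \<Rightarrow> real" where "ZU p = (U p + (-1) * D ex (D ex U) p) + L\<^sup>2 * B p"

lemma idl_ZU: "idl False ZU"
  unfolding ZU_def[abs_def] by (intro idl.idl_add idl_cmult idl_D idl_U idl_B)

lemma fourier_ZU:
  "AE q in freq. fourier L (slice ZU t) q = complex_of_real (Z2_weight q) * fourier L (slice U t) q"
proof -
  have i: "idl False (\<lambda>p. (-1) * D ex (D ex U) p)" "idl False (\<lambda>p. U p + (-1) * D ex (D ex U) p)" "idl False (\<lambda>p. L\<^sup>2 * B p)"
    by (intro idl.idl_add idl_cmult idl_D idl_U idl_B)+
  from fourier_slice_add[OF i(2,3), of t] fourier_slice_add[OF idl_U i(1), of t]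
    fourier_slice_cmult[OF idl_D[OF idl_D[OF idl_U]], of "-1" ex ex t] fourier_slice_cmult[OF idl_B, of "L\<^sup>2" t]
    fourier_slice_dxx[OF idl_U, of t] fourier_B[of t]
  show ?thesis
  proof eventually_elim
    case (elim q)
    have "fourier L (slice ZU t) q = complex_of_real (1 + (fst q)\<^sup>2 + L\<^sup>2 * (real_of_int (snd q) / L / fst q)\<^sup>2) * fourier L (slice U t) q"
      unfolding ZU_def[abs_def] elim(1) unfolding elim(2-5) unfolding elim(6) by (simp add: algebra_simps)
    also have "L\<^sup>2 * (real_of_int (snd q) / L / fst q)\<^sup>2 = (real_of_int (snd q) / fst q)\<^sup>2"
      using L_pos by (simp add: power_divide power_mult_distrib)
    finally show ?case by (simp only: Z2_weight_eq)
  qed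
qed

lemma dx_slice_U: "AE p in Cy. dx L (slice U t) p = slice (D ex U) t p"
  by (rule has_dx_unique[OF dx_has_dx has_dx_slice]) (rule has_dx_slice[OF idl_U] idl_U)+

text \<open>The symbols in the right-hand side are matched with classical derivatives of \<open>U\<close>, the non-local term with \<open>\<partial>\<^sub>x B\<close>.\<close>

lemma KPI_rhs_slice:
  "AE q in freq. fourier L (slice (D et U) t) q = KPI_rhs L (slice U t) q"
proof -
  have n: "idl False (\<lambda>p. U p * D ex U p)" by (intro idl.idl_mult idl_U alg_D alg_U)
  have i: "idl False (\<lambda>p. (-1) * (U p * D ex U p))" "idl False (\<lambda>p. (-1) * D ex (D ex (D ex U)) p)"
    "idl False (\<lambda>p. D ex U p + (-1) * (U p * D ex U p))"
    "idl False (\<lambda>p. (D ex U p + (-1) * (U p * D ex U p)) + (-1) * D ex (D ex (D ex U)) p)"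
    by (intro idl.idl_add idl_cmult idl_D idl_U n)+
  have e: "D et U = (\<lambda>p. ((D ex U p + (-1) * (U p * D ex U p)) + (-1) * D ex (D ex (D ex U)) p) + D ex B p)"
    by (simp add: evolution fun_eq_iff)
  have p: "fourier L (slice (\<lambda>p. U p * D ex U p) t) = fourier L (\<lambda>p. slice U t p * dx L (slice U t) p)"
  proof (rule fourier_cong)
    have "dx L (slice U t) \<in> L2 Cy" using dx_has_dx[OF has_dx_slice[OF idl_U], of t] by (simp add: has_dx_def)
    then show "(\<lambda>p. slice U t p * dx L (slice U t) p) \<in> borel_measurable Cy"
      by (intro borel_measurable_times slice_measurable alg_U L2_measurable)
    show "slice (\<lambda>p. U p * D ex U p) t \<in> borel_measurable Cy" by (rule slice_measurable[OF idl_alg[OF n]])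
    show "AE p in Cy. slice (\<lambda>p. U p * D ex U p) t p = slice U t p * dx L (slice U t) p"
      using dx_slice_U[of t] by eventually_elim (simp add: slice_def)
  qed
  from fourier_slice_add[OF i(4) idl_D[OF idl_B], of ex t] fourier_slice_add[OF i(3,2), of t]
    fourier_slice_add[OF idl_D[OF idl_U] i(1), of ex t]
    fourier_slice_cmult[OF n, of "-1" t] fourier_slice_cmult[OF idl_D[OF idl_D[OF idl_D[OF idl_U]]], of "-1" ex ex ex t]
    fourier_slice_dx[OF idl_U, of t] fourier_slice_dx[OF idl_B, of t] fourier_slice_dxx[OF idl_D[OF idl_U], of ex t]
    fourier_B[of t] AE_freq_fst
  show ?thesis
  proof eventually_elim
    case (elim q)
    let ?x = "complex_of_real (fst q)" and ?k = "complex_of_real (real_of_int (snd q) / L)" and ?U = "fourier L (slice U t) q"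
    have "fourier L (slice (D et U) t) q
      = \<i> * ?x * ?U - fourier L (slice (\<lambda>p. U p * D ex U p) t) q + ?x\<^sup>2 * (\<i> * ?x * ?U) + \<i> * ?x * ((?k / ?x)\<^sup>2 * ?U)"
      unfolding e elim(1) unfolding elim(2) unfolding elim(3) unfolding elim(4,5,7) unfolding elim(8,9) unfolding elim(6) by simp
    also have "\<i> * ?x * ((?k / ?x)\<^sup>2 * ?U) = \<i> * (?k\<^sup>2 / ?x) * ?U"
      using elim(10) by (simp add: power2_eq_square mult.assoc)
    finally show ?case unfolding KPI_rhs_eq p by (simp add: power2_eq_square power3_eq_cube algebra_simps)
  qed
qed

text \<open>All three requirements on a solution become statements about \<open>L\<^sup>2\<close> limits of slices: continuity in \<open>Z\<^sup>2\<close> is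
continuity of \<open>ZU\<close> in \<open>L\<^sup>2\<close>, and the difference quotients in time converge even in \<open>L\<^sup>2\<close>, hence in the weaker
norm of \<open>H\<^sup>-\<^sup>1\<close>.\<close>

lemma KPI_exact: "KPI_solution L (slice U s) (\<lambda>t. slice U (s + t))"
proof -
  note uL = idl_slice(1)[OF idl_U] and zL = idl_slice(1)[OF idl_ZU] and tL = idl_slice(1)[OF idl_D[OF idl_U]]
  have [measurable]: "fourier L (slice U t) \<in> borel_measurable freq" "fourier L (slice ZU t) \<in> borel_measurable freq"
    "fourier L (slice (D et U) t) \<in> borel_measurable freq" for t
    by (intro fourier_measurable uL zL tL)+
  have zw: "(\<lambda>q. complex_of_real (Z2_weight q) * fourier L (slice U t) q) \<in> L2 freq" for t
    by (rule L2_cong_AE[OF fourier_L2[OF zL[of t]]]) (use fourier_ZU[of t] in auto)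
  have 1: "slice U t \<in> Z2 L" for t
    using zw[of t] uL[of t] by (auto simp: Z2_def periodic_y_def slice_def alg_periodic[OF alg_U])
  have 2: "L2_tendsto freq (\<lambda>\<tau> q. complex_of_real (Z2_weight q) * fourier L (slice U (s + \<tau>)) q)
      (\<lambda>q. complex_of_real (Z2_weight q) * fourier L (slice U (s + t)) q) (at t)" for t
  proof -
    have "((\<lambda>\<tau>. \<tau> - t) \<longlongrightarrow> t - t) (at t)" by (intro tendsto_intros)
    then have "filterlim (\<lambda>\<tau>. \<tau> - t) (at 0) (at t)" by (simp add: filterlim_at eventually_at_filter)
    from L2_tendsto_compose[OF slice_continuous[OF idl_ZU, of "s + t"] this]
    have "L2_tendsto Cy (\<lambda>\<tau>. slice ZU (s + \<tau>)) (slice ZU (s + t)) (at t)" by simp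
    from fourier_continuous[OF zL zL this] show ?thesis
      by (rule L2_tendsto_cong) (use fourier_ZU in auto)
  qed
  have 3: "L2_tendsto freq (\<lambda>h q. complex_of_real (Hs_weight L (-1) q) *
                     ((fourier L (slice U (s + (t + h))) q - fourier L (slice U (s + t)) q) / complex_of_real h))
            (\<lambda>q. complex_of_real (Hs_weight L (-1) q) * KPI_rhs L (slice U (s + t)) q) (at 0)" for t
  proof -
    let ?u = "\<lambda>h p. 1 / h * (slice U ((s + t) + h) p - slice U (s + t) p)"
    let ?g = "\<lambda>h q. (fourier L (slice U (s + (t + h))) q - fourier L (slice U (s + t)) q) / complex_of_real h"
    have u: "?u h \<in> L2 Cy" for h by (intro L2_cmult(1) L2_diff uL)
    have [measurable]: "fourier L (?u h) \<in> borel_measurable freq" for h by (rule fourier_measurable[OF u])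
    have f: "AE q in freq. fourier L (?u h) q = ?g h q" for h
      using fourier_cmult[OF L2_diff[OF uL[of "(s + t) + h"] uL[of "s + t"]], of "1 / h"] fourier_diff[OF uL[of "(s + t) + h"] uL[of "s + t"]]
      by eventually_elim (simp add: add.assoc)
    have [measurable]: "KPI_rhs L (slice U (s + t)) \<in> borel_measurable freq"
    proof -
      have "dx L (slice U (s + t)) \<in> L2 Cy" using dx_has_dx[OF has_dx_slice[OF idl_U]] by (simp add: has_dx_def)
      have "(\<lambda>p. slice U (s + t) p * dx L (slice U (s + t)) p) \<in> L2 Cy" by (rule Z2_nonlinearity_L2[OF 1])
      from fourier_measurable[OF this] have [measurable]: "fourier L (\<lambda>p. slice U (s + t) p * dx L (slice U (s + t)) p) \<in> borel_measurable freq" .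
      have [measurable]: "(\<lambda>q. real_of_int (snd q)) \<in> borel_measurable freq" by (rule measurable_int_fun)
      show ?thesis unfolding KPI_rhs_eq[abs_def] by measurable
    qed
    have m: "(\<lambda>q. complex_of_real (H1m q)) \<in> borel_measurable freq" by measurable
    have b: "norm (complex_of_real (H1m q)) \<le> 1" for q using H1m_bounds[of q] by simp
    from L2_tendsto_cmult[OF fourier_continuous[OF u tL time_quotient_slice[OF idl_U, of "s + t"]] m b]
    have "L2_tendsto freq (\<lambda>h q. complex_of_real (H1m q) * ?g h q) (\<lambda>q. complex_of_real (H1m q) * KPI_rhs L (slice U (s + t)) q) (at 0)"
    proof (rule L2_tendsto_cong)
      show "AE q in freq. complex_of_real (H1m q) * fourier L (?u h) q = complex_of_real (H1m q) * ?g h q" for h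
        using f[of h] by eventually_elim (simp only:)
      show "AE q in freq. complex_of_real (H1m q) * fourier L (slice (D et U) (s + t)) q = complex_of_real (H1m q) * KPI_rhs L (slice U (s + t)) q"
        using KPI_rhs_slice[of "s + t"] by eventually_elim (simp only:)
    qed measurable
    then show ?thesis unfolding H1m_def .
  qed
  show ?thesis unfolding KPI_solution_def using 1 2 3 by simp
qed

lemma dx_U_bounded: "\<exists>K. \<forall>t. AE p in Cy. \<bar>dx L (slice U t) p\<bar> \<le> K"
proof -
  obtain K where K: "\<And>p. \<bar>D ex U p\<bar> \<le> K" using alg_bounded[OF alg_D[OF alg_U]] by blast
  have "AE p in Cy. \<bar>dx L (slice U t) p\<bar> \<le> K" for t
    using dx_slice_U[of t] by eventually_elim (simp add: slice_def K)
  then show ?thesis by blast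
qed

end

section \<open>Sobolev distance to the soliton and \<open>L\<^sup>2\<close> distance to its translates\<close>

context unstable begin

text \<open>The operator \<open>1 - \<partial>\<^sub>x\<^sup>2 - \<partial>\<^sub>y\<^sup>2\<close>, whose iterates reduce \<open>H\<^sup>s\<close> norms to \<open>L\<^sup>2\<close> norms.\<close>

definition Lam :: "(pt \<Rightarrow> real) \<Rightarrow> pt \<Rightarrow> real" where
  "Lam f p = (f p + (-1) * D ex (D ex f) p) + (-1) * D ey (D ey f) p"

text \<open>The symbol of \<open>Lam\<close>.\<close>

definition jap :: "real \<times> int \<Rightarrow> real" where
  "jap q = 1 + (fst q)\<^sup>2 + (real_of_int (snd q) / L)\<^sup>2"

lemma jap_ge: "jap q \<ge> 1" by (simp add: jap_def)

lemma jap_measurable [measurable]: "jap \<in> borel_measurable freq"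
proof -
  have [measurable]: "(\<lambda>q. real_of_int (snd q)) \<in> borel_measurable freq" by (rule measurable_int_fun)
  show ?thesis unfolding jap_def[abs_def] by measurable
qed

lemma idl_Lam: "idl b f \<Longrightarrow> idl b (Lam f)"
  unfolding Lam_def[abs_def] by (intro idl.idl_add idl_cmult idl_D)

lemma fourier_Lam:
  assumes f: "idl b f"
  shows "AE q in freq. fourier L (slice (Lam f) t) q = complex_of_real (jap q) * fourier L (slice f t) q"
proof -
  have i: "idl b (\<lambda>p. (-1) * D ex (D ex f) p)" "idl b (\<lambda>p. (-1) * D ey (D ey f) p)" "idl b (\<lambda>p. f p + (-1) * D ex (D ex f) p)"
    by (intro idl.idl_add idl_cmult idl_D f)+
  from fourier_slice_add[OF i(3,2), of t] fourier_slice_add[OF f i(1), of t]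
    fourier_slice_cmult[OF idl_D[OF idl_D[OF f]], of "-1" ex ex t] fourier_slice_cmult[OF idl_D[OF idl_D[OF f]], of "-1" ey ey t]
    fourier_slice_dxx[OF f, of t] fourier_slice_dyy[OF f, of t]
  show ?thesis
  proof eventually_elim
    case (elim q)
    show ?case unfolding Lam_def[abs_def] elim(1) unfolding elim(2-4) unfolding elim(5,6) jap_def by (simp add: algebra_simps)
  qed
qed

lemma idl_Lam_iter: "idl b f \<Longrightarrow> idl b ((Lam ^^ n) f)"
  by (induction n) (auto intro: idl_Lam)

lemma fourier_Lam_iter:
  assumes f: "idl b f"
  shows "AE q in freq. fourier L (slice ((Lam ^^ n) f) t) q = complex_of_real (jap q ^ n) * fourier L (slice f t) q"
proof (induction n)
  case (Suc n)
  from fourier_Lam[OF idl_Lam_iter[OF f, of n], of t] Suc show ?case by eventually_elim simp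
qed simp

text \<open>The weight of order \<open>s\<close> is at most the symbol of an iterate of \<open>Lam\<close>, so it suffices that the ideals are closed under
\<open>Lam\<close> and consist of square-integrable functions.\<close>

lemma Hs_slice:
  assumes f: "idl b f" and n: "s \<le> 2 * real n"
  shows "slice f t \<in> Hs L s" "Hs_norm L s (slice f t) \<le> sqrt (1 / L) * L2_norm Cy (slice ((Lam ^^ n) f) t)"
proof -
  note fL = idl_slice(1)[OF f, of t] and gL = idl_slice(1)[OF idl_Lam_iter[OF f, of n], of t]
  have [measurable]: "fourier L (slice f t) \<in> borel_measurable freq" by (rule fourier_measurable[OF fL])
  have w: "Hs_weight L s q = jap q powr (s / 2)" for q by (cases q) (simp add: Hs_weight_def jap_def)
  have [measurable]: "Hs_weight L s \<in> borel_measurable freq" unfolding w[abs_def] by measurable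
  have le: "0 \<le> Hs_weight L s q \<and> Hs_weight L s q \<le> jap q ^ n" for q
  proof -
    have "jap q powr (s / 2) \<le> jap q powr real n" using jap_ge[of q] n by (intro powr_mono) auto
    also have "\<dots> = jap q ^ n" using jap_ge[of q] by (intro powr_realpow) linarith
    finally show ?thesis unfolding w by simp
  qed
  have "AE q in freq. norm (complex_of_real (Hs_weight L s q) * fourier L (slice f t) q) \<le> norm (fourier L (slice ((Lam ^^ n) f) t) q)"
    using fourier_Lam_iter[OF f, of n t]
  proof eventually_elim
    case (elim q)
    have "\<bar>Hs_weight L s q\<bar> \<le> \<bar>jap q ^ n\<bar>" using le[of q] by linarith
    then show ?case unfolding elim norm_mult norm_of_real by (rule mult_right_mono) simp
  qed
  then have *: "(\<lambda>q. complex_of_real (Hs_weight L s q) * fourier L (slice f t) q) \<in> L2 freq"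
    "L2_norm freq (\<lambda>q. complex_of_real (Hs_weight L s q) * fourier L (slice f t) q) \<le> L2_norm freq (fourier L (slice ((Lam ^^ n) f) t))"
    by (rule L2_norm_mono[OF fourier_L2[OF gL], rotated]; measurable)+
  show "slice f t \<in> Hs L s"
    using *(1) fL by (auto simp: Hs_def periodic_y_def slice_def alg_periodic[OF idl_alg[OF f]])
  show "Hs_norm L s (slice f t) \<le> sqrt (1 / L) * L2_norm Cy (slice ((Lam ^^ n) f) t)"
    using *(2) unfolding Hs_norm_def fourier_isometry[OF gL] .
qed

lemma Hs_norm_decay: "\<exists>C\<ge>0. \<forall>t\<le>0. Hs_norm L s (slice deviation t) \<le> C * exp (\<sigma> * t)"
proof -
  obtain n where n: "s \<le> 2 * real n" using real_arch_simple[of "s / 2"] by (auto simp: mult.commute)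
  obtain C where C: "C \<ge> 0" "\<And>t. t \<le> 0 \<Longrightarrow> L2_norm Cy (slice ((Lam ^^ n) deviation) t) \<le> C * exp (rate True * t)"
    using idl_slice_norm[OF idl_Lam_iter[OF idl_deviation, of n], of 0] by blast
  have "Hs_norm L s (slice deviation t) \<le> (sqrt (1 / L) * C) * exp (\<sigma> * t)" if "t \<le> 0" for t
  proof -
    have "Hs_norm L s (slice deviation t) \<le> sqrt (1 / L) * L2_norm Cy (slice ((Lam ^^ n) deviation) t)" by (rule Hs_slice(2)[OF idl_deviation n])
    also have "\<dots> \<le> sqrt (1 / L) * (C * exp (rate True * t))" using C(2)[OF that] L_pos by (intro mult_left_mono) auto
    finally show ?thesis by (simp add: rate_def mult.assoc)
  qed
  then show ?thesis using C(1) L_pos by (intro exI[of _ "sqrt (1 / L) * C"]) auto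
qed

text \<open>A nonempty open set is not null.\<close>

lemma continuous_AE_Cy_zero:
  assumes f: "continuous_on UNIV f" and z: "AE p in Cy. f p = (0::real)" and y: "0 < y" "y < 2 * pi * L"
  shows "f (x, y) = 0"
proof (rule ccontr)
  assume nz: "f (x, y) \<noteq> 0"
  let ?S = "f -` (- {0}) \<inter> (UNIV \<times> {0<..<2 * pi * L})"
  have o: "open ?S" by (intro open_Int open_vimage f open_Times) auto
  have "(x, y) \<in> ?S" using nz y by auto
  then have n: "\<not> negligible ?S" using open_not_negligible[OF o] by blast
  have "AE p in lborel. p \<in> UNIV \<times> Ydom \<longrightarrow> f p = 0"
    using z unfolding cylinder_def by (subst (asm) AE_restrict_space_iff) auto
  then have "AE p in lborel. p \<notin> ?S" by eventually_elim auto
  then have "?S \<in> null_sets lborel" using o by (subst (asm) AE_iff_null_sets[symmetric]) auto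
  then have "negligible ?S" using negligible_iff_null_sets null_sets_completionI by blast
  with n show False by blast
qed

text \<open>The transform of the \<open>y\<close>-derivative of \<open>Q\<close> is \<open>i k/L\<close> times that of \<open>Q\<close> and vanishes; translation only multiplies by a phase.\<close>

lemma fourier_translate_Q:
  "AE q in freq. snd q \<noteq> 0 \<longrightarrow> fourier L (translate_x a Q) q = 0"
proof -
  have tr: "translate_x a Q = shift (- a) Q" by (auto simp: translate_x_def shift_def fun_eq_iff)
  have QL: "Q \<in> L2 Cy" using idl_slice(1)[OF idl_soliton, of 0] by (simp only: slice_soliton)
  have "D ey soliton = (\<lambda>p. 0 * soliton p)"
  proof -
    have "D ey F0 = (\<lambda>p. 0)" unfolding D_gen by (simp add: ey_def)
    moreover have "D ey soliton = (\<lambda>p. 12 * (D ey F0 p * (1 + (-1) * F0 p) + F0 p * (0 + (-1) * D ey F0 p)))"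
      unfolding soliton_def[abs_def] by (subst D_add D_cmult D_mult D_const | (intro alg_intros))+ (rule refl)
    ultimately show ?thesis by simp
  qed
  then have d: "slice (D ey soliton) 0 = slice (\<lambda>p. 0 * soliton p) 0" by simp
  from fourier_dy_slice[OF idl_soliton, of 0] fourier_slice_cmult[OF idl_soliton, of 0 0] fourier_shift[OF QL, of "- a"]
  show ?thesis unfolding tr d slice_soliton by eventually_elim (use L_pos in auto)
qed

definition transverse :: "real \<times> int \<Rightarrow> complex" where
  "transverse q = (if snd q = 0 then 0 else fourier L (slice U 0) q)"

lemma transverse_L2: "transverse \<in> L2 freq"
proof -
  have [measurable]: "fourier L (slice U 0) \<in> borel_measurable freq" by (rule fourier_measurable[OF idl_slice(1)[OF idl_U]])
  have [measurable]: "(\<lambda>q. real_of_int (snd q)) \<in> borel_measurable freq" by (rule measurable_int_fun)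
  have "transverse = (\<lambda>q. if real_of_int (snd q) = 0 then 0 else fourier L (slice U 0) q)" by (auto simp: transverse_def)
  then have m: "transverse \<in> borel_measurable freq" by (simp only:) measurable
  show ?thesis by (rule L2_norm_mono(1)[OF fourier_L2[OF idl_slice(1)[OF idl_U, of 0]] m]) (simp add: transverse_def)
qed

text \<open>Subtracting a translate of \<open>Q\<close> leaves the modes with \<open>k \<noteq> 0\<close> unchanged, and by Plancherel their norm bounds the distance,
uniformly in the translation.\<close>

lemma distance_lower_bound:
  "sqrt L * L2_norm freq transverse \<le> L2_norm Cy (\<lambda>p. slice U 0 p - translate_x a Q p)"
proof -
  have QL: "translate_x a Q \<in> L2 Cy"
  proof -
    have "translate_x a Q = shift (- a) Q" by (auto simp: translate_x_def shift_def fun_eq_iff)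
    moreover have "Q \<in> L2 Cy" using idl_slice(1)[OF idl_soliton, of 0] by (simp only: slice_soliton)
    ultimately show ?thesis using shift_L2(1) by metis
  qed
  note uL = idl_slice(1)[OF idl_U, of 0]
  have "AE q in freq. norm (transverse q) \<le> norm (fourier L (slice U 0) q - fourier L (translate_x a Q) q)"
    using fourier_translate_Q[of a] by eventually_elim (simp add: transverse_def)
  from L2_norm_mono(2)[OF L2_diff[OF fourier_L2[OF uL] fourier_L2[OF QL]] L2_measurable[OF transverse_L2] this]
  show ?thesis unfolding fourier_diff_norm[OF uL QL] using L_pos by (intro mult_left_mono) auto
qed

text \<open>If the modes with \<open>k \<noteq> 0\<close> vanished, so would \<open>\<partial>\<^sub>y U\<close>, which is a multiple of \<open>\<partial>\<^sub>x\<^sup>2 Gs\<close>.  On the line where \<open>sin (l y) = 1\<close> the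
quotient \<open>Gs\<close> would then be an affine function of \<open>x\<close> that tends to zero at both ends, contradicting its positivity.\<close>

lemma transverse_pos: "L2_norm freq transverse > 0"
proof -
  have "L2_norm freq transverse \<noteq> 0"
  proof
    assume "L2_norm freq transverse = 0"
    then have "AE q in freq. transverse q = 0" using L2_norm_eq_0_iff[OF transverse_L2] by simp
    with fourier_dy_slice[OF idl_U, of 0]
    have z: "AE q in freq. fourier L (slice (D ey U) 0) q = 0"
      by eventually_elim (auto simp: transverse_def split: if_splits)
    note dL = idl_slice(1)[OF idl_D[OF idl_U], of ey 0]
    have "L2_norm freq (fourier L (slice (D ey U) 0)) = 0" using L2_norm_eq_0_iff[OF fourier_L2[OF dL]] z by simp
    then have "L2_norm Cy (slice (D ey U) 0) = 0" using fourier_isometry[OF dL] L_pos by simp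
    then have ae: "AE p in Cy. slice (D ey U) 0 p = 0" using L2_norm_eq_0_iff[OF dL] by simp
    have cont: "continuous_on UNIV (slice (D ey U) 0)"
      unfolding slice_def[abs_def] by (intro continuous_on_compose2[OF alg_continuous[OF alg_D[OF alg_U]]] continuous_intros) auto
    \<comment> \<open>a quarter period, where the sine equals \<open>1\<close>\<close>
    define y where "y = pi / 2 * L"
    have y: "0 < y" "y < 2 * pi * L" using L_pos pi_gt_zero by (auto simp: y_def)
    have 0: "D ey U (0, x, y) = 0" for x using continuous_AE_Cy_zero[OF cont ae y] by (simp add: slice_def)
    have Gs: "D ey U = (\<lambda>p. (- 24 * l) * D ex (D ex Gs) p)"
    proof -
      have "D ey U = (\<lambda>p. 12 * D ex (D ey (Phi ex)) p)"
        unfolding U_def[abs_def] by (subst D_cmult | (intro alg_D alg_Phi))+ (metis D_comm alg_Phi)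
      also have "D ey (Phi ex) = D ex (Phi ey)" by (rule D_Phi_sym)
      also have "Phi ey = (\<lambda>p. (-2 * l) * Gs p)" by (simp add: Phi_def ey_def fun_eq_iff)
      also have "D ex (D ex (\<lambda>p. (-2 * l) * Gs p)) = (\<lambda>p. (-2 * l) * D ex (D ex Gs) p)"
        by (subst D_cmult | (intro alg_D alg_Gs))+ (rule refl)
      finally show ?thesis by (simp add: fun_eq_iff)
    qed
    have lp: "l > 0" using L_pos by (simp add: l_def)
    have dd: "D ex (D ex Gs) (0, x, y) = 0" for x using 0[of x] lp unfolding Gs by simp
    have lin: "Gs (0, h, y) = Gs (0, 0, y) + h * D ex Gs (0, 0, y)" for h
    proof -
      have "\<bar>Gs ((0, 0, y) + h *\<^sub>R ex) - Gs ((0, 0, y) + 0 *\<^sub>R ex) - h * D ex Gs ((0, 0, y) + 0 *\<^sub>R ex)\<bar> \<le> h\<^sup>2 * 0"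
      proof (rule taylor_bound[where \<phi>="\<lambda>s. Gs ((0, 0, y) + s *\<^sub>R ex)" and \<phi>'="\<lambda>s. D ex Gs ((0, 0, y) + s *\<^sub>R ex)" and \<phi>''="\<lambda>s. D ex (D ex Gs) ((0, 0, y) + s *\<^sub>R ex)"])
        show "((\<lambda>s. Gs ((0, 0, y) + s *\<^sub>R ex)) has_real_derivative D ex Gs ((0, 0, y) + s *\<^sub>R ex)) (at s)" for s
          by (rule has_D_along[OF alg_has_D[OF alg_Gs]])
        show "((\<lambda>s. D ex Gs ((0, 0, y) + s *\<^sub>R ex)) has_real_derivative D ex (D ex Gs) ((0, 0, y) + s *\<^sub>R ex)) (at s)" for s
          by (rule has_D_along[OF alg_has_D[OF alg_D[OF alg_Gs]]])
        show "\<bar>D ex (D ex Gs) ((0, 0, y) + s *\<^sub>R ex)\<bar> \<le> 0" for s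
        proof -
          have "(0, 0, y) + s *\<^sub>R ex = (0, s, y)" by (simp add: ex_def)
          then show ?thesis by (simp only: dd abs_zero order_refl)
        qed
      qed
      then show ?thesis by (simp add: ex_def)
    qed
    obtain C where C: "\<And>p. tc p \<le> 0 \<Longrightarrow> \<bar>Gs p\<bar> \<le> C * (exp (rate True * tc p) * exp (- c * \<bar>xc p\<bar>))"
      using idl_decay[OF idl.idl_Gs[of True], of 0] by blast
    have "2 * Gs (0, 0, y) \<le> 2 * C * exp (- c * h)" if "h \<ge> 0" for h
      using C[of "(0, h, y)"] C[of "(0, - h, y)"] lin[of h] lin[of "- h"] that by simp
    moreover have "((\<lambda>h. 2 * C * exp (- c * h)) \<longlongrightarrow> 0) at_top" using c_pos by real_asymp
    ultimately have "2 * Gs (0, 0, y) \<le> 0"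
      by (intro tendsto_lowerbound[of _ 0 at_top]) (auto intro: eventually_at_top_linorderI[of 0])
    moreover have "l * y = pi / 2" using L_pos by (simp add: l_def y_def)
    then have "sin (l * y) = 1" by (simp only: sin_pi_half)
    then have "Gs (0, 0, y) > 0" using tau_pos[of "(0, 0, y)"] by (simp add: Gs_def Es_def)
    ultimately show False by simp
  qed
  then show ?thesis unfolding L2_norm_def by (smt (verit) Bochner_Integration.integral_nonneg real_sqrt_ge_zero zero_le_power2)
qed

end

section \<open>Instability\<close>

lemma time_theta:
  fixes A \<sigma> :: real
  assumes "A > 0" "\<sigma> > 0"
  shows "(\<lambda>\<delta>. max 0 (ln (A / \<delta>) / \<sigma>)) \<in> \<Theta>[at_right 0](\<lambda>\<delta>. \<bar>ln \<delta>\<bar>)"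
  using assms by real_asymp

text \<open>The time is chosen so that \<open>e\<^sup>-\<^sup>\<sigma>\<^sup>T\<close> is a fixed multiple of \<open>\<delta>\<close> when \<open>\<delta>\<close> is small.  The bound \<open>\<eta>\<close> is the norm of the transverse modes of
\<open>U(0)\<close> and depends only on \<open>L\<close>.\<close>

lemma (in unstable) instability:
  "\<exists>\<eta>>0. \<exists>T :: real \<Rightarrow> real.
       T \<in> \<Theta>[at_right 0](\<lambda>\<delta>. \<bar>ln \<delta>\<bar>) \<and>
       (\<forall>\<delta>>0. T \<delta> \<ge> 0 \<and>
          (\<exists>u\<^sub>0 \<in> Z2 L \<inter> Hs L s.
             Hs_norm L s (\<lambda>p. u\<^sub>0 p - Q p) < \<delta> \<and>
             (\<forall>u. KPI_solution L u\<^sub>0 u \<longrightarrow>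
                (INF a::real. L2_norm (cylinder L) (\<lambda>p. u (T \<delta>) p - translate_x a Q p)) \<ge> \<eta>)))"
proof -
  define \<eta> where "\<eta> = sqrt L * L2_norm freq transverse"
  obtain C where C: "C \<ge> 0" "\<And>t. t \<le> 0 \<Longrightarrow> Hs_norm L s (slice deviation t) \<le> C * exp (\<sigma> * t)"
    using Hs_norm_decay by blast
  \<comment> \<open>The cut-off at \<open>0\<close> only acts for large \<open>\<delta>\<close>; adding \<open>1\<close> to \<open>C\<close> keeps the logarithm defined and the
    final inequality strict.\<close>
  define T where "T \<delta> = max 0 (ln ((C + 1) / \<delta>) / \<sigma>)" for \<delta> :: real
  have \<eta>: "\<eta> > 0" using transverse_pos L_pos by (simp add: \<eta>_def)
  have \<Theta>: "T \<in> \<Theta>[at_right 0](\<lambda>\<delta>. \<bar>ln \<delta>\<bar>)"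
    unfolding T_def[abs_def] using C(1) sigma_pos by (intro time_theta) auto
  have main: "T \<delta> \<ge> 0 \<and> (\<exists>u\<^sub>0 \<in> Z2 L \<inter> Hs L s. Hs_norm L s (\<lambda>p. u\<^sub>0 p - Q p) < \<delta> \<and>
             (\<forall>u. KPI_solution L u\<^sub>0 u \<longrightarrow>
                (INF a::real. L2_norm (cylinder L) (\<lambda>p. u (T \<delta>) p - translate_x a Q p)) \<ge> \<eta>))"
    if \<delta>: "\<delta> > 0" for \<delta>
  proof (intro conjI bexI[of _ "slice U (- T \<delta>)"] allI impI)
    show T0: "T \<delta> \<ge> 0" by (simp add: T_def)
    obtain n where n: "s \<le> 2 * real n" using real_arch_simple[of "s / 2"] by (auto simp: mult.commute)
    have v: "KPI_solution L (slice U (- T \<delta>)) (\<lambda>t. slice U (- T \<delta> + t))" by (rule KPI_exact)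
    then have "slice U (- T \<delta> + 0) \<in> Z2 L" unfolding KPI_solution_def by blast
    then show "slice U (- T \<delta>) \<in> Z2 L \<inter> Hs L s" using Hs_slice(1)[OF idl_U n] by simp
    have "Hs_norm L s (slice deviation (- T \<delta>)) \<le> C * exp (\<sigma> * (- T \<delta>))" using T0 by (intro C(2)) simp
    also have "\<dots> \<le> C * (\<delta> / (C + 1))"
    proof (rule mult_left_mono[OF _ C(1)])
      have "ln ((C + 1) / \<delta>) \<le> \<sigma> * T \<delta>" using sigma_pos by (simp add: T_def field_simps max_def)
      then have "exp (\<sigma> * (- T \<delta>)) \<le> exp (- ln ((C + 1) / \<delta>))" by simp
      also have "\<dots> = \<delta> / (C + 1)" using \<delta> C(1) by (simp add: exp_minus)
      finally show "exp (\<sigma> * (- T \<delta>)) \<le> \<delta> / (C + 1)" .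
    qed
    also have "\<dots> < \<delta>" using \<delta> C(1) by (simp add: field_simps)
    finally show "Hs_norm L s (\<lambda>p. slice U (- T \<delta>) p - Q p) < \<delta>"
      by (simp add: deviation_def slice_def[abs_def] flip: slice_soliton[of "- T \<delta>"])
    fix u assume u: "KPI_solution L (slice U (- T \<delta>)) u"
    obtain K where K: "\<And>t. AE p in Cy. \<bar>dx L (slice U t) p\<bar> \<le> K" using dx_U_bounded by blast
    have ae: "AE p in Cy. u (T \<delta>) p = slice U (- T \<delta> + T \<delta>) p"
      by (rule KPI_uniqueness[OF u v T0 K])
    have um: "u (T \<delta>) \<in> borel_measurable Cy" using u by (auto simp: KPI_solution_def Z2_def intro: L2_measurable)
    show "\<eta> \<le> (INF a::real. L2_norm Cy (\<lambda>p. u (T \<delta>) p - translate_x a Q p))"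
    proof (rule cINF_greatest)
      fix a
      have "translate_x a Q = shift (- a) Q" by (auto simp: translate_x_def shift_def fun_eq_iff)
      moreover have "Q \<in> borel_measurable Cy" using slice_measurable[OF idl_alg[OF idl_soliton]] by (simp only: slice_soliton)
      ultimately have [measurable]: "translate_x a Q \<in> borel_measurable Cy" by (simp only:) measurable
      have "L2_norm Cy (\<lambda>p. u (T \<delta>) p - translate_x a Q p) = L2_norm Cy (\<lambda>p. slice U 0 p - translate_x a Q p)"
        by (rule L2_norm_cong_AE) (use ae um slice_measurable[OF alg_U, of 0] in \<open>auto elim: eventually_mono\<close>)
      then show "\<eta> \<le> L2_norm Cy (\<lambda>p. u (T \<delta>) p - translate_x a Q p)"
        using distance_lower_bound[of a] by (simp only: \<eta>_def)
    qed simp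
  qed
  show ?thesis
    by (intro exI[of _ \<eta>] conjI \<eta> exI[of _ T] \<Theta> allI impI main[THEN conjunct1] main[THEN conjunct2])
qed

theorem theorem2:
  fixes L :: real
  assumes "L > 4 / sqrt 3"
  shows "\<forall>s::real. s \<ge> 2 \<longrightarrow>
    (\<exists>\<eta>>0. \<exists>T :: real \<Rightarrow> real.
       T \<in> \<Theta>[at_right 0](\<lambda>\<delta>. \<bar>ln \<delta>\<bar>) \<and>
       (\<forall>\<delta>>0. T \<delta> \<ge> 0 \<and>
          (\<exists>u\<^sub>0 \<in> Z2 L \<inter> Hs L s.
             Hs_norm L s (\<lambda>p. u\<^sub>0 p - Q p) < \<delta> \<and>
             (\<forall>u. KPI_solution L u\<^sub>0 u \<longrightarrow>
                (INF a::real. L2_norm (cylinder L) (\<lambda>p. u (T \<delta>) p - translate_x a Q p)) \<ge> \<eta>))))"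
proof -
  have L: "L > 0" by (rule less_trans[OF _ assms]) simp
  \<comment> \<open>\<open>m\<close> is \<open>1/4 - \<kappa>\<^sup>2\<close> as prescribed by the wave number; the hypothesis on \<open>L\<close> says \<open>m < 1/4\<close>.\<close>
  define m where "m = 1 / (sqrt 3 * L)"
  have "4 < L * sqrt 3" using assms by (simp add: pos_divide_less_eq)
  then have m: "0 < m" "m < 1/4" using L by (auto simp: m_def field_simps)
  define \<kappa> where "\<kappa> = sqrt (1/4 - m)"
  have k: "0 < \<kappa>" using m by (simp add: \<kappa>_def)
  have k2: "\<kappa>\<^sup>2 = 1/4 - m" using m by (simp add: \<kappa>_def)
  have "\<kappa> < 1/2"
  proof (rule power2_less_imp_less)
    show "\<kappa>\<^sup>2 < (1/2)\<^sup>2" unfolding k2 using m by (simp add: power2_eq_square)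
  qed simp
  moreover have "1 / L = sqrt 3 * (1/4 - \<kappa>\<^sup>2)" unfolding k2 m_def by simp
  ultimately interpret unstable L \<kappa> using L k by unfold_locales
  show ?thesis using instability by blast
qed

end
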